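(* There exists a unique weak multi-sheeted solution to the homogenized problem. That is, there exists exactly one multi-sheeted function $\mathbf{v}\in L^2(0,T;\mathbf{H})$ with $\mathbf{v}'\in L^2(0,T;\mathbf{H}^* )$ such that $$\langle \mathbf{v}'(t),\mathbf{u}\rangle+\langle\mathcal{A}(t)\mathbf{v}(t),\mathbf{u}\rangle=\langle\mathbf{F}(t),\mathbf{u}\rangle\qquad\text{for all }\mathbf{u}\in\mathbf{H}\text{ and for a.e. }t\in(0,T),$$ and $\mathbf{v}|_{t=0}=0$.
   Context: **Geometry.** $T>0$. $\Omega_0\subset\mathbb{R}^2$ is a bounded domain with Lipschitz boundary, $\Omega_0\subset\{x=(x_1,x_2): x_2>0\}$; $\partial\Omega_0$ contains the segment $I_0=\{x: x_1\in[0,a],\ x_2=0\}$, and there is $\delta_0>0$ with $\Omega_0\cap\{0<x_2<\delta_0\}=(0,a)\times(0,\delta_0)$. The numbers $a,l_1,l_2,l_3$ are positive, $l_0:=0$. The numbers $h_0,h_{1,1},h_{1,2},h_{2,1},h_{2,2},h_{2,3},h_{2,4}\in(0,1)$ are fixed with $h_{1,1}+h_{1,2}<h_0$, $h_{2,1}+h_{2,2}<h_{1,1}$, $h_{2,3}+h_{2,4}<h_{1,2}$. For $i=0,1,2$, $$D_i=\Big\{x: 0<x_1<a,\ -\sum_{n=0}^{i+1}l_n<x_2<-\sum_{n=0}^{i}l_n\Big\}.$$ $I_1=\{x: x_1\in(0,a),\ x_2=-l_1\}$, $I_2=\{x: x_1\in(0,a),\ x_2=-(l_1+l_2)\}$.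 **Index convention.** The index $m$ runs over $\{1,2\}$ if $i=1$ and over $\{1,2,3,4\}$ if $i=2$; if $i=0$ the index $m$ is absent (there is a single object, e.g. $\varphi^{(0,m)}=\varphi^{(0)}$, $h_{0,m}=h_0$), and $\sum_{m=1}^{2i}$ then means just that single term. **Data.** For $i=0,1,2$ the parameters $\alpha_i,\beta_i$ are real numbers $\ge1$; $\delta_{\alpha_i,1},\delta_{\beta_i,1}$ are Kronecker symbols. The functions $k,k_i,\kappa_i:\mathbb{R}\to\mathbb{R}$ are continuously differentiable and there are constants $c_1,c_2>0$ with $c_1\le k'\le c_2$, $c_1\le k_i'\le c_2$, $c_1\le\kappa_i'\le c_2$ on $\mathbb{R}$, $i=0,1,2$. $f_0\in L^2(\Omega_0\times(0,T))$ and its support is compactly embedded in $\Omega_0$ for a.e. $t\in(0,T)$. With $\varepsilon=a/N$, $N$ a large positive integer, the functions $g^{(i)}_\varepsilon\in L^2(D_i\times(0,T))$ have weak derivatives $\partial_{x_1}g^{(i)}_\varepsilon\in L^2(D_i\times(0,T))$, and there are constants $c_i,\varepsilon_0$ with $\|g^{(i)}_\varepsilon\|_{L^2(D_i\times(0,T))}+\|\partial_{x_1}g^{(i)}_\varepsilon\|_{L^2(D_i\times(0,T))}\le c_i$ for all $\varepsilon\in(0,\varepsilon_0)$. If $\beta_i=1$, then there is $g^{(i)}_0\in L^2(D_i\times(0,T))$ with $g^{(i)}_\varepsilon\to g^{(i)}_0$ in $L^2(D_i\times(0,T))$ as $\varepsilon\to0$. (Terms multiplied by $\delta_{\beta_i,1}=0$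 are absent.) **Spaces.** A multi-sheeted function is a tuple $\boldsymbol\varphi=(\varphi^+,\varphi^{(0)},\{\varphi^{(1,m)}\}_{m=1}^2,\{\varphi^{(2,m)}\}_{m=1}^4)$ with $\varphi^+$ defined on $\Omega_0$ and $\varphi^{(i,m)}$ defined on $D_i$. $\mathbf{V}$ is the Hilbert space of multi-sheeted functions with $\varphi^+\in L^2(\Omega_0)$, $\varphi^{(i,m)}\in L^2(D_i)$, with scalar product $$(\boldsymbol\varphi,\boldsymbol\psi)_{\mathbf{V}}=(\varphi^+,\psi^+)_{L^2(\Omega_0)}+\sum_{i=0}^2\sum_{m=1}^{2i}h_{i,m}(\varphi^{(i,m)},\psi^{(i,m)})_{L^2(D_i)}.$$ $\mathbf{H}$ consists of those $\boldsymbol\varphi$ with $\varphi^+\in H^1(\Omega_0)$, $\varphi^{(i,m)}\in L^2(D_i)$, weak derivatives $\partial_{x_2}\varphi^{(i,m)}\in L^2(D_i)$, and trace conditions $\varphi^+|_{I_0}=\varphi^{(0)}|_{I_0}$, $\varphi^{(0)}|_{I_1}=\varphi^{(1,1)}|_{I_1}=\varphi^{(1,2)}|_{I_1}$, $\varphi^{(1,1)}|_{I_2}=\varphi^{(2,1)}|_{I_2}=\varphi^{(2,2)}|_{I_2}$, $\varphi^{(1,2)}|_{I_2}=\varphi^{(2,3)}|_{I_2}=\varphi^{(2,4)}|_{I_2}$, with scalar product $$(\boldsymbol\varphi,\boldsymbol\psi)_{\mathbf{H}}=(\boldsymbol\varphi,\boldsymbol\psi)_{\mathbf{V}}+(\nabla\varphi^+,\nabla\psi^+)_{L^2(\Omega_0)}+\sum_{i=0}^2\sum_{m=1}^{2i}(\partial_{x_2}\varphi^{(i,m)},\partial_{x_2}\psi^{(i,m)})_{L^2(D_i)}.$$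 $\mathbf{H}$ is continuously and densely embedded in $\mathbf{V}$, and $\mathbf{H}\subset\mathbf{V}\subset\mathbf{H}^*$ is the Gelfand triple (with $\mathbf{V}$ identified with its dual through $(\cdot,\cdot)_{\mathbf V}$); $\langle\cdot,\cdot\rangle$ is the pairing of $\mathbf{H}^*$ and $\mathbf{H}$, and $\mathbf{v}'$ is the distributional time derivative in this triple. A function $\mathbf{v}\in L^2(0,T;\mathbf{H})$ with $\mathbf{v}'\in L^2(0,T;\mathbf{H}^* )$ belongs to $C([0,T];\mathbf{V})$, so $\mathbf{v}|_{t=0}$ makes sense. **Operator and functional.** $\mathcal{A}(t):\mathbf{H}\to\mathbf{H}^*$ and $\mathbf{F}(t)\in\mathbf{H}^*$ are given, for a.e. $t$, by $$\langle\mathcal{A}(t)\boldsymbol\varphi,\boldsymbol\psi\rangle=\int_{\Omega_0}\big(\nabla\varphi^+\cdot\nabla\psi^++k(\varphi^+)\psi^+\big)dx+\sum_{i=0}^2\sum_{m=1}^{2i}\int_{D_i}\Big(h_{i,m}\partial_{x_2}\varphi^{(i,m)}\partial_{x_2}\psi^{(i,m)}+h_{i,m}k_i(\varphi^{(i,m)})\psi^{(i,m)}+2\delta_{\alpha_i,1}\kappa_i(\varphi^{(i,m)})\psi^{(i,m)}\Big)dx,$$ $$\langle\mathbf{F}(t),\boldsymbol\psi\rangle=\int_{\Omega_0}f_0\psi^+dx+2\sum_{i=0}^2\delta_{\beta_i,1}\sum_{m=1}^{2i}\int_{D_i}g^{(i)}_0\psi^{(i,m)}dx.$$ *)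

theory Defs
  imports "HOL-Analysis.Analysis"
begin

section \<open>Function spaces\<close>

text \<open>
  Elements of Lebesgue, Sobolev and Bochner spaces are represented by functions; the classes of
  the literature are these functions modulo equality almost everywhere.  The norms below are
  therefore seminorms on representatives.
\<close>

definition L2 :: "'a measure \<Rightarrow> ('a \<Rightarrow> real) set" where
  "L2 M = {f \<in> borel_measurable M. integrable M (\<lambda>x. (f x)\<^sup>2)}"

definition L2_norm :: "'a measure \<Rightarrow> ('a \<Rightarrow> real) \<Rightarrow> real" where
  "L2_norm M f = sqrt (\<integral>x. (f x)\<^sup>2 \<partial>M)"

definition L2_converges :: "'a measure \<Rightarrow> (nat \<Rightarrow> 'a \<Rightarrow> real) \<Rightarrow> ('a \<Rightarrow> real) \<Rightarrow> bool" where
  "L2_converges M u f \<longleftrightarrow>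
     f \<in> L2 M \<and> (\<forall>\<^sub>F n in sequentially. u n \<in> L2 M) \<and>
     (\<lambda>n. L2_norm M (\<lambda>x. u n x - f x)) \<longlonglongrightarrow> 0"

definition partial :: "'a::euclidean_space \<Rightarrow> ('a \<Rightarrow> real) \<Rightarrow> 'a \<Rightarrow> real" where
  "partial b f x = frechet_derivative f (at x) b"

primrec Ck :: "nat \<Rightarrow> ('a::euclidean_space \<Rightarrow> real) \<Rightarrow> bool" where
  "Ck 0 f \<longleftrightarrow> continuous_on UNIV f"
| "Ck (Suc n) f \<longleftrightarrow> (\<forall>x. f differentiable (at x)) \<and> (\<forall>b\<in>Basis. Ck n (partial b f))"

definition test_function :: "'a::euclidean_space set \<Rightarrow> ('a \<Rightarrow> real) \<Rightarrow> bool" where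
  "test_function U \<phi> \<longleftrightarrow>
     (\<forall>n. Ck n \<phi>) \<and> compact (closure {x. \<phi> x \<noteq> 0}) \<and> closure {x. \<phi> x \<noteq> 0} \<subseteq> U"

definition weak_derivative ::
  "'a::euclidean_space set \<Rightarrow> 'a \<Rightarrow> ('a \<Rightarrow> real) \<Rightarrow> ('a \<Rightarrow> real) \<Rightarrow> bool" where
  "weak_derivative U b f g \<longleftrightarrow>
     (\<forall>\<phi>. test_function U \<phi> \<longrightarrow>
        (\<integral>x. f x * partial b \<phi> x \<partial>lebesgue_on U) = - (\<integral>x. g x * \<phi> x \<partial>lebesgue_on U))"

text \<open>
  Square integrable functions with square integrable weak derivatives in the directions of \<open>B\<close>;
  this is \<open>H\<^sup>1(U)\<close> for \<open>B = Basis\<close>.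
\<close>

definition sobolev :: "'a::euclidean_space set \<Rightarrow> 'a set \<Rightarrow> ('a \<Rightarrow> real) set" where
  "sobolev U B =
     {f \<in> L2 (lebesgue_on U). \<forall>b\<in>B. \<exists>g\<in>L2 (lebesgue_on U). weak_derivative U b f g}"

definition weak_partial ::
  "'a::euclidean_space set \<Rightarrow> 'a \<Rightarrow> ('a \<Rightarrow> real) \<Rightarrow> 'a \<Rightarrow> real" where
  "weak_partial U b f = (SOME g. g \<in> L2 (lebesgue_on U) \<and> weak_derivative U b f g)"

definition ess_support :: "'a::euclidean_space set \<Rightarrow> ('a \<Rightarrow> real) \<Rightarrow> 'a set" where
  "ess_support U f = - \<Union>{W. open W \<and> (AE x in lebesgue_on U. x \<in> W \<longrightarrow> f x = 0)}"

section \<open>Geometry\<close>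

type_synonym point = "real \<times> real"

text \<open>
  Near each boundary point, in suitable orthonormal coordinates, the set is the part of a ball
  lying strictly above the graph of a Lipschitz function.
\<close>

definition lipschitz_boundary :: "point set \<Rightarrow> bool" where
  "lipschitz_boundary U \<longleftrightarrow>
     (\<forall>p\<in>frontier U. \<exists>(Q::point \<Rightarrow> point) (\<gamma>::real \<Rightarrow> real) L r.
        orthogonal_transformation Q \<and> L-lipschitz_on UNIV \<gamma> \<and> r > 0 \<and>
        U \<inter> ball p r = {x \<in> ball p r. \<gamma> (fst (Q x)) < snd (Q x)})"

definition layer :: "real \<Rightarrow> (nat \<Rightarrow> real) \<Rightarrow> nat \<Rightarrow> point set" where
  "layer a l i =
     {x. 0 < fst x \<and> fst x < a \<and> - (\<Sum>n=0..i+1. l n) < snd x \<and> snd x < - (\<Sum>n=0..i. l n)}"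

text \<open>
  The range of the index \<open>m\<close> on layer \<open>i\<close>.  The single object of layer \<open>0\<close>, which carries no
  index \<open>m\<close> on paper, gets the index \<open>m = 1\<close>.
\<close>

definition branches :: "nat \<Rightarrow> nat set" where
  "branches i = (if i = 0 then {1} else {1..2*i})"

section \<open>Multi-sheeted functions\<close>

text \<open>
  \<open>\<phi> Upper\<close> is \<open>\<phi>\<^sup>+\<close> and \<open>\<phi> (Branch i m)\<close> is the component with upper index \<open>(i,m)\<close>.
  Only the components with \<open>i \<le> 2\<close> and \<open>m \<in> branches i\<close>, restricted to their domains, matter.
\<close>

datatype sheet = Upper | Branch nat nat

type_synonym msfun = "sheet \<Rightarrow> point \<Rightarrow> real"

definition ms_eq :: "point set \<Rightarrow> real \<Rightarrow> (nat \<Rightarrow> real) \<Rightarrow> msfun \<Rightarrow> msfun \<Rightarrow> bool" where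
  "ms_eq \<Omega> a l \<phi> \<psi> \<longleftrightarrow>
     (AE x in lebesgue_on \<Omega>. \<phi> Upper x = \<psi> Upper x) \<and>
     (\<forall>i\<le>2. \<forall>m\<in>branches i. AE x in lebesgue_on (layer a l i). \<phi> (Branch i m) x = \<psi> (Branch i m) x)"

definition V_space :: "point set \<Rightarrow> real \<Rightarrow> (nat \<Rightarrow> real) \<Rightarrow> msfun set" where
  "V_space \<Omega> a l =
     {\<phi>. \<phi> Upper \<in> L2 (lebesgue_on \<Omega>) \<and>
         (\<forall>i\<le>2. \<forall>m\<in>branches i. \<phi> (Branch i m) \<in> L2 (lebesgue_on (layer a l i)))}"

definition V_inner ::
  "point set \<Rightarrow> real \<Rightarrow> (nat \<Rightarrow> real) \<Rightarrow> (nat \<Rightarrow> nat \<Rightarrow> real) \<Rightarrow> msfun \<Rightarrow> msfun \<Rightarrow> real" where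
  "V_inner \<Omega> a l h \<phi> \<psi> =
     (\<integral>x. \<phi> Upper x * \<psi> Upper x \<partial>lebesgue_on \<Omega>) +
     (\<Sum>i\<le>2. \<Sum>m\<in>branches i.
        h i m * (\<integral>x. \<phi> (Branch i m) x * \<psi> (Branch i m) x \<partial>lebesgue_on (layer a l i)))"

definition V_norm ::
  "point set \<Rightarrow> real \<Rightarrow> (nat \<Rightarrow> real) \<Rightarrow> (nat \<Rightarrow> nat \<Rightarrow> real) \<Rightarrow> msfun \<Rightarrow> real" where
  "V_norm \<Omega> a l h \<phi> = sqrt (V_inner \<Omega> a l h \<phi> \<phi>)"

text \<open>
  \<open>has_trace U B a c u \<tau>\<close>: the trace of \<open>u\<close> on the segment \<open>{(s,c). 0 < s < a}\<close> of the boundary of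
  \<open>U\<close> is \<open>\<tau>\<close>.  Here \<open>u\<close> lies in \<open>sobolev U B\<close>, and the trace is the extension by continuity of
  the restriction to the segment, from functions continuously differentiable up to the boundary
  (that is, restrictions to \<open>U\<close> of continuously differentiable functions on the plane).
\<close>

definition has_trace ::
  "point set \<Rightarrow> point set \<Rightarrow> real \<Rightarrow> real \<Rightarrow> (point \<Rightarrow> real) \<Rightarrow> (real \<Rightarrow> real) \<Rightarrow> bool" where
  "has_trace U B a c u \<tau> \<longleftrightarrow>
     (\<exists>w. (\<forall>n. Ck 1 (w n)) \<and>
          L2_converges (lebesgue_on U) w u \<and>
          (\<forall>b\<in>B. L2_converges (lebesgue_on U) (\<lambda>n. partial b (w n)) (weak_partial U b u)) \<and>
          L2_converges (lebesgue_on {0<..<a}) (\<lambda>n s. w n (s, c)) \<tau>)"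

definition H_space :: "point set \<Rightarrow> real \<Rightarrow> (nat \<Rightarrow> real) \<Rightarrow> msfun set" where
  "H_space \<Omega> a l =
     {\<phi>. \<phi> Upper \<in> sobolev \<Omega> Basis \<and>
         (\<forall>i\<le>2. \<forall>m\<in>branches i. \<phi> (Branch i m) \<in> sobolev (layer a l i) {(0,1)}) \<and>
         (\<exists>\<tau>. has_trace \<Omega> Basis a 0 (\<phi> Upper) \<tau> \<and>
              has_trace (layer a l 0) {(0,1)} a 0 (\<phi> (Branch 0 1)) \<tau>) \<and>
         (\<exists>\<tau>. has_trace (layer a l 0) {(0,1)} a (- l 1) (\<phi> (Branch 0 1)) \<tau> \<and>
              has_trace (layer a l 1) {(0,1)} a (- l 1) (\<phi> (Branch 1 1)) \<tau> \<and>
              has_trace (layer a l 1) {(0,1)} a (- l 1) (\<phi> (Branch 1 2)) \<tau>) \<and>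
         (\<exists>\<tau>. has_trace (layer a l 1) {(0,1)} a (- (l 1 + l 2)) (\<phi> (Branch 1 1)) \<tau> \<and>
              has_trace (layer a l 2) {(0,1)} a (- (l 1 + l 2)) (\<phi> (Branch 2 1)) \<tau> \<and>
              has_trace (layer a l 2) {(0,1)} a (- (l 1 + l 2)) (\<phi> (Branch 2 2)) \<tau>) \<and>
         (\<exists>\<tau>. has_trace (layer a l 1) {(0,1)} a (- (l 1 + l 2)) (\<phi> (Branch 1 2)) \<tau> \<and>
              has_trace (layer a l 2) {(0,1)} a (- (l 1 + l 2)) (\<phi> (Branch 2 3)) \<tau> \<and>
              has_trace (layer a l 2) {(0,1)} a (- (l 1 + l 2)) (\<phi> (Branch 2 4)) \<tau>)}"

definition grad_dot :: "point set \<Rightarrow> (point \<Rightarrow> real) \<Rightarrow> (point \<Rightarrow> real) \<Rightarrow> point \<Rightarrow> real" where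
  "grad_dot U f g x = (\<Sum>b\<in>Basis. weak_partial U b f x * weak_partial U b g x)"

definition H_inner ::
  "point set \<Rightarrow> real \<Rightarrow> (nat \<Rightarrow> real) \<Rightarrow> (nat \<Rightarrow> nat \<Rightarrow> real) \<Rightarrow> msfun \<Rightarrow> msfun \<Rightarrow> real" where
  "H_inner \<Omega> a l h \<phi> \<psi> =
     V_inner \<Omega> a l h \<phi> \<psi> +
     (\<integral>x. grad_dot \<Omega> (\<phi> Upper) (\<psi> Upper) x \<partial>lebesgue_on \<Omega>) +
     (\<Sum>i\<le>2. \<Sum>m\<in>branches i.
        (\<integral>x. weak_partial (layer a l i) (0,1) (\<phi> (Branch i m)) x *
             weak_partial (layer a l i) (0,1) (\<psi> (Branch i m)) x \<partial>lebesgue_on (layer a l i)))"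

definition H_norm ::
  "point set \<Rightarrow> real \<Rightarrow> (nat \<Rightarrow> real) \<Rightarrow> (nat \<Rightarrow> nat \<Rightarrow> real) \<Rightarrow> msfun \<Rightarrow> real" where
  "H_norm \<Omega> a l h \<phi> = sqrt (H_inner \<Omega> a l h \<phi> \<phi>)"

text \<open>
  Bounded linear functionals on \<open>H\<close>.  They are functions on all of \<open>msfun\<close>, of which only the
  values on \<open>H_space\<close> matter.
\<close>

definition H_dual ::
  "point set \<Rightarrow> real \<Rightarrow> (nat \<Rightarrow> real) \<Rightarrow> (nat \<Rightarrow> nat \<Rightarrow> real) \<Rightarrow> (msfun \<Rightarrow> real) set" where
  "H_dual \<Omega> a l h =
     {\<Lambda>. (\<forall>\<phi>\<in>H_space \<Omega> a l. \<forall>\<psi>\<in>H_space \<Omega> a l. \<forall>p q.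
             \<Lambda> (\<lambda>s x. p * \<phi> s x + q * \<psi> s x) = p * \<Lambda> \<phi> + q * \<Lambda> \<psi>) \<and>
          (\<exists>C. \<forall>\<phi>\<in>H_space \<Omega> a l. \<bar>\<Lambda> \<phi>\<bar> \<le> C * H_norm \<Omega> a l h \<phi>)}"

definition H_dual_norm ::
  "point set \<Rightarrow> real \<Rightarrow> (nat \<Rightarrow> real) \<Rightarrow> (nat \<Rightarrow> nat \<Rightarrow> real) \<Rightarrow> (msfun \<Rightarrow> real) \<Rightarrow> real" where
  "H_dual_norm \<Omega> a l h \<Lambda> = (SUP \<phi>\<in>{\<phi> \<in> H_space \<Omega> a l. H_norm \<Omega> a l h \<phi> \<le> 1}. \<bar>\<Lambda> \<phi>\<bar>)"

section \<open>Functions of time\<close>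

text \<open>
  \<open>L\<^sup>2(0,T;X)\<close> for a space \<open>X\<close> with seminorm \<open>N\<close>: the functions that are almost everywhere limits
  of \<open>X\<close>-valued simple functions (strong measurability) and have square integrable norm.  The
  subtraction is the pointwise one on function types.
\<close>

definition bochner_L2 :: "real \<Rightarrow> 'b::minus set \<Rightarrow> ('b \<Rightarrow> real) \<Rightarrow> (real \<Rightarrow> 'b) set" where
  "bochner_L2 T X N =
     {v. (AE t in lebesgue_on {0<..<T}. v t \<in> X) \<and>
         (\<exists>s. (\<forall>n. simple_function (lebesgue_on {0<..<T}) (s n) \<and> (\<forall>t\<in>{0<..<T}. s n t \<in> X)) \<and>
              (AE t in lebesgue_on {0<..<T}. (\<lambda>n. N (s n t - v t)) \<longlonglongrightarrow> 0)) \<and>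
         integrable (lebesgue_on {0<..<T}) (\<lambda>t. (N (v t))\<^sup>2)}"

text \<open>
  \<open>w\<close> is the distributional derivative of \<open>v\<close> in the triple \<open>H \<subseteq> V \<subseteq> H\<^sup>*\<close>, where \<open>V\<close> is embedded
  in the dual of \<open>H\<close> through \<open>\<phi> \<mapsto> (\<phi>,\<cdot>)\<^sub>V\<close>: the identity \<open>\<integral> v(t) \<eta>'(t) dt = - \<integral> w(t) \<eta>(t) dt\<close> of
  elements of the dual, for all test functions \<open>\<eta>\<close>, with both sides evaluated at \<open>u \<in> H\<close>.
\<close>

definition time_derivative ::
  "point set \<Rightarrow> real \<Rightarrow> (nat \<Rightarrow> real) \<Rightarrow> (nat \<Rightarrow> nat \<Rightarrow> real) \<Rightarrow> real
     \<Rightarrow> (real \<Rightarrow> msfun) \<Rightarrow> (real \<Rightarrow> msfun \<Rightarrow> real) \<Rightarrow> bool" where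
  "time_derivative \<Omega> a l h T v w \<longleftrightarrow>
     (\<forall>\<eta>. test_function {0<..<T} \<eta> \<longrightarrow>
        (\<forall>u\<in>H_space \<Omega> a l.
           (\<integral>t. V_inner \<Omega> a l h (v t) u * deriv \<eta> t \<partial>lebesgue_on {0<..<T}) =
           - (\<integral>t. w t u * \<eta> t \<partial>lebesgue_on {0<..<T})))"

text \<open>The value at time \<open>0\<close> is that of the representative in \<open>C([0,T];V)\<close>.\<close>

definition initial_value ::
  "point set \<Rightarrow> real \<Rightarrow> (nat \<Rightarrow> real) \<Rightarrow> (nat \<Rightarrow> nat \<Rightarrow> real) \<Rightarrow> real
     \<Rightarrow> (real \<Rightarrow> msfun) \<Rightarrow> msfun \<Rightarrow> bool" where
  "initial_value \<Omega> a l h T v v\<^sub>0 \<longleftrightarrow>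
     (\<exists>c. (\<forall>t\<in>{0..T}. c t \<in> V_space \<Omega> a l) \<and>
          (\<forall>t\<in>{0..T}. ((\<lambda>s. V_norm \<Omega> a l h (c s - c t)) \<longlongrightarrow> 0) (at t within {0..T})) \<and>
          (AE t in lebesgue_on {0<..<T}. ms_eq \<Omega> a l (v t) (c t)) \<and>
          ms_eq \<Omega> a l (c 0) v\<^sub>0)"

section \<open>The homogenized problem\<close>

definition kronecker :: "real \<Rightarrow> real \<Rightarrow> real" where
  "kronecker p q = (if p = q then 1 else 0)"

definition hom_operator ::
  "point set \<Rightarrow> real \<Rightarrow> (nat \<Rightarrow> real) \<Rightarrow> (nat \<Rightarrow> nat \<Rightarrow> real)
     \<Rightarrow> (real \<Rightarrow> real) \<Rightarrow> (nat \<Rightarrow> real \<Rightarrow> real) \<Rightarrow> (nat \<Rightarrow> real \<Rightarrow> real) \<Rightarrow> (nat \<Rightarrow> real)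
     \<Rightarrow> msfun \<Rightarrow> msfun \<Rightarrow> real" where
  "hom_operator \<Omega> a l h k ki \<kappa> \<alpha> \<phi> \<psi> =
     (\<integral>x. grad_dot \<Omega> (\<phi> Upper) (\<psi> Upper) x + k (\<phi> Upper x) * \<psi> Upper x \<partial>lebesgue_on \<Omega>) +
     (\<Sum>i\<le>2. \<Sum>m\<in>branches i.
        (\<integral>x. h i m * weak_partial (layer a l i) (0,1) (\<phi> (Branch i m)) x *
                     weak_partial (layer a l i) (0,1) (\<psi> (Branch i m)) x +
             h i m * ki i (\<phi> (Branch i m) x) * \<psi> (Branch i m) x +
             2 * kronecker (\<alpha> i) 1 * \<kappa> i (\<phi> (Branch i m) x) * \<psi> (Branch i m) x
           \<partial>lebesgue_on (layer a l i)))"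

definition hom_functional ::
  "point set \<Rightarrow> real \<Rightarrow> (nat \<Rightarrow> real) \<Rightarrow> (nat \<Rightarrow> real)
     \<Rightarrow> (point \<times> real \<Rightarrow> real) \<Rightarrow> (nat \<Rightarrow> point \<times> real \<Rightarrow> real) \<Rightarrow> real \<Rightarrow> msfun \<Rightarrow> real" where
  "hom_functional \<Omega> a l \<beta> f\<^sub>0 g\<^sub>0 t \<psi> =
     (\<integral>x. f\<^sub>0 (x, t) * \<psi> Upper x \<partial>lebesgue_on \<Omega>) +
     2 * (\<Sum>i\<le>2. kronecker (\<beta> i) 1 *
            (\<Sum>m\<in>branches i. \<integral>x. g\<^sub>0 i (x, t) * \<psi> (Branch i m) x \<partial>lebesgue_on (layer a l i)))"

definition weak_solution ::
  "point set \<Rightarrow> real \<Rightarrow> (nat \<Rightarrow> real) \<Rightarrow> (nat \<Rightarrow> nat \<Rightarrow> real) \<Rightarrow> real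
     \<Rightarrow> (msfun \<Rightarrow> msfun \<Rightarrow> real) \<Rightarrow> (real \<Rightarrow> msfun \<Rightarrow> real) \<Rightarrow> (real \<Rightarrow> msfun) \<Rightarrow> bool" where
  "weak_solution \<Omega> a l h T A F v \<longleftrightarrow>
     v \<in> bochner_L2 T (H_space \<Omega> a l) (H_norm \<Omega> a l h) \<and>
     (\<exists>v'\<in>bochner_L2 T (H_dual \<Omega> a l h) (H_dual_norm \<Omega> a l h).
        time_derivative \<Omega> a l h T v v' \<and>
        (AE t in lebesgue_on {0<..<T}. \<forall>u\<in>H_space \<Omega> a l. v' t u + A (v t) u = F t u)) \<and>
     initial_value \<Omega> a l h T v (\<lambda>_ _. 0)"

end

(*
  A multi-sheeted function is encoded by the vector of its components and weak derivatives, scaled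
  so that the norms of H and V become norms of L2 vectors; the functions in H form a closed
  subspace, since the traces on the junction segments are bounded in the H norm.  In these
  coordinates the problem reads (K v)' + B v = F in one Hilbert space, with a positive semidefinite
  K = Q* Q (Q is the projection to V) and a Lipschitz, strongly monotone B: the latter because
  k', k_i', kappa_i' lie between c1 and c2, so that no growth or compactness argument is needed.

  Existence: for Lipschitz F with F(0) = B(0), the equation (K v + eps v)' + B v = F is an ordinary
  differential equation with Lipschitz right-hand side, and time increments give the bound
  eps |v'| = O(sqrt eps).  Such F are dense, and strong monotonicity makes the approximate solutions
  a Cauchy sequence in L2(0,T;H) and their images under Q one in C([0,T];V).

  Uniqueness does not use an energy identity for weak solutions.  The difference e of two solutions
  solves (K e)' + e = R with R := e - (B v1 - B v2); the approximation scheme yields a solution of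
  this linear problem with the energy inequality, and linear uniqueness, seen by integrating twice
  in time, shows that it is e.  Hence e satisfies the energy inequality and vanishes by monotonicity.
*)
theory Submission
  imports Defs
begin

section \<open>Hilbert spaces\<close>

text \<open>The duality is removed by Riesz representation: functionals on H become vectors of H, so
  that B maps a Hilbert space into itself and right-hand sides are compared in one norm. This is why
  a term \<epsilon> v' of size sqrt \<epsilon> is harmless: it is moved to the right-hand side, and
  strong monotonicity bounds the difference of two solutions by the L2 distance of their right-hand
  sides. The condition F(0) = B(0) makes the zero initial value stationary, v'(0) = 0; otherwise
  v'(0) could be as large as order 1 / \<epsilon>. Lipschitz functions vanishing at 0 are dense in
  L2, so the condition costs only the shift by the constant B(0). The obstacle to uniqueness is that
  v is merely L2 in time, so that K v cannot be differentiated and paired with v by the product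
  rule. A linear equation can be integrated in time until all terms are differentiable; a nonlinear
  one cannot, because B does not commute with integration. Hence the nonlinear difference is treated
  as part of a given right-hand side.\<close>

lemma lipschitz_strongly_monotone_surj:
  fixes f :: "'h::{real_inner,banach} \<Rightarrow> 'h"
  assumes lip: "L-lipschitz_on UNIV f" and c: "c > 0"
    and mono: "\<And>x y. c * (norm (x - y))\<^sup>2 \<le> (f x - f y) \<bullet> (x - y)"
  shows "\<exists>x. f x = y"
proof -
  \<comment> \<open>The maximum with \<open>c\<close> gives \<open>M > 0\<close> and
    \<open>c / M \<le> 1\<close> also on the zero space, where \<open>L\<close> may be 0; on any
    other space \<open>c \<le> L\<close> holds anyway.\<close>
  define M where "M = max L c"
  have M: "M > 0" "c \<le> M" "L \<le> M" using c by (auto simp: M_def)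
  \<comment> \<open>Zarantonello's argument: the solutions of \<open>f x = y\<close> are the fixed
    points of \<open>g\<close> below. Monotonicity and the Lipschitz bound give the squared
    contraction factor 1 - 2 \<rho> c + \<rho>^2 M^2, and this \<rho> minimizes it, with minimum
    q^2.\<close>
  define \<rho> where "\<rho> = c / M\<^sup>2"
  have \<rho>: "\<rho> > 0" using c M by (simp add: \<rho>_def)
  define q where "q = sqrt (1 - (c / M)\<^sup>2)"
  have cM: "0 < (c / M)\<^sup>2" "(c / M)\<^sup>2 \<le> 1" using c M by (auto simp: power_le_one)
  have q: "0 \<le> q" "q < 1" unfolding q_def using cM by auto
  define g where "g = (\<lambda>x. x - \<rho> *\<^sub>R (f x - y))"
  have "dist (g x) (g x') \<le> q * dist x x'" for x x'
  proof -
    let ?d = "x - x'" and ?e = "f x - f x'"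
    have 1: "g x - g x' = ?d - \<rho> *\<^sub>R ?e" by (simp add: g_def algebra_simps)
    have n: "norm ?e \<le> M * norm ?d"
      using lipschitz_on_normD[OF lip, of x x'] mult_right_mono[OF M(3), of "norm ?d"] by auto
    have "(norm (g x - g x'))\<^sup>2 = (norm ?d)\<^sup>2 - 2 * \<rho> * (?e \<bullet> ?d) + \<rho>\<^sup>2 * (norm ?e)\<^sup>2"
      unfolding 1 power2_norm_eq_inner
      by (simp add: inner_diff_left inner_diff_right inner_commute power2_eq_square algebra_simps)
    also have "\<dots> \<le> (norm ?d)\<^sup>2 - 2 * \<rho> * (c * (norm ?d)\<^sup>2) + \<rho>\<^sup>2 * (M * norm ?d)\<^sup>2"
    proof -
      have "\<rho> * (c * (norm ?d)\<^sup>2) \<le> \<rho> * (?e \<bullet> ?d)"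
        using mono[of x x'] \<rho> by (intro mult_left_mono) auto
      moreover have "\<rho>\<^sup>2 * (norm ?e)\<^sup>2 \<le> \<rho>\<^sup>2 * (M * norm ?d)\<^sup>2"
        using n by (intro mult_left_mono power_mono) auto
      ultimately show ?thesis by linarith
    qed
    also have "\<dots> = (1 - (c / M)\<^sup>2) * (norm ?d)\<^sup>2"
      using M(1) by (simp add: \<rho>_def power2_eq_square field_simps)
    also have "\<dots> = (q * norm ?d)\<^sup>2" using cM by (simp add: q_def power_mult_distrib)
    finally show ?thesis
      unfolding dist_norm using q by (rule_tac power2_le_imp_le, simp_all)
  qed
  then obtain x where "g x = x" using banach_fix_type[of q g] q by auto
  then show ?thesis using \<rho> by (auto simp: g_def)
qed

text \<open>A minimizing sequence is Cauchy by the parallelogram law, because the midpoint of two of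
  its terms lies in \<open>S\<close> again and so has distance at least \<open>d\<close> from
  \<open>x\<close>.\<close>

lemma closed_subspace_nearest_point:
  fixes S :: "'h::{real_inner,banach} set"
  assumes S: "closed S" "subspace S"
  shows "\<exists>p\<in>S. \<forall>s\<in>S. dist x p \<le> dist x s"
proof -
  have ne: "S \<noteq> {}" using subspace_0[OF S(2)] by auto
  define d where "d = infdist x S"
  have d: "0 \<le> d" "\<And>s. s \<in> S \<Longrightarrow> d \<le> dist x s" by (auto simp: d_def infdist_nonneg infdist_le)
  have "\<exists>s\<in>S. dist x s < d + 1 / Suc n" for n
  proof (rule ccontr)
    assume "\<not> ?thesis"
    then have "d + 1 / Suc n \<le> infdist x S"
      unfolding infdist_notempty[OF ne] using ne by (intro cINF_greatest) (auto simp: not_less)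
    then show False by (simp add: d_def)
  qed
  then obtain s where s: "\<And>n. s n \<in> S" "\<And>n. dist x (s n) < d + 1 / Suc n" by metis
  have lim: "(\<lambda>n. dist x (s n)) \<longlonglongrightarrow> d"
  proof (rule tendsto_sandwich[of "\<lambda>_. d"])
    show "(\<lambda>n. d + 1 / Suc n) \<longlonglongrightarrow> d"
      using tendsto_add[OF tendsto_const LIMSEQ_Suc[OF lim_1_over_n], of d] by simp
    show "\<forall>\<^sub>F n in sequentially. dist x (s n) \<le> d + 1 / Suc n"
      using s(2) by (intro always_eventually allI less_imp_le)
  qed (use d s in auto)
  have par: "(dist (s m) (s n))\<^sup>2 \<le> 2 * ((dist x (s m))\<^sup>2 - d\<^sup>2) + 2 * ((dist x (s n))\<^sup>2 - d\<^sup>2)" for m n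
  proof -
    let ?u = "x - s m" and ?v = "x - s n"
    let ?p = "(1/2) *\<^sub>R (s m + s n)"
    have "?p \<in> S" using S(2) s(1) by (intro subspace_scale subspace_add)
    then have "d\<^sup>2 \<le> (norm (x - ?p))\<^sup>2"
      using d by (auto intro!: power_mono simp: dist_norm)
    moreover have "2 *\<^sub>R (x - ?p) = ?u + ?v" by (simp add: algebra_simps scaleR_2)
    then have "4 * (norm (x - ?p))\<^sup>2 = (norm (?u + ?v))\<^sup>2"
      by (simp add: power_mult_distrib flip: \<open>2 *\<^sub>R (x - ?p) = ?u + ?v\<close>)
    moreover have "(norm (?u + ?v))\<^sup>2 + (norm (s m - s n))\<^sup>2 = 2 * (norm ?u)\<^sup>2 + 2 * (norm ?v)\<^sup>2"
      unfolding power2_norm_eq_inner by (simp add: algebra_simps inner_commute)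
    ultimately show ?thesis by (simp add: dist_norm)
  qed
  have "Cauchy s"
  proof (rule metric_CauchyI)
    fix e :: real assume e: "0 < e"
    have "(\<lambda>n. (dist x (s n))\<^sup>2 - d\<^sup>2) \<longlonglongrightarrow> d\<^sup>2 - d\<^sup>2"
      by (intro tendsto_intros lim)
    moreover have "0 < e\<^sup>2 / 4" using e by simp
    ultimately have "\<forall>\<^sub>F n in sequentially. (dist x (s n))\<^sup>2 - d\<^sup>2 < e\<^sup>2 / 4"
      by (auto dest!: order_tendstoD(2)[of _ _ _ "e\<^sup>2 / 4"])
    then obtain N where N: "\<And>n. n \<ge> N \<Longrightarrow> (dist x (s n))\<^sup>2 - d\<^sup>2 < e\<^sup>2 / 4"
      by (auto simp: eventually_sequentially)
    have "dist (s m) (s n) < e" if "m \<ge> N" "n \<ge> N" for m n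
    proof -
      have arith: "D < E" if "D \<le> 2 * u + 2 * v" "u < E / 4" "v < E / 4" for D E u v :: real
        using that by simp
      have "(dist (s m) (s n))\<^sup>2 < e\<^sup>2" by (rule arith[OF par N[OF that(1)] N[OF that(2)]])
      then show ?thesis using e by (auto intro: power2_less_imp_less)
    qed
    then show "\<exists>M. \<forall>m\<ge>M. \<forall>n\<ge>M. dist (s m) (s n) < e" by blast
  qed
  then obtain p where p: "s \<longlonglongrightarrow> p" using Cauchy_convergent convergent_def by blast
  have "p \<in> S" using closed_sequentially[OF S(1)] s(1) p by blast
  moreover have "dist x p = d"
    using LIMSEQ_unique[OF tendsto_dist[OF tendsto_const p] lim] .
  ultimately show ?thesis using d by metis
qed

text \<open>Total by choice, so that it can be written without side conditions; it is the orthogonal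
  projection if \<open>S\<close> is a closed subspace, as the context below assumes.\<close>

definition orth_proj :: "'h::{real_inner,banach} set \<Rightarrow> 'h \<Rightarrow> 'h" where
  "orth_proj S x = (SOME p. p \<in> S \<and> (\<forall>s\<in>S. (x - p) \<bullet> s = 0))"

context
  fixes S :: "'h::{real_inner,banach} set"
  assumes S: "closed S" "subspace S"
begin

lemma orth_proj:
  "orth_proj S x \<in> S" "s \<in> S \<Longrightarrow> (x - orth_proj S x) \<bullet> s = 0"
proof -
  obtain p where p: "p \<in> S" and min: "\<And>s. s \<in> S \<Longrightarrow> dist x p \<le> dist x s"
    using closed_subspace_nearest_point[OF S] by blast
  have "(x - p) \<bullet> s = 0" if s: "s \<in> S" for s
  proof (cases "s = 0")
    case False
    then have ss: "s \<bullet> s > 0" by simp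
    \<comment> \<open>The minimizer of the distance from \<open>x\<close> to
      \<open>p + t *\<^sub>R s\<close>. Since \<open>p\<close> is already nearest, the gain, the
      square of \<open>(x - p) \<bullet> s\<close> over \<open>s \<bullet> s\<close>, has to
      vanish.\<close>
    define t where "t = ((x - p) \<bullet> s) / (s \<bullet> s)"
    have "p + t *\<^sub>R s \<in> S" using S(2) p s by (simp add: subspace_add subspace_scale)
    then have "(norm (x - p))\<^sup>2 \<le> (norm (x - (p + t *\<^sub>R s)))\<^sup>2"
      using min by (auto intro!: power_mono simp: dist_norm)
    also have "\<dots> = (norm (x - p))\<^sup>2 - 2 * t * ((x - p) \<bullet> s) + t\<^sup>2 * (s \<bullet> s)"
      unfolding power2_norm_eq_inner
      by (simp add: algebra_simps inner_commute power2_eq_square)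
    also have "\<dots> = (norm (x - p))\<^sup>2 - ((x - p) \<bullet> s)\<^sup>2 / (s \<bullet> s)"
      using ss by (simp add: t_def power2_eq_square field_simps)
    finally have "((x - p) \<bullet> s)\<^sup>2 / (s \<bullet> s) \<le> 0" by simp
    then show ?thesis using ss by (auto simp: divide_le_0_iff power2_less_eq_zero_iff)
  qed simp
  then have "\<exists>p. p \<in> S \<and> (\<forall>s\<in>S. (x - p) \<bullet> s = 0)" using p by blast
  from someI_ex[OF this] show "orth_proj S x \<in> S" "s \<in> S \<Longrightarrow> (x - orth_proj S x) \<bullet> s = 0"
    unfolding orth_proj_def by blast+
qed

lemma orth_proj_unique:
  assumes "p \<in> S" "\<And>s. s \<in> S \<Longrightarrow> (x - p) \<bullet> s = 0"
  shows "orth_proj S x = p"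
proof -
  let ?e = "orth_proj S x - p"
  have e: "?e \<in> S" using orth_proj(1) assms(1) S(2) by (simp add: subspace_diff)
  have "?e \<bullet> ?e = (x - p) \<bullet> ?e - (x - orth_proj S x) \<bullet> ?e" by (simp add: algebra_simps)
  also have "\<dots> = 0" using assms(2)[OF e] orth_proj(2)[OF e] by simp
  finally show ?thesis by simp
qed

lemma orth_proj_id: "x \<in> S \<Longrightarrow> orth_proj S x = x"
  by (rule orth_proj_unique) auto

lemma orth_proj_inner: "s \<in> S \<Longrightarrow> orth_proj S x \<bullet> s = x \<bullet> s"
  using orth_proj(2)[of s x] by (simp add: inner_diff_left)

lemma orth_proj_self_adjoint: "orth_proj S x \<bullet> y = x \<bullet> orth_proj S y"
  by (metis orth_proj(1) orth_proj_inner inner_commute)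

lemma norm_orth_proj_le: "norm (orth_proj S x) \<le> norm x"
proof -
  have "(norm (orth_proj S x))\<^sup>2 = x \<bullet> orth_proj S x"
    by (simp add: power2_norm_eq_inner orth_proj_inner orth_proj(1))
  also have "\<dots> \<le> norm x * norm (orth_proj S x)" by (rule norm_cauchy_schwarz)
  finally show ?thesis by (cases "orth_proj S x = 0") (simp_all add: power2_eq_square)
qed

lemma bounded_linear_orth_proj: "bounded_linear (orth_proj S)"
proof (rule bounded_linear_intro[where K = 1])
  show "orth_proj S (x + y) = orth_proj S x + orth_proj S y" for x y
    by (rule orth_proj_unique)
      (use orth_proj S in \<open>auto simp: subspace_add inner_diff_left inner_add_left orth_proj_inner\<close>)
  show "orth_proj S (r *\<^sub>R x) = r *\<^sub>R orth_proj S x" for r x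
    by (rule orth_proj_unique)
      (use orth_proj S in \<open>auto simp: subspace_scale inner_diff_left orth_proj_inner\<close>)
qed (simp add: norm_orth_proj_le)

end

lemma subspace_closure:
  fixes S :: "'a::real_normed_vector set"
  assumes "subspace S" shows "subspace (closure S)"
proof (rule subspaceI)
  show "0 \<in> closure S" using subspace_0[OF assms] closure_subset by auto
  show "x + y \<in> closure S" if "x \<in> closure S" "y \<in> closure S" for x y
  proof -
    from that obtain u v where "\<forall>n. u n \<in> S" "u \<longlonglongrightarrow> x" "\<forall>n. v n \<in> S" "v \<longlonglongrightarrow> y"
      unfolding closure_sequential by blast
    then show ?thesis unfolding closure_sequential
      by (intro exI[of _ "\<lambda>n. u n + v n"]) (auto intro: subspace_add[OF assms] tendsto_add)
  qed
  show "c *\<^sub>R x \<in> closure S" if "x \<in> closure S" for x c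
  proof -
    from that obtain u where "\<forall>n. u n \<in> S" "u \<longlonglongrightarrow> x"
      unfolding closure_sequential by blast
    then show ?thesis unfolding closure_sequential
      by (intro exI[of _ "\<lambda>n. c *\<^sub>R u n"]) (auto intro: subspace_scale[OF assms] tendsto_intros)
  qed
qed

text \<open>The form of the projection theorem behind the density proofs: to see that
  \<open>S\<close> is dense it is enough to show that the residual \<open>x - p\<close>
  vanishes.\<close>

lemma orthogonal_part_of_closure:
  fixes S :: "'h::{real_inner,banach} set"
  assumes "subspace S"
  obtains p where "p \<in> closure S" "\<And>s. s \<in> S \<Longrightarrow> (x - p) \<bullet> s = 0"
proof
  note cl = closed_closure subspace_closure[OF assms]
  show "orth_proj (closure S) x \<in> closure S" by (rule orth_proj[OF cl])
  show "(x - orth_proj (closure S) x) \<bullet> s = 0" if "s \<in> S" for s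
    using orth_proj(2)[OF cl] that closure_subset by blast
qed

lemma bounded_linear_lipschitz:
  assumes "bounded_linear f" obtains L where "L-lipschitz_on UNIV f"
proof -
  interpret bounded_linear f by fact
  obtain K where K: "\<And>x. norm (f x) \<le> norm x * K" "K > 0" using pos_bounded by auto
  have "K-lipschitz_on UNIV f"
  proof (rule lipschitz_onI)
    show "dist (f x) (f y) \<le> K * dist x y" for x y
      using K(1)[of "x - y"] by (simp add: dist_norm diff mult.commute)
  qed (use K in simp)
  then show ?thesis by (rule that)
qed

section \<open>Square integrable vector-valued functions\<close>

text \<open>Vector-valued counterpart of \<open>L2\<close>. In a second countable space Borel
  measurability is strong measurability, so the Bochner integral applies.\<close>

definition square_integrable :: "'a measure \<Rightarrow> ('a \<Rightarrow> 'b::{real_normed_vector,second_countable_topology}) \<Rightarrow> bool" where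
  "square_integrable M f \<longleftrightarrow> f \<in> borel_measurable M \<and> integrable M (\<lambda>x. (norm (f x))\<^sup>2)"

lemma square_integrable_real_iff: "square_integrable M (f :: _ \<Rightarrow> real) \<longleftrightarrow> f \<in> L2 M"
  by (simp add: square_integrable_def L2_def)

lemma norm_add_sq_le: "(norm (x + y :: 'a::real_normed_vector))\<^sup>2 \<le> 2 * (norm x)\<^sup>2 + 2 * (norm y)\<^sup>2"
proof -
  have "(norm (x + y))\<^sup>2 \<le> (norm x + norm y)\<^sup>2" by (intro power_mono norm_triangle_ineq) auto
  also have "\<dots> \<le> 2 * (norm x)\<^sup>2 + 2 * (norm y)\<^sup>2"
    using zero_le_power2[of "norm x - norm y"] by (simp add: power2_sum power2_diff)
  finally show ?thesis .
qed

lemma square_integrable_bound: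
  assumes "f \<in> borel_measurable M" "integrable M g" "AE x in M. (norm (f x))\<^sup>2 \<le> g x"
  shows "square_integrable M f"
  unfolding square_integrable_def
proof
  show "integrable M (\<lambda>x. (norm (f x))\<^sup>2)"
    using assms by (intro Bochner_Integration.integrable_bound[OF assms(2)]) auto
qed (rule assms)

lemma square_integrable_zero [simp]: "square_integrable M (\<lambda>x. 0)"
  by (simp add: square_integrable_def)

lemma square_integrable_add:
  assumes "square_integrable M f" "square_integrable M g"
  shows "square_integrable M (\<lambda>x. f x + g x)"
  by (rule square_integrable_bound[where g = "\<lambda>x. 2 * (norm (f x))\<^sup>2 + 2 * (norm (g x))\<^sup>2"])
    (use assms in \<open>auto simp: square_integrable_def norm_add_sq_le\<close>)

lemma square_integrable_scaleR:
  "square_integrable M f \<Longrightarrow> square_integrable M (\<lambda>x. c *\<^sub>R f x)"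
  by (auto simp: square_integrable_def power_mult_distrib)

lemma square_integrable_minus:
  "square_integrable M f \<Longrightarrow> square_integrable M (\<lambda>x. - f x)"
  by (auto simp: square_integrable_def)

lemma square_integrable_diff:
  "square_integrable M f \<Longrightarrow> square_integrable M g \<Longrightarrow> square_integrable M (\<lambda>x. f x - g x)"
  using square_integrable_add[OF _ square_integrable_minus, of M f g] by simp

lemma square_integrable_const:
  "finite_measure M \<Longrightarrow> square_integrable M (\<lambda>x. c)"
  by (simp add: square_integrable_def finite_measure.integrable_const)

lemma square_integrable_cong_AE:
  assumes "square_integrable M f" "g \<in> borel_measurable M" "AE x in M. f x = g x"
  shows "square_integrable M g"
  by (rule square_integrable_bound[where g = "\<lambda>x. (norm (f x))\<^sup>2"])
    (use assms in \<open>auto simp: square_integrable_def\<close>)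

text \<open>A Lipschitz map grows at most like \<open>L * norm y + norm (B 0)\<close>; the constant
  \<open>B 0\<close> is the reason for the finite measure.\<close>

lemma square_integrable_lipschitz:
  fixes B :: "'b::{real_normed_vector,second_countable_topology} \<Rightarrow> 'c::{real_normed_vector,second_countable_topology}"
  assumes M: "finite_measure M" and B: "L-lipschitz_on UNIV B" and f: "square_integrable M f"
  shows "square_integrable M (\<lambda>x. B (f x))"
proof (rule square_integrable_bound)
  have "B \<in> borel_measurable borel"
    by (intro borel_measurable_continuous_onI lipschitz_on_continuous_on[OF B])
  then show "(\<lambda>x. B (f x)) \<in> borel_measurable M"
    using f by (auto simp: square_integrable_def)
  show "integrable M (\<lambda>x. 2 * (L\<^sup>2 * (norm (f x))\<^sup>2) + 2 * (norm (B 0))\<^sup>2)"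
    using f M by (auto simp: square_integrable_def finite_measure.integrable_const)
  have "(norm (B y))\<^sup>2 \<le> 2 * (L\<^sup>2 * (norm y)\<^sup>2) + 2 * (norm (B 0))\<^sup>2" for y
  proof -
    have "(norm (B y))\<^sup>2 \<le> 2 * (norm (B y - B 0))\<^sup>2 + 2 * (norm (B 0))\<^sup>2"
      using norm_add_sq_le[of "B y - B 0" "B 0"] by simp
    also have "norm (B y - B 0) \<le> L * norm y"
      using lipschitz_on_normD[OF B, of y 0] by simp
    then have "(norm (B y - B 0))\<^sup>2 \<le> (L * norm y)\<^sup>2" by (intro power_mono) auto
    finally show ?thesis by (simp add: power_mult_distrib)
  qed
  then show "AE x in M. (norm (B (f x)))\<^sup>2 \<le> 2 * (L\<^sup>2 * (norm (f x))\<^sup>2) + 2 * (norm (B 0))\<^sup>2"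
    by simp
qed

lemma square_integrable_inner:
  fixes f g :: "'a \<Rightarrow> 'b::{real_inner,second_countable_topology}"
  assumes "square_integrable M f" "square_integrable M g"
  shows "integrable M (\<lambda>x. f x \<bullet> g x)"
proof (rule Bochner_Integration.integrable_bound)
  show "integrable M (\<lambda>x. (norm (f x))\<^sup>2 + (norm (g x))\<^sup>2)"
    using assms by (auto simp: square_integrable_def)
  have "\<bar>a \<bullet> b\<bar> \<le> (norm a)\<^sup>2 + (norm b)\<^sup>2" for a b :: 'b
  proof -
    have "2 * (norm a * norm b) \<le> (norm a)\<^sup>2 + (norm b)\<^sup>2"
      using sum_squares_bound[of "norm a" "norm b"] by simp
    then show ?thesis using Cauchy_Schwarz_ineq2[of a b]
      by (smt (verit) mult_nonneg_nonneg norm_ge_zero)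
  qed
  then show "AE x in M. norm (f x \<bullet> g x) \<le> norm ((norm (f x))\<^sup>2 + (norm (g x))\<^sup>2)" by simp
  show "(\<lambda>x. f x \<bullet> g x) \<in> borel_measurable M"
    using assms by (auto simp: square_integrable_def)
qed

lemma square_integrable_Cauchy_Schwarz:
  fixes f g :: "'a \<Rightarrow> 'b::{real_inner,second_countable_topology}"
  assumes f: "square_integrable M f" and g: "square_integrable M g"
  shows "\<bar>\<integral>x. f x \<bullet> g x \<partial>M\<bar> \<le> sqrt (\<integral>x. (norm (f x))\<^sup>2 \<partial>M) * sqrt (\<integral>x. (norm (g x))\<^sup>2 \<partial>M)"
proof -
  define A where "A = (\<integral>x. (norm (f x))\<^sup>2 \<partial>M)"
  define C where "C = (\<integral>x. (norm (g x))\<^sup>2 \<partial>M)"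
  define I where "I = (\<integral>x. f x \<bullet> g x \<partial>M)"
  have AC: "A \<ge> 0" "C \<ge> 0" by (auto simp: A_def C_def)
  \<comment> \<open>The discriminant argument. The nonnegative quadratic is evaluated at its minimum
    \<open>- I / C\<close> or, if \<open>C = 0\<close>, at a point where a nonzero \<open>I\<close>
    would make it -1.\<close>
  have quad: "0 \<le> A + 2 * t * I + t\<^sup>2 * C" for t
  proof -
    have "0 \<le> (\<integral>x. (norm (f x + t *\<^sub>R g x))\<^sup>2 \<partial>M)" by simp
    also have "\<dots> = (\<integral>x. (norm (f x))\<^sup>2 + 2 * t * (f x \<bullet> g x) + t\<^sup>2 * (norm (g x))\<^sup>2 \<partial>M)"
      by (intro Bochner_Integration.integral_cong)
        (auto simp: power2_norm_eq_inner inner_add_left inner_add_right inner_commute power2_eq_square[of t] algebra_simps)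
    also have "\<dots> = A + 2 * t * I + t\<^sup>2 * C"
      using f g square_integrable_inner[OF f g] by (simp add: A_def C_def I_def square_integrable_def)
    finally show ?thesis .
  qed
  have "I\<^sup>2 \<le> A * C"
  proof (cases "C = 0")
    case True
    have "I = 0"
    proof (rule ccontr)
      assume "I \<noteq> 0"
      then have "A + 2 * (- (A + 1) / (2 * I)) * I + (- (A + 1) / (2 * I))\<^sup>2 * C = -1"
        using True by (simp add: field_simps)
      then show False using quad[of "- (A + 1) / (2 * I)"] by simp
    qed
    then show ?thesis using AC by simp
  next
    case False
    then have "A + 2 * (- I / C) * I + (- I / C)\<^sup>2 * C = A - I\<^sup>2 / C"
      by (simp add: power2_eq_square field_simps)
    then have "I\<^sup>2 / C \<le> A" using quad[of "- I / C"] by simp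
    then show ?thesis using False AC by (simp add: pos_divide_le_eq)
  qed
  then have "sqrt (I\<^sup>2) \<le> sqrt (A * C)" by (rule real_sqrt_le_mono)
  then show ?thesis by (simp add: A_def C_def I_def real_sqrt_mult)
qed

lemma square_integrable_bounded_linear_comp:
  assumes Q: "bounded_linear Q" and f: "square_integrable M f"
  shows "square_integrable M (\<lambda>x. Q (f x))"
proof -
  obtain K where K: "\<And>x. norm (Q x) \<le> norm x * K"
    using bounded_linear.bounded[OF Q] by blast
  show ?thesis
  proof (rule square_integrable_bound)
    show "(\<lambda>x. Q (f x)) \<in> borel_measurable M"
      using f bounded_linear.continuous_on[OF Q continuous_on_id]
      by (auto simp: square_integrable_def intro: measurable_compose[OF _ borel_measurable_continuous_onI])
    show "integrable M (\<lambda>x. K\<^sup>2 * (norm (f x))\<^sup>2)" using f by (auto simp: square_integrable_def)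
    have "(norm (Q y))\<^sup>2 \<le> K\<^sup>2 * (norm y)\<^sup>2" for y
      using power_mono[OF K, of y 2] by (simp add: power_mult_distrib mult.commute)
    then show "AE x in M. (norm (Q (f x)))\<^sup>2 \<le> K\<^sup>2 * (norm (f x))\<^sup>2" by simp
  qed
qed

lemma tendsto_integral_inner_L2:
  fixes f :: "nat \<Rightarrow> 'a \<Rightarrow> 'b::{real_inner,second_countable_topology}"
  assumes fn: "\<And>n. square_integrable M (f n)" and f: "square_integrable M f'"
    and gn: "\<And>n. square_integrable M (g n)" and g: "square_integrable M g'"
    and cf: "(\<lambda>n. \<integral>x. (norm (f n x - f' x))\<^sup>2 \<partial>M) \<longlonglongrightarrow> 0"
    and cg: "(\<lambda>n. \<integral>x. (norm (g n x - g' x))\<^sup>2 \<partial>M) \<longlonglongrightarrow> 0"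
  shows "(\<lambda>n. \<integral>x. f n x \<bullet> g n x \<partial>M) \<longlonglongrightarrow> (\<integral>x. f' x \<bullet> g' x \<partial>M)"
proof -
  let ?N = "\<lambda>h. sqrt (\<integral>x. (norm (h x))\<^sup>2 \<partial>M)"
  note d = square_integrable_diff
  have "norm ((\<integral>x. f n x \<bullet> g n x \<partial>M) - (\<integral>x. f' x \<bullet> g' x \<partial>M))
      \<le> ?N (\<lambda>x. f n x - f' x) * ?N (\<lambda>x. g n x - g' x) + ?N (\<lambda>x. f n x - f' x) * ?N g'
        + ?N f' * ?N (\<lambda>x. g n x - g' x)" for n
  proof -
    have "(\<integral>x. f n x \<bullet> g n x \<partial>M) - (\<integral>x. f' x \<bullet> g' x \<partial>M)
      = (\<integral>x. f n x \<bullet> g n x - f' x \<bullet> g' x \<partial>M)"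
      by (intro Bochner_Integration.integral_diff[symmetric] square_integrable_inner fn gn f g)
    also have "\<dots> = (\<integral>x. (f n x - f' x) \<bullet> (g n x - g' x) + (f n x - f' x) \<bullet> g' x + f' x \<bullet> (g n x - g' x) \<partial>M)"
      by (intro Bochner_Integration.integral_cong) (auto simp: algebra_simps)
    also have "\<dots> = (\<integral>x. (f n x - f' x) \<bullet> (g n x - g' x) \<partial>M) + (\<integral>x. (f n x - f' x) \<bullet> g' x \<partial>M)
        + (\<integral>x. f' x \<bullet> (g n x - g' x) \<partial>M)"
      by (simp add: square_integrable_inner d fn gn f g)
    finally show ?thesis
      using square_integrable_Cauchy_Schwarz[OF d[OF fn f] d[OF gn g], of n n]
        square_integrable_Cauchy_Schwarz[OF d[OF fn f] g, of n]
        square_integrable_Cauchy_Schwarz[OF f d[OF gn g], of n]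
      by simp
  qed
  moreover have "(\<lambda>n. ?N (\<lambda>x. f n x - f' x) * ?N (\<lambda>x. g n x - g' x) + ?N (\<lambda>x. f n x - f' x) * ?N g'
        + ?N f' * ?N (\<lambda>x. g n x - g' x)) \<longlonglongrightarrow> 0"
  proof -
    have 1: "(\<lambda>n. ?N (\<lambda>x. f n x - f' x)) \<longlonglongrightarrow> 0" "(\<lambda>n. ?N (\<lambda>x. g n x - g' x)) \<longlonglongrightarrow> 0"
      using tendsto_real_sqrt[OF cf] tendsto_real_sqrt[OF cg] by auto
    show ?thesis
      using tendsto_add[OF tendsto_add[OF tendsto_mult[OF 1] tendsto_mult_right[OF 1(1), of "?N g'"]]
          tendsto_mult_left[OF 1(2), of "?N f'"]] by simp
  qed
  ultimately have "(\<lambda>n. (\<integral>x. f n x \<bullet> g n x \<partial>M) - (\<integral>x. f' x \<bullet> g' x \<partial>M)) \<longlonglongrightarrow> 0"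
    by (rule Lim_null_comparison[OF always_eventually[OF allI]])
  then show ?thesis by (rule LIM_zero_cancel)
qed

text \<open>
  The weights \<open>16 ^ k\<close> make the increments of a fast subsequence geometrically small at almost
  every point.
\<close>

lemma square_integrable_complete:
  fixes f :: "nat \<Rightarrow> 'a \<Rightarrow> 'b::{banach,second_countable_topology}"
  assumes f: "\<And>n. square_integrable M (f n)"
    and cauchy: "\<And>e. e > 0 \<Longrightarrow> \<exists>N. \<forall>m\<ge>N. \<forall>n\<ge>N. (\<integral>x. (norm (f m x - f n x))\<^sup>2 \<partial>M) < e"
  obtains g r where "square_integrable M g" "(\<lambda>n. \<integral>x. (norm (f n x - g x))\<^sup>2 \<partial>M) \<longlonglongrightarrow> 0"
    "strict_mono r" "AE x in M. (\<lambda>k. f (r k) x) \<longlonglongrightarrow> g x"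
proof -
  have [measurable]: "f n \<in> borel_measurable M" for n using f by (auto simp: square_integrable_def)
  define I where "I m n = (\<integral>x. (norm (f m x - f n x))\<^sup>2 \<partial>M)" for m n
  have nnI: "(\<integral>\<^sup>+x. ennreal ((norm (f m x - f n x))\<^sup>2) \<partial>M) = ennreal (I m n)" for m n
    unfolding I_def using square_integrable_diff[OF f f, of m n]
    by (intro nn_integral_eq_integral) (auto simp: square_integrable_def)
  have "\<exists>N. \<forall>m\<ge>N. \<forall>n\<ge>N. I m n < (1/16) ^ k" for k :: nat
    using cauchy[of "(1/16)^k"] by (auto simp: I_def)
  then obtain N where N: "\<And>k m n. m \<ge> N k \<Longrightarrow> n \<ge> N k \<Longrightarrow> I m n < (1/16) ^ k" by metis
  define r where "r k = (\<Sum>j\<le>k. N j) + k" for k :: nat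
  have r: "strict_mono r" by (rule strict_monoI_Suc) (simp add: r_def)
  have rN: "r k \<ge> N k" for k
  proof -
    have "N k \<le> (\<Sum>j\<le>k. N j)" by (rule member_le_sum) auto
    then show ?thesis by (simp add: r_def)
  qed
  have rI: "I (r (Suc k)) (r k) \<le> (1/16) ^ k" for k
    using N[of k "r (Suc k)" "r k"] rN[of k] strict_mono_less[OF r, of k "Suc k"] by auto
  define S where "S x = (\<Sum>k. ennreal (4 ^ k * (norm (f (r (Suc k)) x - f (r k) x))\<^sup>2))" for x
  have [measurable]: "S \<in> borel_measurable M" unfolding S_def by measurable
  have "(\<integral>\<^sup>+x. S x \<partial>M) = (\<Sum>k. \<integral>\<^sup>+x. ennreal (4 ^ k * (norm (f (r (Suc k)) x - f (r k) x))\<^sup>2) \<partial>M)"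
    unfolding S_def by (intro nn_integral_suminf) measurable
  also have "\<dots> = (\<Sum>k. ennreal (4 ^ k) * ennreal (I (r (Suc k)) (r k)))"
    by (simp add: ennreal_mult nn_integral_cmult nnI)
  also have "\<dots> \<le> (\<Sum>k. ennreal ((1/4) ^ k))"
  proof (rule suminf_le)
    fix k :: nat
    have "ennreal (4 ^ k) * ennreal (I (r (Suc k)) (r k)) \<le> ennreal (4 ^ k) * ennreal ((1/16) ^ k)"
      by (intro mult_left_mono ennreal_leI rI) auto
    also have "\<dots> = ennreal ((1/4) ^ k)"
      by (simp flip: ennreal_mult power_mult_distrib)
    finally show "ennreal (4 ^ k) * ennreal (I (r (Suc k)) (r k)) \<le> ennreal ((1/4) ^ k)" .
  qed auto
  also have "\<dots> = ennreal (\<Sum>k. (1/4) ^ k)" by (intro suminf_ennreal2 summable_geometric) auto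
  also have "\<dots> < \<infinity>" by simp
  finally have "AE x in M. S x \<noteq> \<infinity>" by (intro nn_integral_PInf_AE) auto
  then have conv: "AE x in M. convergent (\<lambda>k. f (r k) x)"
  proof eventually_elim
    case (elim x)
    define c where "c = enn2real (S x)"
    have c: "S x = ennreal c" "c \<ge> 0" using elim by (auto simp: c_def less_top)
    have step: "norm (f (r (Suc k)) x - f (r k) x) \<le> sqrt c * (1/2) ^ k" for k
    proof -
      have "(\<Sum>j\<in>{k}. ennreal (4 ^ j * (norm (f (r (Suc j)) x - f (r j) x))\<^sup>2)) \<le> S x"
        unfolding S_def by (rule sum_le_suminf) auto
      then have "4 ^ k * (norm (f (r (Suc k)) x - f (r k) x))\<^sup>2 \<le> c"
        using c by simp
      then have "sqrt (4 ^ k * (norm (f (r (Suc k)) x - f (r k) x))\<^sup>2) \<le> sqrt c" by (rule real_sqrt_le_mono)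
      moreover have "sqrt (4 ^ k) = 2 ^ k"
        using real_sqrt_power[of 4 k] by simp
      ultimately show ?thesis by (simp add: real_sqrt_mult field_simps)
    qed
    have "summable (\<lambda>k. f (r (Suc k)) x - f (r k) x)"
      by (rule summable_comparison_test'[where g = "\<lambda>k. sqrt c * (1/2) ^ k"])
        (use step in \<open>auto intro: summable_mult summable_geometric\<close>)
    then have "convergent (\<lambda>n. \<Sum>k<n. f (r (Suc k)) x - f (r k) x)"
      by (simp add: summable_iff_convergent)
    then have "convergent (\<lambda>n. f (r n) x - f (r 0) x)"
      by (simp add: sum_lessThan_telescope[of "\<lambda>n. f (r n) x"])
    then show ?case
      using convergent_add[OF _ convergent_const[of "f (r 0) x"]] by fastforce
  qed
  define g where "g x = lim (\<lambda>k. f (r k) x)" for x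
  have [measurable]: "g \<in> borel_measurable M" unfolding g_def by measurable
  have lim: "AE x in M. (\<lambda>k. f (r k) x) \<longlonglongrightarrow> g x"
    using conv unfolding g_def by eventually_elim (simp add: convergent_LIMSEQ_iff)
  \<comment> \<open>Fatou's lemma along the subsequence turns the Cauchy bound between
    \<open>f n\<close> and \<open>f (r k)\<close> into a bound between \<open>f n\<close> and the
    limit. It also shows that \<open>f n - g\<close> is square integrable before this is known of
    \<open>g\<close>.\<close>
  have fatou: "(\<integral>\<^sup>+x. ennreal ((norm (f n x - g x))\<^sup>2) \<partial>M) \<le> ennreal e"
    if e: "\<And>m. m \<ge> K \<Longrightarrow> I n m \<le> e" for n K e
  proof -
    have "(\<integral>\<^sup>+x. ennreal ((norm (f n x - g x))\<^sup>2) \<partial>M)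
        = (\<integral>\<^sup>+x. liminf (\<lambda>k. ennreal ((norm (f n x - f (r k) x))\<^sup>2)) \<partial>M)"
    proof (rule nn_integral_cong_AE)
      show "AE x in M. ennreal ((norm (f n x - g x))\<^sup>2) = liminf (\<lambda>k. ennreal ((norm (f n x - f (r k) x))\<^sup>2))"
        using lim
      proof eventually_elim
        case (elim x)
        have "(\<lambda>k. ennreal ((norm (f n x - f (r k) x))\<^sup>2)) \<longlonglongrightarrow> ennreal ((norm (f n x - g x))\<^sup>2)"
          by (intro tendsto_intros tendsto_ennrealI elim)
        from lim_imp_Liminf[OF _ this] show ?case by simp
      qed
    qed
    also have "\<dots> \<le> liminf (\<lambda>k. \<integral>\<^sup>+x. ennreal ((norm (f n x - f (r k) x))\<^sup>2) \<partial>M)"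
      by (rule nn_integral_liminf) measurable
    also have "\<dots> \<le> liminf (\<lambda>k::nat. ennreal e)"
    proof (rule Liminf_mono)
      show "\<forall>\<^sub>F k in sequentially. (\<integral>\<^sup>+x. ennreal ((norm (f n x - f (r k) x))\<^sup>2) \<partial>M) \<le> ennreal e"
        using eventually_ge_at_top[of K]
        by eventually_elim (use e seq_suble[OF r] in \<open>auto simp: nnI intro!: ennreal_leI intro: order_trans\<close>)
    qed
    finally show ?thesis by (simp add: Liminf_const)
  qed
  have sq: "square_integrable M (\<lambda>x. f n x - g x)" if "\<And>m. m \<ge> K \<Longrightarrow> I n m \<le> e" for n K e
    unfolding square_integrable_def
    by (auto intro!: integrableI_bounded order.strict_trans1[OF fatou[OF that]])
  obtain K where "\<And>m n. m \<ge> K \<Longrightarrow> n \<ge> K \<Longrightarrow> I m n < 1" using cauchy[of 1] by (auto simp: I_def)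
  then have "square_integrable M (\<lambda>x. f K x - g x)" by (intro sq[of K K 1]) (auto simp: less_imp_le)
  from square_integrable_diff[OF f[of K] this] have g: "square_integrable M g" by simp
  have "(\<lambda>n. \<integral>x. (norm (f n x - g x))\<^sup>2 \<partial>M) \<longlonglongrightarrow> 0"
  proof (rule LIMSEQ_I)
    fix e :: real assume e: "e > 0"
    obtain K where K: "\<And>m n. m \<ge> K \<Longrightarrow> n \<ge> K \<Longrightarrow> I m n < e / 2"
      using cauchy[of "e / 2"] e by (auto simp: I_def)
    have "norm ((\<integral>x. (norm (f n x - g x))\<^sup>2 \<partial>M) - 0) < e" if n: "n \<ge> K" for n
    proof -
      have "ennreal (\<integral>x. (norm (f n x - g x))\<^sup>2 \<partial>M) = (\<integral>\<^sup>+x. ennreal ((norm (f n x - g x))\<^sup>2) \<partial>M)"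
        using square_integrable_diff[OF f g, of n]
        by (intro nn_integral_eq_integral[symmetric]) (auto simp: square_integrable_def)
      also have "\<dots> \<le> ennreal (e / 2)" using K[OF n] by (intro fatou[of K]) (auto simp: less_imp_le)
      finally show ?thesis using e by simp
    qed
    then show "\<exists>no. \<forall>n\<ge>no. norm ((\<integral>x. (norm (f n x - g x))\<^sup>2 \<partial>M) - 0) < e" by blast
  qed
  from that[OF g this r lim] show ?thesis .
qed

section \<open>The Hilbert space of square integrable functions\<close>

lemma L2_measurable: "f \<in> L2 M \<Longrightarrow> f \<in> borel_measurable M"
  by (simp add: L2_def)

lemma L2_zero: "(\<lambda>x. 0) \<in> L2 M"
  by (simp add: L2_def)

lemma L2_add: "f \<in> L2 M \<Longrightarrow> g \<in> L2 M \<Longrightarrow> (\<lambda>x. f x + g x) \<in> L2 M"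
  using square_integrable_add[of M f g] by (simp add: square_integrable_real_iff)

lemma L2_diff: "f \<in> L2 M \<Longrightarrow> g \<in> L2 M \<Longrightarrow> (\<lambda>x. f x - g x) \<in> L2 M"
  using square_integrable_diff[of M f g] by (simp add: square_integrable_real_iff)

lemma L2_uminus: "f \<in> L2 M \<Longrightarrow> (\<lambda>x. - f x) \<in> L2 M"
  using square_integrable_minus[of M f] by (simp add: square_integrable_real_iff)

lemma L2_mult: "f \<in> L2 M \<Longrightarrow> (\<lambda>x. c * f x) \<in> L2 M"
  using square_integrable_scaleR[of M f c] by (simp add: square_integrable_real_iff)

lemma L2_integrable: "f \<in> L2 M \<Longrightarrow> g \<in> L2 M \<Longrightarrow> integrable M (\<lambda>x. f x * g x)"
  using square_integrable_inner[of M f g] by (simp add: square_integrable_real_iff)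

lemma L2_cong_AE:
  "f \<in> L2 M \<Longrightarrow> g \<in> borel_measurable M \<Longrightarrow> AE x in M. f x = g x \<Longrightarrow> g \<in> L2 M"
  using square_integrable_cong_AE[of M f g] by (simp add: square_integrable_real_iff)

text \<open>A partial equivalence: functions outside \<open>L2\<close> are related to nothing. The
  quotient is a type, since inner product, completeness and second countability enter the abstract
  theory as type classes.\<close>

definition l2_rel :: "('a::euclidean_space \<Rightarrow> real) \<Rightarrow> ('a \<Rightarrow> real) \<Rightarrow> bool" where
  "l2_rel f g \<longleftrightarrow> f \<in> L2 lebesgue \<and> g \<in> L2 lebesgue \<and> (AE x in lebesgue. f x = g x)"

lemma part_equivp_l2_rel: "part_equivp l2_rel"
proof (rule part_equivpI)
  show "\<exists>f. l2_rel f f"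
    by (rule exI[of _ "\<lambda>_. 0"]) (simp add: l2_rel_def L2_zero)
  show "symp l2_rel" by (rule sympI) (auto simp: l2_rel_def eq_commute)
  show "transp l2_rel" by (rule transpI) (auto simp: l2_rel_def)
qed

quotient_type (overloaded) 'a l2 = "'a::euclidean_space \<Rightarrow> real" / partial: l2_rel
  by (rule part_equivp_l2_rel)

definition l2_of :: "('a::euclidean_space \<Rightarrow> real) \<Rightarrow> 'a l2" where "l2_of = abs_l2"

text \<open>A chosen representative, determined only almost everywhere; hence the pointwise laws of
  the vector space operations below are AE statements.\<close>

definition l2_fun :: "'a::euclidean_space l2 \<Rightarrow> 'a \<Rightarrow> real" where "l2_fun = rep_l2"

lemma l2_fun_L2 [simp]: "l2_fun x \<in> L2 lebesgue"
  using Quotient_rep_reflp[OF Quotient_l2, of x] by (simp add: l2_fun_def l2_rel_def)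

lemma l2_fun_measurable [measurable]: "l2_fun x \<in> borel_measurable lebesgue"
  by (rule L2_measurable) simp

lemma l2_of_fun [simp]: "l2_of (l2_fun x) = x"
  by (simp add: l2_of_def l2_fun_def Quotient_abs_rep[OF Quotient_l2])

lemma l2_of_eq_iff:
  "f \<in> L2 lebesgue \<Longrightarrow> g \<in> L2 lebesgue \<Longrightarrow> l2_of f = l2_of g \<longleftrightarrow> (AE x in lebesgue. f x = g x)"
  using Quotient_rel[OF Quotient_l2, of f g] by (simp add: l2_of_def l2_rel_def)

lemma l2_fun_of: "f \<in> L2 lebesgue \<Longrightarrow> AE x in lebesgue. l2_fun (l2_of f) x = f x"
  by (subst l2_of_eq_iff[symmetric]) auto

lemma l2_eq_iff: "x = y \<longleftrightarrow> (AE t in lebesgue. l2_fun x t = l2_fun y t)"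
  using l2_of_eq_iff[of "l2_fun x" "l2_fun y"] by simp

instantiation l2 :: (euclidean_space) real_inner
begin

definition "(0 :: 'a l2) = l2_of (\<lambda>_. 0)"
definition "(x :: 'a l2) + y = l2_of (\<lambda>t. l2_fun x t + l2_fun y t)"
definition "(x :: 'a l2) - y = l2_of (\<lambda>t. l2_fun x t - l2_fun y t)"
definition "- (x :: 'a l2) = l2_of (\<lambda>t. - l2_fun x t)"
definition "c *\<^sub>R (x :: 'a l2) = l2_of (\<lambda>t. c * l2_fun x t)"
definition "(x :: 'a l2) \<bullet> y = (\<integral>t. l2_fun x t * l2_fun y t \<partial>lebesgue)"
definition "norm (x :: 'a l2) = sqrt (x \<bullet> x)"
definition "dist (x :: 'a l2) y = norm (x - y)"
definition "sgn (x :: 'a l2) = inverse (norm x) *\<^sub>R x"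
definition "uniformity = (INF e\<in>{0 <..}. principal {(x, y :: 'a l2). dist x y < e})"
definition "open (U :: 'a l2 set) \<longleftrightarrow> (\<forall>x\<in>U. eventually (\<lambda>(x', y). x' = x \<longrightarrow> y \<in> U) uniformity)"

lemma l2_fun_zero: "AE t in lebesgue. l2_fun (0 :: 'a l2) t = 0"
  unfolding zero_l2_def by (rule l2_fun_of) (rule L2_zero)

lemma l2_fun_plus: "AE t in lebesgue. l2_fun (x + y :: 'a l2) t = l2_fun x t + l2_fun y t"
  unfolding plus_l2_def by (rule l2_fun_of) (intro L2_add l2_fun_L2)

lemma l2_fun_minus: "AE t in lebesgue. l2_fun (x - y :: 'a l2) t = l2_fun x t - l2_fun y t"
  unfolding minus_l2_def by (rule l2_fun_of) (intro L2_diff l2_fun_L2)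

lemma l2_fun_uminus: "AE t in lebesgue. l2_fun (- x :: 'a l2) t = - l2_fun x t"
  unfolding uminus_l2_def by (rule l2_fun_of) (intro L2_uminus l2_fun_L2)

lemma l2_fun_scaleR: "AE t in lebesgue. l2_fun (c *\<^sub>R x :: 'a l2) t = c * l2_fun x t"
  unfolding scaleR_l2_def by (rule l2_fun_of) (intro L2_mult l2_fun_L2)

lemma inner_l2_cong:
  assumes "AE t in lebesgue. l2_fun (x :: 'a l2) t = f t" "AE t in lebesgue. l2_fun (y :: 'a l2) t = g t"
    and "f \<in> borel_measurable lebesgue" "g \<in> borel_measurable lebesgue"
  shows "x \<bullet> y = (\<integral>t. f t * g t \<partial>lebesgue)"
  unfolding inner_l2_def
proof (rule Bochner_Integration.integral_cong_AE)
  show "AE t in lebesgue. l2_fun x t * l2_fun y t = f t * g t"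
    using assms(1,2) by eventually_elim simp
qed (use assms in auto)

instance
proof
  fix x y z :: "'a l2" and a b r :: real
  show "dist x y = norm (x - y)" by (rule dist_l2_def)
  show "uniformity = (INF e\<in>{0 <..}. principal {(x, y :: 'a l2). dist x y < e})"
    by (rule uniformity_l2_def)
  show "open U \<longleftrightarrow> (\<forall>x\<in>U. eventually (\<lambda>(x', y). x' = x \<longrightarrow> y \<in> U) uniformity)" for U :: "'a l2 set"
    by (rule open_l2_def)
  show "sgn x = inverse (norm x) *\<^sub>R x" by (rule sgn_l2_def)
  show "norm x = sqrt (x \<bullet> x)" by (rule norm_l2_def)
  show "x + y + z = x + (y + z)"
    unfolding l2_eq_iff using l2_fun_plus[of "x + y" z] l2_fun_plus[of x y] l2_fun_plus[of x "y + z"]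
      l2_fun_plus[of y z] by eventually_elim simp
  show "x + y = y + x" by (simp add: plus_l2_def add.commute)
  show "0 + x = x"
    unfolding l2_eq_iff using l2_fun_plus[of 0 x] l2_fun_zero by eventually_elim simp
  show "- x + x = 0"
    unfolding l2_eq_iff using l2_fun_plus[of "- x" x] l2_fun_uminus[of x] l2_fun_zero
    by eventually_elim simp
  show "x - y = x + - y"
    unfolding l2_eq_iff using l2_fun_plus[of x "- y"] l2_fun_uminus[of y] l2_fun_minus[of x y]
    by eventually_elim simp
  show "a *\<^sub>R (x + y) = a *\<^sub>R x + a *\<^sub>R y"
    unfolding l2_eq_iff using l2_fun_plus[of x y] l2_fun_plus[of "a *\<^sub>R x" "a *\<^sub>R y"]
      l2_fun_scaleR[of a "x + y"] l2_fun_scaleR[of a x] l2_fun_scaleR[of a y]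
    by eventually_elim (simp add: algebra_simps)
  show "(a + b) *\<^sub>R x = a *\<^sub>R x + b *\<^sub>R x"
    unfolding l2_eq_iff using l2_fun_plus[of "a *\<^sub>R x" "b *\<^sub>R x"]
      l2_fun_scaleR[of "a + b" x] l2_fun_scaleR[of a x] l2_fun_scaleR[of b x]
    by eventually_elim (simp add: algebra_simps)
  show "a *\<^sub>R b *\<^sub>R x = (a * b) *\<^sub>R x"
    unfolding l2_eq_iff using l2_fun_scaleR[of a "b *\<^sub>R x"] l2_fun_scaleR[of b x] l2_fun_scaleR[of "a * b" x]
    by eventually_elim simp
  show "1 *\<^sub>R x = x"
    unfolding l2_eq_iff using l2_fun_scaleR[of 1 x] by eventually_elim simp
  show "x \<bullet> y = y \<bullet> x" by (simp add: inner_l2_def mult.commute)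
  show "(x + y) \<bullet> z = x \<bullet> z + y \<bullet> z"
  proof -
    have "(x + y) \<bullet> z = (\<integral>t. (l2_fun x t + l2_fun y t) * l2_fun z t \<partial>lebesgue)"
      by (rule inner_l2_cong) (auto intro: l2_fun_plus)
    then show ?thesis by (simp add: inner_l2_def distrib_right L2_integrable)
  qed
  show "(r *\<^sub>R x) \<bullet> y = r * (x \<bullet> y)"
  proof -
    have "(r *\<^sub>R x) \<bullet> y = (\<integral>t. (r * l2_fun x t) * l2_fun y t \<partial>lebesgue)"
      by (rule inner_l2_cong) (auto intro: l2_fun_scaleR)
    then show ?thesis by (simp add: inner_l2_def mult.assoc)
  qed
  show "0 \<le> x \<bullet> x" by (simp add: inner_l2_def)
  show "x \<bullet> x = 0 \<longleftrightarrow> x = 0"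
  proof -
    have "x \<bullet> x = 0 \<longleftrightarrow> (AE t in lebesgue. l2_fun x t * l2_fun x t = 0)"
      unfolding inner_l2_def by (intro integral_nonneg_eq_0_iff_AE L2_integrable) auto
    also have "\<dots> \<longleftrightarrow> l2_of (l2_fun x) = l2_of (\<lambda>_. 0)"
      by (subst l2_of_eq_iff) (auto simp: L2_zero)
    finally show ?thesis by (simp add: zero_l2_def)
  qed
qed

end

lemma inner_l2_of:
  assumes "f \<in> L2 lebesgue" "g \<in> L2 lebesgue"
  shows "l2_of f \<bullet> l2_of g = (\<integral>t. f t * g t \<partial>lebesgue)"
  by (intro inner_l2_cong l2_fun_of L2_measurable assms)

lemma norm_l2_of_sq: "f \<in> L2 lebesgue \<Longrightarrow> (norm (l2_of f))\<^sup>2 = (\<integral>t. (f t)\<^sup>2 \<partial>lebesgue)"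
  unfolding power2_norm_eq_inner by (simp add: inner_l2_of power2_eq_square)

lemma l2_of_add:
  assumes "f \<in> L2 lebesgue" "g \<in> L2 lebesgue"
  shows "l2_of (\<lambda>x. f x + g x) = l2_of f + l2_of g"
  unfolding plus_l2_def
proof (subst l2_of_eq_iff)
  show "AE x in lebesgue. f x + g x = l2_fun (l2_of f) x + l2_fun (l2_of g) x"
    using l2_fun_of[OF assms(1)] l2_fun_of[OF assms(2)] by eventually_elim simp
qed (auto intro!: L2_add assms)

lemma l2_of_diff:
  assumes "f \<in> L2 lebesgue" "g \<in> L2 lebesgue"
  shows "l2_of (\<lambda>x. f x - g x) = l2_of f - l2_of g"
  unfolding minus_l2_def
proof (subst l2_of_eq_iff)
  show "AE x in lebesgue. f x - g x = l2_fun (l2_of f) x - l2_fun (l2_of g) x"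
    using l2_fun_of[OF assms(1)] l2_fun_of[OF assms(2)] by eventually_elim simp
qed (auto intro!: L2_diff assms)

lemma l2_of_scaleR:
  assumes "f \<in> L2 lebesgue"
  shows "l2_of (\<lambda>x. c * f x) = c *\<^sub>R l2_of f"
  unfolding scaleR_l2_def
proof (subst l2_of_eq_iff)
  show "AE x in lebesgue. c * f x = c * l2_fun (l2_of f) x"
    using l2_fun_of[OF assms(1)] by eventually_elim simp
qed (auto intro!: L2_mult assms)

instance l2 :: (euclidean_space) complete_space
proof
  fix X :: "nat \<Rightarrow> 'a l2" assume X: "Cauchy X"
  define f where "f n = l2_fun (X n)" for n
  have f: "square_integrable lebesgue (f n)" for n
    by (simp add: f_def square_integrable_real_iff)
  have d: "(dist (l2_of u) (l2_of v))\<^sup>2 = (\<integral>x. (norm (u x - v x))\<^sup>2 \<partial>lebesgue)"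
    if "u \<in> L2 lebesgue" "v \<in> L2 lebesgue" for u v :: "'a \<Rightarrow> real"
    by (simp add: dist_norm norm_l2_of_sq L2_diff that flip: l2_of_diff)
  obtain g where g: "square_integrable lebesgue g" "(\<lambda>n. \<integral>x. (norm (f n x - g x))\<^sup>2 \<partial>lebesgue) \<longlonglongrightarrow> 0"
  proof (rule square_integrable_complete[of lebesgue f, OF f])
    fix e :: real assume e: "e > 0"
    then obtain N where N: "\<And>m n. m \<ge> N \<Longrightarrow> n \<ge> N \<Longrightarrow> dist (X m) (X n) < sqrt e"
      using metric_CauchyD[OF X, of "sqrt e"] by auto
    have "(\<integral>x. (norm (f m x - f n x))\<^sup>2 \<partial>lebesgue) < e" if "m \<ge> N" "n \<ge> N" for m n
    proof -
      have "(dist (X m) (X n))\<^sup>2 < (sqrt e)\<^sup>2"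
        using N[OF that] by (intro power_strict_mono) auto
      then show ?thesis using e d[of "f m" "f n"] by (simp add: f_def)
    qed
    then show "\<exists>N. \<forall>m\<ge>N. \<forall>n\<ge>N. (\<integral>x. (norm (f m x - f n x))\<^sup>2 \<partial>lebesgue) < e" by blast
  qed blast
  have "(\<lambda>n. (dist (X n) (l2_of g))\<^sup>2) \<longlonglongrightarrow> 0"
    using g d[of "f n" g for n] by (simp add: f_def square_integrable_real_iff)
  then have "(\<lambda>n. sqrt ((dist (X n) (l2_of g))\<^sup>2)) \<longlonglongrightarrow> sqrt 0" by (rule tendsto_real_sqrt)
  then have "X \<longlonglongrightarrow> l2_of g" by (subst tendsto_dist_iff) simp
  then show "convergent X" by (auto simp: convergent_def)
qed

instance l2 :: (euclidean_space) banach ..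

subsection \<open>Functions on a subset, extended by zero\<close>

text \<open>Extension by zero lets one type \<open>point l2\<close> serve all sheets at once; the
  functions on \<open>U\<close> become a closed subspace of it.\<close>

definition l2_on :: "'a::euclidean_space set \<Rightarrow> ('a \<Rightarrow> real) \<Rightarrow> 'a l2" where
  "l2_on U f = l2_of (\<lambda>x. indicator U x * f x)"

context
  fixes U :: "'a::euclidean_space set"
  assumes U: "U \<in> sets lebesgue"
begin

lemma L2_on_iff: "f \<in> L2 (lebesgue_on U) \<longleftrightarrow> (\<lambda>x. indicator U x * f x) \<in> L2 lebesgue"
proof -
  have "f \<in> borel_measurable (lebesgue_on U) \<longleftrightarrow> (\<lambda>x. indicator U x * f x) \<in> borel_measurable lebesgue"
    using borel_measurable_restrict_space_iff[of U lebesgue f] U by (simp add: mult.commute)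
  moreover have "integrable (lebesgue_on U) (\<lambda>x. (f x)\<^sup>2) \<longleftrightarrow> integrable lebesgue (\<lambda>x. indicator U x * (f x)\<^sup>2)"
    using integrable_restrict_space[of U lebesgue "\<lambda>x. (f x)\<^sup>2"] U by simp
  moreover have "(\<lambda>x. indicator U x * (f x)\<^sup>2) = (\<lambda>x. (indicator U x * f x)\<^sup>2)"
    by (auto simp: fun_eq_iff indicator_def)
  ultimately show ?thesis by (simp add: L2_def)
qed

lemma AE_on_iff: "(AE x in lebesgue_on U. P x) \<longleftrightarrow> (AE x in lebesgue. x \<in> U \<longrightarrow> P x)"
  using AE_restrict_space_iff[of U lebesgue P] U by simp

lemma l2_on_eq_iff:
  assumes "f \<in> L2 (lebesgue_on U)" "g \<in> L2 (lebesgue_on U)"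
  shows "l2_on U f = l2_on U g \<longleftrightarrow> (AE x in lebesgue_on U. f x = g x)"
proof -
  have "l2_on U f = l2_on U g \<longleftrightarrow> (AE x in lebesgue. indicator U x * f x = indicator U x * g x)"
    unfolding l2_on_def using assms by (intro l2_of_eq_iff) (auto simp: L2_on_iff)
  also have "\<dots> \<longleftrightarrow> (AE x in lebesgue. x \<in> U \<longrightarrow> f x = g x)" by (intro AE_cong) (auto simp: indicator_def)
  finally show ?thesis by (simp add: AE_on_iff)
qed

lemma inner_l2_on:
  assumes "f \<in> L2 (lebesgue_on U)" "g \<in> L2 (lebesgue_on U)"
  shows "l2_on U f \<bullet> l2_on U g = (\<integral>x. f x * g x \<partial>lebesgue_on U)"
proof -
  have "l2_on U f \<bullet> l2_on U g = (\<integral>x. (indicator U x * f x) * (indicator U x * g x) \<partial>lebesgue)"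
    unfolding l2_on_def using assms by (intro inner_l2_of) (auto simp: L2_on_iff)
  also have "\<dots> = (\<integral>x. indicator U x *\<^sub>R (f x * g x) \<partial>lebesgue)"
    by (intro Bochner_Integration.integral_cong) (auto simp: indicator_def)
  also have "\<dots> = (\<integral>x. f x * g x \<partial>lebesgue_on U)"
    using U by (intro integral_restrict_space[symmetric]) auto
  finally show ?thesis .
qed

lemma norm_l2_on_sq:
  "f \<in> L2 (lebesgue_on U) \<Longrightarrow> (norm (l2_on U f))\<^sup>2 = (\<integral>x. (f x)\<^sup>2 \<partial>lebesgue_on U)"
  unfolding power2_norm_eq_inner by (simp add: inner_l2_on power2_eq_square)

lemma norm_l2_on: "f \<in> L2 (lebesgue_on U) \<Longrightarrow> norm (l2_on U f) = L2_norm (lebesgue_on U) f"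
  by (simp add: L2_norm_def flip: norm_l2_on_sq)

lemma l2_on_add:
  "f \<in> L2 (lebesgue_on U) \<Longrightarrow> g \<in> L2 (lebesgue_on U) \<Longrightarrow> l2_on U (\<lambda>x. f x + g x) = l2_on U f + l2_on U g"
  unfolding l2_on_def by (subst l2_of_add[symmetric]) (auto simp: L2_on_iff algebra_simps)

lemma l2_on_diff:
  "f \<in> L2 (lebesgue_on U) \<Longrightarrow> g \<in> L2 (lebesgue_on U) \<Longrightarrow> l2_on U (\<lambda>x. f x - g x) = l2_on U f - l2_on U g"
  unfolding l2_on_def by (subst l2_of_diff[symmetric]) (auto simp: L2_on_iff algebra_simps)

lemma l2_on_scaleR:
  "f \<in> L2 (lebesgue_on U) \<Longrightarrow> l2_on U (\<lambda>x. c * f x) = c *\<^sub>R l2_on U f"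
  unfolding l2_on_def by (subst l2_of_scaleR[symmetric]) (auto simp: L2_on_iff algebra_simps)

lemma l2_on_zero: "l2_on U (\<lambda>x. 0) = 0"
  by (simp add: l2_on_def zero_l2_def)

text \<open>Convergence of representatives becomes convergence in a Hilbert space. Membership of
  \<open>u n\<close> in \<open>L2\<close> is required only eventually, and only there does
  \<open>l2_on U (u n)\<close> have a meaning.\<close>

lemma L2_converges_iff:
  "L2_converges (lebesgue_on U) u f \<longleftrightarrow>
     f \<in> L2 (lebesgue_on U) \<and> (\<forall>\<^sub>F n in sequentially. u n \<in> L2 (lebesgue_on U)) \<and>
     (\<lambda>n. l2_on U (u n)) \<longlonglongrightarrow> l2_on U f"
proof -
  have "(\<lambda>n. L2_norm (lebesgue_on U) (\<lambda>x. u n x - f x)) \<longlonglongrightarrow> 0 \<longleftrightarrow> (\<lambda>n. l2_on U (u n)) \<longlonglongrightarrow> l2_on U f"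
    if f: "f \<in> L2 (lebesgue_on U)" and u: "\<forall>\<^sub>F n in sequentially. u n \<in> L2 (lebesgue_on U)"
  proof -
    have "(\<lambda>n. l2_on U (u n)) \<longlonglongrightarrow> l2_on U f
        \<longleftrightarrow> (\<lambda>n. dist (l2_on U (u n)) (l2_on U f)) \<longlonglongrightarrow> 0"
      by (rule tendsto_dist_iff)
    also have "\<dots> \<longleftrightarrow> (\<lambda>n. L2_norm (lebesgue_on U) (\<lambda>x. u n x - f x)) \<longlonglongrightarrow> 0"
      by (intro filterlim_cong refl eventually_mono[OF u])
        (use f in \<open>simp add: dist_norm norm_l2_on L2_diff flip: l2_on_diff\<close>)
    finally show ?thesis by simp
  qed
  then show ?thesis unfolding L2_converges_def by blast
qed

lemma L2_on_l2_fun [simp]: "l2_fun x \<in> L2 (lebesgue_on U)"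
  unfolding L2_on_iff
  unfolding square_integrable_real_iff[symmetric]
proof (rule square_integrable_bound)
  show "(\<lambda>t. indicator U t * l2_fun x t) \<in> borel_measurable lebesgue"
    using U by (intro borel_measurable_times) auto
  show "integrable lebesgue (\<lambda>t. (l2_fun x t)\<^sup>2)" using l2_fun_L2[of x] by (simp add: L2_def)
qed (auto simp: indicator_def)

lemma l2_fun_on:
  assumes "f \<in> L2 (lebesgue_on U)"
  shows "AE x in lebesgue_on U. l2_fun (l2_on U f) x = f x"
  using l2_fun_of[OF assms[unfolded L2_on_iff]] unfolding AE_on_iff l2_on_def
  by eventually_elim auto

end

section \<open>Test functions\<close>

text \<open>With \<open>p = 1\<close> this is the classical smooth function exp(-1/x), extended by
  0. The polynomial factor makes the family closed under differentiation.\<close>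

definition flat :: "real poly \<Rightarrow> real \<Rightarrow> real" where
  "flat p x = (if x > 0 then poly p (1 / x) * exp (- (1 / x)) else 0)"

lemma poly_times_exp_minus_tendsto_0: "((\<lambda>y. poly p y * exp (- y)) \<longlongrightarrow> (0::real)) at_top"
proof -
  have "((\<lambda>y. \<Sum>i\<le>degree p. coeff p i * (y ^ i / exp y)) \<longlongrightarrow> (\<Sum>i\<le>degree p. coeff p i * 0)) at_top"
    by (intro tendsto_intros tendsto_power_div_exp_0)
  then show ?thesis
    by (simp add: poly_altdef exp_minus sum_distrib_right divide_inverse mult.assoc)
qed

text \<open>With y = 1/x one has d/dx = - y^2 d/dy, so p(y) exp(-y) has the derivative y^2 (p -
  p')(y) exp(-y). At 0 the difference quotient from the right is y p(y) exp(-y) with y tending to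
  infinity.\<close>

lemma flat_has_derivative:
  "(flat p has_real_derivative flat ([:0, 0, 1:] * (p - pderiv p)) x) (at x)"
proof -
  consider "x > 0" | "x < 0" | "x = 0" by linarith
  then show ?thesis
  proof cases
    case 1
    have "((\<lambda>x. poly p (1 / x) * exp (- (1 / x))) has_real_derivative
        flat ([:0, 0, 1:] * (p - pderiv p)) x) (at x)"
      using 1 by (auto intro!: derivative_eq_intros DERIV_chain'[OF _ poly_DERIV] simp: flat_def field_simps power2_eq_square)
    then show ?thesis
      by (rule has_field_derivative_transform_within_open[of _ _ _ "{0<..}"]) (use 1 in \<open>auto simp: flat_def\<close>)
  next
    case 2
    have "((\<lambda>x. 0) has_real_derivative flat ([:0, 0, 1:] * (p - pderiv p)) x) (at x)"
      using 2 by (simp add: flat_def)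
    then show ?thesis
      by (rule has_field_derivative_transform_within_open[of _ _ _ "{..<0}"]) (use 2 in \<open>auto simp: flat_def\<close>)
  next
    case 3
    have "((\<lambda>y. (flat p y - flat p 0) / (y - 0)) \<longlongrightarrow> 0) (at_left 0)"
      by (rule tendsto_eventually) (auto simp: flat_def eventually_at_left_field intro!: exI[of _ "-1"])
    moreover have "((\<lambda>y. (flat p y - flat p 0) / (y - 0)) \<longlongrightarrow> 0) (at_right 0)"
      unfolding filterlim_at_right_to_top
    proof (rule Lim_transform_eventually[OF poly_times_exp_minus_tendsto_0[of "[:0, 1:] * p"]])
      show "\<forall>\<^sub>F x in at_top. poly ([:0, 1:] * p) x * exp (- x) = (flat p (inverse x) - flat p 0) / (inverse x - 0)"
        using eventually_gt_at_top[of 0] by eventually_elim (simp add: flat_def field_simps)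
    qed
    ultimately show ?thesis
      using 3 by (simp add: has_field_derivative_iff filterlim_at_split flat_def)
  qed
qed

text \<open>The functions generated by \<open>flat\<close> are closed under partial derivatives, hence smooth.\<close>

inductive_set flat_algebra :: "('a::euclidean_space \<Rightarrow> real) set" where
  flat: "(\<lambda>x. flat p (x \<bullet> v + c)) \<in> flat_algebra"
| const: "(\<lambda>x. c) \<in> flat_algebra"
| add: "f \<in> flat_algebra \<Longrightarrow> g \<in> flat_algebra \<Longrightarrow> (\<lambda>x. f x + g x) \<in> flat_algebra"
| mult: "f \<in> flat_algebra \<Longrightarrow> g \<in> flat_algebra \<Longrightarrow> (\<lambda>x. f x * g x) \<in> flat_algebra"

lemma flat_algebra_derivative:
  assumes "f \<in> flat_algebra"
  shows "\<exists>f'. (\<forall>x. (f has_derivative f' x) (at x)) \<and> (\<forall>b. (\<lambda>x. f' x b) \<in> flat_algebra)"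
  using assms
proof induction
  case (flat p v c)
  let ?q = "[:0, 0, 1:] * (p - pderiv p)"
  have "((\<lambda>x. flat p (x \<bullet> v + c)) has_derivative (\<lambda>b. (b \<bullet> v) * flat ?q (x \<bullet> v + c))) (at x)" for x
    by (rule DERIV_compose_FDERIV[OF flat_has_derivative]) (auto intro!: derivative_eq_intros)
  moreover have "(\<lambda>x. (b \<bullet> v) * flat ?q (x \<bullet> v + c)) \<in> flat_algebra" for b
    by (intro flat_algebra.intros)
  ultimately show ?case
    by (intro exI[of _ "\<lambda>x b. (b \<bullet> v) * flat ?q (x \<bullet> v + c)"]) blast
next
  case (const c)
  show ?case by (rule exI[of _ "\<lambda>_ _. 0"]) (auto intro: flat_algebra.const)
next
  case (add f g)
  then obtain f' g' where "\<And>x. (f has_derivative f' x) (at x)" "\<And>b. (\<lambda>x. f' x b) \<in> flat_algebra"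
    "\<And>x. (g has_derivative g' x) (at x)" "\<And>b. (\<lambda>x. g' x b) \<in> flat_algebra" by blast
  then show ?case
    by (intro exI[of _ "\<lambda>x b. f' x b + g' x b"]) (auto intro: flat_algebra.add has_derivative_add)
next
  case (mult f g)
  then obtain f' g' where "\<And>x. (f has_derivative f' x) (at x)" "\<And>b. (\<lambda>x. f' x b) \<in> flat_algebra"
    "\<And>x. (g has_derivative g' x) (at x)" "\<And>b. (\<lambda>x. g' x b) \<in> flat_algebra" by blast
  with mult.hyps show ?case
    by (intro exI[of _ "\<lambda>x b. f x * g' x b + f' x b * g x"])
      (auto intro!: flat_algebra.add flat_algebra.mult has_derivative_mult)
qed

lemma flat_algebra_differentiable: "f \<in> flat_algebra \<Longrightarrow> f differentiable (at x)"
  using flat_algebra_derivative[of f] by (auto simp: differentiable_def)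

lemma flat_algebra_partial: "f \<in> flat_algebra \<Longrightarrow> partial b f \<in> flat_algebra"
proof -
  assume "f \<in> flat_algebra"
  then obtain f' where f': "\<And>x. (f has_derivative f' x) (at x)" "\<And>b. (\<lambda>x. f' x b) \<in> flat_algebra"
    using flat_algebra_derivative by blast
  have "partial b f = (\<lambda>x. f' x b)"
    by (simp add: fun_eq_iff partial_def flip: frechet_derivative_at[OF f'(1)])
  then show ?thesis using f'(2) by simp
qed

lemma flat_algebra_Ck: "f \<in> flat_algebra \<Longrightarrow> Ck n f"
proof (induction n arbitrary: f)
  case 0
  then show ?case
    by (auto intro!: continuous_at_imp_continuous_on differentiable_imp_continuous_within flat_algebra_differentiable)
next
  case (Suc n)
  then show ?case by (auto simp: flat_algebra_differentiable flat_algebra_partial)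
qed

lemma flat_algebra_prod:
  "finite I \<Longrightarrow> (\<And>i. i \<in> I \<Longrightarrow> f i \<in> flat_algebra) \<Longrightarrow> (\<lambda>x. \<Prod>i\<in>I. f i x) \<in> flat_algebra"
proof (induction rule: finite_induct)
  case empty
  then show ?case by (simp add: flat_algebra.const)
next
  case (insert i I)
  then show ?case by (simp add: flat_algebra.mult)
qed

text \<open>Smooth substitutes for the indicator of the open box: exp(-1/(n y)) tends to 1 for each
  y > 0, while the support stays in the closed box for every \<open>n\<close>. The fundamental lemma
  is tested with these functions alone.\<close>

definition box_bump :: "nat \<Rightarrow> 'a::euclidean_space \<Rightarrow> 'a \<Rightarrow> 'a \<Rightarrow> real" where
  "box_bump n a b x =
     (\<Prod>i\<in>Basis. flat 1 (real n * (x \<bullet> i - a \<bullet> i)) * flat 1 (real n * (b \<bullet> i - x \<bullet> i)))"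

lemma flat_1: "flat 1 x = (if x > 0 then exp (- (1 / x)) else 0)"
  by (simp add: flat_def)

lemma flat_1_bounds: "0 \<le> flat 1 x" "flat 1 x \<le> 1"
  by (auto simp: flat_1)

lemma box_bump_in_flat_algebra: "box_bump n a b \<in> flat_algebra"
proof -
  have "(\<lambda>x. flat 1 (x \<bullet> (real n *\<^sub>R i) + - real n * (a \<bullet> i)) * flat 1 (x \<bullet> (- real n *\<^sub>R i) + real n * (b \<bullet> i)))
      \<in> flat_algebra" for i
    by (intro flat_algebra.intros)
  then have "(\<lambda>x. \<Prod>i\<in>Basis. flat 1 (x \<bullet> (real n *\<^sub>R i) + - real n * (a \<bullet> i)) *
      flat 1 (x \<bullet> (- real n *\<^sub>R i) + real n * (b \<bullet> i))) \<in> flat_algebra"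
    by (intro flat_algebra_prod) auto
  then show ?thesis by (simp add: box_bump_def[abs_def] algebra_simps)
qed

lemma box_bump_bounds: "0 \<le> box_bump n a b x" "box_bump n a b x \<le> 1"
  unfolding box_bump_def
  by (auto intro!: prod_nonneg prod_le_1 mult_nonneg_nonneg mult_le_one simp: flat_1_bounds)

lemma box_bump_outside: "x \<notin> box a b \<Longrightarrow> box_bump n a b x = 0"
proof -
  assume "x \<notin> box a b"
  then obtain i where i: "i \<in> Basis" "x \<bullet> i \<le> a \<bullet> i \<or> b \<bullet> i \<le> x \<bullet> i" by (auto simp: mem_box)
  then have "real n * (x \<bullet> i - a \<bullet> i) \<le> 0 \<or> real n * (b \<bullet> i - x \<bullet> i) \<le> 0"
    by (auto simp: mult_le_0_iff)
  then have "flat 1 (real n * (x \<bullet> i - a \<bullet> i)) * flat 1 (real n * (b \<bullet> i - x \<bullet> i)) = 0"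
    by (auto simp: flat_1)
  with i(1) show ?thesis unfolding box_bump_def by (intro prod_zero) auto
qed

lemma box_bump_tendsto: "(\<lambda>n. box_bump n a b x) \<longlonglongrightarrow> indicator (box a b) x"
proof (cases "x \<in> box a b")
  case True
  have lim: "(\<lambda>n. flat 1 (real n * y)) \<longlonglongrightarrow> 1" if y: "y > 0" for y
  proof -
    have "(\<lambda>n. exp (- (1 / y * (1 / real n)))) \<longlonglongrightarrow> exp (- (1 / y * 0))"
      by (intro tendsto_intros lim_1_over_n)
    moreover have "\<forall>\<^sub>F n in sequentially. exp (- (1 / y * (1 / real n))) = flat 1 (real n * y)"
      using y by (auto simp: flat_1 eventually_sequentially intro!: exI[of _ 1])
    ultimately show ?thesis using Lim_transform_eventually by fastforce
  qed
  have "(\<lambda>n. box_bump n a b x) \<longlonglongrightarrow> (\<Prod>i\<in>(Basis::'a set). 1 * 1)"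
    unfolding box_bump_def
    by (intro tendsto_prod tendsto_mult lim) (use True in \<open>auto simp: mem_box\<close>)
  then show ?thesis using True by simp
qed (simp add: box_bump_outside)

lemma test_function_box_bump:
  assumes "cbox a b \<subseteq> U"
  shows "test_function U (box_bump n a b)"
proof -
  have "{x. box_bump n a b x \<noteq> 0} \<subseteq> box a b" using box_bump_outside[of _ a b n] by blast
  then have cl: "closure {x. box_bump n a b x \<noteq> 0} \<subseteq> cbox a b"
    using box_subset_cbox by (intro closure_minimal closed_cbox) blast
  have "compact (closure {x. box_bump n a b x \<noteq> 0})"
    using cl compact_Int_closed[OF compact_cbox[of a b] closed_closure[of "{x. box_bump n a b x \<noteq> 0}"]]
    by (simp add: Int_absorb1 del: compact_closure)
  moreover have "closure {x. box_bump n a b x \<noteq> 0} \<subseteq> U" using cl assms by blast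
  ultimately show ?thesis
    by (simp add: test_function_def flat_algebra_Ck box_bump_in_flat_algebra del: compact_closure)
qed

lemma Ck_continuous: "Ck n f \<Longrightarrow> continuous_on UNIV f"
  by (cases n) (auto intro!: continuous_at_imp_continuous_on differentiable_imp_continuous_within)

lemma Ck_1_iff:
  "Ck 1 f \<longleftrightarrow> (\<forall>x. f differentiable (at x)) \<and> (\<forall>b\<in>Basis. continuous_on UNIV (partial b f))"
  by simp

lemma bounded_test_function:
  fixes f :: "'a::euclidean_space \<Rightarrow> real"
  assumes "continuous_on UNIV f" "compact K" "\<And>x. x \<notin> K \<Longrightarrow> f x = 0"
  obtains C where "\<And>x. \<bar>f x\<bar> \<le> C"
proof -
  have "compact (f ` K)" using assms by (intro compact_continuous_image continuous_on_subset[OF assms(1)]) auto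
  then obtain C where "\<And>y. y \<in> f ` K \<Longrightarrow> norm y \<le> C" using compact_imp_bounded bounded_iff by metis
  then have "\<bar>f x\<bar> \<le> max C 0" for x using assms(3)[of x] by (cases "x \<in> K") force+
  then show ?thesis by (rule that)
qed

lemma L2_continuous_compact_support:
  fixes f :: "'a::euclidean_space \<Rightarrow> real"
  assumes cont: "continuous_on UNIV f" and K: "compact K" and 0: "\<And>x. x \<notin> K \<Longrightarrow> f x = 0"
    and U: "U \<in> sets lebesgue"
  shows "f \<in> L2 (lebesgue_on U)"
proof -
  obtain C where C: "\<And>x. \<bar>f x\<bar> \<le> C" using bounded_test_function[OF cont K 0] by blast
  have meas: "(\<lambda>x. indicator U x * f x) \<in> borel_measurable lebesgue"
    using borel_measurable_continuous_onI[OF cont] U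
    by (intro borel_measurable_times borel_measurable_indicator measurable_completion) simp_all
  have "integrable lebesgue (indicat_real K)"
    using K by (intro integrable_real_indicator) (auto simp: compact_imp_closed dest: emeasure_bounded_finite[OF compact_imp_bounded])
  then have "integrable lebesgue (\<lambda>x. C\<^sup>2 * indicator K x)" by simp
  then have "square_integrable lebesgue (\<lambda>x. indicator U x * f x)"
  proof (rule square_integrable_bound[OF meas])
    have "f x * f x \<le> C * C" for x
      using C[of x] abs_le_square_iff[of "f x" C] by (simp add: power2_eq_square)
    then show "AE x in lebesgue. (norm (indicator U x * f x))\<^sup>2 \<le> C\<^sup>2 * indicator K x"
      using 0 by (intro AE_I2) (auto simp: indicator_def power2_eq_square)
  qed
  then show ?thesis by (simp add: L2_on_iff[OF U] square_integrable_real_iff)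
qed

lemma partial_outside_support:
  assumes "x \<notin> closure {x. f x \<noteq> 0}"
  shows "partial b f x = 0"
proof -
  have "((\<lambda>x. 0) has_derivative (\<lambda>_. 0)) (at x)" by simp
  then have "(f has_derivative (\<lambda>_. 0)) (at x)"
    by (rule has_derivative_transform_within_open[of _ _ _ _ "- closure {x. f x \<noteq> 0}"])
      (use assms closure_subset[of "{x. f x \<noteq> 0}"] in auto)
  then show ?thesis by (simp add: partial_def flip: frechet_derivative_at)
qed

lemma test_function_L2:
  assumes "test_function U \<phi>" "S \<in> sets lebesgue"
  shows "\<phi> \<in> L2 (lebesgue_on S)" "b \<in> Basis \<Longrightarrow> partial b \<phi> \<in> L2 (lebesgue_on S)"
proof -
  let ?K = "closure {x. \<phi> x \<noteq> 0}"
  have K: "compact ?K" and Ck: "\<And>n. Ck n \<phi>" using assms by (auto simp: test_function_def)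
  show "\<phi> \<in> L2 (lebesgue_on S)"
    by (rule L2_continuous_compact_support[OF Ck_continuous[OF Ck] K _ assms(2)])
      (use closure_subset[of "{x. \<phi> x \<noteq> 0}"] in blast)
  show "partial b \<phi> \<in> L2 (lebesgue_on S)" if "b \<in> Basis"
    by (rule L2_continuous_compact_support[OF _ K _ assms(2)])
      (use Ck[of 1] that in \<open>auto simp: Ck_1_iff partial_outside_support\<close>)
qed

subsection \<open>The fundamental lemma of the calculus of variations\<close>

text \<open>Open boxes are stable under intersection and generate the Borel sets, so vanishing
  integrals spread from boxes to all Borel sets by Dynkin's theorem.\<close>

lemma AE_zero_of_box_integrals:
  fixes f :: "'a::euclidean_space \<Rightarrow> real"
  assumes f: "integrable lborel f"
    and box: "\<And>a b. (\<integral>x. indicator (box a b) x * f x \<partial>lborel) = 0"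
  shows "AE x in lborel. f x = 0"
proof (rule density_unique_real[OF f integrable_zero])
  fix A :: "'a set" assume "A \<in> sets lborel"
  then have A: "A \<in> sigma_sets UNIV (range (\<lambda>(a, b). box a b))" by (simp add: borel_eq_box)
  have "Int_stable (range (\<lambda>(a, b). box a b :: 'a set))" "range (\<lambda>(a, b). box a b :: 'a set) \<subseteq> Pow UNIV"
    by (auto simp: Int_stable_def box_Int_box)
  from this A have "set_lebesgue_integral lborel A f = 0"
  proof (induction rule: sigma_sets_induct_disjoint)
    case (basic A)
    then show ?case using box by (auto simp: set_lebesgue_integral_def)
  next
    case (compl A)
    then have A: "A \<in> sets lborel" by (simp add: borel_eq_box)
    \<comment> \<open>Complements need the total integral to vanish; the whole space is exhausted by
      the boxes of half-width \<open>n\<close>.\<close>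
    have "(\<integral>x. f x \<partial>lborel) = 0"
    proof (rule LIMSEQ_unique)
      let ?B = "\<lambda>n::nat. box (- (real n *\<^sub>R One)) (real n *\<^sub>R One) :: 'a set"
      show "(\<lambda>n. \<integral>x. indicator (?B n) x * f x \<partial>lborel) \<longlonglongrightarrow> (\<integral>x. f x \<partial>lborel)"
      proof (rule integral_dominated_convergence[where w = "\<lambda>x. \<bar>f x\<bar>"])
        show "AE x in lborel. (\<lambda>n. indicator (?B n) x * f x) \<longlonglongrightarrow> f x"
        proof (rule AE_I2)
          fix x :: 'a
          obtain N :: nat where N: "norm x < real N" using reals_Archimedean2 by blast
          have "x \<in> ?B n" if "n \<ge> N" for n
            using N that Basis_le_norm[of _ x] by (force simp: mem_box abs_if split: if_splits)
          then have "\<forall>\<^sub>F n in sequentially. indicator (?B n) x * f x = f x"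
            by (auto simp: eventually_sequentially intro!: exI[of _ N])
          then show "(\<lambda>n. indicator (?B n) x * f x) \<longlonglongrightarrow> f x" by (rule tendsto_eventually)
        qed
      qed (use f in \<open>auto simp: indicator_def\<close>)
    qed (simp add: box)
    moreover have "set_lebesgue_integral lborel (UNIV - A) f = (\<integral>x. f x - indicator A x *\<^sub>R f x \<partial>lborel)"
      unfolding set_lebesgue_integral_def
      by (intro Bochner_Integration.integral_cong) (auto simp: indicator_def)
    moreover have "\<dots> = (\<integral>x. f x \<partial>lborel) - set_lebesgue_integral lborel A f"
      unfolding set_lebesgue_integral_def
      using A f by (intro Bochner_Integration.integral_diff integrable_mult_indicator) auto
    ultimately show ?case using compl.IH by simp
  next
    case (union A)
    then have A: "\<And>i. A i \<in> sets lborel" by (simp add: borel_eq_box) blast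
    show ?case
      by (subst lebesgue_integral_countable_add)
        (use A union f integrable_mult_indicator[of "\<Union> (range A)" lborel f] in
          \<open>auto simp: disjoint_family_on_def set_integrable_def\<close>)
  qed (simp add: set_lebesgue_integral_def)
  then show "set_lebesgue_integral lborel A f = set_lebesgue_integral lborel A (\<lambda>_. 0)"
    by simp
qed

lemma indicator_L2: "B \<in> fmeasurable M \<Longrightarrow> indicat_real B \<in> L2 M"
proof -
  assume "B \<in> fmeasurable M"
  moreover have "(\<lambda>x. (indicat_real B x)\<^sup>2) = indicat_real B" by (auto simp: fun_eq_iff indicator_def)
  ultimately show ?thesis by (auto simp: L2_def fmeasurable_def intro!: integrable_real_indicator)
qed

lemma integrable_indicator_times_L2:
  "g \<in> L2 M \<Longrightarrow> B \<in> fmeasurable M \<Longrightarrow> integrable M (\<lambda>x. indicator B x * g x)"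
  by (intro L2_integrable indicator_L2)

text \<open>Localized to closed boxes inside \<open>U\<close>, countably many of which cover
  \<open>U\<close>. On each of them \<open>g\<close> is replaced by a Borel function, because
  \<open>AE_zero_of_box_integrals\<close> lives on \<open>lborel\<close> while \<open>g\<close> is
  only Lebesgue measurable.\<close>

lemma AE_zero_on_open_of_box_integrals:
  fixes g :: "'a::euclidean_space \<Rightarrow> real"
  assumes U: "open U" and g: "g \<in> L2 lebesgue"
    and box0: "\<And>a b. cbox a b \<subseteq> U \<Longrightarrow> (\<integral>x. indicator (box a b) x * g x \<partial>lebesgue) = 0"
  shows "AE x in lebesgue. x \<in> U \<longrightarrow> g x = 0"
proof -
  have [measurable]: "g \<in> borel_measurable lebesgue" using g by (rule L2_measurable)
  note intbox = integrable_indicator_times_L2[OF g]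
  have onbox: "AE x in lebesgue. x \<in> cbox c d \<longrightarrow> g x = 0" if cd: "cbox c d \<subseteq> U" for c d
  proof -
    have m: "(\<lambda>x. indicator (box c d) x * g x) \<in> borel_measurable lebesgue"
      by (rule borel_measurable_times) (auto intro!: borel_measurable_indicator)
    then obtain f where f [measurable]: "f \<in> borel_measurable lborel"
      and fg: "AE x in lborel. indicator (box c d) x * g x = f x"
      using completion_ex_borel_measurable_real by blast
    have fg': "AE x in lebesgue. indicator (box c d) x * g x = f x"
      using fg by (rule AE_completion)
    have "f \<in> borel_measurable lebesgue" using f by (rule measurable_completion)
    then have "integrable lebesgue f"
      using intbox[of "box c d"] integrable_cong_AE[OF m _ fg'] by simp
    then have "integrable lborel f" using f by (simp add: integrable_completion)
    moreover have "(\<integral>x. indicator (box a b) x * f x \<partial>lborel) = 0" for a b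
    proof -
      have "(\<integral>x. indicator (box a b) x * f x \<partial>lborel) = (\<integral>x. indicator (box a b) x * f x \<partial>lebesgue)"
        by (intro integral_completion[symmetric]) measurable
      also have "\<dots> = (\<integral>x. indicator (box a b \<inter> box c d) x * g x \<partial>lebesgue)"
      proof (rule Bochner_Integration.integral_cong_AE)
        show "AE x in lebesgue. indicator (box a b) x * f x = indicator (box a b \<inter> box c d) x * g x"
          using fg' by eventually_elim (auto simp: indicator_def)
        show "(\<lambda>x. indicator (box a b) x * f x) \<in> borel_measurable lebesgue"
          by (rule measurable_completion) simp
        show "(\<lambda>x. indicator (box a b \<inter> box c d) x * g x) \<in> borel_measurable lebesgue"
          by (rule borel_measurable_times) (auto intro!: borel_measurable_indicator)
      qed
      also have "\<dots> = 0"
      proof (cases "box a b \<inter> box c d = {}")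
        case False
        let ?a = "\<Sum>i\<in>Basis. max (a\<bullet>i) (c\<bullet>i) *\<^sub>R i" and ?b = "\<Sum>i\<in>Basis. min (b\<bullet>i) (d\<bullet>i) *\<^sub>R i"
        have "cbox ?a ?b \<subseteq> cbox c d" by (auto simp: mem_box)
        then have "cbox ?a ?b \<subseteq> U" using cd by blast
        then show ?thesis unfolding box_Int_box by (rule box0)
      qed simp
      finally show ?thesis .
    qed
    ultimately have "AE x in lborel. f x = 0" by (rule AE_zero_of_box_integrals)
    then have "AE x in lebesgue. f x = 0" by (rule AE_completion)
    \<comment> \<open>The argument so far sees the open box only; its boundary is
      negligible.\<close>
    moreover have "AE x in lebesgue. x \<notin> cbox c d - box c d"
      using negligible_frontier_interval[of c d] by (intro AE_not_in) (simp add: negligible_iff_null_sets)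
    ultimately show ?thesis
      using fg' by eventually_elim (use cd box_subset_cbox[of c d] in \<open>auto simp: indicator_def split: if_splits\<close>)
  qed
  obtain D where D: "countable D" "D \<subseteq> Pow U" "\<And>X. X \<in> D \<Longrightarrow> \<exists>a b. X = cbox a b" "\<Union>D = U"
    using open_countable_Union_open_cbox[OF U] by metis
  have "AE x in lebesgue. \<forall>X\<in>D. x \<in> X \<longrightarrow> g x = 0"
  proof (rule AE_ball_countable'[OF _ D(1)])
    fix X assume "X \<in> D"
    then show "AE x in lebesgue. x \<in> X \<longrightarrow> g x = 0" using onbox D(2,3) by blast
  qed
  then show ?thesis
    by eventually_elim (use D(4) in blast)
qed

text \<open>The bumps stay bounded and converge to the indicators of boxes, so dominated convergence
  turns the hypothesis into vanishing box integrals.\<close>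

lemma fundamental_lemma:
  fixes g :: "'a::euclidean_space \<Rightarrow> real"
  assumes U: "open U" and g: "g \<in> L2 (lebesgue_on U)"
    and zero: "\<And>n a b. cbox a b \<subseteq> U \<Longrightarrow> (\<integral>x. g x * box_bump n a b x \<partial>lebesgue_on U) = 0"
  shows "AE x in lebesgue_on U. g x = 0"
proof -
  have Um: "U \<in> sets lebesgue" using U by simp
  let ?g = "\<lambda>x. indicator U x * g x"
  have gL: "?g \<in> L2 lebesgue" using g by (simp add: L2_on_iff[OF Um])
  then have [measurable]: "?g \<in> borel_measurable lebesgue" by (rule L2_measurable)
  note intbox = integrable_indicator_times_L2[OF gL]
  have box0: "(\<integral>x. indicator (box a b) x * ?g x \<partial>lebesgue) = 0" if ab: "cbox a b \<subseteq> U" for a b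
  proof (rule LIMSEQ_unique)
    show "(\<lambda>n. \<integral>x. box_bump n a b x * ?g x \<partial>lebesgue) \<longlonglongrightarrow> (\<integral>x. indicator (box a b) x * ?g x \<partial>lebesgue)"
    proof (rule integral_dominated_convergence[where w = "\<lambda>x. \<bar>indicator (box a b) x * ?g x\<bar>"])
      show "(\<lambda>x. box_bump n a b x * ?g x) \<in> borel_measurable lebesgue" for n
      proof (rule borel_measurable_times)
        have "box_bump n a b \<in> borel_measurable borel"
          by (intro borel_measurable_continuous_onI Ck_continuous[of 0] flat_algebra_Ck box_bump_in_flat_algebra)
        then show "box_bump n a b \<in> borel_measurable lebesgue" by (intro measurable_completion) simp
      qed simp
      show "AE x in lebesgue. norm (box_bump n a b x * ?g x) \<le> \<bar>indicator (box a b) x * ?g x\<bar>" for n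
        using box_bump_bounds[of n a b] box_bump_outside[of _ a b n]
        by (intro AE_I2) (auto simp: abs_mult indicator_def intro!: mult_left_le_one_le)
      show "AE x in lebesgue. (\<lambda>n. box_bump n a b x * ?g x) \<longlonglongrightarrow> indicator (box a b) x * ?g x"
        by (intro AE_I2 tendsto_mult_right box_bump_tendsto)
    qed (use intbox[of "box a b"] in auto)
    have "(\<integral>x. box_bump n a b x * ?g x \<partial>lebesgue) = 0" for n
    proof -
      have "(\<integral>x. box_bump n a b x * ?g x \<partial>lebesgue) = (\<integral>x. indicator U x *\<^sub>R (g x * box_bump n a b x) \<partial>lebesgue)"
        by (intro Bochner_Integration.integral_cong) auto
      also have "\<dots> = (\<integral>x. g x * box_bump n a b x \<partial>lebesgue_on U)"
        using Um by (intro integral_restrict_space[symmetric]) auto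
      also have "\<dots> = 0" by (rule zero[OF ab])
      finally show ?thesis .
    qed
    then show "(\<lambda>n. \<integral>x. box_bump n a b x * ?g x \<partial>lebesgue) \<longlonglongrightarrow> 0" by simp
  qed
  have "AE x in lebesgue. x \<in> U \<longrightarrow> ?g x = 0"
    by (rule AE_zero_on_open_of_box_integrals[OF U gL box0])
  then show ?thesis unfolding AE_on_iff[OF Um] by eventually_elim auto
qed

subsection \<open>Separability\<close>

lemma second_countable_of_dense:
  fixes D :: "'a::metric_space set"
  assumes D: "countable D" "closure D = UNIV"
  shows "\<exists>B :: 'a set set. countable B \<and> open = generate_topology B"
proof -
  define B where "B = (\<lambda>(d, n). ball d (1 / Suc n)) ` (D \<times> (UNIV :: nat set))"
  have "countable B" using D(1) by (simp add: B_def)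
  moreover have "topological_basis B"
  proof (rule topological_basisI)
    fix U :: "'a set" and x assume U: "open U" "x \<in> U"
    then obtain e where e: "e > 0" "ball x e \<subseteq> U" by (meson openE)
    obtain n where n: "1 / Suc n < e / 2" using e nat_approx_posE[of "e / 2"] by auto
    obtain d where d: "d \<in> D" "dist d x < 1 / Suc n"
      using D(2) closure_approachable[of x D] by (metis UNIV_I of_nat_0_less_iff zero_less_divide_1_iff zero_less_Suc)
    have "ball d (1 / Suc n) \<subseteq> ball x e"
    proof
      fix y assume "y \<in> ball d (1 / Suc n)"
      then have "dist x y < 1 / Suc n + 1 / Suc n"
        using d(2) dist_triangle[of x y d] by (simp add: dist_commute)
      then show "y \<in> ball x e" using n by simp
    qed
    with d e show "\<exists>B'\<in>B. x \<in> B' \<and> B' \<subseteq> U" by (intro bexI[of _ "ball d (1 / Suc n)"]) (auto simp: B_def)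
  qed (auto simp: B_def)
  ultimately show ?thesis using topological_basis_imp_subbasis by blast
qed

text \<open>Rational combinations are coded as lists of pairs of a rational and an element of
  \<open>S\<close>, which makes countability immediate; density of the rationals makes the closure
  of \<open>D\<close> a real subspace.\<close>

lemma countable_dense_of_dense_span:
  fixes S :: "'a::real_normed_vector set"
  assumes S: "countable S" "closure (span S) = UNIV"
  obtains D where "countable D" "closure D = (UNIV :: 'a set)"
proof -
  define comb where "comb l = (\<Sum>(q, x)\<leftarrow>l. real_of_rat q *\<^sub>R x)" for l :: "(rat \<times> 'a) list"
  define D where "D = comb ` lists (UNIV \<times> S)"
  have comb_app: "comb (l @ m) = comb l + comb m" for l m by (simp add: comb_def)
  have comb_scale: "comb (map (\<lambda>(q, x). (r * q, x)) l) = real_of_rat r *\<^sub>R comb l" for r l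
    by (induction l) (auto simp: comb_def scaleR_add_right of_rat_mult)
  have "countable D" using S(1) by (simp add: D_def)
  moreover have "closure D = UNIV"
  proof -
    have D_add: "x + y \<in> D" if "x \<in> D" "y \<in> D" for x y
    proof -
      obtain l m where "l \<in> lists (UNIV \<times> S)" "x = comb l" "m \<in> lists (UNIV \<times> S)" "y = comb m"
        using \<open>x \<in> D\<close> \<open>y \<in> D\<close> unfolding D_def by blast
      then show ?thesis unfolding D_def by (intro image_eqI[of _ _ "l @ m"]) (simp_all add: comb_app)
    qed
    have D_scale: "real_of_rat r *\<^sub>R x \<in> D" if "x \<in> D" for r x
    proof -
      obtain l where l: "x = comb l" "l \<in> lists (UNIV \<times> S)"
        by (rule imageE[OF \<open>x \<in> D\<close>[unfolded D_def]])
      have "map (\<lambda>(q, x). (r * q, x)) l \<in> lists (UNIV \<times> S)" using l(2) by auto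
      then have "comb (map (\<lambda>(q, x). (r * q, x)) l) \<in> D" unfolding D_def by (rule imageI)
      then show ?thesis by (simp add: comb_scale l(1))
    qed
    have "subspace (closure D)"
    proof (rule subspaceI)
      have "0 = comb []" by (simp add: comb_def)
      then have "0 \<in> D" by (auto simp: D_def intro!: image_eqI)
      then show "0 \<in> closure D" using closure_subset by blast
      show "x + y \<in> closure D" if "x \<in> closure D" "y \<in> closure D" for x y
      proof -
        from that obtain u v where "\<forall>n. u n \<in> D" "u \<longlonglongrightarrow> x" "\<forall>n. v n \<in> D" "v \<longlonglongrightarrow> y"
          unfolding closure_sequential by blast
        then show ?thesis unfolding closure_sequential
          by (intro exI[of _ "\<lambda>n. u n + v n"]) (auto intro: D_add tendsto_add)
      qed
      show "c *\<^sub>R x \<in> closure D" if x: "x \<in> closure D" for x c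
      proof -
        from x obtain u where u: "\<forall>n. u n \<in> D" "u \<longlonglongrightarrow> x"
          unfolding closure_sequential by blast
        have "\<exists>r. \<bar>real_of_rat r - c\<bar> < 1 / Suc n" for n
        proof -
          obtain r where "c < real_of_rat r" "real_of_rat r < c + 1 / Suc n"
            using of_rat_dense[of c "c + 1 / Suc n"] by auto
          then show ?thesis by (intro exI[of _ r]) (simp add: abs_if)
        qed
        then obtain r where r: "\<And>n. \<bar>real_of_rat (r n) - c\<bar> < 1 / Suc n" by metis
        have "(\<lambda>n. real_of_rat (r n) - c) \<longlonglongrightarrow> 0"
          by (rule Lim_null_comparison[OF _ LIMSEQ_Suc[OF lim_1_over_n]]) (use r in \<open>auto simp: less_imp_le\<close>)
        then have "(\<lambda>n. real_of_rat (r n)) \<longlonglongrightarrow> c" by (rule LIM_zero_cancel)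
        then have "(\<lambda>n. real_of_rat (r n) *\<^sub>R u n) \<longlonglongrightarrow> c *\<^sub>R x" using u(2) by (rule tendsto_scaleR)
        then show ?thesis unfolding closure_sequential using u(1) D_scale
          by (intro exI[of _ "\<lambda>n. real_of_rat (r n) *\<^sub>R u n"]) auto
      qed
    qed
    moreover have "S \<subseteq> closure D"
    proof
      fix x assume "x \<in> S"
      then have "x \<in> D" unfolding D_def by (intro image_eqI[of _ _ "[(1, x)]"]) (auto simp: comb_def)
      then show "x \<in> closure D" using closure_subset by blast
    qed
    ultimately have "span S \<subseteq> closure D" by (rule span_minimal[rotated])
    then have "closure (span S) \<subseteq> closure D" by (rule closure_minimal) simp
    then show ?thesis using S(2) by auto
  qed
  ultimately show ?thesis by (rule that)
qed

lemma dense_of_orthogonal_trivial: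
  fixes S :: "'h::{real_inner,banach} set"
  assumes "subspace S" "\<And>x. (\<And>s. s \<in> S \<Longrightarrow> x \<bullet> s = 0) \<Longrightarrow> x = 0"
  shows "closure S = UNIV"
proof -
  have "x \<in> closure S" for x
  proof -
    obtain p where p: "p \<in> closure S" "\<And>s. s \<in> S \<Longrightarrow> (x - p) \<bullet> s = 0"
      using orthogonal_part_of_closure[OF assms(1)] by blast
    then have "x - p = 0" by (intro assms(2))
    then show ?thesis using p(1) by simp
  qed
  then show ?thesis by blast
qed

definition rational_points :: "'a::euclidean_space set" where
  "rational_points = (\<lambda>f. \<Sum>i\<in>Basis. real_of_rat (f i) *\<^sub>R i) ` (Basis \<rightarrow>\<^sub>E UNIV)"

lemma countable_rational_points: "countable (rational_points :: 'a::euclidean_space set)"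
  unfolding rational_points_def by (intro countable_image countable_PiE) auto

lemma rational_pointsI:
  assumes "\<And>i. i \<in> Basis \<Longrightarrow> x \<bullet> i = real_of_rat (f i)"
  shows "x \<in> rational_points"
  unfolding rational_points_def
proof (rule image_eqI)
  show "x = (\<Sum>i\<in>Basis. real_of_rat (restrict f Basis i) *\<^sub>R i)"
    by (subst euclidean_representation[symmetric]) (simp add: assms)
qed auto

text \<open>The approximation is from inside, so that the indicator of the given box dominates and
  an integral over a real box is the limit of integrals over rational ones.\<close>

lemma rational_box_indicator_approx:
  fixes a b :: "'a::euclidean_space"
  obtains p q where "\<And>n. p n \<in> rational_points" "\<And>n. q n \<in> rational_points"
    "\<And>n. box (p n) (q n) \<subseteq> box a b"
    "\<And>x. (\<lambda>n. indicat_real (box (p n) (q n)) x) \<longlonglongrightarrow> indicator (box a b) x"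
proof -
  have "\<exists>r. a \<bullet> i < real_of_rat r \<and> real_of_rat r < a \<bullet> i + 1 / Suc n" for i n
    by (rule of_rat_dense) simp
  then obtain r where r: "\<And>i n. a \<bullet> i < real_of_rat (r i n)" "\<And>i n. real_of_rat (r i n) < a \<bullet> i + 1 / Suc n"
    by metis
  have "\<exists>r. b \<bullet> i - 1 / Suc n < real_of_rat r \<and> real_of_rat r < b \<bullet> i" for i n
    by (rule of_rat_dense) simp
  then obtain s where s: "\<And>i n. b \<bullet> i - 1 / Suc n < real_of_rat (s i n)" "\<And>i n. real_of_rat (s i n) < b \<bullet> i"
    by metis
  define p where "p n = (\<Sum>i\<in>(Basis::'a set). real_of_rat (r i n) *\<^sub>R i)" for n
  define q where "q n = (\<Sum>i\<in>(Basis::'a set). real_of_rat (s i n) *\<^sub>R i)" for n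
  have p: "p n \<bullet> i = real_of_rat (r i n)" "q n \<bullet> i = real_of_rat (s i n)" if "i \<in> Basis" for n i
    using that by (simp_all add: p_def q_def)
  show ?thesis
  proof (rule that[of p q])
    show "p n \<in> rational_points" "q n \<in> rational_points" for n
      by (rule rational_pointsI, erule p)+
    show sub: "box (p n) (q n) \<subseteq> box a b" for n
    proof
      fix x assume x: "x \<in> box (p n) (q n)"
      have "a \<bullet> i < x \<bullet> i \<and> x \<bullet> i < b \<bullet> i" if "i \<in> Basis" for i
        using x that r(1)[of i n] s(2)[of i n] by (auto simp: mem_box p)
      then show "x \<in> box a b" by (simp add: mem_box)
    qed
    show "(\<lambda>n. indicat_real (box (p n) (q n)) x) \<longlonglongrightarrow> indicator (box a b) x" for x
    proof (cases "x \<in> box a b")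
      case True
      have "\<forall>\<^sub>F n in sequentially. \<forall>i\<in>Basis. p n \<bullet> i < x \<bullet> i \<and> x \<bullet> i < q n \<bullet> i"
      proof (intro eventually_ball_finite ballI)
        fix i :: 'a assume i: "i \<in> Basis"
        then have "0 < min (x \<bullet> i - a \<bullet> i) (b \<bullet> i - x \<bullet> i)" using True by (simp add: mem_box)
        with LIMSEQ_Suc[OF lim_1_over_n]
        have "\<forall>\<^sub>F n in sequentially. 1 / real (Suc n) < min (x \<bullet> i - a \<bullet> i) (b \<bullet> i - x \<bullet> i)"
          by (rule order_tendstoD)
        then show "\<forall>\<^sub>F n in sequentially. p n \<bullet> i < x \<bullet> i \<and> x \<bullet> i < q n \<bullet> i"
        proof eventually_elim
          case (elim n)
          then show ?case using r(2)[of i n] s(1)[of i n] i by (simp add: p)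
        qed
      qed simp
      then have "\<forall>\<^sub>F n in sequentially. indicat_real (box (p n) (q n)) x = indicator (box a b) x"
        by eventually_elim (use True in \<open>simp add: mem_box\<close>)
      then show ?thesis by (rule tendsto_eventually)
    next
      case False
      then have "indicat_real (box (p n) (q n)) x = 0" for n using sub[of n] by (auto simp: indicator_def)
      then show ?thesis using False by simp
    qed
  qed
qed

text \<open>The indicators of boxes with rational corners span a dense subspace: a vector orthogonal
  to them has vanishing integrals over all boxes, hence is 0.\<close>

lemma l2_separable: "\<exists>D. countable D \<and> closure D = (UNIV :: 'a::euclidean_space l2 set)"
proof -
  define S where "S = (\<lambda>(a, b). l2_of (indicator (box a b)) :: 'a l2) ` (rational_points \<times> rational_points)"
  have S: "countable S" unfolding S_def by (intro countable_image countable_SIGMA countable_rational_points)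
  have "closure (span S) = UNIV"
  proof (rule dense_of_orthogonal_trivial)
    fix x :: "'a l2" assume x: "\<And>s. s \<in> span S \<Longrightarrow> x \<bullet> s = 0"
    have rat: "(\<integral>t. indicator (box p q) t * l2_fun x t \<partial>lebesgue) = 0"
      if "p \<in> rational_points" "q \<in> rational_points" for p q
    proof -
      have "l2_of (indicator (box p q)) \<in> span S"
        using that by (auto simp: S_def intro!: span_base)
      then have "l2_of (l2_fun x) \<bullet> l2_of (indicator (box p q)) = 0" using x by simp
      moreover have "l2_of (l2_fun x) \<bullet> l2_of (indicator (box p q)) = (\<integral>t. l2_fun x t * indicator (box p q) t \<partial>lebesgue)"
        by (intro inner_l2_of indicator_L2) auto
      ultimately show ?thesis by (simp add: mult.commute)
    qed
    have "AE t in lebesgue. t \<in> UNIV \<longrightarrow> l2_fun x t = 0"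
    proof (rule AE_zero_on_open_of_box_integrals)
      fix a b :: 'a
      obtain p q where pq: "\<And>n. p n \<in> rational_points" "\<And>n. q n \<in> rational_points"
        and sub: "\<And>n. box (p n) (q n) \<subseteq> box a b"
        and lim: "\<And>x. (\<lambda>n. indicat_real (box (p n) (q n)) x) \<longlonglongrightarrow> indicator (box a b) x"
        using rational_box_indicator_approx by blast
      have "(\<lambda>n. \<integral>t. indicator (box (p n) (q n)) t * l2_fun x t \<partial>lebesgue)
          \<longlonglongrightarrow> (\<integral>t. indicator (box a b) t * l2_fun x t \<partial>lebesgue)"
      proof (rule integral_dominated_convergence[where w = "\<lambda>t. \<bar>indicator (box a b) t * l2_fun x t\<bar>"])
        show "AE t in lebesgue. (\<lambda>n. indicator (box (p n) (q n)) t * l2_fun x t)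
            \<longlonglongrightarrow> indicator (box a b) t * l2_fun x t"
          by (intro AE_I2 tendsto_mult_right lim)
        show "AE t in lebesgue. norm (indicator (box (p n) (q n)) t * l2_fun x t)
            \<le> \<bar>indicator (box a b) t * l2_fun x t\<bar>" for n
          using sub[of n] by (intro AE_I2) (auto simp: indicator_def)
        show "integrable lebesgue (\<lambda>t. \<bar>indicator (box a b) t * l2_fun x t\<bar>)"
          by (intro integrable_abs integrable_indicator_times_L2) auto
      qed (auto intro!: borel_measurable_times borel_measurable_indicator)
      then show "(\<integral>t. indicator (box a b) t * l2_fun x t \<partial>lebesgue) = 0"
        using rat[OF pq] by (simp add: LIMSEQ_const_iff)
    qed auto
    then have "l2_of (l2_fun x) = l2_of (\<lambda>_. 0)" by (subst l2_of_eq_iff) (auto simp: L2_zero)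
    then show "x = 0" by (simp add: zero_l2_def)
  qed simp
  from countable_dense_of_dense_span[OF S this] show ?thesis by blast
qed

instance l2 :: (euclidean_space) second_countable_topology
proof
  show "\<exists>B :: 'a l2 set set. countable B \<and> open = generate_topology B"
    using l2_separable second_countable_of_dense by blast
qed

text \<open>States will be finite families of \<open>l2\<close> vectors, and measurability of
  state-valued functions needs this class. Products of basic open sets form a countable basis
  because the index type is finite.\<close>

instance vec :: ("{metric_space,second_countable_topology}", finite) second_countable_topology
proof
  obtain B :: "'a set set" where B: "countable B" "topological_basis B"
    using ex_countable_basis by auto
  define C where "C = (\<lambda>S. {x :: 'a ^ 'b. \<forall>i. x $ i \<in> S i}) ` (UNIV \<rightarrow>\<^sub>E B)"
  have "countable C" unfolding C_def using B(1) by (intro countable_image countable_PiE) auto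
  moreover have "topological_basis C"
  proof (rule topological_basisI)
    fix U assume "U \<in> C"
    then obtain S where S: "U = {x. \<forall>i. x $ i \<in> S i}" "S \<in> UNIV \<rightarrow>\<^sub>E B"
      unfolding C_def by (rule imageE)
    then have "open (S i)" for i using topological_basis_open[OF B(2)] PiE_mem[OF S(2)] by blast
    then have "\<exists>A. (\<forall>i. open (A i) \<and> x $ i \<in> A i) \<and> (\<forall>y. (\<forall>i. y $ i \<in> A i) \<longrightarrow> y \<in> U)" if "x \<in> U" for x
      using that unfolding S(1) by (intro exI[of _ S]) simp
    then show "open U" unfolding open_vec_def by blast
  next
    fix U :: "('a ^ 'b) set" and x assume "open U" "x \<in> U"
    then obtain A where A: "\<And>i. open (A i)" "\<And>i. x $ i \<in> A i" "\<And>y. (\<forall>i. y $ i \<in> A i) \<Longrightarrow> y \<in> U"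
      unfolding open_vec_def by metis
    have "\<exists>S\<in>B. x $ i \<in> S \<and> S \<subseteq> A i" for i
      using topological_basisE[OF B(2) A(1,2)] by metis
    then obtain S where S: "\<And>i. S i \<in> B" "\<And>i. x $ i \<in> S i" "\<And>i. S i \<subseteq> A i" by metis
    then have "{x. \<forall>i. x $ i \<in> S i} \<in> C" by (auto simp: C_def intro!: image_eqI[of _ _ S])
    moreover have "{x. \<forall>i. x $ i \<in> S i} \<subseteq> U" using A(3) S(3) by blast
    ultimately show "\<exists>B'\<in>C. x \<in> B' \<and> B' \<subseteq> U"
      using S(2) by (intro bexI[of _ "{x. \<forall>i. x $ i \<in> S i}"]) simp_all
  qed
  ultimately show "\<exists>B :: ('a ^ 'b) set set. countable B \<and> open = generate_topology B"
    using topological_basis_imp_subbasis by blast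
qed

lemma inner_l2_on_left:
  assumes U: "U \<in> sets lebesgue" and f: "f \<in> L2 (lebesgue_on U)"
  shows "l2_on U f \<bullet> x = (\<integral>t. f t * l2_fun x t \<partial>lebesgue_on U)"
proof -
  have "l2_on U f \<bullet> l2_of (l2_fun x) = (\<integral>t. indicator U t * f t * l2_fun x t \<partial>lebesgue)"
    unfolding l2_on_def using f by (intro inner_l2_of) (auto simp: L2_on_iff[OF U])
  also have "\<dots> = (\<integral>t. indicator U t *\<^sub>R (f t * l2_fun x t) \<partial>lebesgue)"
    by (simp add: mult.assoc)
  also have "\<dots> = (\<integral>t. f t * l2_fun x t \<partial>lebesgue_on U)"
    using U by (intro integral_restrict_space[symmetric]) auto
  finally show ?thesis by simp
qed

text \<open>\<open>f\<close> is decomposed orthogonally with respect to the closure of the test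
  functions: the residual is orthogonal to every bump, hence vanishes on \<open>U\<close> by the
  fundamental lemma.\<close>

lemma test_functions_dense:
  fixes U :: "'a::euclidean_space set"
  assumes U: "open U" and f: "f \<in> L2 (lebesgue_on U)" and e: "e > 0"
  shows "\<exists>\<phi>. test_function U \<phi> \<and> (\<integral>x. (f x - \<phi> x)\<^sup>2 \<partial>lebesgue_on U) < e"
proof -
  have Um: "U \<in> sets lebesgue" using U by simp
  \<comment> \<open>\<open>flat_algebra\<close> is closed under sums and products by construction,
    which makes the set a subspace at once, and it contains the bumps.\<close>
  define T where "T = {\<phi> \<in> flat_algebra. \<exists>K. compact K \<and> K \<subseteq> U \<and> (\<forall>x. x \<notin> K \<longrightarrow> \<phi> x = 0)}"
  have T: "test_function U \<phi>" if \<phi>: "\<phi> \<in> T" for \<phi>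
  proof -
    obtain K where K: "compact K" "K \<subseteq> U" "\<And>x. x \<notin> K \<Longrightarrow> \<phi> x = 0" using \<phi> by (auto simp: T_def)
    have "closure {x. \<phi> x \<noteq> 0} \<subseteq> K"
      using K by (intro closure_minimal compact_imp_closed) auto
    moreover from this have "compact (closure {x. \<phi> x \<noteq> 0})"
      using compact_Int_closed[OF K(1) closed_closure[of "{x. \<phi> x \<noteq> 0}"]] by (simp add: Int_absorb1 del: compact_closure)
    ultimately show ?thesis
      using \<phi> K(2) by (auto simp: test_function_def flat_algebra_Ck T_def simp del: compact_closure)
  qed
  note TL = test_function_L2(1)[OF T Um]
  define S where "S = l2_on U ` T"
  have "subspace S"
  proof (rule subspaceI)
    have "(\<lambda>x. 0) \<in> T" by (auto simp: T_def intro: flat_algebra.const)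
    then show "0 \<in> S" by (auto simp: S_def l2_on_zero[OF Um] intro!: image_eqI)
    show "x + y \<in> S" if "x \<in> S" "y \<in> S" for x y
    proof -
      obtain u v where uv: "u \<in> T" "x = l2_on U u" "v \<in> T" "y = l2_on U v" using \<open>x \<in> S\<close> \<open>y \<in> S\<close> by (auto simp: S_def)
      then obtain K L where "compact K" "K \<subseteq> U" "\<And>x. x \<notin> K \<Longrightarrow> u x = 0"
        "compact L" "L \<subseteq> U" "\<And>x. x \<notin> L \<Longrightarrow> v x = 0" by (auto simp: T_def)
      then have "(\<lambda>x. u x + v x) \<in> T"
        using uv unfolding T_def by (auto intro!: flat_algebra.add exI[of _ "K \<union> L"])
      then show ?thesis using uv by (auto simp: S_def l2_on_add[OF Um] TL intro!: image_eqI)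
    qed
    show "c *\<^sub>R x \<in> S" if "x \<in> S" for c x
    proof -
      obtain u where u: "u \<in> T" "x = l2_on U u" using \<open>x \<in> S\<close> by (auto simp: S_def)
      then have "(\<lambda>x. c * u x) \<in> T"
        unfolding T_def by (auto intro!: flat_algebra.mult flat_algebra.const)
      then show ?thesis using u by (auto simp: S_def l2_on_scaleR[OF Um] TL intro!: image_eqI)
    qed
  qed
  then obtain p where p: "p \<in> closure S" "\<And>s. s \<in> S \<Longrightarrow> (l2_on U f - p) \<bullet> s = 0"
    using orthogonal_part_of_closure by blast
  define r where "r = l2_on U f - p"
  have "AE x in lebesgue_on U. l2_fun r x = 0"
  proof (rule fundamental_lemma[OF U])
    fix n and a b :: 'a assume "cbox a b \<subseteq> U"
    then have "box_bump n a b \<in> T"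
      using box_bump_outside[of _ a b n] box_subset_cbox[of a b]
      by (auto simp: T_def box_bump_in_flat_algebra intro!: exI[of _ "cbox a b"])
    then show "(\<integral>x. l2_fun r x * box_bump n a b x \<partial>lebesgue_on U) = 0"
      using p(2)[of "l2_on U (box_bump n a b)"] inner_l2_on_left[OF Um TL, of "box_bump n a b" r]
      by (simp add: S_def r_def inner_commute mult.commute)
  qed (simp add: L2_on_l2_fun[OF Um])
  then have r0: "l2_on U h \<bullet> r = 0" if "h \<in> L2 (lebesgue_on U)" for h
    unfolding inner_l2_on_left[OF Um that] by (intro integral_eq_zero_AE) auto
  obtain s where s: "s \<in> S" "dist s p < sqrt e"
    using p(1) e closure_approachable[of p S] by (meson real_sqrt_gt_zero)
  then obtain \<phi> where \<phi>: "\<phi> \<in> T" "s = l2_on U \<phi>" by (auto simp: S_def)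
  let ?d = "l2_on U f - s"
  have d: "?d = l2_on U (\<lambda>x. f x - \<phi> x)" using \<phi> f by (simp add: l2_on_diff[OF Um] TL)
  \<comment> \<open>\<open>?d = (p - s) + r\<close> and \<open>?d\<close> is orthogonal to
    \<open>r\<close>; so \<open>s\<close> is no farther from \<open>f\<close> than from
    \<open>p\<close>.\<close>
  have "(norm ?d)\<^sup>2 = ?d \<bullet> (p - s) + ?d \<bullet> r"
    by (simp add: power2_norm_eq_inner r_def flip: inner_add_right)
  also have "?d \<bullet> r = 0" unfolding d by (intro r0 L2_diff f TL \<phi>)
  also have "?d \<bullet> (p - s) \<le> norm ?d * norm (p - s)" by (rule norm_cauchy_schwarz)
  finally have "norm ?d \<le> norm (p - s)" by (cases "?d = 0") (simp_all add: power2_eq_square)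
  then have "norm ?d < sqrt e" using s(2) by (simp add: dist_norm norm_minus_commute)
  then have "(norm ?d)\<^sup>2 < (sqrt e)\<^sup>2" by (intro power_strict_mono) auto
  then have "(\<integral>x. (f x - \<phi> x)\<^sup>2 \<partial>lebesgue_on U) < e"
    using e unfolding d by (simp add: norm_l2_on_sq[OF Um] L2_diff f TL \<phi>)
  then show ?thesis using T[OF \<phi>(1)] by blast
qed

section \<open>An initial value problem in a Banach space\<close>

text \<open>
  Picard iteration is a contraction on the whole interval for the norm weighted with
  \<open>exp (- \<gamma> t)\<close>, \<open>\<gamma>\<close> larger than the Lipschitz constant.
\<close>

lemma lipschitz_ivp_exists:
  fixes f :: "real \<Rightarrow> 'b::banach \<Rightarrow> 'b"
  assumes T: "T \<ge> 0"
    and cont: "\<And>v. continuous_on {0..T} v \<Longrightarrow> continuous_on {0..T} (\<lambda>t. f t (v t))"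
    and lip: "\<And>t x y. norm (f t x - f t y) \<le> L * norm (x - y)"
  shows "\<exists>v. v 0 = 0 \<and> (\<forall>t\<in>{0..T}. (v has_vector_derivative f t (v t)) (at t within {0..T}))"
proof -
  \<comment> \<open>Twice the Lipschitz constant gives the contraction factor 1/2; the summand 1
    keeps \<gamma> positive.\<close>
  define \<gamma> where "\<gamma> = 2 * \<bar>L\<bar> + 1"
  have \<gamma>: "\<gamma> > 0" "\<bar>L\<bar> / \<gamma> \<le> 1 / 2" by (auto simp: \<gamma>_def field_simps)
  \<comment> \<open>Clamping time to \<open>[0, T]\<close> turns the iterates into bounded
    continuous functions on the whole real line, the elements of a complete metric type.\<close>
  define s where "s t = max 0 (min t T)" for t :: real
  have s: "s t \<in> {0..T}" "t \<in> {0..T} \<Longrightarrow> s t = t" for t using T by (auto simp: s_def)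
  have s_cont: "continuous_on UNIV s" unfolding s_def by (intro continuous_intros)
  \<comment> \<open>The unknown is \<open>u t = exp (- \<gamma> * t) *\<^sub>R v t\<close>, so the
    plain supremum norm of \<open>u\<close> is the weighted norm of \<open>v\<close>.\<close>
  define g where "g u r = f r (exp (\<gamma> * r) *\<^sub>R apply_bcontfun u r)" for u r
  define \<Phi> where "\<Phi> u t = exp (- \<gamma> * t) *\<^sub>R integral {0..t} (g u)" for u t
  have g_cont: "continuous_on {0..T} (g u)" for u
    unfolding g_def by (intro cont continuous_intros continuous_on_apply_bcontfun)
  have g_int: "g u integrable_on {0..t}" if "t \<in> {0..T}" for u t
    using that by (intro integrable_continuous_interval continuous_on_subset[OF g_cont]) auto
  have exp_int: "((\<lambda>r. exp (\<gamma> * r)) has_integral (exp (\<gamma> * t) - 1) / \<gamma>) {0..t}" if "0 \<le> t" for t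
  proof -
    have "((\<lambda>r. exp (\<gamma> * r)) has_integral exp (\<gamma> * t) / \<gamma> - exp (\<gamma> * 0) / \<gamma>) {0..t}"
      using that \<gamma>
      by (intro fundamental_theorem_of_calculus)
        (auto intro!: derivative_eq_intros simp flip: has_real_derivative_iff_has_vector_derivative)
    then show ?thesis by (simp add: diff_divide_distrib)
  qed
  have \<Phi>_diff: "norm (\<Phi> u t - \<Phi> w t) \<le> 1 / 2 * dist u w" if t: "t \<in> {0..T}" for u w t
  proof -
    have "norm (integral {0..t} (g u) - integral {0..t} (g w)) = norm (integral {0..t} (\<lambda>r. g u r - g w r))"
      using t by (subst integral_diff) (auto intro: g_int)
    also have "\<dots> \<le> integral {0..t} (\<lambda>r. (\<bar>L\<bar> * dist u w) * exp (\<gamma> * r))"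
    proof (rule integral_norm_bound_integral)
      show "(\<lambda>r. g u r - g w r) integrable_on {0..t}" using t by (intro integrable_diff g_int)
      show "(\<lambda>r. (\<bar>L\<bar> * dist u w) * exp (\<gamma> * r)) integrable_on {0..t}"
        by (intro integrable_continuous_interval continuous_intros)
      fix r assume "r \<in> {0..t}"
      have "norm (g u r - g w r) \<le> L * norm (exp (\<gamma> * r) *\<^sub>R apply_bcontfun u r - exp (\<gamma> * r) *\<^sub>R apply_bcontfun w r)"
        unfolding g_def by (rule lip)
      also have "\<dots> \<le> \<bar>L\<bar> * (exp (\<gamma> * r) * dist (apply_bcontfun u r) (apply_bcontfun w r))"
        by (intro mult_mono) (auto simp: dist_norm simp flip: scaleR_diff_right)
      also have "\<dots> \<le> \<bar>L\<bar> * (exp (\<gamma> * r) * dist u w)"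
        by (intro mult_left_mono dist_bounded) auto
      finally show "norm (g u r - g w r) \<le> (\<bar>L\<bar> * dist u w) * exp (\<gamma> * r)"
        by (simp add: mult_ac)
    qed
    also have "\<dots> = \<bar>L\<bar> * dist u w * ((exp (\<gamma> * t) - 1) / \<gamma>)"
      using exp_int[of t] t by (simp add: integral_unique)
    also have "\<dots> \<le> \<bar>L\<bar> * dist u w * (exp (\<gamma> * t) / \<gamma>)"
      using \<gamma>(1) by (intro mult_left_mono divide_right_mono) auto
    finally have "exp (- \<gamma> * t) * norm (integral {0..t} (g u) - integral {0..t} (g w))
        \<le> exp (- \<gamma> * t) * (\<bar>L\<bar> * dist u w * (exp (\<gamma> * t) / \<gamma>))"
      by (intro mult_left_mono) auto
    also have "\<dots> = \<bar>L\<bar> / \<gamma> * dist u w" by (simp add: exp_minus field_simps)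
    also have "\<dots> \<le> 1 / 2 * dist u w" using \<gamma>(2) by (intro mult_right_mono) auto
    finally show ?thesis by (simp add: \<Phi>_def flip: scaleR_diff_right)
  qed
  have \<Phi>_cont: "continuous_on {0..T} (\<Phi> u)" for u
    unfolding \<Phi>_def
    by (intro continuous_intros indefinite_integral_continuous_1 integrable_continuous_interval g_cont)
  have bc: "(\<lambda>t. \<Phi> u (s t)) \<in> bcontfun" for u
    unfolding bcontfun_def mem_Collect_eq
  proof (intro conjI)
    show "continuous_on UNIV (\<lambda>t. \<Phi> u (s t))"
      by (rule continuous_on_compose2[OF \<Phi>_cont s_cont]) (use s in auto)
    have "compact (\<Phi> u ` {0..T})" by (intro compact_continuous_image \<Phi>_cont) auto
    then show "bounded (range (\<lambda>t. \<Phi> u (s t)))"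
      by (rule bounded_subset[OF compact_imp_bounded]) (use s in auto)
  qed
  define P where "P u = Bcontfun (\<lambda>t. \<Phi> u (s t))" for u
  have P: "apply_bcontfun (P u) t = \<Phi> u (s t)" for u t
    unfolding P_def by (simp add: Bcontfun_inverse[OF bc])
  have "dist (P u) (P w) \<le> 1 / 2 * dist u w" for u w
    by (rule dist_bound) (use \<Phi>_diff s in \<open>simp add: P dist_norm\<close>)
  then obtain u where u: "P u = u" using banach_fix_type[of "1/2" P] by auto
  define v where "v t = exp (\<gamma> * t) *\<^sub>R apply_bcontfun u t" for t
  have v: "v t = integral {0..t} (\<lambda>r. f r (v r))" if t: "t \<in> {0..T}" for t
  proof -
    have "v t = exp (\<gamma> * t) *\<^sub>R \<Phi> u t" using P[of u t] s(2)[OF t] by (simp add: v_def u)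
    then show ?thesis by (simp add: \<Phi>_def g_def[abs_def] v_def[abs_def] flip: exp_add)
  qed
  have "continuous_on {0..T} v"
    unfolding v_def by (intro continuous_intros continuous_on_apply_bcontfun)
  then have fc: "continuous_on {0..T} (\<lambda>t. f t (v t))" by (rule cont)
  have "v 0 = 0" using v[of 0] T by simp
  moreover have "(v has_vector_derivative f t (v t)) (at t within {0..T})" if t: "t \<in> {0..T}" for t
    by (rule has_vector_derivative_transform[OF t v integral_has_vector_derivative[OF fc t]])
  ultimately show ?thesis by blast
qed

section \<open>Abstract parabolic problems: existence\<close>

lemma growth_bound:
  fixes D :: "real \<Rightarrow> real"
  assumes ab: "a \<le> b"
    and D: "\<And>s. s \<in> {a..b} \<Longrightarrow> (D has_vector_derivative D' s) (at s within {a..b})"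
    and k: "\<And>s. s \<in> {a..b} \<Longrightarrow> D' s \<le> k"
  shows "D b \<le> D a + k * (b - a)"
proof -
  have "(D' has_integral D b - D a) {a..b}" by (rule fundamental_theorem_of_calculus[OF ab D])
  moreover have "((\<lambda>_. k) has_integral k * (b - a)) {a..b}"
    using has_integral_const_real[of k a b] ab by (simp add: mult.commute)
  ultimately have "D b - D a \<le> k * (b - a)" using k by (rule has_integral_le)
  then show ?thesis by simp
qed

text \<open>Completing the square; the maximum is at x = u / (2c). It lets the coercive term absorb
  a forcing that is linear in the solution.\<close>

lemma quadratic_max: "c > 0 \<Longrightarrow> u * x - c * x\<^sup>2 \<le> u\<^sup>2 / (4 * c)" for u x c :: real
  using zero_le_power2[of "u - 2 * c * x"]
  by (simp add: field_simps power2_eq_square)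

text \<open>The derivative is a limit of difference quotients, which are one-sided at the ends;
  \<open>a < b\<close> makes the filter nontrivial there.\<close>

lemma norm_vector_derivative_le:
  fixes v :: "real \<Rightarrow> 'b::real_normed_vector"
  assumes v: "(v has_vector_derivative p) (at t within {a..b})" and t: "t \<in> {a..b}" and ab: "a < b"
    and lip: "\<And>s. s \<in> {a..b} \<Longrightarrow> norm (v s - v t) \<le> C * \<bar>s - t\<bar>"
  shows "norm p \<le> C"
proof -
  let ?r = "\<lambda>s. (1 / norm (s - t)) *\<^sub>R (v s - (v t + (s - t) *\<^sub>R p))"
  have "(?r \<longlongrightarrow> 0) (at t within {a..b})"
    using v by (simp add: has_vector_derivative_def has_derivative_within)
  then have "((\<lambda>s. C + norm (?r s)) \<longlongrightarrow> C + norm (0::'b)) (at t within {a..b})"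
    by (intro tendsto_intros)
  moreover have "\<forall>\<^sub>F s in at t within {a..b}. norm p \<le> C + norm (?r s)"
    unfolding eventually_at_filter
  proof (intro always_eventually allI impI)
    fix s assume s: "s \<noteq> t" "s \<in> {a..b}"
    have "\<bar>s - t\<bar> * norm p = norm ((v s - v t) - (v s - (v t + (s - t) *\<^sub>R p)))" by simp
    also have "\<dots> \<le> C * \<bar>s - t\<bar> + norm (v s - (v t + (s - t) *\<^sub>R p))"
      by (rule order_trans[OF norm_triangle_ineq4]) (use lip[OF s(2)] in simp)
    also have "norm (v s - (v t + (s - t) *\<^sub>R p)) = \<bar>s - t\<bar> * norm (?r s)"
      unfolding norm_scaleR using s(1) by simp
    finally have "\<bar>s - t\<bar> * norm p \<le> \<bar>s - t\<bar> * (C + norm (?r s))" by (simp add: algebra_simps)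
    then show "norm p \<le> C + norm (?r s)" using s(1) by simp
  qed
  moreover have "at t within {a..b} \<noteq> bot"
    using t ab by (simp add: trivial_limit_within islimpt_Icc)
  ultimately show ?thesis using tendsto_lowerbound by fastforce
qed

text \<open>\<open>Q\<close> stands for the passage to V: the V norm of \<open>x\<close> is
  \<open>norm (Q x)\<close>, its H norm \<open>norm x\<close>. The identity for \<open>K\<close>
  says K = Q* Q without an adjoint having to be constructed. Coercivity in the full norm sits in
  \<open>B\<close>.\<close>

locale parabolic_problem =
  fixes Q K B :: "'h::{real_inner,banach,second_countable_topology} \<Rightarrow> 'h" and L c T :: real
  assumes Q: "bounded_linear Q" and K: "bounded_linear K"
    and K_inner: "\<And>x y. K x \<bullet> y = Q x \<bullet> Q y"
    and B_lip: "L-lipschitz_on UNIV B" and c: "c > 0"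
    and B_mono: "\<And>x y. c * (norm (x - y))\<^sup>2 \<le> (B x - B y) \<bullet> (x - y)"
    and T: "T > 0"
begin

text \<open>\<open>K\<close> is symmetric, so the energy has the derivative
  \<open>2 * ((K (w' s) + \<epsilon> *\<^sub>R w' s) \<bullet> w s)\<close>. It is applied to a
  solution and to its time increments.\<close>

lemma energy_growth:
  assumes e: "\<epsilon> \<ge> 0" and ab: "a \<le> b"
    and w: "\<And>s. s \<in> {a..b} \<Longrightarrow> (w has_vector_derivative w' s) (at s within {a..b})"
    and k: "\<And>s. s \<in> {a..b} \<Longrightarrow> (K (w' s) + \<epsilon> *\<^sub>R w' s) \<bullet> w s \<le> k"
  shows "(norm (Q (w b)))\<^sup>2 + \<epsilon> * (norm (w b))\<^sup>2
    \<le> (norm (Q (w a)))\<^sup>2 + \<epsilon> * (norm (w a))\<^sup>2 + 2 * k * (b - a)"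
proof -
  let ?D = "\<lambda>s. K (w s) \<bullet> w s + \<epsilon> * (w s \<bullet> w s)"
  have "?D b \<le> ?D a + (2 * k) * (b - a)"
  proof (rule growth_bound[OF ab])
    fix s assume s: "s \<in> {a..b}"
    have "((\<lambda>s. K (w s)) has_vector_derivative K (w' s)) (at s within {a..b})"
      by (rule bounded_linear.has_vector_derivative[OF K w[OF s]])
    from bounded_bilinear.has_vector_derivative[OF bounded_bilinear_inner this w[OF s]]
      bounded_bilinear.has_vector_derivative[OF bounded_bilinear_inner w[OF s] w[OF s]]
    show "(?D has_vector_derivative (K (w s) \<bullet> w' s + K (w' s) \<bullet> w s) + \<epsilon> * (w s \<bullet> w' s + w' s \<bullet> w s))
        (at s within {a..b})"
      by (intro derivative_intros)
    have "K (w s) \<bullet> w' s = K (w' s) \<bullet> w s" by (metis K_inner inner_commute)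
    then show "(K (w s) \<bullet> w' s + K (w' s) \<bullet> w s) + \<epsilon> * (w s \<bullet> w' s + w' s \<bullet> w s) \<le> 2 * k"
      using k[OF s] by (simp add: inner_add_left inner_commute algebra_simps)
  qed
  then show ?thesis by (simp add: K_inner power2_norm_eq_inner)
qed

text \<open>
  The energy of the time increments \<open>v (t + s) - v t\<close> is controlled by the Lipschitz constant of
  \<open>F\<close>; the compatibility condition \<open>F 0 = B 0\<close> controls it at \<open>t = 0\<close>.  Hence
  \<open>\<epsilon> * norm (v' t)\<close> is of order \<open>sqrt \<epsilon>\<close>.
\<close>

lemma regularized_solution:
  assumes F: "m-lipschitz_on UNIV F" "F 0 = B 0" and e: "\<epsilon> > 0"
  obtains v p where "continuous_on {0..T} p" "v 0 = 0"
    "\<And>t. t \<in> {0..T} \<Longrightarrow> (v has_vector_derivative p t) (at t within {0..T})"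
    "\<And>t. t \<in> {0..T} \<Longrightarrow> K (p t) + \<epsilon> *\<^sub>R p t + B (v t) = F t"
    "\<And>t. t \<in> {0..T} \<Longrightarrow> \<epsilon> * (norm (p t))\<^sup>2 \<le> m\<^sup>2 * T / (2 * c)"
proof -
  interpret K: bounded_linear K by (rule K)
  have m: "m \<ge> 0" using lipschitz_on_nonneg[OF F(1)] .
  \<comment> \<open>\<open>K\<close> may fail to be onto. The added multiple of the identity makes
    it strongly monotone, and the inverse \<open>R\<close> turns the equation into
    \<open>v' = R (F - B v)\<close>.\<close>
  let ?K = "\<lambda>x. K x + \<epsilon> *\<^sub>R x"
  have Kmono: "\<epsilon> * (norm (x - y))\<^sup>2 \<le> (?K x - ?K y) \<bullet> (x - y)" for x y
  proof -
    have "?K x - ?K y = K (x - y) + \<epsilon> *\<^sub>R (x - y)" by (simp add: K.diff algebra_simps)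
    then show ?thesis by (simp add: inner_add_left K_inner power2_norm_eq_inner)
  qed
  have "bounded_linear ?K" by (intro bounded_linear_add K bounded_linear_scaleR_right)
  then obtain L' where "L'-lipschitz_on UNIV ?K" by (rule bounded_linear_lipschitz)
  from lipschitz_strongly_monotone_surj[OF this e Kmono] obtain R where R: "\<And>y. ?K (R y) = y" by metis
  have R_lip: "norm (R x - R y) \<le> 1 / \<epsilon> * norm (x - y)" for x y
  proof -
    have "\<epsilon> * (norm (R x - R y))\<^sup>2 \<le> (x - y) \<bullet> (R x - R y)" using Kmono[of "R x" "R y"] by (simp add: R)
    also have "\<dots> \<le> norm (x - y) * norm (R x - R y)" by (rule norm_cauchy_schwarz)
    finally show ?thesis using e
      by (cases "R x = R y") (simp_all add: power2_eq_square field_simps)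
  qed
  have "(1 / \<epsilon>)-lipschitz_on UNIV R"
    using R_lip e by (intro lipschitz_onI) (auto simp: dist_norm)
  then have R_cont: "continuous_on UNIV R" by (rule lipschitz_on_continuous_on)
  have B_cont: "continuous_on UNIV B" by (rule lipschitz_on_continuous_on[OF B_lip])
  have F_cont: "continuous_on UNIV F" by (rule lipschitz_on_continuous_on[OF F(1)])
  have f_cont: "continuous_on {0..T} (\<lambda>t. R (F t - B (v t)))" if "continuous_on {0..T} v" for v
    by (intro continuous_on_compose2[OF R_cont] continuous_on_diff continuous_on_subset[OF F_cont]
        continuous_on_compose2[OF B_cont that]) auto
  have "\<exists>v. v 0 = 0 \<and> (\<forall>t\<in>{0..T}. (v has_vector_derivative R (F t - B (v t))) (at t within {0..T}))"
  proof (rule lipschitz_ivp_exists)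
    fix t x y
    have "norm (R (F t - B x) - R (F t - B y)) \<le> 1 / \<epsilon> * norm (B x - B y)"
      using R_lip[of "F t - B x" "F t - B y"] by (simp add: norm_minus_commute)
    also have "\<dots> \<le> 1 / \<epsilon> * (L * norm (x - y))"
      using e lipschitz_on_normD[OF B_lip, of x y] by (intro mult_left_mono) auto
    finally show "norm (R (F t - B x) - R (F t - B y)) \<le> (1 / \<epsilon> * L) * norm (x - y)" by (simp add: mult.assoc)
  qed (use T f_cont in auto)
  then obtain v where v0: "v 0 = 0"
    and dv: "\<And>t. t \<in> {0..T} \<Longrightarrow> (v has_vector_derivative R (F t - B (v t))) (at t within {0..T})" by blast
  define p where "p t = R (F t - B (v t))" for t
  have v_cont: "continuous_on {0..T} v"
    using dv by (intro continuous_on_vector_derivative) auto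
  have eq: "?K (p t) = F t - B (v t)" for t unfolding p_def by (rule R)
  \<comment> \<open>On \<open>[0, s]\<close> the forcing relative to the stationary state is
    \<open>F r - F 0\<close>, of norm at most \<open>m * s\<close>, so the energy at time
    \<open>s\<close> is of order s^3. As \<open>v 0 = 0\<close>, this is the initial energy of the
    increment with step \<open>s\<close>.\<close>
  have start: "(norm (Q (v s)))\<^sup>2 + \<epsilon> * (norm (v s))\<^sup>2 \<le> 2 * ((m * s)\<^sup>2 / (4 * c)) * s"
    if s: "s \<in> {0..T}" for s
  proof -
    have "(norm (Q (v s)))\<^sup>2 + \<epsilon> * (norm (v s))\<^sup>2
        \<le> (norm (Q (v 0)))\<^sup>2 + \<epsilon> * (norm (v 0))\<^sup>2 + 2 * ((m * s)\<^sup>2 / (4 * c)) * (s - 0)"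
    proof (rule energy_growth[where w' = p])
      fix r assume r: "r \<in> {0..s}"
      show "(v has_vector_derivative p r) (at r within {0..s})"
        unfolding p_def using r s by (intro has_vector_derivative_within_subset[OF dv]) auto
      have "?K (p r) \<bullet> v r = (F r - F 0) \<bullet> v r - (B (v r) - B 0) \<bullet> (v r - 0)"
        by (simp add: eq F(2) algebra_simps)
      also have "\<dots> \<le> (m * s) * norm (v r) - c * (norm (v r))\<^sup>2"
      proof (intro diff_mono)
        have "(F r - F 0) \<bullet> v r \<le> norm (F r - F 0) * norm (v r)" by (rule norm_cauchy_schwarz)
        also have "norm (F r - F 0) \<le> m * s"
          using lipschitz_on_normD[OF F(1), of r 0] mult_left_mono[of r s m] r m by auto
        finally show "(F r - F 0) \<bullet> v r \<le> m * s * norm (v r)" by (simp add: mult_right_mono)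
        show "c * (norm (v r))\<^sup>2 \<le> (B (v r) - B 0) \<bullet> (v r - 0)" using B_mono[of "v r" 0] by simp
      qed
      also have "\<dots> \<le> (m * s)\<^sup>2 / (4 * c)" by (rule quadratic_max[OF c])
      finally show "?K (p r) \<bullet> v r \<le> (m * s)\<^sup>2 / (4 * c)" .
    qed (use e s in auto)
    then show ?thesis by (simp add: v0 linear_0 bounded_linear.linear[OF Q])
  qed
  \<comment> \<open>The growth during time \<open>t\<close> at the rate (m s)^2 / (2c) is added to
    \<open>start\<close>; the sum is (m s)^2 (t + s) / (2c), and \<open>t + s \<le> T\<close>. The
    factor s^2 is what survives division by the step.\<close>
  have incr: "\<epsilon> * (norm (v (t + s) - v t))\<^sup>2 \<le> s\<^sup>2 * (m\<^sup>2 * T / (2 * c))"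
    if s: "0 \<le> s" "0 \<le> t" "t + s \<le> T" for s t
  proof -
    let ?w = "\<lambda>r. v (r + s) - v r" and ?w' = "\<lambda>r. p (r + s) - p r"
    have "(norm (Q (?w t)))\<^sup>2 + \<epsilon> * (norm (?w t))\<^sup>2
        \<le> (norm (Q (?w 0)))\<^sup>2 + \<epsilon> * (norm (?w 0))\<^sup>2 + 2 * ((m * s)\<^sup>2 / (4 * c)) * (t - 0)"
    proof (rule energy_growth[where w' = ?w'])
      fix r assume r: "r \<in> {0..t}"
      have "((\<lambda>r. v (r + s)) has_vector_derivative 1 *\<^sub>R p (r + s)) (at r within {0..t})"
      proof (rule vector_diff_chain_within[of "\<lambda>r. r + s" 1 r "{0..t}" v, unfolded o_def])
        show "((\<lambda>r. r + s) has_vector_derivative 1) (at r within {0..t})"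
          by (auto intro!: derivative_eq_intros)
        show "(v has_vector_derivative p (r + s)) (at (r + s) within (\<lambda>r. r + s) ` {0..t})"
          unfolding p_def using r s by (intro has_vector_derivative_within_subset[OF dv]) auto
      qed
      moreover have "(v has_vector_derivative p r) (at r within {0..t})"
        unfolding p_def using r s by (intro has_vector_derivative_within_subset[OF dv]) auto
      ultimately show "(?w has_vector_derivative ?w' r) (at r within {0..t})"
        by (auto intro: has_vector_derivative_diff)
      have "?K (?w' r) \<bullet> ?w r = (?K (p (r + s)) - ?K (p r)) \<bullet> ?w r"
        by (simp add: K.diff algebra_simps)
      also have "\<dots> = (F (r + s) - F r) \<bullet> ?w r - (B (v (r + s)) - B (v r)) \<bullet> ?w r"
        by (simp only: eq) (simp add: algebra_simps)
      also have "\<dots> \<le> (m * s) * norm (?w r) - c * (norm (?w r))\<^sup>2"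
      proof (intro diff_mono B_mono)
        have "(F (r + s) - F r) \<bullet> ?w r \<le> norm (F (r + s) - F r) * norm (?w r)" by (rule norm_cauchy_schwarz)
        also have "norm (F (r + s) - F r) \<le> m * s"
          using lipschitz_on_normD[OF F(1), of "r + s" r] s by auto
        finally show "(F (r + s) - F r) \<bullet> ?w r \<le> m * s * norm (?w r)" by (simp add: mult_right_mono)
      qed
      also have "\<dots> \<le> (m * s)\<^sup>2 / (4 * c)" by (rule quadratic_max[OF c])
      finally show "?K (?w' r) \<bullet> ?w r \<le> (m * s)\<^sup>2 / (4 * c)" .
    qed (use e s in auto)
    also have "(norm (Q (?w 0)))\<^sup>2 + \<epsilon> * (norm (?w 0))\<^sup>2 \<le> 2 * ((m * s)\<^sup>2 / (4 * c)) * s"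
      using start[of s] s by (simp add: v0)
    finally have "\<epsilon> * (norm (?w t))\<^sup>2 \<le> 2 * ((m * s)\<^sup>2 / (4 * c)) * s + 2 * ((m * s)\<^sup>2 / (4 * c)) * (t - 0)"
      using zero_le_power2[of "norm (Q (?w t))"] by linarith
    also have "\<dots> = 2 * ((m * s)\<^sup>2 / (4 * c)) * (t + s)" by (simp add: distrib_left)
    also have "\<dots> \<le> 2 * ((m * s)\<^sup>2 / (4 * c)) * T" using s c by (intro mult_left_mono) auto
    finally show ?thesis by (simp add: power_mult_distrib mult_ac)
  qed
  \<comment> \<open>The Lipschitz constant of \<open>v\<close> read off from \<open>incr\<close>. It
    bounds the derivative as well, and \<epsilon> C^2 does not depend on \<epsilon>.\<close>
  define C where "C = sqrt (m\<^sup>2 * T / (2 * c) / \<epsilon>)"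
  have C2: "C\<^sup>2 = m\<^sup>2 * T / (2 * c) / \<epsilon>" "C \<ge> 0" using T c e by (simp_all add: C_def)
  have incr': "norm (v (t + s) - v t) \<le> C * s" if s: "0 \<le> s" "0 \<le> t" "t + s \<le> T" for s t
  proof (rule power2_le_imp_le)
    have "(norm (v (t + s) - v t))\<^sup>2 \<le> s\<^sup>2 * (m\<^sup>2 * T / (2 * c)) / \<epsilon>"
      unfolding pos_le_divide_eq[OF e] by (subst mult.commute) (rule incr[OF s])
    also have "\<dots> = (C * s)\<^sup>2" by (simp add: power_mult_distrib C2)
    finally show "(norm (v (t + s) - v t))\<^sup>2 \<le> (C * s)\<^sup>2" .
  qed (use C2 s in auto)
  have lipv: "norm (v s - v t) \<le> C * \<bar>s - t\<bar>" if "s \<in> {0..T}" "t \<in> {0..T}" for s t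
  proof (cases "t \<le> s")
    case True
    then show ?thesis using incr'[of "s - t" t] that by simp
  next
    case False
    then show ?thesis using incr'[of "t - s" s] that by (simp add: norm_minus_commute)
  qed
  show ?thesis
  proof (rule that[of p v])
    show "continuous_on {0..T} p" unfolding p_def by (rule f_cont[OF v_cont])
    show "(v has_vector_derivative p t) (at t within {0..T})" if "t \<in> {0..T}" for t
      using dv[OF that] by (simp add: p_def)
    show "K (p t) + \<epsilon> *\<^sub>R p t + B (v t) = F t" for t using eq[of t] by simp
    show "\<epsilon> * (norm (p t))\<^sup>2 \<le> m\<^sup>2 * T / (2 * c)" if t: "t \<in> {0..T}" for t
    proof -
      have "norm (p t) \<le> C"
        unfolding p_def using norm_vector_derivative_le[OF dv[OF t] t T] lipv t by blast
      then have "(norm (p t))\<^sup>2 \<le> C\<^sup>2" by (intro power_mono) auto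
      then have "(norm (p t))\<^sup>2 * \<epsilon> \<le> m\<^sup>2 * T / (2 * c)"
        unfolding C2 pos_le_divide_eq[OF e] .
      then show ?thesis by (subst mult.commute)
    qed
  qed (rule v0)
qed

end

section \<open>Integrals over a time interval and Lipschitz approximation in time\<close>

lemma integral_open_interval_continuous:
  fixes f :: "real \<Rightarrow> real"
  assumes "continuous_on {a..b} f"
  shows "integrable (lebesgue_on {a<..<b}) f" "(\<integral>t. f t \<partial>lebesgue_on {a<..<b}) = integral {a..b} f"
proof -
  have "set_integrable lebesgue {a..b} f"
    using absolutely_integrable_continuous_real[OF assms] by simp
  then have "set_integrable lebesgue {a<..<b} f"
    by (rule set_integrable_subset) auto
  then show i: "integrable (lebesgue_on {a<..<b}) f"
    by (simp add: integrable_restrict_space set_integrable_def)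
  then show "(\<integral>t. f t \<partial>lebesgue_on {a<..<b}) = integral {a..b} f"
    by (subst lebesgue_integral_eq_integral) (auto simp: integral_open_interval_real)
qed

lemma finite_measure_interval: "finite_measure (lebesgue_on {a<..<b::real})"
  by (rule finite_measure_lebesgue_on) auto

lemma square_integrable_continuous:
  fixes f :: "real \<Rightarrow> 'b::{real_normed_vector,second_countable_topology}"
  assumes f: "continuous_on {a..b} f"
  shows "square_integrable (lebesgue_on {a<..<b}) f"
  unfolding square_integrable_def
proof
  show "integrable (lebesgue_on {a<..<b}) (\<lambda>t. (norm (f t))\<^sup>2)"
    by (intro integral_open_interval_continuous continuous_intros f)
  show "f \<in> borel_measurable (lebesgue_on {a<..<b})"
  proof (cases "a \<le> b")
    case True
    \<comment> \<open>A continuous extension to the real line, which is Borel measurable.\<close>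
    let ?g = "\<lambda>t. f (max a (min t b))"
    have "continuous_on UNIV ?g"
      by (rule continuous_on_compose2[OF f]) (use True in \<open>auto intro!: continuous_intros\<close>)
    then have "?g \<in> borel_measurable borel" by (rule borel_measurable_continuous_onI)
    then have "?g \<in> borel_measurable lborel" by simp
    then have "?g \<in> borel_measurable lebesgue" by (rule measurable_completion)
    then have "?g \<in> borel_measurable (lebesgue_on {a<..<b})" by (rule measurable_restrict_space1)
    then show ?thesis by (rule measurable_cong[THEN iffD1, rotated]) auto
  next
    case False
    then have "{a<..<b} = {}" by auto
    then show ?thesis by (auto simp: measurable_def)
  qed
qed

lemma test_function_real:
  fixes \<phi> :: "real \<Rightarrow> real"
  assumes "test_function U \<phi>"
  shows "(\<phi> has_real_derivative deriv \<phi> x) (at x)" "continuous_on S \<phi>" "continuous_on S (deriv \<phi>)"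
    and "\<exists>m. m-lipschitz_on UNIV \<phi>" "x \<notin> U \<Longrightarrow> \<phi> x = 0"
proof -
  let ?K = "closure {x. \<phi> x \<noteq> 0}"
  have K: "compact ?K" "?K \<subseteq> U" and Ck: "\<And>n. Ck n \<phi>" using assms by (auto simp: test_function_def)
  have diff: "\<phi> differentiable (at x)" for x using Ck[of 1] by simp
  show D: "(\<phi> has_real_derivative deriv \<phi> x) (at x)" for x
    using diff[of x] by (simp add: DERIV_deriv_iff_real_differentiable)
  have partial: "partial 1 \<phi> = deriv \<phi>"
  proof
    fix x
    have "(\<phi> has_derivative (*) (deriv \<phi> x)) (at x)" using D[of x] by (simp add: has_field_derivative_def)
    then show "partial 1 \<phi> x = deriv \<phi> x"
      by (simp add: partial_def flip: frechet_derivative_at)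
  qed
  show "continuous_on S \<phi>" using Ck_continuous[OF Ck] by (rule continuous_on_subset) simp
  have cont: "continuous_on UNIV (deriv \<phi>)" using Ck[of 1] by (simp add: Ck_1_iff partial)
  then show "continuous_on S (deriv \<phi>)" by (rule continuous_on_subset) simp
  have "deriv \<phi> x = 0" if "x \<notin> ?K" for x
    using partial_outside_support[OF that, of 1] by (simp add: partial)
  from bounded_test_function[OF cont K(1) this] obtain C where C: "\<And>x. \<bar>deriv \<phi> x\<bar> \<le> C" by blast
  have "C-lipschitz_on UNIV \<phi>"
  proof (rule lipschitz_onI)
    show "dist (\<phi> x) (\<phi> y) \<le> C * dist x y" for x y
      unfolding dist_norm by (rule field_differentiable_bound[OF convex_UNIV, of _ "deriv \<phi>"]) (use D C in auto)
    show "0 \<le> C" using C[of 0] by linarith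
  qed
  then show "\<exists>m. m-lipschitz_on UNIV \<phi>" by blast
  show "x \<notin> U \<Longrightarrow> \<phi> x = 0" using K(2) closure_subset[of "{x. \<phi> x \<noteq> 0}"] by blast
qed

text \<open>\<open>G 0 = 0\<close> is the compatibility condition of
  \<open>regularized_solution\<close> after \<open>B 0\<close> has been subtracted.\<close>

definition lipschitz_approximable :: "real \<Rightarrow> (real \<Rightarrow> 'b::{real_normed_vector,second_countable_topology}) \<Rightarrow> bool" where
  "lipschitz_approximable T F \<longleftrightarrow> square_integrable (lebesgue_on {0<..<T}) F \<and>
     (\<forall>e>0. \<exists>G m. m-lipschitz_on UNIV G \<and> G 0 = 0 \<and>
        (\<integral>t. (norm (F t - G t))\<^sup>2 \<partial>lebesgue_on {0<..<T}) < e)"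

lemma lipschitz_square_integrable:
  "m-lipschitz_on UNIV G \<Longrightarrow> square_integrable (lebesgue_on {a<..<b::real}) G"
  by (intro square_integrable_continuous continuous_on_subset[OF lipschitz_on_continuous_on]) auto

lemma integral_norm_add_sq_le:
  assumes "square_integrable M f" "square_integrable M g"
  shows "(\<integral>x. (norm (f x + g x))\<^sup>2 \<partial>M) \<le> 2 * (\<integral>x. (norm (f x))\<^sup>2 \<partial>M) + 2 * (\<integral>x. (norm (g x))\<^sup>2 \<partial>M)"
proof -
  have "(\<integral>x. (norm (f x + g x))\<^sup>2 \<partial>M) \<le> (\<integral>x. 2 * (norm (f x))\<^sup>2 + 2 * (norm (g x))\<^sup>2 \<partial>M)"
    using assms square_integrable_add[OF assms]
    by (intro integral_mono norm_add_sq_le) (auto simp: square_integrable_def)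
  also have "\<dots> = 2 * (\<integral>x. (norm (f x))\<^sup>2 \<partial>M) + 2 * (\<integral>x. (norm (g x))\<^sup>2 \<partial>M)"
    using assms by (simp add: square_integrable_def)
  finally show ?thesis .
qed

lemma lipschitz_approximable_zero: "lipschitz_approximable T (\<lambda>t. 0)"
  unfolding lipschitz_approximable_def
  by (auto intro!: exI[of _ "\<lambda>_. 0"] exI[of _ 0] lipschitz_on_constant)

lemma lipschitz_approximable_add:
  assumes "lipschitz_approximable T F" "lipschitz_approximable T G"
  shows "lipschitz_approximable T (\<lambda>t. F t + G t)"
  unfolding lipschitz_approximable_def
proof (intro conjI allI impI)
  let ?M = "lebesgue_on {0<..<T}"
  have F: "square_integrable ?M F" and G: "square_integrable ?M G"
    using assms by (auto simp: lipschitz_approximable_def)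
  then show "square_integrable ?M (\<lambda>t. F t + G t)" by (rule square_integrable_add)
  fix e :: real assume "e > 0"
  then have "e / 4 > 0" by simp
  then obtain f g m m' where f: "m-lipschitz_on UNIV f" "f 0 = 0" "(\<integral>t. (norm (F t - f t))\<^sup>2 \<partial>?M) < e / 4"
    and g: "m'-lipschitz_on UNIV g" "g 0 = 0" "(\<integral>t. (norm (G t - g t))\<^sup>2 \<partial>?M) < e / 4"
    using assms unfolding lipschitz_approximable_def by meson
  have "(\<integral>t. (norm ((F t - f t) + (G t - g t)))\<^sup>2 \<partial>?M)
      \<le> 2 * (\<integral>t. (norm (F t - f t))\<^sup>2 \<partial>?M) + 2 * (\<integral>t. (norm (G t - g t))\<^sup>2 \<partial>?M)"
    by (intro integral_norm_add_sq_le square_integrable_diff F G lipschitz_square_integrable[OF f(1)]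
        lipschitz_square_integrable[OF g(1)])
  then have "(\<integral>t. (norm (F t + G t - (f t + g t)))\<^sup>2 \<partial>?M) < e"
    using f(3) g(3) by (simp add: algebra_simps)
  then show "\<exists>h m. m-lipschitz_on UNIV h \<and> h 0 = 0 \<and> (\<integral>t. (norm (F t + G t - h t))\<^sup>2 \<partial>?M) < e"
    using f g by (intro exI[of _ "\<lambda>t. f t + g t"] exI[of _ "m + m'"]) (auto intro: lipschitz_on_add)
qed

lemma lipschitz_approximable_sum:
  "finite I \<Longrightarrow> (\<And>i. i \<in> I \<Longrightarrow> lipschitz_approximable T (F i)) \<Longrightarrow> lipschitz_approximable T (\<lambda>t. \<Sum>i\<in>I. F i t)"
  by (induction rule: finite_induct) (auto intro: lipschitz_approximable_zero lipschitz_approximable_add)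

text \<open>Test functions on the open interval are dense in L2; being Lipschitz and zero at time 0,
  they give admissible approximations \<open>\<phi> t *\<^sub>R y\<close>.\<close>

lemma lipschitz_approximable_indicator:
  assumes A: "A \<in> sets (lebesgue_on {0<..<T})"
  shows "lipschitz_approximable T (\<lambda>t. indicator A t *\<^sub>R y)"
  unfolding lipschitz_approximable_def
proof (intro conjI allI impI)
  let ?M = "lebesgue_on {0<..<T}"
  interpret finite_measure ?M by (rule finite_measure_interval)
  have iL: "indicat_real A \<in> L2 ?M" using A by (intro indicator_L2) (simp add: fmeasurable_eq_sets)
  then have ind: "square_integrable ?M (indicat_real A)" by (simp add: square_integrable_real_iff)
  then show "square_integrable ?M (\<lambda>t. indicator A t *\<^sub>R y)"
    by (rule square_integrable_bounded_linear_comp[OF bounded_linear_scaleR_left])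
  fix e :: real assume e: "e > 0"
  \<comment> \<open>The summand 1 avoids a division by 0 for \<open>y = 0\<close> and makes the
    final inequality strict.\<close>
  define d where "d = e / ((norm y)\<^sup>2 + 1)"
  have y: "(norm y)\<^sup>2 + 1 > 0" by (simp add: add_nonneg_pos)
  then have d: "d > 0" using e by (simp add: d_def)
  obtain \<phi> where \<phi>: "test_function {0<..<T} \<phi>" "(\<integral>x. (indicat_real A x - \<phi> x)\<^sup>2 \<partial>?M) < d"
    using test_functions_dense[OF _ iL d] by auto
  obtain m where m: "m-lipschitz_on UNIV \<phi>" using test_function_real(4)[OF \<phi>(1)] by blast
  have "(norm y)-lipschitz_on UNIV (\<lambda>r::real. r *\<^sub>R y)"
    by (rule lipschitz_onI) (auto simp: dist_norm simp flip: scaleR_diff_left)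
  from lipschitz_on_compose2[OF m lipschitz_on_subset[OF this]]
  have lip: "(norm y * m)-lipschitz_on UNIV (\<lambda>t. \<phi> t *\<^sub>R y)" by simp
  have "(\<integral>t. (norm (indicator A t *\<^sub>R y - \<phi> t *\<^sub>R y))\<^sup>2 \<partial>?M) = (norm y)\<^sup>2 * (\<integral>x. (indicat_real A x - \<phi> x)\<^sup>2 \<partial>?M)"
    by (simp add: power_mult_distrib mult.commute flip: scaleR_diff_left)
  also have "\<dots> \<le> (norm y)\<^sup>2 * d" using \<phi>(2) by (intro mult_left_mono) auto
  also have "\<dots> < ((norm y)\<^sup>2 + 1) * d" using d by simp
  also have "\<dots> = e" using y by (simp add: d_def)
  finally show "\<exists>G m. m-lipschitz_on UNIV G \<and> G 0 = 0 \<and> (\<integral>t. (norm (indicator A t *\<^sub>R y - G t))\<^sup>2 \<partial>?M) < e"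
    using lip test_function_real(5)[OF \<phi>(1), of 0]
    by (intro exI[of _ "\<lambda>t. \<phi> t *\<^sub>R y"] exI[of _ "norm y * m"]) auto
qed

lemma square_integrable_lipschitz_approximable:
  fixes F :: "real \<Rightarrow> 'b::{real_normed_vector,second_countable_topology}"
  assumes F: "square_integrable (lebesgue_on {0<..<T}) F"
  shows "lipschitz_approximable T F"
  unfolding lipschitz_approximable_def
proof (intro conjI allI impI F)
  let ?M = "lebesgue_on {0<..<T}"
  interpret finite_measure ?M by (rule finite_measure_interval)
  have [measurable]: "F \<in> borel_measurable ?M" using F by (simp add: square_integrable_def)
  have "F \<in> borel_measurable ?M" by measurable
  from borel_measurable_implies_sequence_metric[OF this, of 0]
  obtain s where "\<forall>i. simple_function ?M (s i)" "\<forall>t\<in>space ?M. (\<lambda>i. s i t) \<longlonglongrightarrow> F t"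
    "\<forall>i. \<forall>t\<in>space ?M. dist (s i t) 0 \<le> 2 * dist (F t) 0"
    by blast
  then have s: "\<And>i. simple_function ?M (s i)" "\<And>t. t \<in> space ?M \<Longrightarrow> (\<lambda>i. s i t) \<longlonglongrightarrow> F t"
    "\<And>i t. t \<in> space ?M \<Longrightarrow> dist (s i t) 0 \<le> 2 * dist (F t) 0"
    by simp_all
  have [measurable]: "s i \<in> borel_measurable ?M" for i by (rule borel_measurable_simple_function[OF s(1)])
  have appr: "lipschitz_approximable T (s i)" for i
  proof -
    let ?S = "\<lambda>t. \<Sum>y\<in>s i ` space ?M. indicator (s i -` {y} \<inter> space ?M) t *\<^sub>R y"
    have "lipschitz_approximable T ?S"
      using s(1)[of i] by (intro lipschitz_approximable_sum lipschitz_approximable_indicator)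
        (auto simp: simple_function_def)
    moreover have S: "?S t = s i t" if "t \<in> space ?M" for t
    proof -
      have "?S t = (\<Sum>y\<in>s i ` space ?M. if s i t = y then y else 0)"
        using that by (intro sum.cong) (auto simp: indicator_def)
      also have "\<dots> = s i t" using that s(1)[of i] by (subst sum.delta') (auto simp: simple_function_def)
      finally show ?thesis .
    qed
    moreover have "(\<integral>t. (norm (?S t - G t))\<^sup>2 \<partial>?M) = (\<integral>t. (norm (s i t - G t))\<^sup>2 \<partial>?M)" for G
      by (intro Bochner_Integration.integral_cong refl) (simp only: S)
    moreover have "square_integrable ?M (s i)"
    proof (rule square_integrable_cong_AE)
      show "square_integrable ?M ?S" using calculation(1) by (simp add: lipschitz_approximable_def)
      show "AE t in ?M. ?S t = s i t" by (rule AE_I2) (rule S)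
    qed simp
    ultimately show ?thesis by (simp add: lipschitz_approximable_def)
  qed
  have "(\<lambda>i. \<integral>t. (norm (F t - s i t))\<^sup>2 \<partial>?M) \<longlonglongrightarrow> (\<integral>t. 0 \<partial>?M)"
  \<comment> \<open>From \<open>norm (s i t) \<le> 2 * norm (F t)\<close> the difference has norm at
    most \<open>3 * norm (F t)\<close>, whose square gives the factor 9.\<close>
  proof (rule integral_dominated_convergence[where w = "\<lambda>t. 9 * (norm (F t))\<^sup>2"])
    show "AE t in ?M. (\<lambda>i. (norm (F t - s i t))\<^sup>2) \<longlonglongrightarrow> 0"
    proof (rule AE_I2)
      fix t assume t: "t \<in> space ?M"
      have "(\<lambda>i. (norm (F t - s i t))\<^sup>2) \<longlonglongrightarrow> (norm (F t - F t))\<^sup>2" by (intro tendsto_intros s(2) t)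
      then show "(\<lambda>i. (norm (F t - s i t))\<^sup>2) \<longlonglongrightarrow> 0" by simp
    qed
    show "AE t in ?M. norm ((norm (F t - s i t))\<^sup>2) \<le> 9 * (norm (F t))\<^sup>2" for i
    proof (rule AE_I2)
      fix t assume "t \<in> space ?M"
      then have "norm (F t - s i t) \<le> 3 * norm (F t)"
        using norm_triangle_ineq4[of "F t" "s i t"] s(3)[of t i] by simp
      then have "(norm (F t - s i t))\<^sup>2 \<le> (3 * norm (F t))\<^sup>2" by (intro power_mono) auto
      then show "norm ((norm (F t - s i t))\<^sup>2) \<le> 9 * (norm (F t))\<^sup>2" by (simp add: power_mult_distrib)
    qed
  qed (use F in \<open>auto simp: square_integrable_def\<close>)
  moreover fix e :: real assume e: "e > 0"
  ultimately have "\<forall>\<^sub>F i in sequentially. (\<integral>t. (norm (F t - s i t))\<^sup>2 \<partial>?M) < e / 4"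
    by (intro order_tendstoD) auto
  then obtain i where i: "(\<integral>t. (norm (F t - s i t))\<^sup>2 \<partial>?M) < e / 4" by (auto simp: eventually_sequentially)
  have "e / 4 > 0" using e by simp
  then obtain G m where G: "m-lipschitz_on UNIV G" "G 0 = 0" "(\<integral>t. (norm (s i t - G t))\<^sup>2 \<partial>?M) < e / 4"
    using appr[of i] unfolding lipschitz_approximable_def by meson
  have "(\<integral>t. (norm ((F t - s i t) + (s i t - G t)))\<^sup>2 \<partial>?M)
      \<le> 2 * (\<integral>t. (norm (F t - s i t))\<^sup>2 \<partial>?M) + 2 * (\<integral>t. (norm (s i t - G t))\<^sup>2 \<partial>?M)"
    using F appr[of i] G(1)
    by (intro integral_norm_add_sq_le square_integrable_diff) (auto simp: lipschitz_approximable_def intro: lipschitz_square_integrable)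
  then have "(\<integral>t. (norm (F t - G t))\<^sup>2 \<partial>?M) < e" using i G(3) by simp
  then show "\<exists>G m. m-lipschitz_on UNIV G \<and> G 0 = 0 \<and> (\<integral>t. (norm (F t - G t))\<^sup>2 \<partial>?M) < e"
    using G by blast
qed

section \<open>Limits of the regularized solutions\<close>

context parabolic_problem
begin

abbreviation time_measure :: "real measure" where "time_measure \<equiv> lebesgue_on {0<..<T}"

lemma measure_time_measure: "measure time_measure {0<..<T} = T"
  using T by (simp add: measure_restrict_space)

text \<open>The defect is the error in the forcing plus the regularizing term
  \<open>\<epsilon> *\<^sub>R p t\<close>. For a fixed Lipschitz forcing the latter tends to 0 in L2
  with \<epsilon>, even if \<open>p\<close> does not stay bounded.\<close>

lemma approximate_solutions:
  assumes F: "square_integrable time_measure F"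
  obtains v p :: "nat \<Rightarrow> real \<Rightarrow> 'h" where
    "\<And>n. continuous_on {0..T} (p n)" "\<And>n. v n 0 = 0"
    "\<And>n t. t \<in> {0..T} \<Longrightarrow> (v n has_vector_derivative p n t) (at t within {0..T})"
    "(\<lambda>n. \<integral>t. (norm (K (p n t) + B (v n t) - F t))\<^sup>2 \<partial>time_measure) \<longlonglongrightarrow> 0"
proof -
  interpret finite_measure time_measure by (rule finite_measure_interval)
  \<comment> \<open>Subtracting \<open>B 0\<close> here and adding it back to \<open>G\<close>
    produces a forcing that equals \<open>B 0\<close> at time 0.\<close>
  let ?F = "\<lambda>t. F t - B 0"
  have F0: "square_integrable time_measure ?F"
    by (intro square_integrable_diff F square_integrable_const finite_measure_axioms)
  define good where "good d v p \<longleftrightarrow> continuous_on {0..T} p \<and> v 0 = 0 \<and>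
      (\<forall>t\<in>{0..T}. (v has_vector_derivative p t) (at t within {0..T})) \<and>
      (\<integral>t. (norm (K (p t) + B (v t) - F t))\<^sup>2 \<partial>time_measure) \<le> d * (2 + 2 * T)" for d v p
  have "\<exists>v p. good d v p" if d: "d > 0" for d
  proof -
    obtain G m where G: "m-lipschitz_on UNIV G" "G 0 = 0" "(\<integral>t. (norm (?F t - G t))\<^sup>2 \<partial>time_measure) < d"
      using square_integrable_lipschitz_approximable[OF F0] d unfolding lipschitz_approximable_def by meson
    have H: "m-lipschitz_on UNIV (\<lambda>t. G t + B 0)" "G 0 + B 0 = B 0"
      using lipschitz_on_add[OF G(1) lipschitz_on_constant] G(2) by auto
    define C where "C = m\<^sup>2 * T / (2 * c)"
    have C: "C \<ge> 0" using T c by (simp add: C_def)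
    \<comment> \<open>\<open>C\<close> depends on the Lipschitz constant of the approximation, so
      \<epsilon> is chosen last. The squared norm of \<epsilon> p is \<epsilon> times a quantity
      bounded by \<open>C\<close>, hence at most \<open>\<epsilon> * C \<le> d\<close>.\<close>
    define \<epsilon> where "\<epsilon> = d / (C + 1)"
    have e: "\<epsilon> > 0" using d C by (simp add: \<epsilon>_def)
    have "\<epsilon> * C \<le> \<epsilon> * (C + 1)" using e by simp
    also have "\<dots> = d" using C by (simp add: \<epsilon>_def)
    finally have eC: "\<epsilon> * C \<le> d" .
    obtain v p where p: "continuous_on {0..T} p" and v0: "v 0 = 0"
      and v: "\<And>t. t \<in> {0..T} \<Longrightarrow> (v has_vector_derivative p t) (at t within {0..T})"
      and eq: "\<And>t. t \<in> {0..T} \<Longrightarrow> K (p t) + \<epsilon> *\<^sub>R p t + B (v t) = G t + B 0"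
      and small: "\<And>t. t \<in> {0..T} \<Longrightarrow> \<epsilon> * (norm (p t))\<^sup>2 \<le> C"
      by (rule regularized_solution[OF H e, folded C_def]) (rule that)
    have ep: "square_integrable time_measure (\<lambda>t. \<epsilon> *\<^sub>R p t)"
      by (intro square_integrable_scaleR square_integrable_continuous p)
    have "(\<integral>t. (norm (\<epsilon> *\<^sub>R p t))\<^sup>2 \<partial>time_measure) \<le> (\<integral>t. d \<partial>time_measure)"
    proof (rule integral_mono)
      fix t assume "t \<in> space time_measure"
      then have "\<epsilon> * (\<epsilon> * (norm (p t))\<^sup>2) \<le> \<epsilon> * C" using e small[of t] by (intro mult_left_mono) auto
      moreover have "(norm (\<epsilon> *\<^sub>R p t))\<^sup>2 = \<epsilon> * (\<epsilon> * (norm (p t))\<^sup>2)"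
        using e by (simp add: power_mult_distrib power2_eq_square)
      ultimately show "(norm (\<epsilon> *\<^sub>R p t))\<^sup>2 \<le> d" using eC by linarith
    qed (use ep in \<open>simp_all add: square_integrable_def\<close>)
    also have "\<dots> = d * T" using measure_time_measure by simp
    finally have ep_le: "(\<integral>t. (norm (\<epsilon> *\<^sub>R p t))\<^sup>2 \<partial>time_measure) \<le> d * T" .
    have GF: "square_integrable time_measure (\<lambda>t. G t - ?F t)"
      by (intro square_integrable_diff lipschitz_square_integrable[OF G(1)] F0)
    have "(\<integral>t. (norm (K (p t) + B (v t) - F t))\<^sup>2 \<partial>time_measure) = (\<integral>t. (norm ((G t - ?F t) + - (\<epsilon> *\<^sub>R p t)))\<^sup>2 \<partial>time_measure)"
    proof (intro Bochner_Integration.integral_cong refl)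
      fix t assume t: "t \<in> space time_measure"
      have "K (p t) + B (v t) = (K (p t) + \<epsilon> *\<^sub>R p t + B (v t)) - \<epsilon> *\<^sub>R p t" by simp
      also have "K (p t) + \<epsilon> *\<^sub>R p t + B (v t) = G t + B 0" using t by (intro eq) simp
      finally have "K (p t) + B (v t) - F t = (G t - ?F t) + - (\<epsilon> *\<^sub>R p t)" by (simp add: algebra_simps)
      then show "(norm (K (p t) + B (v t) - F t))\<^sup>2 = (norm ((G t - ?F t) + - (\<epsilon> *\<^sub>R p t)))\<^sup>2"
        by (simp only:)
    qed
    also have "\<dots> \<le> 2 * (\<integral>t. (norm (G t - ?F t))\<^sup>2 \<partial>time_measure) + 2 * (\<integral>t. (norm (- (\<epsilon> *\<^sub>R p t)))\<^sup>2 \<partial>time_measure)"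
      by (intro integral_norm_add_sq_le GF square_integrable_minus ep)
    also have "\<dots> \<le> 2 * d + 2 * (d * T)"
      using G(3) ep_le by (intro add_mono mult_left_mono) (simp_all add: norm_minus_commute)
    finally have "(\<integral>t. (norm (K (p t) + B (v t) - F t))\<^sup>2 \<partial>time_measure) \<le> d * (2 + 2 * T)"
      by (simp add: algebra_simps)
    with p v0 v show ?thesis unfolding good_def by blast
  qed
  then have "\<exists>v p. good (1 / real (Suc n)) v p" for n by simp
  then obtain v p where vp: "\<And>n. good (1 / real (Suc n)) (v n) (p n)" by metis
  show ?thesis
  proof (rule that[of p v])
    have "(\<lambda>n. 1 / real (Suc n) * (2 + 2 * T)) \<longlonglongrightarrow> 0 * (2 + 2 * T)"
      by (intro tendsto_intros LIMSEQ_Suc[OF lim_1_over_n])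
    then have lim: "(\<lambda>n. 1 / real (Suc n) * (2 + 2 * T)) \<longlonglongrightarrow> 0" by simp
    show "(\<lambda>n. \<integral>t. (norm (K (p n t) + B (v n t) - F t))\<^sup>2 \<partial>time_measure) \<longlonglongrightarrow> 0"
      by (rule tendsto_sandwich[OF _ _ tendsto_const lim])
        (use vp in \<open>auto intro!: always_eventually simp: good_def\<close>)
  qed (use vp in \<open>auto simp: good_def\<close>)
qed

lemma energy_identity:
  assumes v0: "v 0 = 0" and s: "s \<in> {0..T}"
    and v: "\<And>t. t \<in> {0..T} \<Longrightarrow> (v has_vector_derivative p t) (at t within {0..T})"
  shows "((\<lambda>t. 2 * (K (p t) \<bullet> v t)) has_integral (norm (Q (v s)))\<^sup>2) {0..s}"
proof -
  have "((\<lambda>t. 2 * (K (p t) \<bullet> v t)) has_integral K (v s) \<bullet> v s - K (v 0) \<bullet> v 0) {0..s}"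
  proof (rule fundamental_theorem_of_calculus)
    fix t assume t: "t \<in> {0..s}"
    have dv: "(v has_vector_derivative p t) (at t within {0..s})"
      using t s by (intro has_vector_derivative_within_subset[OF v]) auto
    have "((\<lambda>t. K (v t) \<bullet> v t) has_vector_derivative (K (v t) \<bullet> p t + K (p t) \<bullet> v t)) (at t within {0..s})"
      by (intro bounded_bilinear.has_vector_derivative[OF bounded_bilinear_inner]
          bounded_linear.has_vector_derivative[OF K] dv)
    moreover have "K (v t) \<bullet> p t = K (p t) \<bullet> v t" by (metis K_inner inner_commute)
    ultimately show "((\<lambda>t. K (v t) \<bullet> v t) has_vector_derivative 2 * (K (p t) \<bullet> v t)) (at t within {0..s})"
      by simp
  qed (use s in auto)
  then show ?thesis by (simp add: v0 K_inner power2_norm_eq_inner)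
qed

text \<open>\<open>v\<close> is determined only almost everywhere in time, so the initial value is
  carried by \<open>w\<close>, the continuous version of \<open>Q v\<close>. The equation is (K v)'
  + B v = F in the sense of distributions, tested with \<open>\<eta> t\<close> times a fixed vector
  \<open>u\<close>.\<close>

definition solves :: "(real \<Rightarrow> 'h) \<Rightarrow> (real \<Rightarrow> 'h) \<Rightarrow> (real \<Rightarrow> 'h) \<Rightarrow> bool" where
  "solves F v w \<longleftrightarrow> square_integrable time_measure v \<and> continuous_on {0..T} w \<and> w 0 = 0 \<and>
     (AE t in time_measure. w t = Q (v t)) \<and>
     (\<forall>\<eta> u. test_function {0<..<T} \<eta> \<longrightarrow>
        (\<integral>t. (Q (v t) \<bullet> Q u) * deriv \<eta> t \<partial>time_measure) = - (\<integral>t. ((F t - B (v t)) \<bullet> u) * \<eta> t \<partial>time_measure))"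

text \<open>Two right-hand sides are compared: half of the coercivity absorbs their difference, and
  the other half remains as the bound on \<open>v1 - v2\<close>. The boundary term of the energy
  identity controls \<open>Q (v1 s - v2 s)\<close> uniformly in time.\<close>

lemma increment_bound:
  assumes p: "continuous_on {0..T} p1" "continuous_on {0..T} p2" and v0: "v1 0 = 0" "v2 0 = 0"
    and v1: "\<And>t. t \<in> {0..T} \<Longrightarrow> (v1 has_vector_derivative p1 t) (at t within {0..T})"
    and v2: "\<And>t. t \<in> {0..T} \<Longrightarrow> (v2 has_vector_derivative p2 t) (at t within {0..T})"
  defines "I \<equiv> (\<integral>t. (norm ((K (p1 t) + B (v1 t)) - (K (p2 t) + B (v2 t))))\<^sup>2 \<partial>time_measure)"
  shows "(\<integral>t. (norm (v1 t - v2 t))\<^sup>2 \<partial>time_measure) \<le> I / c\<^sup>2"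
    and "\<And>s. s \<in> {0..T} \<Longrightarrow> (norm (Q (v1 s - v2 s)))\<^sup>2 \<le> I / c"
proof -
  interpret K: bounded_linear K by (rule K)
  let ?d = "\<lambda>t. v1 t - v2 t" and ?g = "\<lambda>t. (K (p1 t) + B (v1 t)) - (K (p2 t) + B (v2 t))"
  have v_cont: "continuous_on {0..T} v1" "continuous_on {0..T} v2"
    using v1 v2 by (blast intro: continuous_on_vector_derivative)+
  have B_cont: "continuous_on UNIV B" by (rule lipschitz_on_continuous_on[OF B_lip])
  have g_cont: "continuous_on {0..T} ?g"
    by (intro continuous_intros K.continuous_on p continuous_on_compose2[OF B_cont] v_cont) auto
  have dd: "(?d has_vector_derivative p1 t - p2 t) (at t within {0..T})" if "t \<in> {0..T}" for t
    using that by (intro has_vector_derivative_diff v1 v2)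
  have est: "(norm (Q (?d s)))\<^sup>2 \<le> integral {0..s} (\<lambda>t. (norm (?g t))\<^sup>2 / c) - integral {0..s} (\<lambda>t. c * (norm (?d t))\<^sup>2)"
    if s: "s \<in> {0..T}" for s
  proof -
    have sub: "{0..s} \<subseteq> {0..T}" using s by auto
    have i1: "(\<lambda>t. (norm (?g t))\<^sup>2 / c) integrable_on {0..s}"
      using c by (intro integrable_continuous_interval continuous_intros continuous_on_subset[OF g_cont sub]) auto
    have i2: "(\<lambda>t. c * (norm (?d t))\<^sup>2) integrable_on {0..s}"
      by (intro integrable_continuous_interval continuous_intros v_cont[THEN continuous_on_subset, OF sub])
    have "(norm (Q (?d s)))\<^sup>2 \<le> integral {0..s} (\<lambda>t. (norm (?g t))\<^sup>2 / c - c * (norm (?d t))\<^sup>2)"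
    proof (rule has_integral_le[OF energy_identity integrable_integral])
      show "?d 0 = 0" by (simp add: v0)
      show "(\<lambda>t. (norm (?g t))\<^sup>2 / c - c * (norm (?d t))\<^sup>2) integrable_on {0..s}"
        by (intro integrable_diff i1 i2)
      fix t assume t: "t \<in> {0..s}"
      have "K (p1 t - p2 t) \<bullet> ?d t = ?g t \<bullet> ?d t - (B (v1 t) - B (v2 t)) \<bullet> ?d t"
        by (simp add: K.diff algebra_simps)
      also have "\<dots> \<le> norm (?g t) * norm (?d t) - c * (norm (?d t))\<^sup>2"
        by (intro diff_mono norm_cauchy_schwarz B_mono)
      also have "2 * \<dots> = 2 * (norm (?g t) * norm (?d t) - (c / 2) * (norm (?d t))\<^sup>2) - c * (norm (?d t))\<^sup>2"
        by (simp add: algebra_simps)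
      also have "\<dots> \<le> 2 * ((norm (?g t))\<^sup>2 / (4 * (c / 2))) - c * (norm (?d t))\<^sup>2"
        using c by (intro diff_right_mono mult_left_mono quadratic_max) auto
      finally show "2 * (K (p1 t - p2 t) \<bullet> ?d t) \<le> (norm (?g t))\<^sup>2 / c - c * (norm (?d t))\<^sup>2" by simp
    qed (use s dd in auto)
    then show ?thesis by (simp add: integral_diff[OF i1 i2])
  qed
  have gT: "integral {0..T} (\<lambda>t. (norm (?g t))\<^sup>2 / c) = I / c"
    using integral_open_interval_continuous(2)[of 0 T "\<lambda>t. (norm (?g t))\<^sup>2"]
    by (simp add: I_def continuous_intros g_cont)
  have dT: "integral {0..T} (\<lambda>t. c * (norm (?d t))\<^sup>2) = c * (\<integral>t. (norm (?d t))\<^sup>2 \<partial>time_measure)"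
    using integral_open_interval_continuous(2)[of 0 T "\<lambda>t. (norm (?d t))\<^sup>2"]
    by (simp add: continuous_intros v_cont)
  have "c * (\<integral>t. (norm (?d t))\<^sup>2 \<partial>time_measure) \<le> I / c"
    using order_trans[OF zero_le_power2 est[of T, unfolded gT dT]] T by simp
  then show "(\<integral>t. (norm (?d t))\<^sup>2 \<partial>time_measure) \<le> I / c\<^sup>2"
    using c by (simp add: power2_eq_square pos_le_divide_eq mult_ac)
  show "(norm (Q (?d s)))\<^sup>2 \<le> I / c" if s: "s \<in> {0..T}" for s
  proof -
    have "0 \<le> integral {0..s} (\<lambda>t. c * (norm (?d t))\<^sup>2)" 
      using s c by (intro integral_nonneg integrable_continuous_interval continuous_intros
          v_cont[THEN continuous_on_subset]) auto
    moreover have "integral {0..s} (\<lambda>t. (norm (?g t))\<^sup>2 / c) \<le> integral {0..T} (\<lambda>t. (norm (?g t))\<^sup>2 / c)"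
      using s c by (intro integral_subset_le integrable_continuous_interval continuous_intros
          continuous_on_subset[OF g_cont]) auto
    ultimately show ?thesis using est[OF s] gT by linarith
  qed
qed

text \<open>Two facts are kept from the construction: the energy inequality, which the uniqueness
  proof uses for a linear problem, and \<open>w t \<in> closure (range Q)\<close>, by which the
  continuous version can be read as a function with values in V.\<close>

theorem solution_exists:
  assumes F: "square_integrable time_measure F"
  obtains v w where "solves F v w" "0 \<le> (\<integral>t. (F t - B (v t)) \<bullet> v t \<partial>time_measure)"
    "\<And>t. t \<in> {0..T} \<Longrightarrow> w t \<in> closure (range Q)"
proof -
  interpret finite_measure time_measure by (rule finite_measure_interval)
  interpret Q: bounded_linear Q by (rule Q)
  interpret K: bounded_linear K by (rule K)
  obtain v p where p: "\<And>n. continuous_on {0..T} (p n)" and v0: "\<And>n. v n 0 = 0"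
    and dv: "\<And>n t. t \<in> {0..T} \<Longrightarrow> (v n has_vector_derivative p n t) (at t within {0..T})"
    and lim: "(\<lambda>n. \<integral>t. (norm (K (p n t) + B (v n t) - F t))\<^sup>2 \<partial>time_measure) \<longlonglongrightarrow> 0"
    by (rule approximate_solutions[OF F]) (rule that)
  \<comment> \<open>The right-hand side for which \<open>v n\<close> is an exact solution. It tends
    to \<open>F\<close> in L2, so \<open>increment_bound\<close> makes the \<open>v n\<close> a
    Cauchy sequence.\<close>
  define G where "G n t = K (p n t) + B (v n t)" for n t
  have v_cont: "continuous_on {0..T} (v n)" for n
    using dv by (blast intro: continuous_on_vector_derivative)
  have B_cont: "continuous_on UNIV B" by (rule lipschitz_on_continuous_on[OF B_lip])
  have G_cont: "continuous_on {0..T} (G n)" for n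
    unfolding G_def
    by (intro continuous_intros K.continuous_on p continuous_on_compose2[OF B_cont] v_cont) auto
  have sq_v: "square_integrable time_measure (v n)" and sq_G: "square_integrable time_measure (G n)" for n
    by (intro square_integrable_continuous v_cont G_cont)+
  define J where "J n = (\<integral>t. (norm (G n t - F t))\<^sup>2 \<partial>time_measure)" for n
  have J: "J \<longlonglongrightarrow> 0" using lim by (simp add: J_def[abs_def] G_def)
  have GG: "(\<integral>t. (norm (G m t - G n t))\<^sup>2 \<partial>time_measure) \<le> 2 * J m + 2 * J n" for m n
    using integral_norm_add_sq_le[OF square_integrable_diff[OF sq_G F]
        square_integrable_minus[OF square_integrable_diff[OF sq_G F]], of m n]
    by (simp add: J_def norm_minus_commute)
  note bound = increment_bound[OF p p v0 v0 dv dv, folded G_def]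
  have small: "\<exists>N. \<forall>m\<ge>N. \<forall>n\<ge>N. (\<integral>t. (norm (G m t - G n t))\<^sup>2 \<partial>time_measure) < e" if "e > 0" for e
  proof -
    have "\<forall>\<^sub>F n in sequentially. J n < e / 4" using J that by (intro order_tendstoD) auto
    then obtain N where N: "\<And>n. n \<ge> N \<Longrightarrow> J n < e / 4" by (auto simp: eventually_sequentially)
    have "2 * J m + 2 * J n < e" if "m \<ge> N" "n \<ge> N" for m n
      using N[OF that(1)] N[OF that(2)] by simp
    then show ?thesis using GG le_less_trans by (intro exI[of _ N]) blast
  qed
  obtain V r where V: "square_integrable time_measure V"
    "(\<lambda>n. \<integral>t. (norm (v n t - V t))\<^sup>2 \<partial>time_measure) \<longlonglongrightarrow> 0" "strict_mono r"
    "AE t in time_measure. (\<lambda>k. v (r k) t) \<longlonglongrightarrow> V t"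
  proof (rule square_integrable_complete[of time_measure v, OF sq_v])
    fix e :: real assume "e > 0"
    then have "e * c\<^sup>2 > 0" using c by simp
    from small[OF this] obtain N where N: "\<And>m n. m \<ge> N \<Longrightarrow> n \<ge> N \<Longrightarrow> (\<integral>t. (norm (G m t - G n t))\<^sup>2 \<partial>time_measure) < e * c\<^sup>2" by blast
    have "(\<integral>t. (norm (v m t - v n t))\<^sup>2 \<partial>time_measure) < e" if "m \<ge> N" "n \<ge> N" for m n
      using bound(1)[of m n] N[OF that] c by (simp add: pos_divide_less_eq[symmetric] order.strict_trans1)
    then show "\<exists>N. \<forall>m\<ge>N. \<forall>n\<ge>N. (\<integral>t. (norm (v m t - v n t))\<^sup>2 \<partial>time_measure) < e" by blast
  qed blast
  have "uniformly_Cauchy_on {0..T} (\<lambda>n t. Q (v n t))"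
    unfolding uniformly_Cauchy_on_def
  proof (intro allI impI)
    fix e :: real assume e: "e > 0"
    then have "e\<^sup>2 * c > 0" using c by simp
    from small[OF this] obtain N where N: "\<And>m n. m \<ge> N \<Longrightarrow> n \<ge> N \<Longrightarrow> (\<integral>t. (norm (G m t - G n t))\<^sup>2 \<partial>time_measure) < e\<^sup>2 * c" by blast
    have "dist (Q (v m t)) (Q (v n t)) < e" if "m \<ge> N" "n \<ge> N" "t \<in> {0..T}" for m n t
    proof -
      have "(norm (Q (v m t - v n t)))\<^sup>2 < e\<^sup>2"
        using bound(2)[of t m n] N[OF that(1,2)] that(3) c
        by (simp add: pos_divide_less_eq[symmetric] order.strict_trans1)
      then have "norm (Q (v m t - v n t)) < e" using e by (auto intro: power2_less_imp_less)
      then show ?thesis by (simp add: dist_norm Q.diff)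
    qed
    then show "\<exists>M. \<forall>t\<in>{0..T}. \<forall>m\<ge>M. \<forall>n\<ge>M. dist (Q (v m t)) (Q (v n t)) < e" by blast
  qed
  then obtain w where w: "uniform_limit {0..T} (\<lambda>n t. Q (v n t)) w sequentially"
    using Cauchy_uniformly_convergent uniformly_convergent_on_def by blast
  have w_lim: "(\<lambda>n. Q (v n t)) \<longlonglongrightarrow> w t" if "t \<in> {0..T}" for t
    using tendsto_uniform_limitI[OF w that] .
  have w_cont: "continuous_on {0..T} w"
    by (rule uniform_limit_theorem[OF always_eventually w]) (auto intro: Q.continuous_on v_cont)
  have w0: "w 0 = 0"
    using w_lim[of 0] T by (simp add: v0 Q.zero LIMSEQ_const_iff)
  \<comment> \<open>The almost everywhere convergent subsequence identifies the uniform limit of the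
    \<open>Q (v n t)\<close> with \<open>Q (V t)\<close>.\<close>
  have wV: "AE t in time_measure. w t = Q (V t)"
    using V(4) AE_space
  proof eventually_elim
    case (elim t)
    have "(\<lambda>k. Q (v (r k) t)) \<longlonglongrightarrow> Q (V t)" by (intro Q.tendsto elim)
    moreover have "(\<lambda>k. Q (v (r k) t)) \<longlonglongrightarrow> w t"
      using LIMSEQ_subseq_LIMSEQ[OF w_lim V(3), of t] elim by (simp add: o_def)
    ultimately show ?case by (rule LIMSEQ_unique[rotated])
  qed
  have sq_BV: "square_integrable time_measure (\<lambda>t. B (V t))" and sq_Bv: "square_integrable time_measure (\<lambda>t. B (v n t))" for n
    by (intro square_integrable_lipschitz[OF finite_measure_axioms B_lip] V sq_v)+
  have BV: "(\<lambda>n. \<integral>t. (norm (B (v n t) - B (V t)))\<^sup>2 \<partial>time_measure) \<longlonglongrightarrow> 0"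
  proof (rule tendsto_sandwich[OF _ _ tendsto_const])
    show "(\<lambda>n. L\<^sup>2 * (\<integral>t. (norm (v n t - V t))\<^sup>2 \<partial>time_measure)) \<longlonglongrightarrow> 0"
      using tendsto_mult_left[OF V(2), of "L\<^sup>2"] by simp
    have "(\<integral>t. (norm (B (v n t) - B (V t)))\<^sup>2 \<partial>time_measure) \<le> (\<integral>t. L\<^sup>2 * (norm (v n t - V t))\<^sup>2 \<partial>time_measure)" for n
    proof (rule integral_mono)
      show "(norm (B (v n t) - B (V t)))\<^sup>2 \<le> L\<^sup>2 * (norm (v n t - V t))\<^sup>2" for t
        using power_mono[OF lipschitz_on_normD[OF B_lip, of "v n t" "V t"], of 2] by (simp add: power_mult_distrib)
    qed (use square_integrable_diff[OF sq_Bv sq_BV, of n] square_integrable_diff[OF sq_v V(1), of n] in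
        \<open>auto simp: square_integrable_def\<close>)
    then show "\<forall>\<^sub>F n in sequentially. (\<integral>t. (norm (B (v n t) - B (V t)))\<^sup>2 \<partial>time_measure)
        \<le> L\<^sup>2 * (\<integral>t. (norm (v n t - V t))\<^sup>2 \<partial>time_measure)" by simp
  qed simp
  have sq_rhs: "square_integrable time_measure (\<lambda>t. F t - B (V t))"
    "square_integrable time_measure (\<lambda>t. G n t - B (v n t))" for n
    by (intro square_integrable_diff F sq_BV sq_G sq_Bv)+
  have rhs: "(\<lambda>n. \<integral>t. (norm ((G n t - B (v n t)) - (F t - B (V t))))\<^sup>2 \<partial>time_measure) \<longlonglongrightarrow> 0"
  proof (rule tendsto_sandwich[OF _ _ tendsto_const])
    show "(\<lambda>n. 2 * J n + 2 * (\<integral>t. (norm (B (v n t) - B (V t)))\<^sup>2 \<partial>time_measure)) \<longlonglongrightarrow> 0"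
      using tendsto_add[OF tendsto_mult_left[OF J, of 2] tendsto_mult_left[OF BV, of 2]] by simp
    have "(\<integral>t. (norm ((G n t - B (v n t)) - (F t - B (V t))))\<^sup>2 \<partial>time_measure)
        \<le> 2 * J n + 2 * (\<integral>t. (norm (B (v n t) - B (V t)))\<^sup>2 \<partial>time_measure)" for n
      using integral_norm_add_sq_le[OF square_integrable_diff[OF sq_G F]
          square_integrable_minus[OF square_integrable_diff[OF sq_Bv sq_BV]], of n n]
      by (simp add: J_def norm_minus_commute algebra_simps)
    then show "\<forall>\<^sub>F n in sequentially. (\<integral>t. (norm ((G n t - B (v n t)) - (F t - B (V t))))\<^sup>2 \<partial>time_measure)
        \<le> 2 * J n + 2 * (\<integral>t. (norm (B (v n t) - B (V t)))\<^sup>2 \<partial>time_measure)" by simp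
  qed simp
  have dist_form: "(\<integral>t. (Q (V t) \<bullet> Q u) * deriv \<eta> t \<partial>time_measure) = - (\<integral>t. ((F t - B (V t)) \<bullet> u) * \<eta> t \<partial>time_measure)"
    if \<eta>: "test_function {0<..<T} \<eta>" for \<eta> u
  proof (rule LIMSEQ_unique)
    note \<eta>' = test_function_real[OF \<eta>]
    have sq1: "square_integrable time_measure (\<lambda>t. deriv \<eta> t *\<^sub>R K u)"
      and sq2: "square_integrable time_measure (\<lambda>t. \<eta> t *\<^sub>R u)"
      by (intro square_integrable_continuous continuous_intros \<eta>')+
    have "(\<lambda>n. \<integral>t. v n t \<bullet> (deriv \<eta> t *\<^sub>R K u) \<partial>time_measure) \<longlonglongrightarrow> (\<integral>t. V t \<bullet> (deriv \<eta> t *\<^sub>R K u) \<partial>time_measure)"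
      by (rule tendsto_integral_inner_L2[OF sq_v V(1) sq1 sq1 V(2)]) simp
    moreover have KQ: "x \<bullet> (a *\<^sub>R K u) = (Q x \<bullet> Q u) * a" for x a
      by (simp add: K_inner inner_commute[of x] inner_commute[of "Q u"])
    ultimately show "(\<lambda>n. \<integral>t. (Q (v n t) \<bullet> Q u) * deriv \<eta> t \<partial>time_measure) \<longlonglongrightarrow> (\<integral>t. (Q (V t) \<bullet> Q u) * deriv \<eta> t \<partial>time_measure)"
      by (simp only: KQ)
    have "(\<lambda>n. \<integral>t. (G n t - B (v n t)) \<bullet> (\<eta> t *\<^sub>R u) \<partial>time_measure) \<longlonglongrightarrow> (\<integral>t. (F t - B (V t)) \<bullet> (\<eta> t *\<^sub>R u) \<partial>time_measure)"
      by (rule tendsto_integral_inner_L2[OF sq_rhs(2) sq_rhs(1) sq2 sq2 rhs]) simp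
    then have "(\<lambda>n. - (\<integral>t. (G n t - B (v n t)) \<bullet> (\<eta> t *\<^sub>R u) \<partial>time_measure)) \<longlonglongrightarrow> - (\<integral>t. (F t - B (V t)) \<bullet> (\<eta> t *\<^sub>R u) \<partial>time_measure)"
      by (rule tendsto_minus)
    moreover have "- (\<integral>t. (G n t - B (v n t)) \<bullet> (\<eta> t *\<^sub>R u) \<partial>time_measure) = (\<integral>t. (Q (v n t) \<bullet> Q u) * deriv \<eta> t \<partial>time_measure)" for n
    proof -
      let ?a = "\<lambda>t. (Q (v n t) \<bullet> Q u) * deriv \<eta> t" and ?b = "\<lambda>t. (Q (p n t) \<bullet> Q u) * \<eta> t"
      have a: "continuous_on {0..T} ?a" and b: "continuous_on {0..T} ?b"
        by (intro continuous_intros Q.continuous_on v_cont p \<eta>')+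
      have "((\<lambda>t. ?a t + ?b t) has_integral (Q (v n T) \<bullet> Q u) * \<eta> T - (Q (v n 0) \<bullet> Q u) * \<eta> 0) {0..T}"
      proof (rule fundamental_theorem_of_calculus)
        fix t assume t: "t \<in> {0..T}"
        have "((\<lambda>t. Q (v n t) \<bullet> Q u) has_vector_derivative Q (p n t) \<bullet> Q u) (at t within {0..T})"
          by (intro bounded_linear.has_vector_derivative[OF bounded_linear_inner_left]
              bounded_linear.has_vector_derivative[OF Q] dv t)
        moreover have "(\<eta> has_vector_derivative deriv \<eta> t) (at t within {0..T})"
          using \<eta>'(1)[of t] by (simp add: has_real_derivative_iff_has_vector_derivative has_vector_derivative_at_within)
        ultimately show "((\<lambda>t. (Q (v n t) \<bullet> Q u) * \<eta> t) has_vector_derivative ?a t + ?b t) (at t within {0..T})"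
          by (rule has_vector_derivative_mult)
      qed (use T in simp)
      then have "integral {0..T} (\<lambda>t. ?a t + ?b t) = 0"
        using \<eta>'(5)[of 0] \<eta>'(5)[of T] by (simp add: integral_unique)
      then have "integral {0..T} ?a + integral {0..T} ?b = 0"
        by (subst (asm) integral_add) (auto intro: integrable_continuous_interval a b)
      moreover have "(G n t - B (v n t)) \<bullet> (\<eta> t *\<^sub>R u) = ?b t" for t
        by (simp add: G_def K_inner mult.commute)
      ultimately show ?thesis
        by (simp only: integral_open_interval_continuous(2)[OF a] integral_open_interval_continuous(2)[OF b])
    qed
    ultimately show "(\<lambda>n. \<integral>t. (Q (v n t) \<bullet> Q u) * deriv \<eta> t \<partial>time_measure) \<longlonglongrightarrow> - (\<integral>t. ((F t - B (V t)) \<bullet> u) * \<eta> t \<partial>time_measure)"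
      by (simp add: mult.commute)
  qed
  have "(\<lambda>n. \<integral>t. (G n t - B (v n t)) \<bullet> v n t \<partial>time_measure) \<longlonglongrightarrow> (\<integral>t. (F t - B (V t)) \<bullet> V t \<partial>time_measure)"
    by (rule tendsto_integral_inner_L2[OF sq_rhs(2) sq_rhs(1) sq_v V(1) rhs V(2)])
  \<comment> \<open>For the approximations the integral is half the square of
    \<open>norm (Q (v n T))\<close>; only its sign is carried to the limit.\<close>
  moreover have "0 \<le> (\<integral>t. (G n t - B (v n t)) \<bullet> v n t \<partial>time_measure)" for n
  proof -
    have cont: "continuous_on {0..T} (\<lambda>t. K (p n t) \<bullet> v n t)"
      by (intro continuous_intros K.continuous_on p v_cont)
    have "integral {0..T} (\<lambda>t. 2 * (K (p n t) \<bullet> v n t)) = (norm (Q (v n T)))\<^sup>2"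
      by (rule integral_unique[OF energy_identity[OF v0 _ dv]]) (use T in simp_all)
    then have "0 \<le> 2 * integral {0..T} (\<lambda>t. K (p n t) \<bullet> v n t)" by simp
    then have "0 \<le> integral {0..T} (\<lambda>t. K (p n t) \<bullet> v n t)" by linarith
    then show ?thesis by (simp add: G_def integral_open_interval_continuous(2)[OF cont])
  qed
  ultimately have energy: "0 \<le> (\<integral>t. (F t - B (V t)) \<bullet> V t \<partial>time_measure)"
    by (intro LIMSEQ_le_const) auto
  show ?thesis
  proof (rule that)
    show "solves F V w" using V(1) w_cont w0 wV dist_form by (simp add: solves_def)
    show "w t \<in> closure (range Q)" if "t \<in> {0..T}" for t
      unfolding closure_sequential using w_lim[OF that] by (intro exI[of _ "\<lambda>n. Q (v n t)"]) simp
    show "0 \<le> (\<integral>t. (F t - B (V t)) \<bullet> V t \<partial>time_measure)" by (rule energy)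
  qed
qed

end

section \<open>Abstract parabolic problems: uniqueness\<close>

lemma lebesgue_on_restrict:
  fixes f :: "'a::euclidean_space \<Rightarrow> 'b::{banach,second_countable_topology}"
  assumes "S \<in> sets lebesgue" "U \<in> sets lebesgue" "S \<subseteq> U"
  shows "(\<integral>t. indicator S t *\<^sub>R f t \<partial>lebesgue_on U) = (\<integral>t. f t \<partial>lebesgue_on S)"
    and "integrable (lebesgue_on U) f \<Longrightarrow> integrable (lebesgue_on S) f"
proof -
  have "(\<integral>t. indicator S t *\<^sub>R f t \<partial>lebesgue_on U) = (\<integral>t. indicator U t *\<^sub>R (indicator S t *\<^sub>R f t) \<partial>lebesgue)"
    using assms by (intro integral_restrict_space) auto
  also have "\<dots> = (\<integral>t. indicator S t *\<^sub>R f t \<partial>lebesgue)"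
    using assms(3) by (intro Bochner_Integration.integral_cong) (auto simp: indicator_def)
  also have "\<dots> = (\<integral>t. f t \<partial>lebesgue_on S)"
    using assms by (intro integral_restrict_space[symmetric]) auto
  finally show "(\<integral>t. indicator S t *\<^sub>R f t \<partial>lebesgue_on U) = (\<integral>t. f t \<partial>lebesgue_on S)" .
  assume "integrable (lebesgue_on U) f"
  then have "set_integrable lebesgue U f"
    using assms by (simp add: integrable_restrict_space set_integrable_def)
  then have "set_integrable lebesgue S f" by (rule set_integrable_subset) (use assms in auto)
  then show "integrable (lebesgue_on S) f"
    unfolding set_integrable_def by (subst integrable_restrict_space) (use assms(1) in simp_all)
qed

lemma tendsto_integral_box_bump:
  fixes g :: "real \<Rightarrow> real"
  assumes g: "integrable (lebesgue_on U) g" and U: "U \<in> sets lebesgue" "{a<..<b} \<subseteq> U"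
  shows "(\<lambda>n. \<integral>t. g t * box_bump n a b t \<partial>lebesgue_on U) \<longlonglongrightarrow> (\<integral>t. g t \<partial>lebesgue_on {a<..<b})"
proof -
  have bump: "box_bump n a b \<in> borel_measurable (lebesgue_on U)" for n
    by (intro L2_measurable test_function_L2(1)[OF test_function_box_bump[OF subset_UNIV]] U)
  have ind: "(indicator (box a b) :: real \<Rightarrow> real) \<in> borel_measurable (lebesgue_on U)"
    using U by (intro borel_measurable_indicator) (auto simp: sets_restrict_space_iff)
  have "(\<lambda>n. \<integral>t. g t * box_bump n a b t \<partial>lebesgue_on U) \<longlonglongrightarrow> (\<integral>t. g t * indicator (box a b) t \<partial>lebesgue_on U)"
  proof (rule integral_dominated_convergence[where w = "\<lambda>t. \<bar>g t\<bar>"])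
    show "AE t in lebesgue_on U. (\<lambda>n. g t * box_bump n a b t) \<longlonglongrightarrow> g t * indicator (box a b) t"
      by (intro AE_I2 tendsto_mult_left box_bump_tendsto)
    show "AE t in lebesgue_on U. norm (g t * box_bump n a b t) \<le> \<bar>g t\<bar>" for n
      using box_bump_bounds[of n a b] by (intro AE_I2) (auto simp: abs_mult intro!: mult_right_le_one_le)
  qed (use g bump ind in auto)
  also have "(\<integral>t. g t * indicator (box a b) t \<partial>lebesgue_on U) = (\<integral>t. g t \<partial>lebesgue_on {a<..<b})"
    using lebesgue_on_restrict(1)[of "{a<..<b}" U g] U by (simp add: box_real mult.commute)
  finally show ?thesis .
qed

text \<open>
  Testing with the bumps that approximate the indicator of \<open>{a<..<b}\<close>: their derivatives have
  total mass at most \<open>2\<close>, so \<open>f\<close> may be replaced by a uniformly close polynomial.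
\<close>

lemma distributional_derivative_integrated:
  fixes f g :: "real \<Rightarrow> real"
  assumes f: "continuous_on {0..T} f" and g: "integrable (lebesgue_on {0<..<T}) g"
    and fg: "\<And>\<eta>. test_function {0<..<T} \<eta> \<Longrightarrow>
      (\<integral>t. f t * deriv \<eta> t \<partial>lebesgue_on {0<..<T}) = - (\<integral>t. g t * \<eta> t \<partial>lebesgue_on {0<..<T})"
    and ab: "0 < a" "a < b" "b < T"
  shows "f b - f a = (\<integral>t. g t \<partial>lebesgue_on {a<..<b})"
proof (rule ccontr)
  let ?M = "lebesgue_on {0<..<T}"
  let ?q = "[:0, 0, 1:] * (1 - pderiv 1) :: real poly"
  define I where "I = (\<integral>t. g t \<partial>lebesgue_on {a<..<b})"
  assume "f b - f a \<noteq> (\<integral>t. g t \<partial>lebesgue_on {a<..<b})"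
  then have "\<bar>f b - f a - I\<bar> > 0" by (simp add: I_def)
  \<comment> \<open>Error budget: \<open>2 * e\<close> from the mass of the derivative of the bump,
    and less than \<open>e\<close> for the polynomial at each of \<open>a\<close> and
    \<open>b\<close>, together less than \<open>4 * e\<close>.\<close>
  then obtain e where e: "e > 0" "5 * e < \<bar>f b - f a - I\<bar>"
    by (intro that[of "\<bar>f b - f a - I\<bar> / 6"]) auto
  obtain p where p: "polynomial_function p" "\<And>t. t \<in> {0..T} \<Longrightarrow> norm (f t - p t) < e"
    using Stone_Weierstrass_polynomial_function[OF compact_Icc f e(1)] by blast
  obtain p' where p': "polynomial_function p'" "\<And>t. (p has_vector_derivative p' t) (at t)"
    using has_vector_derivative_polynomial_function[OF p(1)] by blast
  have p_cont: "continuous_on S p" "continuous_on S p'" for S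
    using p(1) p'(1) by (auto intro: continuous_on_polymonial_function)
  have bound: "\<bar>(p b - p a) - I\<bar> \<le> 2 * e"
  proof (rule LIMSEQ_le_const2)
    have "(\<lambda>n. \<integral>t. p' t * box_bump n a b t \<partial>?M) \<longlonglongrightarrow> (\<integral>t. p' t \<partial>lebesgue_on {a<..<b})"
      using ab by (intro tendsto_integral_box_bump integral_open_interval_continuous p_cont) auto
    also have "(\<integral>t. p' t \<partial>lebesgue_on {a<..<b}) = integral {a..b} p'"
      by (intro integral_open_interval_continuous p_cont)
    also have "\<dots> = p b - p a"
      using ab by (intro integral_unique fundamental_theorem_of_calculus has_vector_derivative_at_within[OF p'(2)]) simp
    finally have 1: "(\<lambda>n. \<integral>t. p' t * box_bump n a b t \<partial>?M) \<longlonglongrightarrow> p b - p a" .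
    have 2: "(\<lambda>n. \<integral>t. g t * box_bump n a b t \<partial>?M) \<longlonglongrightarrow> I"
      unfolding I_def using ab by (intro tendsto_integral_box_bump g) auto
    show "(\<lambda>n. \<bar>(\<integral>t. p' t * box_bump n a b t \<partial>?M) - (\<integral>t. g t * box_bump n a b t \<partial>?M)\<bar>) \<longlonglongrightarrow> \<bar>(p b - p a) - I\<bar>"
      by (intro tendsto_intros 1 2)
    have "\<bar>(\<integral>t. p' t * box_bump n a b t \<partial>?M) - (\<integral>t. g t * box_bump n a b t \<partial>?M)\<bar> \<le> 2 * e" for n
    proof -
      let ?\<eta> = "box_bump n a b"
      \<comment> \<open>The bump is the product of a rising factor \<open>?u\<close> and a falling
        factor \<open>?v\<close>. Both lie between 0 and 1, so its derivative is at most
        \<open>?u' - ?v'\<close> in absolute value, a function whose integral is found from the end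
        values and is at most 2.\<close>
      let ?u = "\<lambda>t. flat 1 (real n * (t - a))" and ?v = "\<lambda>t. flat 1 (real n * (b - t))"
      let ?u' = "\<lambda>t. real n * flat ?q (real n * (t - a))" and ?v' = "\<lambda>t. - real n * flat ?q (real n * (b - t))"
      have test: "test_function {0<..<T} ?\<eta>" using ab by (intro test_function_box_bump) auto
      note \<eta> = test_function_real[OF test]
      have du: "(?u has_real_derivative ?u' t) (at t)" for t
        by (rule DERIV_cong[OF DERIV_chain2[OF flat_has_derivative]]) (auto intro!: derivative_eq_intros)
      have dv: "(?v has_real_derivative ?v' t) (at t)" for t
        by (rule DERIV_cong[OF DERIV_chain2[OF flat_has_derivative]]) (auto intro!: derivative_eq_intros)
      have "?\<eta> = (\<lambda>t. ?u t * ?v t)" by (simp add: box_bump_def fun_eq_iff)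
      moreover have "((\<lambda>t. ?u t * ?v t) has_real_derivative ?u' t * ?v t + ?u t * ?v' t) (at t)" for t
        using DERIV_mult[OF du dv, of t] by (simp add: mult.commute add.commute)
      ultimately have der: "deriv ?\<eta> t = ?u' t * ?v t + ?u t * ?v' t" for t
        by (simp only: DERIV_imp_deriv)
      have fq: "flat ?q x \<ge> 0" for x by (simp add: flat_def)
      have abs_der: "\<bar>deriv ?\<eta> t\<bar> \<le> ?u' t - ?v' t" for t
      proof -
        have "0 \<le> ?u' t" "0 \<le> - ?v' t" using fq by auto
        then have "0 \<le> ?u' t * ?v t" "?u' t * ?v t \<le> ?u' t" "0 \<le> - (?u t * ?v' t)" "- (?u t * ?v' t) \<le> - ?v' t"
          using flat_1_bounds[of "real n * (t - a)"] flat_1_bounds[of "real n * (b - t)"]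
            mult_left_le[of "?v t" "?u' t"] mult_left_le[of "?u t" "- ?v' t"]
            mult_nonneg_nonneg[of "?u' t" "?v t"] mult_nonneg_nonneg[of "?u t" "- ?v' t"]
          by (simp_all only: mult.commute[of "?u t"] mult_minus_left) 
        then show ?thesis unfolding der by linarith
      qed
      have fq_cont: "continuous_on UNIV (flat ?q)"
        by (intro DERIV_continuous_on[OF has_field_derivative_at_within[OF flat_has_derivative]])
      have uv_cont: "continuous_on S (\<lambda>t. ?u' t - ?v' t)" for S
        by (intro continuous_intros continuous_on_compose2[OF fq_cont]) auto
      have "((\<lambda>t. ?u' t - ?v' t) has_integral (?u T - ?v T) - (?u 0 - ?v 0)) {0..T}"
      proof (rule fundamental_theorem_of_calculus[where f = "\<lambda>t. ?u t - ?v t"])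
        fix t
        show "((\<lambda>t. ?u t - ?v t) has_vector_derivative ?u' t - ?v' t) (at t within {0..T})"
          using DERIV_diff[OF du dv, of t]
          by (simp only: has_real_derivative_iff_has_vector_derivative has_vector_derivative_at_within)
      qed (use ab in simp)
      then have "(\<integral>t. ?u' t - ?v' t \<partial>?M) = (?u T - ?v T) - (?u 0 - ?v 0)"
        unfolding integral_open_interval_continuous(2)[OF uv_cont] by (rule integral_unique)
      then have mass: "(\<integral>t. ?u' t - ?v' t \<partial>?M) \<le> 2"
        using flat_1_bounds[of "real n * (T - a)"] flat_1_bounds[of "real n * (b - T)"]
          flat_1_bounds[of "real n * (0 - a)"] flat_1_bounds[of "real n * (b - 0)"] by linarith
      have c1: "continuous_on {0..T} (\<lambda>t. f t * deriv ?\<eta> t)" and c2: "continuous_on {0..T} (\<lambda>t. p t * deriv ?\<eta> t)"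
        and c3: "continuous_on {0..T} (\<lambda>t. p' t * ?\<eta> t)"
        by (intro continuous_intros f p_cont \<eta>)+
      have "((\<lambda>t. p t * deriv ?\<eta> t + p' t * ?\<eta> t) has_integral p T * ?\<eta> T - p 0 * ?\<eta> 0) {0..T}"
      proof (rule fundamental_theorem_of_calculus)
        fix t
        have "(?\<eta> has_vector_derivative deriv ?\<eta> t) (at t within {0..T})"
          using \<eta>(1)[of t] by (simp add: has_real_derivative_iff_has_vector_derivative has_vector_derivative_at_within)
        from has_vector_derivative_mult[OF has_vector_derivative_at_within[OF p'(2)] this]
        show "((\<lambda>t. p t * ?\<eta> t) has_vector_derivative p t * deriv ?\<eta> t + p' t * ?\<eta> t) (at t within {0..T})" .
      qed (use ab in simp)
      then have "integral {0..T} (\<lambda>t. p t * deriv ?\<eta> t + p' t * ?\<eta> t) = 0"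
        using \<eta>(5)[of 0] \<eta>(5)[of T] by (simp add: integral_unique)
      then have "integral {0..T} (\<lambda>t. p t * deriv ?\<eta> t) + integral {0..T} (\<lambda>t. p' t * ?\<eta> t) = 0"
        by (subst (asm) integral_add) (auto intro: integrable_continuous_interval c2 c3)
      then have parts: "(\<integral>t. p' t * ?\<eta> t \<partial>?M) = - (\<integral>t. p t * deriv ?\<eta> t \<partial>?M)"
        by (simp only: integral_open_interval_continuous(2)[OF c2] integral_open_interval_continuous(2)[OF c3])
      have "(\<integral>t. p' t * ?\<eta> t \<partial>?M) - (\<integral>t. g t * ?\<eta> t \<partial>?M) = (\<integral>t. f t * deriv ?\<eta> t \<partial>?M) - (\<integral>t. p t * deriv ?\<eta> t \<partial>?M)"
        using parts fg[OF test] by simp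
      also have "\<dots> = (\<integral>t. f t * deriv ?\<eta> t - p t * deriv ?\<eta> t \<partial>?M)"
        by (intro Bochner_Integration.integral_diff[symmetric] integral_open_interval_continuous c1 c2)
      finally have eq: "(\<integral>t. p' t * ?\<eta> t \<partial>?M) - (\<integral>t. g t * ?\<eta> t \<partial>?M)
          = (\<integral>t. f t * deriv ?\<eta> t - p t * deriv ?\<eta> t \<partial>?M)" .
      have "\<bar>\<integral>t. f t * deriv ?\<eta> t - p t * deriv ?\<eta> t \<partial>?M\<bar> \<le> (\<integral>t. e * (?u' t - ?v' t) \<partial>?M)"
      proof (rule integral_abs_bound_integral)
        show "integrable ?M (\<lambda>t. f t * deriv ?\<eta> t - p t * deriv ?\<eta> t)"
          by (intro Bochner_Integration.integrable_diff integral_open_interval_continuous c1 c2)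
        show "integrable ?M (\<lambda>t. e * (?u' t - ?v' t))"
          by (intro integrable_mult_right integral_open_interval_continuous uv_cont)
        fix t assume "t \<in> space ?M"
        then have "\<bar>f t - p t\<bar> * \<bar>deriv ?\<eta> t\<bar> \<le> e * (?u' t - ?v' t)"
          using p(2)[of t] abs_der e(1) by (intro mult_mono) auto
        then show "\<bar>f t * deriv ?\<eta> t - p t * deriv ?\<eta> t\<bar> \<le> e * (?u' t - ?v' t)"
          by (simp flip: abs_mult left_diff_distrib)
      qed
      also have "\<dots> = e * (\<integral>t. ?u' t - ?v' t \<partial>?M)" by (rule integral_mult_right_zero)
      also have "\<dots> \<le> e * 2" using mass e(1) by (intro mult_left_mono) auto
      finally show ?thesis by (simp only: eq mult.commute[of 2])
    qed
    then show "\<exists>N. \<forall>n\<ge>N. \<bar>(\<integral>t. p' t * box_bump n a b t \<partial>?M) - (\<integral>t. g t * box_bump n a b t \<partial>?M)\<bar> \<le> 2 * e"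
      by blast
  qed
  have "\<bar>f a - p a\<bar> < e" "\<bar>f b - p b\<bar> < e" using p(2)[of a] p(2)[of b] ab by auto
  then show False using bound e by linarith
qed

text \<open>Intervals with left end 0 suffice, since every other one is a difference of two of them
  up to a point. The exceptional null set is made independent of \<open>u\<close> by letting
  \<open>u\<close> run through a countable dense set.\<close>

lemma AE_zero_of_interval_integrals:
  fixes z :: "real \<Rightarrow> 'h::{real_inner,banach,second_countable_topology}"
  assumes z: "square_integrable (lebesgue_on {0<..<T}) z"
    and zero: "\<And>s u. 0 < s \<Longrightarrow> s < T \<Longrightarrow> (\<integral>t. z t \<bullet> u \<partial>lebesgue_on {0<..<s}) = 0"
  shows "AE t in lebesgue_on {0<..<T}. z t = 0"
proof -
  let ?M = "lebesgue_on {0<..<T}"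
  interpret finite_measure ?M by (rule finite_measure_interval)
  obtain D :: "'h set" where D: "countable D" "\<And>X. open X \<Longrightarrow> X \<noteq> {} \<Longrightarrow> \<exists>d\<in>D. d \<in> X"
    by (erule countable_dense_setE)
  have "AE t in ?M. z t \<bullet> u = 0" for u
  proof -
    let ?g = "\<lambda>t. indicator {0<..<T} t * (z t \<bullet> u)"
    have sq: "square_integrable ?M (\<lambda>t. z t \<bullet> u)"
      by (rule square_integrable_bounded_linear_comp[OF bounded_linear_inner_left z])
    then have gL: "?g \<in> L2 lebesgue"
      by (simp add: square_integrable_real_iff flip: L2_on_iff)
    have int: "integrable ?M (\<lambda>t. z t \<bullet> u)"
      using square_integrable_inner[OF z square_integrable_const[OF finite_measure_axioms]] .
    have "AE t in lebesgue. t \<in> {0<..<T} \<longrightarrow> ?g t = 0"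
    proof (rule AE_zero_on_open_of_box_integrals[OF _ gL])
      fix a b assume sub: "cbox a b \<subseteq> {0<..<T}"
      show "(\<integral>t. indicator (box a b) t * ?g t \<partial>lebesgue) = 0"
      proof (cases "a < b")
        case True
        have ab: "0 < a" "b < T" using sub True by (auto simp: subset_iff)
        have res: "(\<integral>t. indicator S t *\<^sub>R (z t \<bullet> u) \<partial>?M) = (\<integral>t. z t \<bullet> u \<partial>lebesgue_on S)"
          and int': "integrable ?M (\<lambda>t. indicator S t *\<^sub>R (z t \<bullet> u))"
          if "S \<in> sets lebesgue" "S \<subseteq> {0<..<T}" for S
        proof -
          show "(\<integral>t. indicator S t *\<^sub>R (z t \<bullet> u) \<partial>?M) = (\<integral>t. z t \<bullet> u \<partial>lebesgue_on S)"
            using that by (intro lebesgue_on_restrict(1)) auto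
          have "S \<in> sets ?M" using that by (simp add: sets_restrict_space_iff)
          then show "integrable ?M (\<lambda>t. indicator S t *\<^sub>R (z t \<bullet> u))" using int by (rule integrable_mult_indicator)
        qed
        have "(\<integral>t. indicator (box a b) t * ?g t \<partial>lebesgue) = (\<integral>t. indicator {a<..<b} t *\<^sub>R (z t \<bullet> u) \<partial>lebesgue)"
          using ab by (intro Bochner_Integration.integral_cong) (auto simp: indicator_def box_real)
        also have "\<dots> = (\<integral>t. z t \<bullet> u \<partial>lebesgue_on {a<..<b})"
          by (intro integral_restrict_space[symmetric]) auto
        also have "\<dots> = (\<integral>t. indicator {a<..<b} t *\<^sub>R (z t \<bullet> u) \<partial>?M)"
          using ab by (intro res[symmetric]) auto
        also have "\<dots> = (\<integral>t. indicator {0<..<b} t *\<^sub>R (z t \<bullet> u) - indicator {0<..<a} t *\<^sub>R (z t \<bullet> u) \<partial>?M)"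
        proof (rule Bochner_Integration.integral_cong_AE)
          have "AE t in lebesgue. t \<notin> {a}" by (rule AE_not_in) (simp flip: negligible_iff_null_sets)
          then have "AE t in ?M. t \<notin> {a}" by (simp add: AE_on_iff) (auto elim: eventually_mono)
          then show "AE t in ?M. indicator {a<..<b} t *\<^sub>R (z t \<bullet> u)
              = indicator {0<..<b} t *\<^sub>R (z t \<bullet> u) - indicator {0<..<a} t *\<^sub>R (z t \<bullet> u)"
            using AE_space by eventually_elim (use ab True in \<open>auto simp: indicator_def\<close>)
        qed (use ab True in \<open>auto intro!: borel_measurable_integrable int' Bochner_Integration.integrable_diff
            simp del: real_scaleR_def\<close>)
        also have "\<dots> = (\<integral>t. indicator {0<..<b} t *\<^sub>R (z t \<bullet> u) \<partial>?M) - (\<integral>t. indicator {0<..<a} t *\<^sub>R (z t \<bullet> u) \<partial>?M)"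
          using ab True by (intro Bochner_Integration.integral_diff int') auto
        also have "\<dots> = (\<integral>t. z t \<bullet> u \<partial>lebesgue_on {0<..<b}) - (\<integral>t. z t \<bullet> u \<partial>lebesgue_on {0<..<a})"
          using ab True by (intro arg_cong2[where f = "(-)"] res) auto
        also have "\<dots> = 0" using zero[of b u] zero[of a u] ab True by simp
        finally show ?thesis .
      qed (simp add: box_real)
    qed simp
    then show ?thesis by (auto simp: AE_on_iff elim: eventually_mono)
  qed
  then have "AE t in ?M. \<forall>u\<in>D. z t \<bullet> u = 0"
    by (intro AE_ball_countable' D(1)) auto
  then show ?thesis
  proof eventually_elim
    case (elim t)
    show ?case
    proof (rule ccontr)
      assume z0: "z t \<noteq> 0"
      have "open (ball (z t) (norm (z t)))" "ball (z t) (norm (z t)) \<noteq> {}" using z0 by auto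
      \<comment> \<open>A vector closer to \<open>z t\<close> than \<open>norm (z t)\<close> cannot
        be orthogonal to it.\<close>
      from D(2)[OF this] obtain d where d: "d \<in> D" "dist (z t) d < norm (z t)" by auto
      have "(norm (z t))\<^sup>2 = z t \<bullet> (z t - d)" using elim d(1) by (simp add: inner_diff_right power2_norm_eq_inner)
      also have "\<dots> \<le> norm (z t) * norm (z t - d)" by (rule norm_cauchy_schwarz)
      also have "\<dots> < norm (z t) * norm (z t)" using d(2) z0 by (simp add: dist_norm)
      finally show False by (simp add: power2_eq_square)
    qed
  qed
qed

context parabolic_problem
begin

lemma square_integrable_rhs:
  assumes "square_integrable time_measure F" "solves F v w"
  shows "square_integrable time_measure (\<lambda>t. F t - B (v t))"
  using assms unfolding solves_def
  by (intro square_integrable_diff square_integrable_lipschitz[OF finite_measure_interval B_lip]) auto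

text \<open>The distributional identity yields the increments of \<open>w t \<bullet> Q u\<close>
  between interior times; the lower end is then moved to 0, where \<open>w\<close> is continuous and
  vanishes.\<close>

lemma solves_integrated:
  assumes F: "square_integrable time_measure F" and sol: "solves F v w" and s: "0 < s" "s < T"
  shows "w s \<bullet> Q u = (\<integral>t. (F t - B (v t)) \<bullet> u \<partial>lebesgue_on {0<..<s})"
proof -
  interpret finite_measure time_measure by (rule finite_measure_interval)
  let ?f = "\<lambda>t. w t \<bullet> Q u" and ?g = "\<lambda>t. (F t - B (v t)) \<bullet> u"
  have w: "continuous_on {0..T} w" "w 0 = 0" and wv: "AE t in time_measure. w t = Q (v t)"
    and v: "square_integrable time_measure v"
    and eq: "\<And>\<eta>. test_function {0<..<T} \<eta> \<Longrightarrow>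
        (\<integral>t. (Q (v t) \<bullet> Q u) * deriv \<eta> t \<partial>time_measure) = - (\<integral>t. ?g t * \<eta> t \<partial>time_measure)"
    using sol by (auto simp: solves_def)
  have f: "continuous_on {0..T} ?f" by (intro continuous_intros w)
  have g: "integrable time_measure ?g"
    by (intro square_integrable_inner square_integrable_rhs[OF F sol] square_integrable_const finite_measure_axioms)
  have fg: "(\<integral>t. ?f t * deriv \<eta> t \<partial>time_measure) = - (\<integral>t. ?g t * \<eta> t \<partial>time_measure)"
    if \<eta>: "test_function {0<..<T} \<eta>" for \<eta>
  proof -
    have "(\<integral>t. ?f t * deriv \<eta> t \<partial>time_measure) = (\<integral>t. (Q (v t) \<bullet> Q u) * deriv \<eta> t \<partial>time_measure)"
    proof (rule Bochner_Integration.integral_cong_AE)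
      show "AE t in time_measure. ?f t * deriv \<eta> t = (Q (v t) \<bullet> Q u) * deriv \<eta> t"
        using wv by eventually_elim simp
      have d: "deriv \<eta> \<in> borel_measurable time_measure"
        using square_integrable_continuous[OF test_function_real(3)[OF \<eta>]] by (simp add: square_integrable_def)
      have "?f \<in> borel_measurable time_measure"
        using square_integrable_continuous[OF f] by (simp add: square_integrable_def)
      with d show "(\<lambda>t. ?f t * deriv \<eta> t) \<in> borel_measurable time_measure" by simp
      have "(\<lambda>t. Q (v t)) \<in> borel_measurable time_measure"
        using square_integrable_bounded_linear_comp[OF Q v] by (simp add: square_integrable_def)
      with d show "(\<lambda>t. (Q (v t) \<bullet> Q u) * deriv \<eta> t) \<in> borel_measurable time_measure" by simp
    qed
    then show ?thesis using eq[OF \<eta>] by simp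
  qed
  have gs: "integrable (lebesgue_on {0<..<s}) ?g"
    using g s by (intro lebesgue_on_restrict(2)[of "{0<..<s}" "{0<..<T}"]) auto
  \<comment> \<open>The offset 2 keeps the lower end strictly between 0 and \<open>s\<close> also
    for \<open>n = 0\<close>.\<close>
  let ?a = "\<lambda>n::nat. s / real (n + 2)"
  have a: "0 < ?a n" "?a n < s" for n
  proof -
    have "s * 1 < s * real (n + 2)" using s by (intro mult_strict_left_mono) auto
    then show "0 < ?a n" "?a n < s" using s by (simp_all add: pos_divide_less_eq)
  qed
  have a_lim: "?a \<longlonglongrightarrow> 0"
  proof -
    have "(\<lambda>n. s * (1 / real (n + 2))) \<longlonglongrightarrow> s * 0"
      by (intro tendsto_intros LIMSEQ_ignore_initial_segment[OF lim_1_over_n, of 2])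
    then show ?thesis by simp
  qed
  have "(\<lambda>n. ?f s - ?f (?a n)) \<longlonglongrightarrow> ?f s - ?f 0"
  proof (intro tendsto_diff tendsto_const)
    have "((\<lambda>t. ?f t) \<longlongrightarrow> ?f 0) (at 0 within {0..T})"
      using f T by (simp add: continuous_on)
    moreover have "filterlim ?a (at 0 within {0..T}) sequentially"
      unfolding filterlim_at using a_lim a s by (auto intro!: always_eventually less_imp_le intro: less_trans simp: less_imp_neq[symmetric])
    ultimately show "(\<lambda>n. ?f (?a n)) \<longlonglongrightarrow> ?f 0" by (rule filterlim_compose)
  qed
  moreover have "?f s - ?f (?a n) = (\<integral>t. indicator {?a n<..<s} t *\<^sub>R ?g t \<partial>lebesgue_on {0<..<s})" for n
  proof -
    have "?f s - ?f (?a n) = (\<integral>t. ?g t \<partial>lebesgue_on {?a n<..<s})"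
      using a[of n] s by (intro distributional_derivative_integrated[OF f g fg]) auto
    also have "\<dots> = (\<integral>t. indicator {?a n<..<s} t *\<^sub>R ?g t \<partial>lebesgue_on {0<..<s})"
      using a[of n] by (intro lebesgue_on_restrict(1)[symmetric]) auto
    finally show ?thesis .
  qed
  moreover have "(\<lambda>n. \<integral>t. indicator {?a n<..<s} t *\<^sub>R ?g t \<partial>lebesgue_on {0<..<s}) \<longlonglongrightarrow> (\<integral>t. ?g t \<partial>lebesgue_on {0<..<s})"
  proof (rule integral_dominated_convergence[where w = "\<lambda>t. norm (?g t)"])
    show "AE t in lebesgue_on {0<..<s}. (\<lambda>n. indicator {?a n<..<s} t *\<^sub>R ?g t) \<longlonglongrightarrow> ?g t"
    proof (rule AE_I2)
      fix t assume t: "t \<in> space (lebesgue_on {0<..<s})"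
      then have "\<forall>\<^sub>F n in sequentially. ?a n < t" using a_lim by (intro order_tendstoD) auto
      then have "\<forall>\<^sub>F n in sequentially. indicator {?a n<..<s} t *\<^sub>R ?g t = ?g t"
        by eventually_elim (use t in simp)
      then show "(\<lambda>n. indicator {?a n<..<s} t *\<^sub>R ?g t) \<longlonglongrightarrow> ?g t" by (rule tendsto_eventually)
    qed
    show "(\<lambda>t. indicator {?a n<..<s} t *\<^sub>R ?g t) \<in> borel_measurable (lebesgue_on {0<..<s})" for n
      using gs a[of n] by (intro borel_measurable_scaleR borel_measurable_indicator borel_measurable_integrable)
        (auto simp: sets_restrict_space_iff)
  qed (use gs in \<open>auto simp: indicator_def intro!: AE_I2\<close>)
  ultimately have "?f s - ?f 0 = (\<integral>t. ?g t \<partial>lebesgue_on {0<..<s})"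
    by (simp only: LIMSEQ_unique)
  then show ?thesis by (simp add: w(2))
qed

text \<open>
  Uniqueness for the homogeneous linear problem \<open>(K z)' + z = 0\<close>, integrated twice in time: with
  \<open>Y'' = z\<close> one has \<open>K Y' = - Y\<close>, so that \<open>norm Y\<close> is nonincreasing.
\<close>

lemma homogeneous_linear_unique:
  assumes z: "square_integrable time_measure z" and w: "continuous_on {0..T} w" "w 0 = 0"
    and wz: "AE t in time_measure. w t = Q (z t)"
    and eq: "\<And>s u. 0 < s \<Longrightarrow> s < T \<Longrightarrow> w s \<bullet> Q u = - (\<integral>t. z t \<bullet> u \<partial>lebesgue_on {0<..<s})"
  shows "AE t in time_measure. z t = 0"
proof (rule AE_zero_of_interval_integrals[OF z])
  fix s0 u0 assume s0: "0 < s0" "s0 < T"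
  interpret finite_measure time_measure by (rule finite_measure_interval)
  interpret Q: bounded_linear Q by (rule Q)
  \<comment> \<open>The first primitive of \<open>z\<close>. Its continuity is read off from
    \<open>w\<close>: testing \<open>w s \<bullet> Q u = - (Z s \<bullet> u)\<close> with
    \<open>u = Z r - Z s\<close> bounds the increment of \<open>Z\<close> by that of
    \<open>w\<close>.\<close>
  define Z where "Z s = (\<integral>t. z t \<partial>lebesgue_on {0<..<s})" for s
  have "square_integrable time_measure (\<lambda>t. norm (z t))" using z by (auto simp: square_integrable_def)
  from square_integrable_inner[OF this square_integrable_const[OF finite_measure_axioms, of 1]]
  have "integrable time_measure (\<lambda>t. norm (z t))" by simp
  then have "integrable time_measure z"
    by (rule Bochner_Integration.integrable_bound) (use z in \<open>auto simp: square_integrable_def\<close>)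
  then have z_int: "integrable (lebesgue_on {0<..<s}) z" if "s \<le> T" for s
    using that by (intro lebesgue_on_restrict(2)[of "{0<..<s}" "{0<..<T}"]) auto
  have Zu: "Z s \<bullet> u = (\<integral>t. z t \<bullet> u \<partial>lebesgue_on {0<..<s})" if "s \<le> T" for s u
    unfolding Z_def using z_int[OF that] by simp
  have wZ: "w s \<bullet> Q u = - (Z s \<bullet> u)" if "s \<in> {0..s0}" for s u
  proof (cases "s = 0")
    case True
    then show ?thesis using Zu[of 0 u] T by (simp add: w(2))
  next
    case False
    then show ?thesis using eq[of s u] Zu[of s u] that s0 by simp
  qed
  have Z_cont: "continuous_on {0..s0} Z"
  proof -
    obtain C where C: "C > 0" "\<And>x. norm (Q x) \<le> norm x * C" using Q.pos_bounded by blast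
    have "norm (Z r - Z s) \<le> norm (w r - w s) * C" if "r \<in> {0..s0}" "s \<in> {0..s0}" for r s
    proof -
      let ?d = "Z r - Z s"
      have "(norm ?d)\<^sup>2 = - ((w r - w s) \<bullet> Q ?d)"
        using wZ[OF that(1), of ?d] wZ[OF that(2), of ?d] by (simp add: power2_norm_eq_inner inner_diff_left)
      also have "\<dots> \<le> norm (w r - w s) * norm (Q ?d)"
        using Cauchy_Schwarz_ineq2[of "w r - w s" "Q ?d"] by linarith
      also have "\<dots> \<le> norm (w r - w s) * (norm ?d * C)" by (intro mult_left_mono C(2)) auto
      finally have "norm ?d * norm ?d \<le> norm ?d * (norm (w r - w s) * C)" by (simp add: power2_eq_square mult_ac)
      then show ?thesis using C(1) by (cases "?d = 0") simp_all
    qed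
    note lip = this
    show ?thesis
      unfolding continuous_on
    proof
      fix s assume s: "s \<in> {0..s0}"
      have "(w \<longlongrightarrow> w s) (at s within {0..s0})"
        using continuous_on_subset[OF w(1), of "{0..s0}"] s s0 by (simp add: continuous_on)
      then have "((\<lambda>r. norm (w r - w s) * C) \<longlongrightarrow> norm (w s - w s) * C) (at s within {0..s0})"
        by (intro tendsto_intros)
      then have "((\<lambda>r. norm (w r - w s) * C) \<longlongrightarrow> 0) (at s within {0..s0})" by simp
      then have "((\<lambda>r. Z r - Z s) \<longlongrightarrow> 0) (at s within {0..s0})"
        by (rule Lim_null_comparison[rotated]) (use lip s in \<open>auto simp: eventually_at_filter\<close>)
      then show "(Z \<longlongrightarrow> Z s) (at s within {0..s0})" by (rule LIM_zero_cancel)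
    qed
  qed
  \<comment> \<open>\<open>Z\<close> is continuous, so \<open>Y\<close> is differentiable in the
    classical sense; this second integration is what permits the product rule.\<close>
  define Y where "Y s = integral {0..s} Z" for s
  have dY: "(Y has_vector_derivative Z s) (at s within {0..s0})" if "s \<in> {0..s0}" for s
    unfolding Y_def by (rule integral_has_vector_derivative[OF Z_cont that])
  have YQ: "Y s \<bullet> u = - (Q (Z s) \<bullet> Q u)" if s: "s \<in> {0..s0}" for s u
  proof -
    have Zs: "Z integrable_on {0..s}"
      using s by (intro integrable_continuous_interval continuous_on_subset[OF Z_cont]) auto
    have "Y s \<bullet> u = integral {0..s} (\<lambda>r. Z r \<bullet> u)"
      unfolding Y_def using integral_linear[OF Zs bounded_linear_inner_left, of u] by (simp add: o_def)
    also have "\<dots> = integral {0..s} (\<lambda>r. - (w r \<bullet> Q u))"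
      using wZ s by (intro integral_cong) auto
    also have "\<dots> = - (\<integral>r. w r \<bullet> Q u \<partial>lebesgue_on {0<..<s})"
    proof -
      have "continuous_on {0..s} (\<lambda>r. w r \<bullet> Q u)"
        using s s0 by (intro continuous_intros continuous_on_subset[OF w(1)]) auto
      from integral_open_interval_continuous(2)[OF this] show ?thesis by simp
    qed
    also have "(\<integral>r. w r \<bullet> Q u \<partial>lebesgue_on {0<..<s}) = (\<integral>r. z r \<bullet> K u \<partial>lebesgue_on {0<..<s})"
    proof (rule Bochner_Integration.integral_cong_AE)
      have "AE r in lebesgue_on {0<..<s}. w r = Q (z r)"
        using wz s s0 by (auto simp: AE_on_iff elim: eventually_mono)
      then show "AE r in lebesgue_on {0<..<s}. w r \<bullet> Q u = z r \<bullet> K u"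
        by eventually_elim (metis K_inner inner_commute)
      have "square_integrable (lebesgue_on {0<..<s}) w"
        using s s0 by (intro square_integrable_continuous continuous_on_subset[OF w(1)]) auto
      then show "(\<lambda>r. w r \<bullet> Q u) \<in> borel_measurable (lebesgue_on {0<..<s})" by (auto simp: square_integrable_def)
      show "(\<lambda>r. z r \<bullet> K u) \<in> borel_measurable (lebesgue_on {0<..<s})"
        using z_int[of s] s s0 by auto
    qed
    also have "\<dots> = Q (Z s) \<bullet> Q u" using Zu[of s "K u"] s s0 K_inner[of u "Z s"] by (simp add: inner_commute)
    finally show ?thesis .
  qed
  \<comment> \<open>The squared norm of \<open>Y\<close> has the derivative
    \<open>2 * (Y r \<bullet> Z r)\<close>, which \<open>YQ\<close> with \<open>u = Z r\<close>
    turns into -2 times the squared norm of \<open>Q (Z r)\<close>.\<close>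
  have Y0: "Y s = 0" if s: "s \<in> {0..s0}" for s
  proof -
    have "Y s \<bullet> Y s \<le> Y 0 \<bullet> Y 0 + 0 * (s - 0)"
    proof (rule growth_bound[where D' = "\<lambda>r. Y r \<bullet> Z r + Z r \<bullet> Y r"])
      fix r assume r: "r \<in> {0..s}"
      then have dYr: "(Y has_vector_derivative Z r) (at r within {0..s})"
        using s by (intro has_vector_derivative_within_subset[OF dY]) auto
      from bounded_bilinear.has_vector_derivative[OF bounded_bilinear_inner dYr dYr]
      show "((\<lambda>r. Y r \<bullet> Y r) has_vector_derivative Y r \<bullet> Z r + Z r \<bullet> Y r) (at r within {0..s})" .
      have "r \<in> {0..s0}" using r s by auto
      then have "Y r \<bullet> Z r \<le> 0" using YQ[of r "Z r"] by simp
      then show "Y r \<bullet> Z r + Z r \<bullet> Y r \<le> 0" by (simp add: inner_commute)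
    qed (use s in auto)
    moreover have "Y 0 = 0" by (simp add: Y_def)
    ultimately have "Y s \<bullet> Y s \<le> 0" by simp
    then show ?thesis using inner_ge_zero[of "Y s"] by (simp only: inner_eq_zero_iff order_antisym_conv)
  qed
  have "Z s0 = 0"
  proof (rule vector_derivative_unique_within_closed_interval[of 0 s0 s0 Y])
    show "(Y has_vector_derivative 0) (at s0 within cbox 0 s0)"
      by (rule has_vector_derivative_transform[of _ _ _ "\<lambda>_. 0"]) (use s0 Y0 in auto)
    show "(Y has_vector_derivative Z s0) (at s0 within cbox 0 s0)" using dY[of s0] s0 by simp
  qed (use s0 in auto)
  then show "(\<integral>t. z t \<bullet> u0 \<partial>lebesgue_on {0<..<s0}) = 0" using Zu[of s0 u0] s0 by simp
qed

text \<open>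
  The difference \<open>e\<close> of two solutions solves a linear problem; the solution of the latter that is
  obtained by approximation satisfies the energy inequality, and coincides with \<open>e\<close>.
\<close>

theorem solution_unique:
  assumes F: "square_integrable time_measure F" and s1: "solves F v1 w1" and s2: "solves F v2 w2"
  shows "AE t in time_measure. v1 t = v2 t"
proof -
  interpret finite_measure time_measure by (rule finite_measure_interval)
  interpret Q: bounded_linear Q by (rule Q)
  interpret K: bounded_linear K by (rule K)
  have v: "square_integrable time_measure v1" "square_integrable time_measure v2"
    and wc: "continuous_on {0..T} w1" "continuous_on {0..T} w2" "w1 0 = 0" "w2 0 = 0"
    and wv: "AE t in time_measure. w1 t = Q (v1 t)" "AE t in time_measure. w2 t = Q (v2 t)"
    using s1 s2 by (auto simp: solves_def)
  define e where "e t = v1 t - v2 t" for t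
  define b where "b t = B (v1 t) - B (v2 t)" for t
  \<comment> \<open>Subtracting the two equations gives (K e)' = - b, hence (K e)' + e = G, a linear
    problem with \<open>G\<close> regarded as given.\<close>
  define G where "G t = e t - b t" for t
  have sq_e: "square_integrable time_measure e" unfolding e_def by (intro square_integrable_diff v)
  have sq_b: "square_integrable time_measure b"
    unfolding b_def by (intro square_integrable_diff square_integrable_lipschitz[OF finite_measure_axioms B_lip] v)
  have sq_G: "square_integrable time_measure G" unfolding G_def by (intro square_integrable_diff sq_e sq_b)
  \<comment> \<open>The linear problem has the identity in place of \<open>B\<close>, with both
    constants equal to 1, and shares \<open>Q\<close> and \<open>K\<close>.\<close>
  interpret lin: parabolic_problem Q K "\<lambda>x. x" 1 1 T
  proof
    show "1-lipschitz_on UNIV (\<lambda>x::'h. x)" by (rule lipschitz_onI) auto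
    show "K x \<bullet> y = Q x \<bullet> Q y" for x y by (rule K_inner)
  qed (use T in \<open>auto simp: power2_norm_eq_inner\<close>)
  obtain y w where y: "lin.solves G y w" "0 \<le> (\<integral>t. (G t - y t) \<bullet> y t \<partial>time_measure)"
    by (rule lin.solution_exists[OF sq_G]) (rule that)
  have sq_y: "square_integrable time_measure y" and w: "continuous_on {0..T} w" "w 0 = 0"
    and wy: "AE t in time_measure. w t = Q (y t)" using y(1) by (auto simp: lin.solves_def)
  have "AE t in time_measure. e t - y t = 0"
  proof (rule homogeneous_linear_unique[where w = "\<lambda>t. w1 t - w2 t - w t"])
    show "square_integrable time_measure (\<lambda>t. e t - y t)" by (intro square_integrable_diff sq_e sq_y)
    show "continuous_on {0..T} (\<lambda>t. w1 t - w2 t - w t)" by (intro continuous_intros wc w)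
    show "w1 0 - w2 0 - w 0 = 0" by (simp add: wc w)
    show "AE t in time_measure. w1 t - w2 t - w t = Q (e t - y t)"
      using wv wy by eventually_elim (simp add: e_def Q.diff)
    fix s :: real and u :: 'h assume s: "0 < s" "s < T"
    have int: "integrable (lebesgue_on {0<..<s}) (\<lambda>t. f t \<bullet> u)" if "square_integrable time_measure f" for f
      using s square_integrable_inner[OF that square_integrable_const[OF finite_measure_axioms]]
      by (intro lebesgue_on_restrict(2)[of "{0<..<s}" "{0<..<T}"]) auto
    have "(w1 s - w2 s - w s) \<bullet> Q u = (\<integral>t. (F t - B (v1 t)) \<bullet> u \<partial>lebesgue_on {0<..<s})
        - (\<integral>t. (F t - B (v2 t)) \<bullet> u \<partial>lebesgue_on {0<..<s}) - (\<integral>t. (G t - y t) \<bullet> u \<partial>lebesgue_on {0<..<s})"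
      by (simp only: inner_diff_left[of "w1 s - w2 s"] inner_diff_left[of "w1 s"]
          solves_integrated[OF F s1 s] solves_integrated[OF F s2 s] lin.solves_integrated[OF sq_G y(1) s])
    also have "\<dots> = (\<integral>t. (F t - B (v1 t)) \<bullet> u - (F t - B (v2 t)) \<bullet> u - (G t - y t) \<bullet> u \<partial>lebesgue_on {0<..<s})"
      using int[OF square_integrable_rhs[OF F s1]] int[OF square_integrable_rhs[OF F s2]]
        int[OF square_integrable_diff[OF sq_G sq_y]] by simp
    also have "\<dots> = (\<integral>t. - ((e t - y t) \<bullet> u) \<partial>lebesgue_on {0<..<s})"
      by (intro Bochner_Integration.integral_cong) (auto simp: G_def b_def algebra_simps)
    finally show "(w1 s - w2 s - w s) \<bullet> Q u = - (\<integral>t. (e t - y t) \<bullet> u \<partial>lebesgue_on {0<..<s})" by simp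
  qed
  then have ey: "AE t in time_measure. y t = e t" by eventually_elim simp
  \<comment> \<open>With \<open>y = e\<close> the energy inequality says that the integral of
    \<open>- (b t \<bullet> e t)\<close> is nonnegative, whereas monotonicity bounds it above by
    \<open>- c\<close> times the squared L2 norm of \<open>e\<close>.\<close>
  have "0 \<le> (\<integral>t. (G t - y t) \<bullet> y t \<partial>time_measure)" by (rule y(2))
  also have "\<dots> = (\<integral>t. - (b t \<bullet> e t) \<partial>time_measure)"
  proof (rule Bochner_Integration.integral_cong_AE)
    show "AE t in time_measure. (G t - y t) \<bullet> y t = - (b t \<bullet> e t)"
      using ey by eventually_elim (simp add: G_def)
  qed (use sq_G sq_y sq_b sq_e in \<open>auto simp: square_integrable_def\<close>)
  also have "\<dots> \<le> (\<integral>t. - (c * (norm (e t))\<^sup>2) \<partial>time_measure)"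
  proof (rule integral_mono)
    show "- (b t \<bullet> e t) \<le> - (c * (norm (e t))\<^sup>2)" for t
      using B_mono[of "v1 t" "v2 t"] by (simp add: b_def e_def)
  qed (use square_integrable_inner[OF sq_b sq_e] sq_e in \<open>auto simp: square_integrable_def\<close>)
  finally have "(\<integral>t. (norm (e t))\<^sup>2 \<partial>time_measure) \<le> 0" using c by (simp add: mult_le_0_iff)
  moreover have "0 \<le> (\<integral>t. (norm (e t))\<^sup>2 \<partial>time_measure)" by simp
  ultimately have "(\<integral>t. (norm (e t))\<^sup>2 \<partial>time_measure) = 0" by linarith
  then have "AE t in time_measure. (norm (e t))\<^sup>2 = 0"
    using sq_e by (subst (asm) integral_nonneg_eq_0_iff_AE) (auto simp: square_integrable_def)
  then show ?thesis by eventually_elim (simp add: e_def)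
qed

end

section \<open>Square integrable functions on a space-time cylinder\<close>

text \<open>Lebesgue measure is complete: whatever \<open>g\<close> does on the exceptional null set
  is measurable.\<close>

lemma borel_measurable_AE_lebesgue:
  fixes f g :: "'a::euclidean_space \<Rightarrow> 'b::topological_space"
  assumes f: "f \<in> borel_measurable lebesgue" and ae: "AE x in lebesgue. f x = g x"
  shows "g \<in> borel_measurable lebesgue"
proof (rule measurableI)
  obtain N where N: "N \<in> null_sets lebesgue" "{x \<in> space lebesgue. f x \<noteq> g x} \<subseteq> N"
    using ae unfolding eventually_ae_filter by auto
  fix A :: "'b set" assume "A \<in> sets borel"
  then have "f -` A \<inter> space lebesgue \<in> sets lebesgue" using f by (rule measurable_sets[rotated])
  moreover have "g -` A \<inter> N \<in> sets lebesgue"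
    by (rule negligible_imp_sets[OF negligible_subset[of N]]) (use N(1) in \<open>auto simp: negligible_iff_null_sets\<close>)
  moreover have "g -` A \<inter> space lebesgue = ((f -` A \<inter> space lebesgue) - N) \<union> (g -` A \<inter> N)"
  proof (intro set_eqI)
    show "x \<in> g -` A \<inter> space lebesgue \<longleftrightarrow> x \<in> ((f -` A \<inter> space lebesgue) - N) \<union> (g -` A \<inter> N)" for x
      using N(2) by (cases "x \<in> N"; cases "f x = g x") auto
  qed
  moreover have "N \<in> sets lebesgue" using N(1) by (rule null_setsD2)
  ultimately show "g -` A \<inter> space lebesgue \<in> sets lebesgue" by (metis sets.Diff sets.Un)
qed simp

text \<open>Open sets are countable unions of balls around points of a dense set, so the scalar
  distances decide measurability. For an L2-valued function these distances come from integrals, to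
  which Tonelli's theorem applies.\<close>

lemma borel_measurable_distI:
  fixes f :: "'a \<Rightarrow> 'b::{metric_space,second_countable_topology}"
  assumes f: "\<And>y. (\<lambda>x. dist (f x) y) \<in> borel_measurable M"
  shows "f \<in> borel_measurable M"
proof (rule borel_measurableI)
  fix S :: "'b set" assume S: "open S"
  obtain D :: "'b set" where D: "countable D" "\<And>X. open X \<Longrightarrow> X \<noteq> {} \<Longrightarrow> \<exists>d\<in>D. d \<in> X"
    by (erule countable_dense_setE)
  let ?I = "{(d, n :: nat). d \<in> D \<and> ball d (1 / Suc n) \<subseteq> S}"
  have "?I \<subseteq> D \<times> UNIV" by auto
  then have I: "countable ?I" by (rule countable_subset) (use D(1) in simp)
  have cover: "\<exists>d n. (d, n) \<in> ?I \<and> x \<in> ball d (1 / Suc n)" if x: "x \<in> S" for x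
  proof -
    obtain e where e: "e > 0" "ball x e \<subseteq> S" using S x by (meson openE)
    obtain n where n: "1 / Suc n < e / 2" using e nat_approx_posE[of "e / 2"] by auto
    have "open (ball x (1 / Suc n))" "ball x (1 / Suc n) \<noteq> {}" by auto
    from D(2)[OF this] obtain d where d: "d \<in> D" "dist x d < 1 / Suc n" by auto
    have "ball d (1 / Suc n) \<subseteq> ball x e"
    proof
      fix y assume "y \<in> ball d (1 / Suc n)"
      then show "y \<in> ball x e" using d(2) n dist_triangle[of x y d] by simp
    qed
    then show ?thesis using d e by (intro exI[of _ d] exI[of _ n]) (auto simp: dist_commute)
  qed
  have "f -` S \<inter> space M = (\<Union>(d, n)\<in>?I. {x \<in> space M. dist (f x) d < 1 / Suc n})"
  proof (intro equalityI subsetI)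
    fix x assume "x \<in> f -` S \<inter> space M"
    then show "x \<in> (\<Union>(d, n)\<in>?I. {x \<in> space M. dist (f x) d < 1 / Suc n})"
      using cover[of "f x"] by (fastforce simp: dist_commute)
  qed (auto simp: dist_commute)
  also have "\<dots> \<in> sets M"
  proof (rule sets.countable_UN'[OF I])
    have "{x \<in> space M. dist (f x) d < 1 / Suc n} \<in> sets M" for d n
      using f[of d] by measurable
    then show "(\<lambda>(d, n). {x \<in> space M. dist (f x) d < 1 / Suc n}) ` ?I \<subseteq> sets M" by auto
  qed
  finally show "f -` S \<inter> space M \<in> sets M" .
qed

lemma L2_lborel_iff:
  "f \<in> borel_measurable borel \<Longrightarrow> f \<in> L2 lebesgue \<longleftrightarrow> (\<integral>\<^sup>+x. ennreal ((f x)\<^sup>2) \<partial>lborel) < \<infinity>"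
  unfolding L2_def
  by (auto simp: integrable_iff_bounded nn_integral_completion intro: measurable_completion)

text \<open>Fubini's theorem, reading L2 of the cylinder as L2(0,T; L2(S)). Lebesgue measure on the
  product space is the completion of a product measure and not itself a product; hence the passage
  to a Borel representative \<open>g\<close> and to \<open>lborel\<close>.\<close>

lemma time_sections:
  fixes S :: "'a::euclidean_space set" and f :: "'a \<times> real \<Rightarrow> real"
  assumes S: "open S" and f: "f \<in> L2 (lebesgue_on (S \<times> {0<..<T}))"
  obtains F where "square_integrable (lebesgue_on {0<..<T}) F"
    "AE t in lebesgue_on {0<..<T}. (\<lambda>x. f (x, t)) \<in> L2 (lebesgue_on S) \<and> F t = l2_on S (\<lambda>x. f (x, t))"
proof -
  have Sm: "S \<in> sets lebesgue" and Um: "S \<times> {0<..<T} \<in> sets lebesgue"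
    using S open_Times[OF S open_greaterThanLessThan[of 0 T]] by simp_all
  let ?f1 = "\<lambda>z. indicator (S \<times> {0<..<T}) z * f z"
  have f1: "?f1 \<in> L2 lebesgue" using f by (simp add: L2_on_iff[OF Um])
  obtain g where g [measurable]: "g \<in> borel_measurable lborel" and ae: "AE z in lborel. ?f1 z = g z"
    using completion_ex_borel_measurable_real[OF L2_measurable[OF f1]] by blast
  have gb [measurable]: "g \<in> borel_measurable borel" using g by simp
  have g2 [measurable]: "g \<in> borel_measurable (borel \<Otimes>\<^sub>M borel)" using gb by (simp add: borel_prod)
  have "g \<in> L2 lebesgue"
    by (rule L2_cong_AE[OF f1 measurable_completion[OF g] AE_completion[OF ae]])
  then have fin: "(\<integral>\<^sup>+z. ennreal ((g z)\<^sup>2) \<partial>lborel) < \<infinity>" by (simp add: L2_lborel_iff)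
  define I where "I t = (\<integral>\<^sup>+x. ennreal ((g (x, t))\<^sup>2) \<partial>lborel)" for t
  have I_meas [measurable]: "I \<in> borel_measurable borel"
    unfolding I_def by measurable
  have I_int: "(\<integral>\<^sup>+t. I t \<partial>lborel) = (\<integral>\<^sup>+z. ennreal ((g z)\<^sup>2) \<partial>lborel)"
    unfolding I_def using lborel_pair.nn_integral_snd[of "\<lambda>z. ennreal ((g z)\<^sup>2)"]
    by (simp add: lborel_prod)
  have I_fin: "AE t in lborel. I t \<noteq> \<infinity>"
    by (rule nn_integral_PInf_AE) (use fin in \<open>auto simp: I_int\<close>)
  have sect: "(\<lambda>x. g (x, t)) \<in> borel_measurable borel" for t by measurable
  have sL: "(\<lambda>x. g (x, t)) \<in> L2 lebesgue" if "I t \<noteq> \<infinity>" for t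
    using that sect by (simp add: L2_lborel_iff I_def less_top)
  \<comment> \<open>At the times where the section is not square integrable, a null set,
    \<open>F\<close> is set to 0; this keeps it Borel measurable.\<close>
  define F where "F t = (if I t = \<infinity> then 0 else l2_of (\<lambda>x. g (x, t)))" for t
  have F_meas: "F \<in> borel_measurable borel"
  proof (rule borel_measurable_distI)
    fix y :: "'a l2"
    obtain y' where y' [measurable]: "y' \<in> borel_measurable lborel" and yy: "AE x in lborel. l2_fun y x = y' x"
      using completion_ex_borel_measurable_real[OF l2_fun_measurable] by blast
    have y'L: "y' \<in> L2 lebesgue" and y: "y = l2_of y'"
    proof -
      show *: "y' \<in> L2 lebesgue"
        by (rule L2_cong_AE[OF l2_fun_L2 measurable_completion[OF y'] AE_completion[OF yy]])
      have "l2_of (l2_fun y) = l2_of y'" using AE_completion[OF yy] by (subst l2_of_eq_iff) (auto simp: *)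
      then show "y = l2_of y'" by simp
    qed
    have "dist (F t) y = (if I t = \<infinity> then norm y else sqrt (enn2real (\<integral>\<^sup>+x. ennreal ((g (x, t) - y' x)\<^sup>2) \<partial>lborel)))" for t
    proof (cases "I t = \<infinity>")
      case False
      have "(norm (l2_of (\<lambda>x. g (x, t)) - l2_of y'))\<^sup>2 = (\<integral>x. (g (x, t) - y' x)\<^sup>2 \<partial>lebesgue)"
        by (simp add: norm_l2_of_sq L2_diff sL[OF False] y'L flip: l2_of_diff)
      also have "\<dots> = enn2real (\<integral>\<^sup>+x. ennreal ((g (x, t) - y' x)\<^sup>2) \<partial>lborel)"
        by (subst integral_eq_nn_integral) (auto simp: nn_integral_completion intro!: measurable_completion)
      finally have "norm (l2_of (\<lambda>x. g (x, t)) - l2_of y') = sqrt (enn2real (\<integral>\<^sup>+x. ennreal ((g (x, t) - y' x)\<^sup>2) \<partial>lborel))"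
        by (metis norm_ge_zero real_sqrt_unique)
      then show ?thesis using False by (simp add: F_def dist_norm y)
    qed (simp add: F_def)
    then show "(\<lambda>t. dist (F t) y) \<in> borel_measurable borel" by simp
  qed
  have nF: "ennreal ((norm (F t))\<^sup>2) \<le> I t" for t
  proof (cases "I t = \<infinity>")
    case False
    have "(norm (F t))\<^sup>2 = enn2real (I t)"
      using False unfolding I_def
      by (simp add: F_def I_def norm_l2_of_sq sL, subst integral_eq_nn_integral)
        (auto simp: nn_integral_completion intro!: measurable_completion)
    then show ?thesis using False by (simp add: less_top)
  qed simp
  show ?thesis
  proof (rule that)
    have "F \<in> borel_measurable lebesgue" by (rule measurable_completion) (use F_meas in simp)
    then have "F \<in> borel_measurable (lebesgue_on {0<..<T})" by (rule measurable_restrict_space1)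
    moreover have int: "integrable lebesgue (\<lambda>t. (norm (F t))\<^sup>2)"
    proof (rule integrableI_bounded)
      show "(\<lambda>t. (norm (F t))\<^sup>2) \<in> borel_measurable lebesgue"
        by (rule measurable_completion) (use F_meas in simp)
      have "(\<integral>\<^sup>+t. ennreal ((norm (F t))\<^sup>2) \<partial>lborel) \<le> (\<integral>\<^sup>+t. I t \<partial>lborel)"
        by (intro nn_integral_mono nF)
      also have "\<dots> < \<infinity>" using fin by (simp add: I_int)
      finally show "(\<integral>\<^sup>+t. ennreal (norm ((norm (F t))\<^sup>2)) \<partial>lebesgue) < \<infinity>"
        by (simp add: nn_integral_completion)
    qed
    moreover have "integrable (lebesgue_on {0<..<T}) (\<lambda>t. (norm (F t))\<^sup>2)"
      using integrable_mult_indicator[OF _ int, of "{0<..<T}"] by (simp add: integrable_restrict_space)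
    ultimately show "square_integrable (lebesgue_on {0<..<T}) F"
      by (simp add: square_integrable_def)
    show "AE t in lebesgue_on {0<..<T}. (\<lambda>x. f (x, t)) \<in> L2 (lebesgue_on S) \<and> F t = l2_on S (\<lambda>x. f (x, t))"
    proof -
      \<comment> \<open>The set where \<open>g\<close> is not the given function on the cylinder has
        null sections at almost every time. The variables are exchanged because time is the second
        one.\<close>
      obtain N where N: "N \<in> null_sets lborel" "{z \<in> space lborel. ?f1 z \<noteq> g z} \<subseteq> N"
        using ae unfolding eventually_ae_filter by auto
      have Nb: "N \<in> sets (lborel \<Otimes>\<^sub>M lborel)" using null_setsD2[OF N(1)] by (simp only: lborel_prod)
      have "AE z in lborel \<Otimes>\<^sub>M lborel. z \<notin> N" using AE_not_in[OF N(1)] by (simp only: lborel_prod)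
      then have "AE x in lborel. AE t in lborel. (x, t) \<notin> N" by (rule lborel_pair.AE_pair)
      moreover have "{z \<in> space (lborel \<Otimes>\<^sub>M lborel). (fst z, snd z) \<notin> N} \<in> sets (lborel \<Otimes>\<^sub>M lborel)"
        using sets.compl_sets[OF Nb] by (auto simp: set_diff_eq space_pair_measure)
      ultimately have "AE t in lborel. AE x in lborel. (x, t) \<notin> N"
        using lborel_pair.AE_commute[of "\<lambda>x t. (x, t) \<notin> N"] by simp
      with I_fin have "AE t in lborel. t \<in> {0<..<T} \<longrightarrow>
          (\<lambda>x. f (x, t)) \<in> L2 (lebesgue_on S) \<and> F t = l2_on S (\<lambda>x. f (x, t))"
      proof eventually_elim
        case (elim t)
        show ?case
        proof
          assume t: "t \<in> {0<..<T}"
          have "AE x in lborel. g (x, t) = indicator S x * f (x, t)"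
            using elim(2)
          proof eventually_elim
            case (elim x)
            then have "?f1 (x, t) = g (x, t)" using N(2) by auto
            then show ?case using t by (simp add: indicator_def split: if_splits)
          qed
          then have eq: "AE x in lebesgue. g (x, t) = indicator S x * f (x, t)" by (rule AE_completion)
          have L: "(\<lambda>x. indicator S x * f (x, t)) \<in> L2 lebesgue"
            by (rule L2_cong_AE[OF sL[OF elim(1)] borel_measurable_AE_lebesgue[OF L2_measurable[OF sL[OF elim(1)]] eq] eq])
          moreover have "F t = l2_of (\<lambda>x. indicator S x * f (x, t))"
            using elim(1) eq by (simp add: F_def l2_of_eq_iff[OF sL[OF elim(1)] L])
          ultimately show "(\<lambda>x. f (x, t)) \<in> L2 (lebesgue_on S) \<and> F t = l2_on S (\<lambda>x. f (x, t))"
            by (simp add: L2_on_iff[OF Sm] l2_on_def)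
        qed
      qed
      from AE_completion[OF this] show ?thesis by (subst AE_on_iff) simp_all
    qed
  qed
qed

section \<open>Superposition operators\<close>

text \<open>The Nemytskii operator of \<open>n\<close>, cut off outside \<open>S\<close>. The cutoff
  matters when \<open>n 0\<close> is not 0: on a set of finite measure the result is still square
  integrable.\<close>

definition superpose :: "'a::euclidean_space set \<Rightarrow> (real \<Rightarrow> real) \<Rightarrow> 'a l2 \<Rightarrow> 'a l2" where
  "superpose S n x = l2_on S (\<lambda>t. n (l2_fun x t))"

context
  fixes S :: "'a::euclidean_space set" and n :: "real \<Rightarrow> real" and L :: real
  assumes S: "S \<in> lmeasurable" and n: "L-lipschitz_on UNIV n"
begin

lemma superpose_L2: "f \<in> L2 (lebesgue_on S) \<Longrightarrow> (\<lambda>t. n (f t)) \<in> L2 (lebesgue_on S)"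
  using square_integrable_lipschitz[OF finite_measure_lebesgue_on[OF S] n, of f]
  by (simp add: square_integrable_real_iff)

lemma superpose_on: "f \<in> L2 (lebesgue_on S) \<Longrightarrow> superpose S n (l2_on S f) = l2_on S (\<lambda>t. n (f t))"
proof -
  assume f: "f \<in> L2 (lebesgue_on S)"
  have "AE t in lebesgue_on S. n (l2_fun (l2_on S f) t) = n (f t)"
    using l2_fun_on[OF fmeasurableD[OF S] f] by eventually_elim simp
  then show ?thesis unfolding superpose_def
    by (subst l2_on_eq_iff[OF fmeasurableD[OF S]]) (auto intro!: superpose_L2 f L2_on_l2_fun fmeasurableD[OF S])
qed

lemma superpose_diff:
  "superpose S n x - superpose S n y = l2_on S (\<lambda>t. n (l2_fun x t) - n (l2_fun y t))"
  unfolding superpose_def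
  by (subst l2_on_diff[OF fmeasurableD[OF S]]) (auto intro!: superpose_L2 L2_on_l2_fun fmeasurableD[OF S])

lemma superpose_lipschitz: "L-lipschitz_on UNIV (superpose S n)"
proof (rule lipschitz_onI)
  note Sm = fmeasurableD[OF S]
  show L0: "0 \<le> L" by (rule lipschitz_on_nonneg[OF n])
  fix x y :: "'a l2"
  have L2d: "(\<lambda>t. n (l2_fun x t) - n (l2_fun y t)) \<in> L2 (lebesgue_on S)"
    by (intro L2_diff superpose_L2 L2_on_l2_fun Sm)
  have xy: "(\<lambda>t. l2_fun x t - l2_fun y t) \<in> L2 lebesgue" by (intro L2_diff l2_fun_L2)
  have xyS: "(\<lambda>t. l2_fun x t - l2_fun y t) \<in> L2 (lebesgue_on S)" by (intro L2_diff L2_on_l2_fun Sm)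
  have "(dist (superpose S n x) (superpose S n y))\<^sup>2 = (\<integral>t. (n (l2_fun x t) - n (l2_fun y t))\<^sup>2 \<partial>lebesgue_on S)"
    by (simp add: dist_norm superpose_diff norm_l2_on_sq[OF Sm L2d])
  also have "\<dots> \<le> (\<integral>t. L\<^sup>2 * (l2_fun x t - l2_fun y t)\<^sup>2 \<partial>lebesgue_on S)"
  proof (rule integral_mono)
    show "(n a - n b)\<^sup>2 \<le> L\<^sup>2 * (a - b)\<^sup>2" for a b
      using power_mono[OF lipschitz_on_normD[OF n, of a b], of 2] by (simp add: power_mult_distrib)
  qed (use L2d xyS in \<open>auto simp: L2_def\<close>)
  also have "\<dots> = L\<^sup>2 * (\<integral>t. indicator S t *\<^sub>R (l2_fun x t - l2_fun y t)\<^sup>2 \<partial>lebesgue)"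
    using Sm by (simp add: integral_restrict_space)
  also have "\<dots> \<le> L\<^sup>2 * (\<integral>t. (l2_fun x t - l2_fun y t)\<^sup>2 \<partial>lebesgue)"
    using xy Sm by (intro mult_left_mono integral_mono integrable_mult_indicator) (auto simp: L2_def indicator_def)
  also have "\<dots> = (L * dist x y)\<^sup>2"
    using norm_l2_of_sq[OF xy] by (simp add: power_mult_distrib dist_norm l2_of_diff)
  finally show "dist (superpose S n x) (superpose S n y) \<le> L * dist x y"
    by (rule power2_le_imp_le) (use L0 in auto)
qed

text \<open>Stated for vectors of the form \<open>l2_on S f\<close>: the operator does not see its
  argument outside \<open>S\<close>, so for general vectors it cannot control the full norm.\<close>

lemma superpose_strongly_monotone:
  assumes mono: "\<And>a b. c * (a - b)\<^sup>2 \<le> (n a - n b) * (a - b)"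
    and f: "f \<in> L2 (lebesgue_on S)" and g: "g \<in> L2 (lebesgue_on S)"
  shows "c * (norm (l2_on S f - l2_on S g))\<^sup>2
    \<le> (superpose S n (l2_on S f) - superpose S n (l2_on S g)) \<bullet> (l2_on S f - l2_on S g)"
proof -
  note Sm = fmeasurableD[OF S]
  have fg: "(\<lambda>t. f t - g t) \<in> L2 (lebesgue_on S)" by (intro L2_diff f g)
  have nfg: "(\<lambda>t. n (f t) - n (g t)) \<in> L2 (lebesgue_on S)" by (intro L2_diff superpose_L2 f g)
  have "c * (norm (l2_on S f - l2_on S g))\<^sup>2 = (\<integral>t. c * (f t - g t)\<^sup>2 \<partial>lebesgue_on S)"
    by (simp add: norm_l2_on_sq[OF Sm fg] flip: l2_on_diff[OF Sm f g])
  also have "\<dots> \<le> (\<integral>t. (n (f t) - n (g t)) * (f t - g t) \<partial>lebesgue_on S)"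
    by (rule integral_mono) (use L2_integrable[OF nfg fg] fg mono in \<open>auto simp: L2_def\<close>)
  also have "\<dots> = l2_on S (\<lambda>t. n (f t) - n (g t)) \<bullet> l2_on S (\<lambda>t. f t - g t)"
    by (rule inner_l2_on[OF Sm nfg fg, symmetric])
  also have "\<dots> = (superpose S n (l2_on S f) - superpose S n (l2_on S g)) \<bullet> (l2_on S f - l2_on S g)"
    by (simp only: superpose_on[OF f] superpose_on[OF g] l2_on_diff[OF Sm superpose_L2[OF f] superpose_L2[OF g]] l2_on_diff[OF Sm f g])
  finally show ?thesis .
qed

end

section \<open>Traces on horizontal segments\<close>

lemma Ck_1_vertical_derivative:
  fixes w :: "point \<Rightarrow> real"
  assumes "Ck 1 w"
  shows "((\<lambda>y. w (s, y)) has_real_derivative partial (0, 1) w (s, y)) (at y)"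
proof -
  have "w differentiable (at (s, y))" using assms by simp
  then have D: "(w has_derivative frechet_derivative w (at (s, y))) (at (s, y))"
    by (simp add: frechet_derivative_works)
  have "((\<lambda>y. (s, y)) has_derivative (\<lambda>h. (0, h))) (at y)"
    by (auto intro!: derivative_eq_intros)
  from diff_chain_at[OF this D]
  have "((\<lambda>y. w (s, y)) has_derivative (\<lambda>h. frechet_derivative w (at (s, y)) (0, h))) (at y)"
    by (simp add: o_def)
  moreover have "frechet_derivative w (at (s, y)) (0, h) = partial (0, 1) w (s, y) * h" for h
  proof -
    have "(0, h) = h *\<^sub>R (0 :: real, 1 :: real)" by simp
    then show ?thesis
      using linear_cmul[OF has_derivative_linear[OF D], of h "(0, 1)"] by (simp add: partial_def mult.commute)
  qed
  ultimately show ?thesis by (simp add: has_field_derivative_def)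
qed

lemma point_Basis: "(Basis :: point set) = {(1, 0), (0, 1)}"
  by (auto simp: Basis_prod_def)

lemma Ck_1_continuous:
  fixes w :: "point \<Rightarrow> real"
  assumes "Ck 1 w"
  shows "continuous_on UNIV w" "continuous_on UNIV (partial (0, 1) w)"
  using assms Ck_continuous[OF assms] by (simp_all add: point_Basis)

lemma vertical_continuous:
  fixes w :: "point \<Rightarrow> real"
  assumes "continuous_on UNIV w"
  shows "continuous_on I (\<lambda>y. w (s, y))" "continuous_on I (\<lambda>s. w (s, y))"
  by (rule continuous_on_compose2[OF assms]; auto intro!: continuous_intros)+

text \<open>On a vertical segment the values at \<open>c\<close> and at any other height differ by
  at most the integral \<open>J\<close> of the absolute derivative. Cauchy-Schwarz for
  \<open>J\<close> and averaging over the height give the bound, also if \<open>c\<close> is an end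
  of the interval.\<close>

lemma trace_bound_pointwise:
  fixes w :: "point \<Rightarrow> real"
  assumes w: "Ck 1 w" and c: "c \<in> {lo..hi}" and d: "lo < hi"
  shows "(hi - lo) * (w (s, c))\<^sup>2 \<le> 2 * integral {lo..hi} (\<lambda>y. (w (s, y))\<^sup>2)
    + 2 * (hi - lo)\<^sup>2 * integral {lo..hi} (\<lambda>y. (partial (0, 1) w (s, y))\<^sup>2)"
proof -
  let ?D = "\<lambda>y. partial (0, 1) w (s, y)" and ?M = "lebesgue_on {lo<..<hi}"
  note cont = Ck_1_continuous[OF w]
  have Dc: "continuous_on I ?D" and wc: "continuous_on I (\<lambda>y. w (s, y))" for I
    using cont by (auto intro: vertical_continuous)
  interpret finite_measure ?M by (rule finite_measure_interval)
  define J where "J = integral {lo..hi} (\<lambda>y. \<bar>?D y\<bar>)"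
  define E where "E = integral {lo..hi} (\<lambda>y. (?D y)\<^sup>2)"
  have osc: "\<bar>w (s, y) - w (s, z)\<bar> \<le> J" if yz: "z \<le> y" "z \<in> {lo..hi}" "y \<in> {lo..hi}" for y z
  proof -
    have "(?D has_integral w (s, y) - w (s, z)) {z..y}"
    proof (rule fundamental_theorem_of_calculus[OF yz(1)])
      show "((\<lambda>y. w (s, y)) has_vector_derivative ?D x) (at x within {z..y})" for x
        using Ck_1_vertical_derivative[OF w, of s x]
        by (simp add: has_real_derivative_iff_has_vector_derivative has_vector_derivative_at_within)
    qed
    then have "w (s, y) - w (s, z) = integral {z..y} ?D" by (simp add: integral_unique)
    also have "norm \<dots> \<le> integral {z..y} (\<lambda>y. \<bar>?D y\<bar>)"
      by (intro integral_norm_bound_integral integrable_continuous_interval continuous_intros Dc) auto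
    also have "\<dots> \<le> J" unfolding J_def
      using yz by (intro integral_subset_le integrable_continuous_interval continuous_intros Dc) auto
    finally show ?thesis by simp
  qed
  have osc: "\<bar>w (s, c) - w (s, y)\<bar> \<le> J" if "y \<in> {lo..hi}" for y
    using osc[of y c] osc[of c y] that c by (cases "y \<le> c") (auto simp: abs_minus_commute)
  have J2: "J\<^sup>2 \<le> (hi - lo) * E"
  proof -
    have absc: "continuous_on {lo..hi} (\<lambda>y. \<bar>?D y\<bar>)" by (intro continuous_intros Dc)
    have "\<bar>\<integral>y. \<bar>?D y\<bar> \<bullet> 1 \<partial>?M\<bar> \<le> sqrt (\<integral>y. (norm \<bar>?D y\<bar>)\<^sup>2 \<partial>?M) * sqrt (\<integral>y. (norm (1::real))\<^sup>2 \<partial>?M)"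
      by (intro square_integrable_Cauchy_Schwarz square_integrable_continuous square_integrable_const finite_measure_axioms absc)
    moreover have "(\<integral>y. \<bar>?D y\<bar> \<bullet> 1 \<partial>?M) = J"
      using integral_open_interval_continuous(2)[OF absc] by (simp add: J_def)
    moreover have "(\<integral>y. (norm \<bar>?D y\<bar>)\<^sup>2 \<partial>?M) = E"
      using integral_open_interval_continuous(2)[of lo hi "\<lambda>y. (?D y)\<^sup>2"] by (simp add: E_def continuous_intros Dc)
    moreover have "(\<integral>y. (norm (1::real))\<^sup>2 \<partial>?M) = hi - lo"
      using d by (simp add: measure_restrict_space)
    ultimately have "J \<le> sqrt E * sqrt (hi - lo)" by simp
    moreover have "0 \<le> J"
      unfolding J_def by (intro integral_nonneg integrable_continuous_interval absc) auto
    ultimately have "J\<^sup>2 \<le> (sqrt E * sqrt (hi - lo))\<^sup>2" by (intro power_mono)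
    moreover have "E \<ge> 0" unfolding E_def by (intro integral_nonneg integrable_continuous_interval continuous_intros Dc) auto
    ultimately show ?thesis using d by (simp add: power_mult_distrib mult.commute)
  qed
  have "(w (s, c))\<^sup>2 \<le> 2 * (w (s, y))\<^sup>2 + 2 * ((hi - lo) * E)" if "y \<in> {lo..hi}" for y
  proof -
    have "(w (s, c))\<^sup>2 \<le> 2 * (w (s, y))\<^sup>2 + 2 * (w (s, c) - w (s, y))\<^sup>2"
      using norm_add_sq_le[of "w (s, y)" "w (s, c) - w (s, y)"] by simp
    also have "(w (s, c) - w (s, y))\<^sup>2 \<le> J\<^sup>2"
      using power_mono[OF osc[OF that], of 2] by simp
    finally show ?thesis using J2 by linarith
  qed
  then have "integral {lo..hi} (\<lambda>y. (w (s, c))\<^sup>2) \<le> integral {lo..hi} (\<lambda>y. 2 * (w (s, y))\<^sup>2 + 2 * ((hi - lo) * E))"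
    by (intro integral_le integrable_continuous_interval continuous_intros wc) auto
  also have "\<dots> = integral {lo..hi} (\<lambda>y. 2 * (w (s, y))\<^sup>2) + integral {lo..hi} (\<lambda>y. 2 * ((hi - lo) * E))"
    by (intro integral_add integrable_continuous_interval continuous_intros wc)
  finally show ?thesis using d by (simp add: E_def power2_eq_square algebra_simps)
qed

text \<open>Integrates \<open>trace_bound_pointwise\<close> over the strip by Tonelli. Only the
  vertical derivative enters, so the estimate serves the layers, where H contains no other
  derivative, as well as \<Omega>.\<close>

lemma trace_bound:
  fixes w :: "point \<Rightarrow> real"
  assumes w: "Ck 1 w" and c: "c \<in> {lo..hi}" and d: "lo < hi"
    and R: "{0<..<a} \<times> {lo<..<hi} \<subseteq> U" and U: "U \<in> sets lebesgue"
    and L2: "w \<in> L2 (lebesgue_on U)" "partial (0, 1) w \<in> L2 (lebesgue_on U)"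
  shows "(\<lambda>s. w (s, c)) \<in> L2 (lebesgue_on {0<..<a})"
    and "(norm (l2_on {0<..<a} (\<lambda>s. w (s, c))))\<^sup>2
      \<le> 2 / (hi - lo) * (norm (l2_on U w))\<^sup>2 + 2 * (hi - lo) * (norm (l2_on U (partial (0, 1) w)))\<^sup>2"
proof -
  note cont = Ck_1_continuous[OF w]
  have bm [measurable]: "w \<in> borel_measurable borel" "partial (0, 1) w \<in> borel_measurable borel"
    by (intro borel_measurable_continuous_onI cont)+
  show tr: "(\<lambda>s. w (s, c)) \<in> L2 (lebesgue_on {0<..<a})"
    using square_integrable_continuous[OF vertical_continuous(2)[OF cont(1)]] by (simp add: square_integrable_real_iff)
  have slab: "(\<integral>\<^sup>+s. indicator {0<..<a} s * (\<integral>\<^sup>+y. indicator {lo<..<hi} y * ennreal ((f (s, y))\<^sup>2) \<partial>lborel) \<partial>lborel)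
      \<le> ennreal ((norm (l2_on U f))\<^sup>2)"
    if f [measurable]: "f \<in> borel_measurable borel" and fL: "f \<in> L2 (lebesgue_on U)" for f :: "point \<Rightarrow> real"
  proof -
    have [measurable]: "f \<in> borel_measurable (borel \<Otimes>\<^sub>M borel)" using f by (simp add: borel_prod)
    let ?h = "\<lambda>z. indicator ({0<..<a} \<times> {lo<..<hi}) z * ennreal ((f z)\<^sup>2)"
    have "(\<integral>\<^sup>+s. indicator {0<..<a} s * (\<integral>\<^sup>+y. indicator {lo<..<hi} y * ennreal ((f (s, y))\<^sup>2) \<partial>lborel) \<partial>lborel)
        = (\<integral>\<^sup>+s. (\<integral>\<^sup>+y. ?h (s, y) \<partial>lborel) \<partial>lborel)"
      by (intro nn_integral_cong) (auto simp: indicator_times indicator_def)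
    also have "\<dots> = (\<integral>\<^sup>+z. ?h z \<partial>(lborel \<Otimes>\<^sub>M lborel))"
      by (rule lborel.nn_integral_fst) measurable
    also have "\<dots> = (\<integral>\<^sup>+z. ?h z \<partial>lebesgue)"
      by (simp add: lborel_prod nn_integral_completion)
    also have "\<dots> \<le> (\<integral>\<^sup>+z. ennreal ((indicator U z * f z)\<^sup>2) \<partial>lebesgue)"
      using R by (intro nn_integral_mono) (auto simp: indicator_def)
    also have "\<dots> = ennreal (\<integral>z. (indicator U z * f z)\<^sup>2 \<partial>lebesgue)"
      using fL unfolding L2_on_iff[OF U] by (intro nn_integral_eq_integral) (auto simp: L2_def)
    also have "\<dots> = ennreal ((norm (l2_on U f))\<^sup>2)"
      unfolding l2_on_def using fL by (simp add: norm_l2_of_sq L2_on_iff[OF U])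
    finally show ?thesis .
  qed
  have line: "(\<integral>\<^sup>+y. indicator {lo<..<hi} y * ennreal ((f (s, y))\<^sup>2) \<partial>lborel) = ennreal (integral {lo..hi} (\<lambda>y. (f (s, y))\<^sup>2))"
    if f: "continuous_on UNIV f" for f :: "point \<Rightarrow> real" and s
  proof -
    have c: "continuous_on {lo..hi} (\<lambda>y. (f (s, y))\<^sup>2)" by (intro continuous_intros vertical_continuous f)
    have [measurable]: "(\<lambda>y. (f (s, y))\<^sup>2) \<in> borel_measurable borel"
      by (intro borel_measurable_continuous_onI continuous_intros vertical_continuous f)
    have "(\<integral>\<^sup>+y. indicator {lo<..<hi} y * ennreal ((f (s, y))\<^sup>2) \<partial>lborel)
        = (\<integral>\<^sup>+y. ennreal (indicator {lo<..<hi} y * (f (s, y))\<^sup>2) \<partial>lborel)"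
      by (intro nn_integral_cong) (auto simp: indicator_def)
    also have "\<dots> = ennreal (integral {lo..hi} (\<lambda>y. (f (s, y))\<^sup>2))"
    proof (rule nn_integral_has_integral_lborel)
      have "((\<lambda>y. (f (s, y))\<^sup>2) has_integral integral {lo..hi} (\<lambda>y. (f (s, y))\<^sup>2)) {lo<..<hi}"
        using integrable_integral[OF integrable_continuous_interval[OF c]]
        by (simp add: has_integral_Icc_iff_Ioo)
      moreover have "(\<lambda>y. indicator {lo<..<hi} y * (f (s, y))\<^sup>2) = (\<lambda>y. if y \<in> {lo<..<hi} then (f (s, y))\<^sup>2 else 0)"
        by (auto simp: fun_eq_iff indicator_def)
      ultimately show "((\<lambda>y. indicator {lo<..<hi} y * (f (s, y))\<^sup>2) has_integral integral {lo..hi} (\<lambda>y. (f (s, y))\<^sup>2)) UNIV"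
        by (simp only: has_integral_restrict_UNIV)
    qed auto
    finally show ?thesis .
  qed
  have E0: "0 \<le> integral {lo..hi} (\<lambda>y. (f (s, y))\<^sup>2)" if f: "continuous_on UNIV f" for f :: "point \<Rightarrow> real" and s
    by (intro integral_nonneg integrable_continuous_interval continuous_intros vertical_continuous f) auto
  let ?A = "\<lambda>s. \<integral>\<^sup>+y. indicator {lo<..<hi} y * ennreal ((w (s, y))\<^sup>2) \<partial>lborel"
  let ?B = "\<lambda>s. \<integral>\<^sup>+y. indicator {lo<..<hi} y * ennreal ((partial (0, 1) w (s, y))\<^sup>2) \<partial>lborel"
  let ?k = "2 / (hi - lo)" and ?m = "2 * (hi - lo)"
  have AB [measurable]: "?A \<in> borel_measurable borel" "?B \<in> borel_measurable borel"
  proof -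
    have [measurable]: "w \<in> borel_measurable (borel \<Otimes>\<^sub>M borel)" "partial (0, 1) w \<in> borel_measurable (borel \<Otimes>\<^sub>M borel)"
      using bm by (simp_all add: borel_prod)
    show "?A \<in> borel_measurable borel" "?B \<in> borel_measurable borel" by measurable
  qed
  have ennreal_comb: "ennreal (p * x + q * y) = ennreal p * ennreal x + ennreal q * ennreal y"
    if "0 \<le> p" "0 \<le> q" "0 \<le> x" "0 \<le> y" for p q x y :: real
    using that by (simp add: ennreal_mult ennreal_plus)
  have pt: "ennreal ((w (s, c))\<^sup>2) \<le> ennreal ?k * ?A s + ennreal ?m * ?B s" for s
  proof -
    have "(w (s, c))\<^sup>2 \<le> ?k * integral {lo..hi} (\<lambda>y. (w (s, y))\<^sup>2) + ?m * integral {lo..hi} (\<lambda>y. (partial (0, 1) w (s, y))\<^sup>2)"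
      using trace_bound_pointwise[OF w c d, of s] d
      by (simp add: field_simps power2_eq_square)
    then have "ennreal ((w (s, c))\<^sup>2) \<le> ennreal (?k * integral {lo..hi} (\<lambda>y. (w (s, y))\<^sup>2) + ?m * integral {lo..hi} (\<lambda>y. (partial (0, 1) w (s, y))\<^sup>2))"
      by (rule ennreal_leI)
    also have "\<dots> = ennreal ?k * ?A s + ennreal ?m * ?B s"
      unfolding line[OF cont(1)] line[OF cont(2)]
      by (rule ennreal_comb) (use d E0[OF cont(1), of s] E0[OF cont(2), of s] in auto)
    finally show ?thesis .
  qed
  have "ennreal ((norm (l2_on {0<..<a} (\<lambda>s. w (s, c))))\<^sup>2) = (\<integral>\<^sup>+s. ennreal ((indicator {0<..<a} s * w (s, c))\<^sup>2) \<partial>lebesgue)"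
  proof -
    have "(\<lambda>s. indicator {0<..<a} s * w (s, c)) \<in> L2 lebesgue" using tr by (subst L2_on_iff[symmetric]) auto
    then show ?thesis unfolding l2_on_def
      by (subst nn_integral_eq_integral) (auto simp: norm_l2_of_sq L2_def)
  qed
  also have "\<dots> \<le> (\<integral>\<^sup>+s. ennreal ?k * (indicator {0<..<a} s * ?A s) + ennreal ?m * (indicator {0<..<a} s * ?B s) \<partial>lebesgue)"
    using pt by (intro nn_integral_mono) (auto simp: indicator_def)
  also have "\<dots> = ennreal ?k * (\<integral>\<^sup>+s. indicator {0<..<a} s * ?A s \<partial>lborel) + ennreal ?m * (\<integral>\<^sup>+s. indicator {0<..<a} s * ?B s \<partial>lborel)"
    by (simp add: nn_integral_completion nn_integral_add nn_integral_cmult)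
  also have "\<dots> \<le> ennreal ?k * ennreal ((norm (l2_on U w))\<^sup>2) + ennreal ?m * ennreal ((norm (l2_on U (partial (0, 1) w)))\<^sup>2)"
    by (intro add_mono mult_left_mono slab bm L2) auto
  also have "\<dots> = ennreal (?k * (norm (l2_on U w))\<^sup>2 + ?m * (norm (l2_on U (partial (0, 1) w)))\<^sup>2)"
    by (rule ennreal_comb[symmetric]) (use d in auto)
  finally show "(norm (l2_on {0<..<a} (\<lambda>s. w (s, c))))\<^sup>2
      \<le> ?k * (norm (l2_on U w))\<^sup>2 + ?m * (norm (l2_on U (partial (0, 1) w)))\<^sup>2"
    using d by (subst (asm) ennreal_le_iff) auto
qed

section \<open>Weak derivatives\<close>

text \<open>Written with inner products, the condition is continuous in the vectors of
  \<open>f\<close> and \<open>g\<close>; this makes weak differentiability a closed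
  condition.\<close>

lemma weak_derivative_iff:
  assumes U: "open U" and b: "b \<in> Basis" and f: "f \<in> L2 (lebesgue_on U)" and g: "g \<in> L2 (lebesgue_on U)"
  shows "weak_derivative U b f g \<longleftrightarrow> (\<forall>\<phi>. test_function U \<phi> \<longrightarrow>
    l2_on U f \<bullet> l2_on U (partial b \<phi>) = - (l2_on U g \<bullet> l2_on U \<phi>))"
proof -
  have Um: "U \<in> sets lebesgue" using U by simp
  show ?thesis unfolding weak_derivative_def
  proof (intro all_cong1 imp_cong refl)
    fix \<phi> assume t: "test_function U \<phi>"
    show "(\<integral>x. f x * partial b \<phi> x \<partial>lebesgue_on U) = - (\<integral>x. g x * \<phi> x \<partial>lebesgue_on U) \<longleftrightarrow>
        l2_on U f \<bullet> l2_on U (partial b \<phi>) = - (l2_on U g \<bullet> l2_on U \<phi>)"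
      by (simp only: inner_l2_on[OF Um f test_function_L2(2)[OF t Um b]] inner_l2_on[OF Um g test_function_L2(1)[OF t Um]])
  qed
qed

text \<open>Makes the arbitrary choice in \<open>weak_partial\<close> harmless: all candidates give
  the same \<open>l2\<close> vector.\<close>

lemma weak_derivative_unique:
  assumes U: "open U" and g: "g1 \<in> L2 (lebesgue_on U)" "g2 \<in> L2 (lebesgue_on U)"
    and wd: "weak_derivative U b f g1" "weak_derivative U b f g2"
  shows "l2_on U g1 = l2_on U g2"
proof -
  have Um: "U \<in> sets lebesgue" using U by simp
  have "AE x in lebesgue_on U. g1 x - g2 x = 0"
  proof (rule fundamental_lemma[OF U L2_diff[OF g]])
    fix n c d assume "cbox c d \<subseteq> U"
    then have t: "test_function U (box_bump n c d)" by (rule test_function_box_bump)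
    note i = L2_integrable[OF _ test_function_L2(1)[OF t Um]]
    have "(\<integral>x. (g1 x - g2 x) * box_bump n c d x \<partial>lebesgue_on U)
        = (\<integral>x. g1 x * box_bump n c d x \<partial>lebesgue_on U) - (\<integral>x. g2 x * box_bump n c d x \<partial>lebesgue_on U)"
      using i[OF g(1)] i[OF g(2)] by (simp add: left_diff_distrib)
    also have "\<dots> = 0" using wd t by (auto simp: weak_derivative_def)
    finally show "(\<integral>x. (g1 x - g2 x) * box_bump n c d x \<partial>lebesgue_on U) = 0" .
  qed
  then have "AE x in lebesgue_on U. g1 x = g2 x" by eventually_elim simp
  then show ?thesis using g by (simp add: l2_on_eq_iff[OF Um])
qed

lemma weak_partial:
  assumes "f \<in> sobolev U B" "b \<in> B"
  shows "weak_partial U b f \<in> L2 (lebesgue_on U)" "weak_derivative U b f (weak_partial U b f)"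
proof -
  have "\<exists>g. g \<in> L2 (lebesgue_on U) \<and> weak_derivative U b f g" using assms by (auto simp: sobolev_def)
  from someI_ex[OF this] show "weak_partial U b f \<in> L2 (lebesgue_on U)" "weak_derivative U b f (weak_partial U b f)"
    by (auto simp: weak_partial_def)
qed

lemma weak_derivative_lincomb:
  assumes U: "open U" and b: "b \<in> Basis" and f: "f1 \<in> L2 (lebesgue_on U)" "f2 \<in> L2 (lebesgue_on U)"
    and g: "g1 \<in> L2 (lebesgue_on U)" "g2 \<in> L2 (lebesgue_on U)"
    and wd: "weak_derivative U b f1 g1" "weak_derivative U b f2 g2"
  shows "weak_derivative U b (\<lambda>x. p * f1 x + q * f2 x) (\<lambda>x. p * g1 x + q * g2 x)"
proof -
  have Um: "U \<in> sets lebesgue" using U by simp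
  have lin: "l2_on U (\<lambda>x. p * u x + q * v x) = p *\<^sub>R l2_on U u + q *\<^sub>R l2_on U v"
    if "u \<in> L2 (lebesgue_on U)" "v \<in> L2 (lebesgue_on U)" for u v
    using that by (simp add: l2_on_add[OF Um] l2_on_scaleR[OF Um] L2_mult)
  show ?thesis
    using wd by (simp add: weak_derivative_iff[OF U b] f g L2_add L2_mult lin inner_add_left)
qed

section \<open>The encoding of multi-sheeted functions\<close>

definition sheets :: "sheet set" where
  "sheets = insert Upper {Branch i m |i m. i \<le> 2 \<and> m \<in> branches i}"

definition dirs :: "sheet \<Rightarrow> point set" where
  "dirs s = (case s of Upper \<Rightarrow> Basis | Branch i m \<Rightarrow> {(0, 1)})"

lemma sheets_eq: "sheets = insert Upper ((\<lambda>(i, m). Branch i m) ` (SIGMA i:{..2}. branches i))"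
  by (auto simp: sheets_def)

lemma finite_branches: "finite (branches i)" by (simp add: branches_def)

lemma finite_sheets: "finite sheets"
  unfolding sheets_eq using finite_branches by (intro finite.insertI finite_imageI finite_SigmaI) auto

lemma sum_sheets: "(\<Sum>s\<in>sheets. f s) = f Upper + (\<Sum>i\<le>2. \<Sum>m\<in>branches i. f (Branch i m))"
proof -
  have "(\<Sum>s\<in>sheets. f s) = f Upper + (\<Sum>s\<in>(\<lambda>(i, m). Branch i m) ` (SIGMA i:{..2}. branches i). f s)"
    unfolding sheets_eq using finite_branches by (subst sum.insert) (auto intro!: finite_imageI finite_SigmaI)
  also have "(\<Sum>s\<in>(\<lambda>(i, m). Branch i m) ` (SIGMA i:{..2}. branches i). f s) = (\<Sum>(i, m)\<in>(SIGMA i:{..2}. branches i). f (Branch i m))"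
    by (subst sum.reindex) (auto simp: inj_on_def intro!: sum.cong)
  also have "\<dots> = (\<Sum>i\<le>2. \<Sum>m\<in>branches i. f (Branch i m))"
    using finite_branches by (subst sum.Sigma) auto
  finally show ?thesis .
qed

lemma ball_sheets: "(\<forall>s\<in>sheets. P s) \<longleftrightarrow> P Upper \<and> (\<forall>i\<le>2. \<forall>m\<in>branches i. P (Branch i m))"
  by (auto simp: sheets_def)

lemma dirs_Basis: "dirs s \<subseteq> Basis" "finite (dirs s)" "(0, 1) \<in> dirs s"
  by (cases s; auto simp: dirs_def point_Basis)+

text \<open>
  The index \<open>(s, None)\<close> stands for the function on the sheet \<open>s\<close>, the index \<open>(s, Some b)\<close> for its
  derivative in the direction \<open>b\<close>.
\<close>

typedef component = "SIGMA s:sheets. insert None (Some ` dirs s)"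
  by (rule exI[of _ "(Upper, None)"]) (simp add: sheets_def)

instance component :: finite
proof
  have "(UNIV :: component set) = Abs_component ` (SIGMA s:sheets. insert None (Some ` dirs s))"
    by (rule type_definition.Abs_image[OF type_definition_component, symmetric])
  moreover have "finite (Abs_component ` (SIGMA s:sheets. insert None (Some ` dirs s)))"
    by (intro finite_imageI finite_SigmaI finite.insertI finite_sheets dirs_Basis)
  ultimately show "finite (UNIV :: component set)" by (simp only:)
qed

text \<open>A finite power of a Hilbert space is again a Hilbert space; this is the single space in
  which the abstract problem is posed.\<close>

type_synonym state = "(point l2, component) vec"

definition state :: "(sheet \<Rightarrow> point option \<Rightarrow> point l2) \<Rightarrow> state" where
  "state f = (\<chi> j. f (fst (Rep_component j)) (snd (Rep_component j)))"

definition coord :: "state \<Rightarrow> sheet \<Rightarrow> point option \<Rightarrow> point l2" where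
  "coord e s d = e $ Abs_component (s, d)"

lemma coord_state:
  "s \<in> sheets \<Longrightarrow> d \<in> insert None (Some ` dirs s) \<Longrightarrow> coord (state f) s d = f s d"
  by (simp add: coord_def state_def Abs_component_inverse)

lemma coord_state_simps [simp]:
  "s \<in> sheets \<Longrightarrow> coord (state f) s None = f s None"
  "s \<in> sheets \<Longrightarrow> b \<in> dirs s \<Longrightarrow> coord (state f) s (Some b) = f s (Some b)"
  by (simp_all add: coord_state)

lemma state_coord: "state (coord e) = e"
  by (simp add: state_def coord_def vec_eq_iff Rep_component_inverse)

lemma Rep_component_cases:
  obtains s where "s \<in> sheets" "Rep_component j = (s, None)"
  | s b where "s \<in> sheets" "b \<in> dirs s" "Rep_component j = (s, Some b)"
proof -
  obtain s d where sd: "Rep_component j = (s, d)" by (rule prod.exhaust)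
  then have "s \<in> sheets" "d = None \<or> (\<exists>b\<in>dirs s. d = Some b)"
    using Rep_component[of j] by auto
  then show ?thesis using sd that by blast
qed

lemma state_cong:
  assumes "\<And>s. s \<in> sheets \<Longrightarrow> f s None = g s None"
    and "\<And>s b. s \<in> sheets \<Longrightarrow> b \<in> dirs s \<Longrightarrow> f s (Some b) = g s (Some b)"
  shows "state f = state g"
proof -
  have "f (fst (Rep_component j)) (snd (Rep_component j)) = g (fst (Rep_component j)) (snd (Rep_component j))" for j
    by (rule Rep_component_cases[of j]) (simp_all add: assms)
  then show ?thesis by (simp add: state_def vec_eq_iff)
qed

lemma state_eqI:
  assumes "\<And>s. s \<in> sheets \<Longrightarrow> coord x s None = coord y s None"
    and "\<And>s b. s \<in> sheets \<Longrightarrow> b \<in> dirs s \<Longrightarrow> coord x s (Some b) = coord y s (Some b)"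
  shows "x = y"
  using state_cong[of "coord x" "coord y"] assms by (simp add: state_coord)

lemma state_linear:
  "state f + state g = state (\<lambda>s d. f s d + g s d)" "r *\<^sub>R state f = state (\<lambda>s d. r *\<^sub>R f s d)"
  "state f - state g = state (\<lambda>s d. f s d - g s d)"
  by (simp_all add: state_def vec_eq_iff)

lemma coord_linear [simp]:
  "coord (x + y) s d = coord x s d + coord y s d" "coord (r *\<^sub>R x) s d = r *\<^sub>R coord x s d"
  "coord (x - y) s d = coord x s d - coord y s d" "coord 0 s d = 0"
  by (simp_all add: coord_def)

lemma bounded_linear_coord: "bounded_linear (\<lambda>x. coord x s d)"
  unfolding coord_def by (rule bounded_linear_vec_nth)

lemma norm_coord_le: "norm (coord x s d) \<le> norm x"
  unfolding coord_def by (rule Finite_Cartesian_Product.norm_nth_le)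

lemma inner_state:
  "x \<bullet> y = (\<Sum>s\<in>sheets. coord x s None \<bullet> coord y s None + (\<Sum>b\<in>dirs s. coord x s (Some b) \<bullet> coord y s (Some b)))"
proof -
  let ?I = "SIGMA s:sheets. insert None (Some ` dirs s)"
  have "x \<bullet> y = (\<Sum>j\<in>UNIV. x $ j \<bullet> y $ j)" by (rule inner_vec_def)
  also have "\<dots> = (\<Sum>z\<in>?I. x $ Abs_component z \<bullet> y $ Abs_component z)"
  proof -
    have im: "(UNIV :: component set) = Abs_component ` ?I"
      by (rule type_definition.Abs_image[OF type_definition_component, symmetric])
    show ?thesis unfolding im
      by (subst sum.reindex) (auto simp: inj_on_def Abs_component_inject)
  qed
  also have "\<dots> = (\<Sum>(s, d)\<in>?I. coord x s d \<bullet> coord y s d)" by (auto simp: coord_def intro!: sum.cong)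
  also have "\<dots> = (\<Sum>s\<in>sheets. \<Sum>d\<in>insert None (Some ` dirs s). coord x s d \<bullet> coord y s d)"
    using finite_sheets dirs_Basis(2) by (subst sum.Sigma) auto
  also have "\<dots> = (\<Sum>s\<in>sheets. coord x s None \<bullet> coord y s None + (\<Sum>b\<in>dirs s. coord x s (Some b) \<bullet> coord y s (Some b)))"
  proof (intro sum.cong refl)
    fix s
    have "(\<Sum>d\<in>insert None (Some ` dirs s). coord x s d \<bullet> coord y s d)
        = coord x s None \<bullet> coord y s None + (\<Sum>d\<in>Some ` dirs s. coord x s d \<bullet> coord y s d)"
      using dirs_Basis(2)[of s] by (subst sum.insert) auto
    then show "(\<Sum>d\<in>insert None (Some ` dirs s). coord x s d \<bullet> coord y s d)
        = coord x s None \<bullet> coord y s None + (\<Sum>b\<in>dirs s. coord x s (Some b) \<bullet> coord y s (Some b))"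
      by (subst (asm) sum.reindex) (auto simp: o_def)
  qed
  finally show ?thesis .
qed

lemma state_tendstoI:
  assumes "\<And>s. s \<in> sheets \<Longrightarrow> ((\<lambda>n. coord (x n) s None) \<longlongrightarrow> coord y s None) F"
    and "\<And>s b. s \<in> sheets \<Longrightarrow> b \<in> dirs s \<Longrightarrow> ((\<lambda>n. coord (x n) s (Some b)) \<longlongrightarrow> coord y s (Some b)) F"
  shows "(x \<longlongrightarrow> y) F"
proof (rule vec_tendstoI)
  fix j :: component
  have "((\<lambda>n. coord (x n) (fst (Rep_component j)) (snd (Rep_component j)))
      \<longlongrightarrow> coord y (fst (Rep_component j)) (snd (Rep_component j))) F"
    by (rule Rep_component_cases[of j]) (simp_all add: assms)
  then show "((\<lambda>n. x n $ j) \<longlongrightarrow> y $ j) F" by (simp add: coord_def Rep_component_inverse)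
qed

text \<open>The operator that forgets derivatives: the V norm of a function is the norm of the value
  part of its state.\<close>

definition value_part :: "state \<Rightarrow> state" where
  "value_part x = state (\<lambda>s d. if d = None then coord x s d else 0)"

lemma bounded_linear_value_part: "bounded_linear value_part"
proof (rule bounded_linear_intro[where K = 1])
  show "value_part (x + y) = value_part x + value_part y" "value_part (r *\<^sub>R x) = r *\<^sub>R value_part x" for x y r
    unfolding value_part_def state_linear by (auto intro!: state_cong)
  show "norm (value_part x) \<le> norm x * 1" for x
    by (auto simp: norm_eq_sqrt_inner inner_state value_part_def intro!: sum_mono add_mono sum_nonneg)
qed

lemma inner_value_part: "value_part x \<bullet> value_part y = (\<Sum>s\<in>sheets. coord x s None \<bullet> coord y s None)"
  by (simp add: inner_state value_part_def)

lemma value_part_self_adjoint: "value_part x \<bullet> y = value_part x \<bullet> value_part y"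
  by (simp add: inner_state value_part_def)

definition sheet_part :: "sheet \<Rightarrow> state \<Rightarrow> state" where
  "sheet_part s0 x = state (\<lambda>s d. if s = s0 then coord x s d else 0)"

lemma bounded_linear_sheet_part: "bounded_linear (sheet_part s0)"
proof (rule bounded_linear_intro[where K = 1])
  show "sheet_part s0 (x + y) = sheet_part s0 x + sheet_part s0 y" "sheet_part s0 (r *\<^sub>R x) = r *\<^sub>R sheet_part s0 x" for x y r
    unfolding sheet_part_def state_linear by (auto intro!: state_cong)
  show "norm (sheet_part s0 x) \<le> norm x * 1" for x
    by (auto simp: norm_eq_sqrt_inner inner_state sheet_part_def intro!: sum_mono add_mono sum_nonneg)
qed

text \<open>Multiplication by the indicator of \<open>S\<close>, written as superposition with the
  identity so that the Lipschitz bound is inherited. Its fixed points are the vectors that vanish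
  outside \<open>S\<close>, a closed condition.\<close>

definition restr :: "'a::euclidean_space set \<Rightarrow> 'a l2 \<Rightarrow> 'a l2" where
  "restr S = superpose S (\<lambda>t. t)"

lemma restr_l2_on:
  assumes "S \<in> lmeasurable" "f \<in> L2 (lebesgue_on S)" shows "restr S (l2_on S f) = l2_on S f"
  unfolding restr_def
  by (rule superpose_on[OF assms(1) _ assms(2)]) (rule lipschitz_onI[of _ _ 1]; simp)

lemma restr_eq: "restr S x = l2_on S (l2_fun x)"
  by (simp add: restr_def superpose_def)

lemma bounded_linear_restr:
  assumes S: "S \<in> lmeasurable" shows "bounded_linear (restr S)"
proof (rule bounded_linear_intro[where K = 1])
  note Sm = fmeasurableD[OF S]
  have ae: "AE t in lebesgue. P t \<Longrightarrow> AE t in lebesgue_on S. P t" for P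
    using Sm by (auto simp: AE_on_iff elim: eventually_mono)
  show "restr S (x + y) = restr S x + restr S y" for x y
    unfolding restr_eq using ae[OF l2_fun_plus[of x y]]
    by (subst l2_on_add[OF Sm, symmetric]) (auto simp: l2_on_eq_iff[OF Sm] L2_on_l2_fun[OF Sm] L2_add)
  show "restr S (r *\<^sub>R x) = r *\<^sub>R restr S x" for r x
    unfolding restr_eq using ae[OF l2_fun_scaleR[of r x]]
    by (subst l2_on_scaleR[OF Sm, symmetric]) (auto simp: l2_on_eq_iff[OF Sm] L2_on_l2_fun[OF Sm] L2_mult)
  show "norm (restr S x) \<le> norm x * 1" for x
  proof -
    have "1-lipschitz_on UNIV (\<lambda>t::real. t)" by (rule lipschitz_onI) auto
    from lipschitz_on_normD[OF superpose_lipschitz[OF S this], of x 0]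
    have "norm (restr S x - restr S 0) \<le> norm x" by (simp add: restr_def)
    moreover have "restr S 0 = 0"
      using restr_l2_on[OF S L2_zero] by (simp add: l2_on_zero[OF Sm])
    ultimately show ?thesis by simp
  qed
qed

lemma Ck_1_lincomb:
  assumes u: "Ck 1 u" and v: "Ck 1 v"
  shows "Ck 1 (\<lambda>x. u x + r * v x)" "partial b (\<lambda>x. u x + r * v x) = (\<lambda>x. partial b u x + r * partial b v x)"
proof -
  have D: "((\<lambda>x. u x + r * v x) has_derivative (\<lambda>h. frechet_derivative u (at x) h + r * frechet_derivative v (at x) h)) (at x)" for x
    using u v by (intro derivative_intros) (auto simp: frechet_derivative_works[symmetric])
  show p: "partial b (\<lambda>x. u x + r * v x) = (\<lambda>x. partial b u x + r * partial b v x)" for b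
    by (simp add: fun_eq_iff partial_def flip: frechet_derivative_at[OF D])
  show "Ck 1 (\<lambda>x. u x + r * v x)"
    using u v D unfolding Ck_1_iff p by (auto simp: differentiable_def intro!: continuous_intros)
qed

lemma Ck_1_zero: "Ck 1 (\<lambda>x. 0)"
  using flat_algebra_Ck[OF flat_algebra.const] .

section \<open>Geometry of the sheets and the isometric encoding of V and H\<close>

locale multisheet =
  fixes \<Omega> :: "point set" and a \<delta> :: real and l :: "nat \<Rightarrow> real" and h :: "nat \<Rightarrow> nat \<Rightarrow> real"
  assumes a: "a > 0" and l: "l 0 = 0" "l 1 > 0" "l 2 > 0" "l 3 > 0"
    and \<Omega>: "open \<Omega>" "bounded \<Omega>" and \<delta>: "\<delta> > 0" "{0<..<a} \<times> {0<..<\<delta>} \<subseteq> \<Omega>"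
    and h: "\<And>i m. i \<le> 2 \<Longrightarrow> m \<in> branches i \<Longrightarrow> 0 < h i m"
begin

definition dom :: "sheet \<Rightarrow> point set" where
  "dom s = (case s of Upper \<Rightarrow> \<Omega> | Branch i m \<Rightarrow> layer a l i)"

definition wt :: "sheet \<Rightarrow> real" where
  "wt s = (case s of Upper \<Rightarrow> 1 | Branch i m \<Rightarrow> h i m)"

lemma dom_simps [simp]: "dom Upper = \<Omega>" "dom (Branch i m) = layer a l i"
  by (simp_all add: dom_def)

lemma wt_simps [simp]: "wt Upper = 1" "wt (Branch i m) = h i m"
  by (simp_all add: wt_def)

lemma layer_eq: "layer a l i = {0<..<a} \<times> {- (\<Sum>n=0..i+1. l n)<..<- (\<Sum>n=0..i. l n)}"
  by (auto simp: layer_def)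

lemma layers:
  "layer a l 0 = {0<..<a} \<times> {- l 1<..<0}" "layer a l 1 = {0<..<a} \<times> {- (l 1 + l 2)<..<- l 1}"
  "layer a l 2 = {0<..<a} \<times> {- (l 1 + l 2 + l 3)<..<- (l 1 + l 2)}"
  using l by (simp_all add: layer_eq eval_nat_numeral)

lemma open_dom: "open (dom s)"
  using \<Omega> by (cases s) (auto simp: layer_eq intro!: open_Times)

lemma lmeasurable_dom: "dom s \<in> lmeasurable"
proof -
  have "bounded (dom s)" using \<Omega> by (cases s) (auto simp: layer_eq intro!: bounded_Times)
  then show ?thesis by (intro lmeasurable_open open_dom)
qed

lemma sets_dom: "dom s \<in> sets lebesgue"
  by (rule fmeasurableD[OF lmeasurable_dom])

lemma wt_pos: "s \<in> sheets \<Longrightarrow> 0 < wt s"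
  using h by (auto simp: sheets_def)

definition sob :: "msfun \<Rightarrow> bool" where
  "sob \<phi> \<longleftrightarrow> (\<forall>s\<in>sheets. \<phi> s \<in> sobolev (dom s) (dirs s))"

text \<open>Values carry the factor \<open>sqrt (wt s)\<close> and derivatives none, because in the
  inner product of H the weights \<open>h i m\<close> occur only in the V part. With these factors
  \<open>H_inner\<close> is the plain inner product of states.\<close>

definition embed :: "msfun \<Rightarrow> state" where
  "embed \<phi> = state (\<lambda>s d. case d of None \<Rightarrow> sqrt (wt s) *\<^sub>R l2_on (dom s) (\<phi> s)
     | Some b \<Rightarrow> l2_on (dom s) (weak_partial (dom s) b (\<phi> s)))"

text \<open>Agrees with the value part of \<open>embed\<close>, but is meaningful on all of V, where
  weak derivatives need not exist.\<close>

definition embed_value :: "msfun \<Rightarrow> state" where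
  "embed_value \<phi> = state (\<lambda>s d. if d = None then sqrt (wt s) *\<^sub>R l2_on (dom s) (\<phi> s) else 0)"

text \<open>Only the value coordinates are read; for states in \<open>weak_states\<close> the
  derivative coordinates come back as weak derivatives.\<close>

definition unembed :: "state \<Rightarrow> msfun" where
  "unembed e = (\<lambda>s x. 1 / sqrt (wt s) * l2_fun (coord e s None) x)"

lemma coord_embed [simp]:
  "s \<in> sheets \<Longrightarrow> coord (embed \<phi>) s None = sqrt (wt s) *\<^sub>R l2_on (dom s) (\<phi> s)"
  "s \<in> sheets \<Longrightarrow> b \<in> dirs s \<Longrightarrow> coord (embed \<phi>) s (Some b) = l2_on (dom s) (weak_partial (dom s) b (\<phi> s))"
  by (simp_all add: embed_def)

lemma value_part_embed: "value_part (embed \<phi>) = embed_value \<phi>"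
  unfolding value_part_def embed_value_def by (rule state_cong) auto

lemma sob_L2: "sob \<phi> \<Longrightarrow> s \<in> sheets \<Longrightarrow> \<phi> s \<in> L2 (lebesgue_on (dom s))"
  by (auto simp: sob_def sobolev_def)

lemma sob_weak_partial:
  assumes "sob \<phi>" "s \<in> sheets" "b \<in> dirs s"
  shows "weak_partial (dom s) b (\<phi> s) \<in> L2 (lebesgue_on (dom s))"
    "weak_derivative (dom s) b (\<phi> s) (weak_partial (dom s) b (\<phi> s))"
  using weak_partial[of "\<phi> s" "dom s" "dirs s" b] assms by (auto simp: sob_def)

text \<open>Any weak derivatives \<open>D\<close> may stand for the chosen ones, by
  uniqueness.\<close>

lemma sob_embedI:
  assumes f: "\<And>s. s \<in> sheets \<Longrightarrow> \<phi> s \<in> L2 (lebesgue_on (dom s))"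
    and D: "\<And>s b. s \<in> sheets \<Longrightarrow> b \<in> dirs s \<Longrightarrow> D s b \<in> L2 (lebesgue_on (dom s))"
    and wd: "\<And>s b. s \<in> sheets \<Longrightarrow> b \<in> dirs s \<Longrightarrow> weak_derivative (dom s) b (\<phi> s) (D s b)"
  shows "sob \<phi>" "embed \<phi> = state (\<lambda>s d. case d of None \<Rightarrow> sqrt (wt s) *\<^sub>R l2_on (dom s) (\<phi> s) | Some b \<Rightarrow> l2_on (dom s) (D s b))"
proof -
  show s: "sob \<phi>" using assms unfolding sob_def sobolev_def by blast
  show "embed \<phi> = state (\<lambda>s d. case d of None \<Rightarrow> sqrt (wt s) *\<^sub>R l2_on (dom s) (\<phi> s) | Some b \<Rightarrow> l2_on (dom s) (D s b))"
    unfolding embed_def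
  proof (rule state_cong)
    fix s b assume sb: "s \<in> sheets" "b \<in> dirs s"
    have "l2_on (dom s) (weak_partial (dom s) b (\<phi> s)) = l2_on (dom s) (D s b)"
      by (rule weak_derivative_unique[OF open_dom sob_weak_partial(1)[OF s sb] D[OF sb] sob_weak_partial(2)[OF s sb] wd[OF sb]])
    then show "(case Some b of None \<Rightarrow> sqrt (wt s) *\<^sub>R l2_on (dom s) (\<phi> s) | Some b \<Rightarrow> l2_on (dom s) (weak_partial (dom s) b (\<phi> s)))
        = (case Some b of None \<Rightarrow> sqrt (wt s) *\<^sub>R l2_on (dom s) (\<phi> s) | Some b \<Rightarrow> l2_on (dom s) (D s b))" by simp
  qed simp
qed

text \<open>\<open>weak_partial\<close> is a choice and therefore not linear on functions; linearity
  holds for the \<open>l2\<close> vectors.\<close>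

lemma sob_lincomb:
  assumes \<phi>: "sob \<phi>" and \<psi>: "sob \<psi>"
  shows "sob (\<lambda>s x. p * \<phi> s x + q * \<psi> s x)"
    "embed (\<lambda>s x. p * \<phi> s x + q * \<psi> s x) = p *\<^sub>R embed \<phi> + q *\<^sub>R embed \<psi>"
proof -
  let ?D = "\<lambda>s b x. p * weak_partial (dom s) b (\<phi> s) x + q * weak_partial (dom s) b (\<psi> s) x"
  have L: "(\<lambda>x. p * u x + q * v x) \<in> L2 M" if "u \<in> L2 M" "v \<in> L2 M" for u v and M :: "point measure"
    using that by (intro L2_add L2_mult)
  have lin: "l2_on (dom s) (\<lambda>x. p * u x + q * v x) = p *\<^sub>R l2_on (dom s) u + q *\<^sub>R l2_on (dom s) v"
    if "u \<in> L2 (lebesgue_on (dom s))" "v \<in> L2 (lebesgue_on (dom s))" for u v s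
    using that by (simp add: l2_on_add[OF sets_dom] l2_on_scaleR[OF sets_dom] L2_mult)
  have wd: "weak_derivative (dom s) b (\<lambda>x. p * \<phi> s x + q * \<psi> s x) (?D s b)" if "s \<in> sheets" "b \<in> dirs s" for s b
    using that dirs_Basis(1)[of s] sob_L2[OF \<phi>] sob_L2[OF \<psi>] sob_weak_partial[OF \<phi> that] sob_weak_partial[OF \<psi> that]
    by (intro weak_derivative_lincomb open_dom) auto
  note I = sob_embedI[of "\<lambda>s x. p * \<phi> s x + q * \<psi> s x" ?D, OF L[OF sob_L2[OF \<phi>] sob_L2[OF \<psi>]]
      L[OF sob_weak_partial(1)[OF \<phi>] sob_weak_partial(1)[OF \<psi>]] wd]
  show "sob (\<lambda>s x. p * \<phi> s x + q * \<psi> s x)" by (rule I(1))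
  have "embed (\<lambda>s x. p * \<phi> s x + q * \<psi> s x) = state (\<lambda>s d. case d of None \<Rightarrow> sqrt (wt s) *\<^sub>R l2_on (dom s) (\<lambda>x. p * \<phi> s x + q * \<psi> s x) | Some b \<Rightarrow> l2_on (dom s) (?D s b))"
    by (rule I(2))
  also have "\<dots> = p *\<^sub>R embed \<phi> + q *\<^sub>R embed \<psi>"
    unfolding embed_def state_linear
  proof (rule state_cong, goal_cases)
    case (1 s)
    then show ?case using lin[OF sob_L2[OF \<phi> 1] sob_L2[OF \<psi> 1]] by (simp add: algebra_simps)
  next
    case (2 s b)
    then show ?case using lin[OF sob_weak_partial(1)[OF \<phi> 2] sob_weak_partial(1)[OF \<psi> 2]] by simp
  qed
  finally show "embed (\<lambda>s x. p * \<phi> s x + q * \<psi> s x) = p *\<^sub>R embed \<phi> + q *\<^sub>R embed \<psi>" .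
qed

lemma V_space_iff: "\<phi> \<in> V_space \<Omega> a l \<longleftrightarrow> (\<forall>s\<in>sheets. \<phi> s \<in> L2 (lebesgue_on (dom s)))"
  by (simp add: V_space_def ball_sheets)

lemma V_inner_eq:
  assumes "\<phi> \<in> V_space \<Omega> a l" "\<psi> \<in> V_space \<Omega> a l"
  shows "V_inner \<Omega> a l h \<phi> \<psi> = embed_value \<phi> \<bullet> embed_value \<psi>"
proof -
  have "embed_value \<phi> \<bullet> embed_value \<psi> = (\<Sum>s\<in>sheets. wt s * (\<integral>x. \<phi> s x * \<psi> s x \<partial>lebesgue_on (dom s)))"
  proof -
    have "embed_value \<phi> \<bullet> embed_value \<psi> = (\<Sum>s\<in>sheets. (sqrt (wt s) *\<^sub>R l2_on (dom s) (\<phi> s)) \<bullet> (sqrt (wt s) *\<^sub>R l2_on (dom s) (\<psi> s)))"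
      unfolding inner_state by (intro sum.cong refl) (simp add: embed_value_def)
    also have "\<dots> = (\<Sum>s\<in>sheets. wt s * (\<integral>x. \<phi> s x * \<psi> s x \<partial>lebesgue_on (dom s)))"
    proof (intro sum.cong refl)
      fix s assume s: "s \<in> sheets"
      have "l2_on (dom s) (\<phi> s) \<bullet> l2_on (dom s) (\<psi> s) = (\<integral>x. \<phi> s x * \<psi> s x \<partial>lebesgue_on (dom s))"
        using assms s by (intro inner_l2_on sets_dom) (auto simp: V_space_iff)
      then show "(sqrt (wt s) *\<^sub>R l2_on (dom s) (\<phi> s)) \<bullet> (sqrt (wt s) *\<^sub>R l2_on (dom s) (\<psi> s)) = wt s * (\<integral>x. \<phi> s x * \<psi> s x \<partial>lebesgue_on (dom s))"
        using wt_pos[OF s] by (simp flip: mult.assoc)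
    qed
    finally show ?thesis .
  qed
  then show ?thesis by (simp add: V_inner_def sum_sheets)
qed

lemma sob_V: "sob \<phi> \<Longrightarrow> \<phi> \<in> V_space \<Omega> a l"
  by (simp add: V_space_iff sob_L2)

lemma sum_dirs: "(\<Sum>b\<in>dirs Upper. f b) = (\<Sum>b\<in>Basis. f b)" "(\<Sum>b\<in>dirs (Branch i m). f b) = f (0, 1)"
  by (simp_all add: dirs_def)

lemma H_inner_eq:
  assumes \<phi>: "sob \<phi>" and \<psi>: "sob \<psi>"
  shows "H_inner \<Omega> a l h \<phi> \<psi> = embed \<phi> \<bullet> embed \<psi>"
proof -
  let ?I = "\<lambda>s b. \<integral>x. weak_partial (dom s) b (\<phi> s) x * weak_partial (dom s) b (\<psi> s) x \<partial>lebesgue_on (dom s)"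
  have "embed \<phi> \<bullet> embed \<psi> = value_part (embed \<phi>) \<bullet> value_part (embed \<psi>) + (\<Sum>s\<in>sheets. \<Sum>b\<in>dirs s. coord (embed \<phi>) s (Some b) \<bullet> coord (embed \<psi>) s (Some b))"
    unfolding inner_value_part by (simp add: inner_state sum.distrib)
  also have "value_part (embed \<phi>) \<bullet> value_part (embed \<psi>) = V_inner \<Omega> a l h \<phi> \<psi>"
    unfolding value_part_embed by (rule V_inner_eq[OF sob_V[OF \<phi>] sob_V[OF \<psi>], symmetric])
  also have "(\<Sum>s\<in>sheets. \<Sum>b\<in>dirs s. coord (embed \<phi>) s (Some b) \<bullet> coord (embed \<psi>) s (Some b)) = (\<Sum>s\<in>sheets. \<Sum>b\<in>dirs s. ?I s b)"
    by (intro sum.cong refl)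
      (simp add: inner_l2_on[OF sets_dom sob_weak_partial(1)[OF \<phi>] sob_weak_partial(1)[OF \<psi>]])
  also have "\<dots> = (\<Sum>b\<in>Basis. ?I Upper b) + (\<Sum>i\<le>2. \<Sum>m\<in>branches i. ?I (Branch i m) (0, 1))"
    by (simp add: sum_sheets sum_dirs)
  also have "(\<Sum>b\<in>Basis. ?I Upper b) = (\<integral>x. grad_dot \<Omega> (\<phi> Upper) (\<psi> Upper) x \<partial>lebesgue_on \<Omega>)"
    unfolding grad_dot_def
  proof (subst Bochner_Integration.integral_sum)
    fix b :: point assume b: "b \<in> Basis"
    have U: "Upper \<in> sheets" "b \<in> dirs Upper" using b by (auto simp: sheets_def dirs_def)
    show "integrable (lebesgue_on \<Omega>) (\<lambda>x. weak_partial \<Omega> b (\<phi> Upper) x * weak_partial \<Omega> b (\<psi> Upper) x)"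
      using L2_integrable[OF sob_weak_partial(1)[OF \<phi> U] sob_weak_partial(1)[OF \<psi> U]] by simp
  qed simp
  finally show ?thesis by (simp add: H_inner_def)
qed

lemma H_norm_eq: "sob \<phi> \<Longrightarrow> H_norm \<Omega> a l h \<phi> = norm (embed \<phi>)"
  by (simp add: H_norm_def H_inner_eq norm_eq_sqrt_inner)

lemma V_norm_eq: "\<phi> \<in> V_space \<Omega> a l \<Longrightarrow> V_norm \<Omega> a l h \<phi> = norm (embed_value \<phi>)"
  by (simp add: V_norm_def V_inner_eq norm_eq_sqrt_inner)

lemma ms_eq_iff:
  assumes "\<phi> \<in> V_space \<Omega> a l" "\<psi> \<in> V_space \<Omega> a l"
  shows "ms_eq \<Omega> a l \<phi> \<psi> \<longleftrightarrow> embed_value \<phi> = embed_value \<psi>"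
proof -
  have "ms_eq \<Omega> a l \<phi> \<psi> \<longleftrightarrow> (\<forall>s\<in>sheets. AE x in lebesgue_on (dom s). \<phi> s x = \<psi> s x)"
    by (simp only: ms_eq_def ball_sheets dom_simps)
  also have "\<dots> \<longleftrightarrow> (\<forall>s\<in>sheets. coord (embed_value \<phi>) s None = coord (embed_value \<psi>) s None)"
  proof (intro ball_cong refl)
    fix s assume s: "s \<in> sheets"
    then show "(AE x in lebesgue_on (dom s). \<phi> s x = \<psi> s x) \<longleftrightarrow> coord (embed_value \<phi>) s None = coord (embed_value \<psi>) s None"
      using assms wt_pos[OF s] by (simp add: embed_value_def V_space_iff l2_on_eq_iff[OF sets_dom])
  qed
  also have "\<dots> \<longleftrightarrow> embed_value \<phi> = embed_value \<psi>"
  proof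
    assume *: "\<forall>s\<in>sheets. coord (embed_value \<phi>) s None = coord (embed_value \<psi>) s None"
    show "embed_value \<phi> = embed_value \<psi>"
      by (rule state_eqI) (use * in \<open>simp_all add: embed_value_def\<close>)
  qed simp
  finally show ?thesis .
qed

subsection \<open>The trace conditions\<close>

text \<open>Each pair consists of a height and the sheets glued together there; the last two share a
  segment but join different sheets. The four trace conditions of \<open>H_space\<close> thus become
  one quantified statement.\<close>

definition junctions :: "(real \<times> sheet set) set" where
  "junctions = {(0, {Upper, Branch 0 1}), (- l 1, {Branch 0 1, Branch 1 1, Branch 1 2}),
     (- (l 1 + l 2), {Branch 1 1, Branch 2 1, Branch 2 2}), (- (l 1 + l 2), {Branch 1 2, Branch 2 3, Branch 2 4})}"

lemma H_space_junctions:
  "\<phi> \<in> H_space \<Omega> a l \<longleftrightarrow> sob \<phi> \<and>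
     (\<forall>(c, G)\<in>junctions. \<exists>\<tau>. \<forall>s\<in>G. has_trace (dom s) (dirs s) a c (\<phi> s) \<tau>)"
  by (simp add: H_space_def junctions_def sob_def ball_sheets dirs_def)

text \<open>The state of a continuously differentiable function on one sheet, with classical
  derivatives. The other sheets are set to 0 to make it comparable with
  \<open>sheet_part\<close>.\<close>

definition lift_C1 :: "sheet \<Rightarrow> (point \<Rightarrow> real) \<Rightarrow> state" where
  "lift_C1 s w = state (\<lambda>s' d. if s' = s then (case d of None \<Rightarrow> sqrt (wt s) *\<^sub>R l2_on (dom s) w
     | Some b \<Rightarrow> l2_on (dom s) (partial b w)) else 0)"

definition C1_L2 :: "sheet \<Rightarrow> real \<Rightarrow> (point \<Rightarrow> real) set" where
  "C1_L2 s c = {w. Ck 1 w \<and> w \<in> L2 (lebesgue_on (dom s)) \<and> (\<forall>b\<in>dirs s. partial b w \<in> L2 (lebesgue_on (dom s))) \<and>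
     (\<lambda>t. w (t, c)) \<in> L2 (lebesgue_on {0<..<a})}"

text \<open>The graph of the classical trace operator; that of \<open>has_trace\<close> is its closure.\<close>

definition trace_graph :: "sheet \<Rightarrow> real \<Rightarrow> (state \<times> real l2) set" where
  "trace_graph s c = (\<lambda>w. (lift_C1 s w, l2_on {0<..<a} (\<lambda>t. w (t, c)))) ` C1_L2 s c"

lemma trace_graph_lincomb:
  assumes "x \<in> trace_graph s c" "y \<in> trace_graph s c"
  shows "x + r *\<^sub>R y \<in> trace_graph s c"
proof -
  obtain u where u: "x = (lift_C1 s u, l2_on {0<..<a} (\<lambda>t. u (t, c)))" "u \<in> C1_L2 s c"
    using assms(1) unfolding trace_graph_def by (rule imageE)
  obtain v where v: "y = (lift_C1 s v, l2_on {0<..<a} (\<lambda>t. v (t, c)))" "v \<in> C1_L2 s c"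
    using assms(2) unfolding trace_graph_def by (rule imageE)
  have Ck: "Ck 1 u" "Ck 1 v" using u(2) v(2) by (auto simp: C1_L2_def)
  let ?w = "\<lambda>x. u x + r * v x"
  have "(\<lambda>x. partial b u x + r * partial b v x) \<in> L2 (lebesgue_on (dom s))" if "b \<in> dirs s" for b
    using u(2) v(2) that by (intro L2_add L2_mult) (auto simp: C1_L2_def)
  then have "?w \<in> C1_L2 s c"
    using u(2) v(2) Ck_1_lincomb[OF Ck, where r = r] unfolding C1_L2_def mem_Collect_eq Ck_1_lincomb(2)[OF Ck]
    by (auto intro: L2_add L2_mult)
  moreover have "lift_C1 s u + r *\<^sub>R lift_C1 s v = lift_C1 s ?w"
    unfolding lift_C1_def state_linear Ck_1_lincomb(2)[OF Ck]
  proof (rule state_cong, goal_cases)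
    case (1 s')
    then show ?case using u(2) v(2)
      by (simp add: C1_L2_def l2_on_add[OF sets_dom] l2_on_scaleR[OF sets_dom] L2_mult algebra_simps)
  next
    case (2 s' b)
    then show ?case using u(2) v(2)
      by (auto simp: C1_L2_def l2_on_add[OF sets_dom] l2_on_scaleR[OF sets_dom] L2_mult)
  qed
  moreover have "l2_on {0<..<a} (\<lambda>t. u (t, c)) + r *\<^sub>R l2_on {0<..<a} (\<lambda>t. v (t, c)) = l2_on {0<..<a} (\<lambda>t. ?w (t, c))"
    using u(2) v(2) by (simp add: C1_L2_def l2_on_add l2_on_scaleR L2_mult)
  ultimately show ?thesis by (auto simp: u(1) v(1) trace_graph_def intro!: image_eqI)
qed

lemma subspace_trace_graph: "subspace (trace_graph s c)"
proof (rule subspaceI)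
  have z: "(\<lambda>x. 0) \<in> C1_L2 s c"
  proof -
    have "partial b (\<lambda>x. 0 :: real) = (\<lambda>x. 0)" for b :: point
      using Ck_1_lincomb(2)[OF Ck_1_zero Ck_1_zero, where r = "-1" and b = b] by (simp add: fun_eq_iff)
    then show ?thesis by (simp add: C1_L2_def Ck_1_zero L2_zero del: Ck.simps One_nat_def)
  qed
  then have "(lift_C1 s (\<lambda>x. 0), l2_on {0<..<a} (\<lambda>t. 0)) \<in> trace_graph s c" (is "?z \<in> _")
    by (auto simp: trace_graph_def)
  from trace_graph_lincomb[OF this this, of "-1"] show 0: "0 \<in> trace_graph s c" by (simp add: zero_prod_def)
  show "x + y \<in> trace_graph s c" if "x \<in> trace_graph s c" "y \<in> trace_graph s c" for x y
    using trace_graph_lincomb[OF that, of 1] by simp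
  show "r *\<^sub>R x \<in> trace_graph s c" if "x \<in> trace_graph s c" for r x
    using trace_graph_lincomb[OF 0 that, of r] by simp
qed

text \<open>The convergences in \<open>has_trace\<close> together are convergence in the product of
  states and \<open>real l2\<close>, so a trace is a point of the closed graph. The sequence lies in
  the graph only eventually, which does not affect the limit.\<close>

lemma has_trace_iff:
  assumes s: "s \<in> sheets" and \<phi>: "sob \<phi>"
  shows "has_trace (dom s) (dirs s) a c (\<phi> s) \<tau> \<longleftrightarrow>
    \<tau> \<in> L2 (lebesgue_on {0<..<a}) \<and> (sheet_part s (embed \<phi>), l2_on {0<..<a} \<tau>) \<in> closure (trace_graph s c)"
    (is "?L \<longleftrightarrow> ?R")
proof
  let ?u = "sheet_part s (embed \<phi>)"
  have Am: "{0<..<a} \<in> sets lebesgue" by simp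
  have wt: "sqrt (wt s) \<noteq> 0" using wt_pos[OF s] by simp
  {
    assume ?L
    then obtain w where w: "\<And>n. Ck 1 (w n)" and c1: "L2_converges (lebesgue_on (dom s)) w (\<phi> s)"
      and c2: "\<And>b. b \<in> dirs s \<Longrightarrow> L2_converges (lebesgue_on (dom s)) (\<lambda>n. partial b (w n)) (weak_partial (dom s) b (\<phi> s))"
      and c3: "L2_converges (lebesgue_on {0<..<a}) (\<lambda>n t. w n (t, c)) \<tau>"
      unfolding has_trace_def by blast
    note c1' = c1[unfolded L2_converges_iff[OF sets_dom]] and c2' = c2[unfolded L2_converges_iff[OF sets_dom]]
      and c3' = c3[unfolded L2_converges_iff[OF Am]]
    have "\<forall>\<^sub>F n in sequentially. \<forall>b\<in>dirs s. partial b (w n) \<in> L2 (lebesgue_on (dom s))"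
      using c2' dirs_Basis(2) by (intro eventually_ball_finite) auto
    with c1' c3' have "\<forall>\<^sub>F n in sequentially. w n \<in> C1_L2 s c"
      using w unfolding C1_L2_def mem_Collect_eq by (auto intro: eventually_conj)
    then have "\<forall>\<^sub>F n in sequentially. (lift_C1 s (w n), l2_on {0<..<a} (\<lambda>t. w n (t, c))) \<in> closure (trace_graph s c)"
      by eventually_elim (rule subsetD[OF closure_subset], simp add: trace_graph_def)
    moreover have "(\<lambda>n. (lift_C1 s (w n), l2_on {0<..<a} (\<lambda>t. w n (t, c)))) \<longlonglongrightarrow> (?u, l2_on {0<..<a} \<tau>)"
    proof (intro tendsto_Pair state_tendstoI)
      fix s' assume s': "s' \<in> sheets"
      show "(\<lambda>n. coord (lift_C1 s (w n)) s' None) \<longlonglongrightarrow> coord ?u s' None"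
        using s' c1' by (cases "s' = s") (auto simp: lift_C1_def sheet_part_def intro!: tendsto_intros)
      fix b assume b: "b \<in> dirs s'"
      show "(\<lambda>n. coord (lift_C1 s (w n)) s' (Some b)) \<longlonglongrightarrow> coord ?u s' (Some b)"
        using s' b c2'[of b] by (cases "s' = s") (auto simp: lift_C1_def sheet_part_def)
    qed (use c3' in simp)
    ultimately have "(?u, l2_on {0<..<a} \<tau>) \<in> closure (trace_graph s c)"
      by (intro Lim_in_closed_set[OF closed_closure]) auto
    then show ?R using c3' by simp
  next
    assume R: ?R
    then obtain z where z: "\<forall>n. z n \<in> trace_graph s c" "z \<longlonglongrightarrow> (?u, l2_on {0<..<a} \<tau>)"
      unfolding closure_sequential by blast
    then have "\<exists>w. w \<in> C1_L2 s c \<and> z n = (lift_C1 s w, l2_on {0<..<a} (\<lambda>t. w (t, c)))" for n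
      unfolding trace_graph_def by blast
    then obtain w where w: "\<And>n. w n \<in> C1_L2 s c" "\<And>n. z n = (lift_C1 s (w n), l2_on {0<..<a} (\<lambda>t. w n (t, c)))"
      by metis
    have l1: "(\<lambda>n. lift_C1 s (w n)) \<longlonglongrightarrow> ?u" and l2: "(\<lambda>n. l2_on {0<..<a} (\<lambda>t. w n (t, c))) \<longlonglongrightarrow> l2_on {0<..<a} \<tau>"
      using tendsto_fst[OF z(2)] tendsto_snd[OF z(2)] by (simp_all add: w(2))
    have "(\<lambda>n. (1 / sqrt (wt s)) *\<^sub>R coord (lift_C1 s (w n)) s None) \<longlonglongrightarrow> (1 / sqrt (wt s)) *\<^sub>R coord ?u s None"
      by (intro tendsto_scaleR tendsto_const bounded_linear.tendsto[OF bounded_linear_coord] l1)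
    then have "(\<lambda>n. l2_on (dom s) (w n)) \<longlonglongrightarrow> l2_on (dom s) (\<phi> s)"
      using s wt by (simp add: lift_C1_def sheet_part_def)
    moreover have "(\<lambda>n. l2_on (dom s) (partial b (w n))) \<longlonglongrightarrow> l2_on (dom s) (weak_partial (dom s) b (\<phi> s))" if b: "b \<in> dirs s" for b
      using bounded_linear.tendsto[OF bounded_linear_coord l1, of s "Some b"] s b by (simp add: lift_C1_def sheet_part_def)
    ultimately show ?L
      unfolding has_trace_def L2_converges_iff[OF sets_dom] L2_converges_iff[OF Am]
      using w(1) l2 R sob_L2[OF \<phi> s] sob_weak_partial(1)[OF \<phi> s]
      by (intro exI[of _ w]) (auto simp: C1_L2_def simp del: Ck.simps One_nat_def)
  }
qed

text \<open>The geometric input of \<open>trace_bound\<close>: next to a junction every adjoining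
  sheet contains a strip over the whole segment that ends at the junction height.\<close>

lemma junction_strip:
  assumes "(c, G) \<in> junctions" "s \<in> G"
  shows "s \<in> sheets \<and> (\<exists>lo hi. c \<in> {lo..hi} \<and> lo < hi \<and> {0<..<a} \<times> {lo<..<hi} \<subseteq> dom s)"
proof -
  have strip: "\<exists>lo hi. c \<in> {lo..hi} \<and> lo < hi \<and> {0<..<a} \<times> {lo<..<hi} \<subseteq> D"
    if "{0<..<a} \<times> {lo<..<hi} \<subseteq> D" "lo < hi" "c = lo \<or> c = hi" for D :: "point set" and lo hi c :: real
    using that by (intro exI[of _ lo] exI[of _ hi]) auto
  have br: "Branch 0 1 \<in> sheets" "Branch 1 m \<in> sheets" if "m \<in> {1, 2}" for m
    using that by (auto simp: sheets_def branches_def)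
  have br2: "Branch 2 m \<in> sheets" if "m \<in> {1, 2, 3, 4}" for m
    using that by (auto simp: sheets_def branches_def)
  have up: "Upper \<in> sheets" by (simp add: sheets_def)
  consider "c = 0" "s = Upper" | "c = 0 \<or> c = - l 1" "s = Branch 0 1"
    | m where "c = - l 1 \<or> c = - (l 1 + l 2)" "m \<in> {1, 2}" "s = Branch 1 m"
    | m where "c = - (l 1 + l 2)" "m \<in> {1, 2, 3, 4}" "s = Branch 2 m"
    using assms by (auto simp: junctions_def)
  then show ?thesis
  proof cases
    case 1
    then show ?thesis using strip[of 0 \<delta> \<Omega> c] \<delta> up by auto
  next
    case 2
    then show ?thesis using strip[of "- l 1" 0 "layer a l 0" c] l br(1)[of 1] by (auto simp: layers)
  next
    case (3 m)
    then show ?thesis using strip[of "- (l 1 + l 2)" "- l 1" "layer a l 1" c] l br(2)[of m] by (auto simp: layers simp del: One_nat_def)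
  next
    case (4 m)
    then show ?thesis using strip[of "- (l 1 + l 2 + l 3)" "- (l 1 + l 2)" "layer a l 2" c] l br2[of m] by (auto simp: layers)
  qed
qed

text \<open>The bound for classical traces is a closed condition on pairs, so it passes to the
  closure. The closure is therefore the graph of a bounded linear operator on its domain: traces are
  unique and depend continuously on the state.\<close>

lemma trace_graph_bound:
  assumes cG: "(c, G) \<in> junctions" "s \<in> G"
  shows "\<exists>C. \<forall>z\<in>closure (trace_graph s c). norm (snd z) \<le> C * norm (fst z)"
proof -
  obtain lo hi where s: "s \<in> sheets" and c: "c \<in> {lo..hi}" "lo < hi" "{0<..<a} \<times> {lo<..<hi} \<subseteq> dom s"
    using junction_strip[OF cG] by blast
  define k where "k = 2 / (hi - lo)"
  define m where "m = 2 * (hi - lo)"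
  have km: "k \<ge> 0" "m \<ge> 0" "wt s > 0" using c wt_pos[OF s] by (auto simp: k_def m_def)
  \<comment> \<open>\<open>trace_bound\<close> contains the unscaled values, while the state has
    them multiplied by \<open>sqrt (wt s)\<close>; hence \<open>k / wt s\<close>.\<close>
  define C where "C = sqrt (k / wt s + m)"
  have "norm (snd z) \<le> C * norm (fst z)" if z: "z \<in> trace_graph s c" for z
  proof (rule power2_le_imp_le)
    obtain w where w: "z = (lift_C1 s w, l2_on {0<..<a} (\<lambda>t. w (t, c)))" "w \<in> C1_L2 s c"
      using z unfolding trace_graph_def by (rule imageE)
    let ?x = "lift_C1 s w"
    have n1: "wt s * (norm (l2_on (dom s) w))\<^sup>2 \<le> (norm ?x)\<^sup>2"
    proof -
      have "wt s * (norm (l2_on (dom s) w))\<^sup>2 = (norm (coord ?x s None))\<^sup>2"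
        using s km by (simp add: lift_C1_def power_mult_distrib)
      then show ?thesis using norm_coord_le[of ?x s None] by (simp add: power_mono)
    qed
    have n2: "(norm (l2_on (dom s) (partial (0, 1) w)))\<^sup>2 \<le> (norm ?x)\<^sup>2"
    proof -
      have "l2_on (dom s) (partial (0, 1) w) = coord ?x s (Some (0, 1))"
        using s dirs_Basis(3)[of s] by (simp add: lift_C1_def)
      then show ?thesis using norm_coord_le[of ?x s "Some (0, 1)"] by (simp add: power_mono)
    qed
    have "(norm (l2_on {0<..<a} (\<lambda>t. w (t, c))))\<^sup>2 \<le> k * (norm (l2_on (dom s) w))\<^sup>2 + m * (norm (l2_on (dom s) (partial (0, 1) w)))\<^sup>2"
      unfolding k_def m_def using w(2) dirs_Basis(3)[of s]
      by (intro trace_bound[OF _ c sets_dom]) (auto simp: C1_L2_def simp del: Ck.simps One_nat_def)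
    also have "\<dots> \<le> k * ((norm ?x)\<^sup>2 / wt s) + m * (norm ?x)\<^sup>2"
      using n1 n2 km by (intro add_mono mult_left_mono) (auto simp: pos_le_divide_eq mult.commute)
    also have "\<dots> = (C * norm ?x)\<^sup>2"
      using km by (simp add: C_def power_mult_distrib algebra_simps)
    finally show "(norm (snd z))\<^sup>2 \<le> (C * norm (fst z))\<^sup>2" by (simp add: w(1))
  next
    show "0 \<le> C * norm (fst z)" using km by (simp add: C_def)
  qed
  then have "trace_graph s c \<subseteq> {z. norm (snd z) \<le> C * norm (fst z)}" by blast
  moreover have "closed {z :: state \<times> real l2. norm (snd z) \<le> C * norm (fst z)}"
    by (intro closed_Collect_le continuous_intros)
  ultimately have "closure (trace_graph s c) \<subseteq> {z. norm (snd z) \<le> C * norm (fst z)}" by (rule closure_minimal)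
  then show ?thesis by blast
qed

text \<open>A limit trace vanishes outside the segment, so its representative, restricted to the
  segment, gives back the same vector; this is the way from vectors back to
  \<open>has_trace\<close>.\<close>

lemma trace_graph_restr:
  assumes "z \<in> closure (trace_graph s c)"
  shows "restr {0<..<a} (snd z) = snd z"
proof -
  have Al: "{0<..<a} \<in> lmeasurable" by simp
  have "trace_graph s c \<subseteq> {z. restr {0<..<a} (snd z) = snd z}"
    by (auto simp: trace_graph_def C1_L2_def restr_l2_on[OF Al])
  moreover have "closed {z :: state \<times> real l2. restr {0<..<a} (snd z) = snd z}"
    by (intro closed_Collect_eq continuous_intros bounded_linear.continuous_on[OF bounded_linear_restr[OF Al]])
  ultimately have "closure (trace_graph s c) \<subseteq> {z. restr {0<..<a} (snd z) = snd z}" by (rule closure_minimal)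
  then show ?thesis using assms by blast
qed

section \<open>The closed subspace of states that represents H\<close>

definition traces :: "state set" where
  "traces = {e. \<forall>(c, G)\<in>junctions. \<exists>\<tau>. \<forall>s\<in>G. (sheet_part s e, \<tau>) \<in> closure (trace_graph s c)}"

text \<open>A common trace is a function in \<open>has_trace\<close> and a vector in
  \<open>traces\<close>; \<open>trace_graph_restr\<close> supplies the function from the
  vector.\<close>

lemma H_space_iff: "\<phi> \<in> H_space \<Omega> a l \<longleftrightarrow> sob \<phi> \<and> embed \<phi> \<in> traces"
proof -
  have "(\<exists>\<tau>. \<forall>s\<in>G. has_trace (dom s) (dirs s) a c (\<phi> s) \<tau>) \<longleftrightarrow>
      (\<exists>\<tau>. \<forall>s\<in>G. (sheet_part s (embed \<phi>), \<tau>) \<in> closure (trace_graph s c))"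
    if \<phi>: "sob \<phi>" and cG: "(c, G) \<in> junctions" for c G
  proof -
    have sh: "s \<in> sheets" if "s \<in> G" for s using junction_strip[OF cG that] by blast
    have ne: "G \<noteq> {}" using cG by (auto simp: junctions_def)
    have Am: "{0<..<a} \<in> sets lebesgue" by simp
    show ?thesis
    proof
      assume "\<exists>\<tau>. \<forall>s\<in>G. has_trace (dom s) (dirs s) a c (\<phi> s) \<tau>"
      then show "\<exists>\<tau>. \<forall>s\<in>G. (sheet_part s (embed \<phi>), \<tau>) \<in> closure (trace_graph s c)"
        using has_trace_iff[OF sh \<phi>] by blast
    next
      assume "\<exists>\<tau>. \<forall>s\<in>G. (sheet_part s (embed \<phi>), \<tau>) \<in> closure (trace_graph s c)"
      then obtain \<tau> where \<tau>: "\<And>s. s \<in> G \<Longrightarrow> (sheet_part s (embed \<phi>), \<tau>) \<in> closure (trace_graph s c)" by blast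
      obtain s where "s \<in> G" using ne by blast
      from trace_graph_restr[OF \<tau>[OF this]] have r: "l2_on {0<..<a} (l2_fun \<tau>) = \<tau>" by (simp add: restr_eq)
      have "has_trace (dom s) (dirs s) a c (\<phi> s) (l2_fun \<tau>)" if "s \<in> G" for s
        using has_trace_iff[OF sh[OF that] \<phi>, of c "l2_fun \<tau>"] \<tau>[OF that] by (simp add: r L2_on_l2_fun[OF Am])
      then show "\<exists>\<tau>. \<forall>s\<in>G. has_trace (dom s) (dirs s) a c (\<phi> s) \<tau>" by blast
    qed
  qed
  then show ?thesis unfolding H_space_junctions traces_def by blast
qed

text \<open>The image of the weakly differentiable functions, described by equations that are
  continuous in the state: coordinates vanish outside their domain, and integration by parts holds.
  The factor \<open>sqrt (wt s)\<close> stems from the scaled value coordinate.\<close>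

definition weak_states :: "state set" where
  "weak_states = {e. \<forall>s\<in>sheets. restr (dom s) (coord e s None) = coord e s None \<and>
     (\<forall>b\<in>dirs s. restr (dom s) (coord e s (Some b)) = coord e s (Some b) \<and>
        (\<forall>\<phi>. test_function (dom s) \<phi> \<longrightarrow> coord e s None \<bullet> l2_on (dom s) (partial b \<phi>)
           = - sqrt (wt s) * (coord e s (Some b) \<bullet> l2_on (dom s) \<phi>)))}"

lemma embed_weak_states:
  assumes \<phi>: "sob \<phi>" shows "embed \<phi> \<in> weak_states"
  unfolding weak_states_def
proof (intro CollectI ballI conjI allI impI)
  fix s assume s: "s \<in> sheets"
  have r: "restr (dom s) (l2_on (dom s) u) = l2_on (dom s) u" if "u \<in> L2 (lebesgue_on (dom s))" for u
    by (rule restr_l2_on[OF lmeasurable_dom that])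
  show "restr (dom s) (coord (embed \<phi>) s None) = coord (embed \<phi>) s None"
    using s r[OF sob_L2[OF \<phi> s]] linear_cmul[OF bounded_linear.linear[OF bounded_linear_restr[OF lmeasurable_dom]]] by simp
  fix b assume b: "b \<in> dirs s"
  show "restr (dom s) (coord (embed \<phi>) s (Some b)) = coord (embed \<phi>) s (Some b)"
    using s b r[OF sob_weak_partial(1)[OF \<phi> s b]] by simp
  fix \<psi> assume "test_function (dom s) \<psi>"
  then have "l2_on (dom s) (\<phi> s) \<bullet> l2_on (dom s) (partial b \<psi>) = - (l2_on (dom s) (weak_partial (dom s) b (\<phi> s)) \<bullet> l2_on (dom s) \<psi>)"
    using sob_weak_partial[OF \<phi> s b] weak_derivative_iff[OF open_dom _ sob_L2[OF \<phi> s] sob_weak_partial(1)[OF \<phi> s b]]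
      dirs_Basis(1) b by blast
  then show "coord (embed \<phi>) s None \<bullet> l2_on (dom s) (partial b \<psi>) = - sqrt (wt s) * (coord (embed \<phi>) s (Some b) \<bullet> l2_on (dom s) \<psi>)"
    using s b by simp
qed

lemma unembed_value:
  assumes s: "s \<in> sheets" and e: "restr (dom s) (coord e s None) = coord e s None"
  shows "unembed e s \<in> L2 (lebesgue_on (dom s))" "sqrt (wt s) *\<^sub>R l2_on (dom s) (unembed e s) = coord e s None"
proof -
  have eq: "unembed e s = (\<lambda>x. 1 / sqrt (wt s) * l2_fun (coord e s None) x)" by (simp add: unembed_def)
  show "unembed e s \<in> L2 (lebesgue_on (dom s))"
    unfolding eq by (intro L2_mult L2_on_l2_fun sets_dom)
  have "l2_on (dom s) (unembed e s) = (1 / sqrt (wt s)) *\<^sub>R l2_on (dom s) (l2_fun (coord e s None))"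
    unfolding eq by (rule l2_on_scaleR[OF sets_dom L2_on_l2_fun[OF sets_dom]])
  then show "sqrt (wt s) *\<^sub>R l2_on (dom s) (unembed e s) = coord e s None"
    using e wt_pos[OF s] by (simp add: restr_eq)
qed

lemma unembed_weak_states:
  assumes e: "e \<in> weak_states"
  shows "sob (unembed e)" "embed (unembed e) = e"
proof -
  have r1: "restr (dom s) (coord e s None) = coord e s None" if "s \<in> sheets" for s
    using e that by (auto simp: weak_states_def)
  have r2: "l2_on (dom s) (l2_fun (coord e s (Some b))) = coord e s (Some b)" if "s \<in> sheets" "b \<in> dirs s" for s b
    using e that by (auto simp: weak_states_def restr_eq)
  have wd: "weak_derivative (dom s) b (unembed e s) (l2_fun (coord e s (Some b)))" if s: "s \<in> sheets" and b: "b \<in> dirs s" for s b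
  proof -
    have bB: "b \<in> Basis" using dirs_Basis(1) b by blast
    note u = unembed_value[OF s r1[OF s]]
    have "l2_on (dom s) (unembed e s) \<bullet> l2_on (dom s) (partial b \<psi>) = - (coord e s (Some b) \<bullet> l2_on (dom s) \<psi>)"
      if t: "test_function (dom s) \<psi>" for \<psi>
    proof -
      have "sqrt (wt s) * (l2_on (dom s) (unembed e s) \<bullet> l2_on (dom s) (partial b \<psi>)) = coord e s None \<bullet> l2_on (dom s) (partial b \<psi>)"
        unfolding u(2)[symmetric] by simp
      also have "\<dots> = - sqrt (wt s) * (coord e s (Some b) \<bullet> l2_on (dom s) \<psi>)"
        using e s b t unfolding weak_states_def by blast
      finally have "sqrt (wt s) * (l2_on (dom s) (unembed e s) \<bullet> l2_on (dom s) (partial b \<psi>)) = sqrt (wt s) * (- (coord e s (Some b) \<bullet> l2_on (dom s) \<psi>))"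
        by simp
      then show ?thesis using wt_pos[OF s] by (subst (asm) mult_left_cancel) auto
    qed
    then show ?thesis
      by (simp add: weak_derivative_iff[OF open_dom bB u(1) L2_on_l2_fun[OF sets_dom]] r2[OF s b])
  qed
  note I = sob_embedI[of "unembed e" "\<lambda>s b. l2_fun (coord e s (Some b))", OF unembed_value(1)[OF _ r1] L2_on_l2_fun[OF sets_dom] wd]
  show "sob (unembed e)" by (rule I(1)) auto
  have "embed (unembed e) = state (\<lambda>s d. case d of None \<Rightarrow> sqrt (wt s) *\<^sub>R l2_on (dom s) (unembed e s)
      | Some b \<Rightarrow> l2_on (dom s) (l2_fun (coord e s (Some b))))" by (rule I(2)) auto
  also have "\<dots> = state (coord e)"
    by (rule state_cong) (simp_all add: unembed_value(2)[OF _ r1] r2)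
  finally show "embed (unembed e) = e" by (simp add: state_coord)
qed

definition H_states :: "state set" where "H_states = weak_states \<inter> traces"

lemma embed_H: "\<phi> \<in> H_space \<Omega> a l \<Longrightarrow> embed \<phi> \<in> H_states"
  using embed_weak_states by (auto simp: H_space_iff H_states_def)

lemma unembed_H: "e \<in> H_states \<Longrightarrow> unembed e \<in> H_space \<Omega> a l" "e \<in> H_states \<Longrightarrow> embed (unembed e) = e"
  using unembed_weak_states[of e] by (auto simp: H_space_iff H_states_def)

lemma closed_weak_states: "closed weak_states"
proof -
  note bl = bounded_linear_restr[OF lmeasurable_dom]
  have c: "continuous_on UNIV (\<lambda>e. coord e s d)" for s d
    by (rule bounded_linear.continuous_on[OF bounded_linear_coord continuous_on_id])
  have "closed {e. restr (dom s) (coord e s d) = coord e s d}" for s d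
    by (intro closed_Collect_eq bounded_linear.continuous_on[OF bl] c)
  moreover have "closed {e. coord e s None \<bullet> l2_on (dom s) (partial b \<phi>)
      = - sqrt (wt s) * (coord e s (Some b) \<bullet> l2_on (dom s) \<phi>)}" for s b \<phi>
    by (intro closed_Collect_eq continuous_intros c)
  ultimately show ?thesis
    unfolding weak_states_def Ball_def by (intro closed_Collect_all closed_Collect_imp closed_Collect_conj open_Collect_const) auto
qed

lemma traces_lincomb:
  assumes "x \<in> traces" "y \<in> traces" shows "x + r *\<^sub>R y \<in> traces"
  unfolding traces_def
proof (rule CollectI, clarify)
  fix c G assume cG: "(c, G) \<in> junctions"
  obtain \<tau> where t: "\<forall>s\<in>G. (sheet_part s x, \<tau>) \<in> closure (trace_graph s c)"
    using assms(1) cG unfolding traces_def by blast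
  obtain \<sigma> where s: "\<forall>s\<in>G. (sheet_part s y, \<sigma>) \<in> closure (trace_graph s c)"
    using assms(2) cG unfolding traces_def by blast
  have "(sheet_part s' (x + r *\<^sub>R y), \<tau> + r *\<^sub>R \<sigma>) \<in> closure (trace_graph s' c)" if "s' \<in> G" for s'
  proof -
    note lin = bounded_linear.linear[OF bounded_linear_sheet_part]
    note sub = subspace_closure[OF subspace_trace_graph]
    have "(sheet_part s' x, \<tau>) + r *\<^sub>R (sheet_part s' y, \<sigma>) \<in> closure (trace_graph s' c)"
      using t s that by (intro subspace_add[OF sub] subspace_scale[OF sub]) auto
    then show ?thesis by (simp add: linear_add[OF lin] linear_cmul[OF lin])
  qed
  then show "\<exists>\<tau>. \<forall>s\<in>G. (sheet_part s (x + r *\<^sub>R y), \<tau>) \<in> closure (trace_graph s c)" by blast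
qed

lemma zero_traces: "0 \<in> traces"
proof -
  have "(sheet_part s 0, 0) \<in> closure (trace_graph s c)" for s c
    using subspace_0[OF subspace_closure[OF subspace_trace_graph]] linear_0[OF bounded_linear.linear[OF bounded_linear_sheet_part]]
    by (simp flip: zero_prod_def)
  then show ?thesis unfolding traces_def by blast
qed

text \<open>Along a convergent sequence of states the common traces are Cauchy, by
  \<open>trace_graph_bound\<close> on a single sheet of the junction. Their limit is a common trace
  on all its sheets because the graphs are closed.\<close>

lemma closed_traces: "closed traces"
  unfolding closed_sequential_limits
proof (intro allI impI, elim conjE)
  fix x e assume x: "\<forall>n. x n \<in> traces" and lim: "x \<longlonglongrightarrow> e"
  show "e \<in> traces" unfolding traces_def
  proof (rule CollectI, clarify)
    fix c G assume cG: "(c, G) \<in> junctions"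
    have "\<forall>n. \<exists>\<tau>. \<forall>s\<in>G. (sheet_part s (x n), \<tau>) \<in> closure (trace_graph s c)"
      using x cG unfolding traces_def by blast
    then obtain \<tau> where t: "\<And>n s. s \<in> G \<Longrightarrow> (sheet_part s (x n), \<tau> n) \<in> closure (trace_graph s c)" by metis
    obtain s0 where s0: "s0 \<in> G" using cG by (auto simp: junctions_def)
    obtain C where C: "\<And>z. z \<in> closure (trace_graph s0 c) \<Longrightarrow> norm (snd z) \<le> C * norm (fst z)"
      using trace_graph_bound[OF cG s0] by blast
    note lin = bounded_linear.linear[OF bounded_linear_sheet_part]
    have part_lim: "(\<lambda>n. sheet_part s (x n)) \<longlonglongrightarrow> sheet_part s e" for s
      by (rule bounded_linear.tendsto[OF bounded_linear_sheet_part lim])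
    have bnd: "norm (\<tau> m - \<tau> n) \<le> \<bar>C\<bar> * norm (sheet_part s0 (x m) - sheet_part s0 (x n))" for m n
    proof -
      have "(sheet_part s0 (x m), \<tau> m) - (sheet_part s0 (x n), \<tau> n) \<in> closure (trace_graph s0 c)"
        by (intro subspace_diff[OF subspace_closure[OF subspace_trace_graph]] t s0)
      from C[OF this] have "norm (\<tau> m - \<tau> n) \<le> C * norm (sheet_part s0 (x m) - sheet_part s0 (x n))" by simp
      also have "\<dots> \<le> \<bar>C\<bar> * norm (sheet_part s0 (x m) - sheet_part s0 (x n))" by (intro mult_right_mono) auto
      finally show ?thesis .
    qed
    have "Cauchy \<tau>"
    proof (rule metric_CauchyI)
      fix \<epsilon> :: real assume e: "\<epsilon> > 0"
      then have "\<epsilon> / (\<bar>C\<bar> + 1) > 0" by simp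
      from metric_CauchyD[OF LIMSEQ_imp_Cauchy[OF part_lim[of s0]] this] obtain N where
        N: "\<And>m n. m \<ge> N \<Longrightarrow> n \<ge> N \<Longrightarrow> dist (sheet_part s0 (x m)) (sheet_part s0 (x n)) < \<epsilon> / (\<bar>C\<bar> + 1)" by blast
      have "dist (\<tau> m) (\<tau> n) < \<epsilon>" if "m \<ge> N" "n \<ge> N" for m n
      proof -
        have "norm (\<tau> m - \<tau> n) \<le> (\<bar>C\<bar> + 1) * norm (sheet_part s0 (x m) - sheet_part s0 (x n))"
          by (rule order_trans[OF bnd]) (simp add: mult_right_mono)
        also have "\<dots> < (\<bar>C\<bar> + 1) * (\<epsilon> / (\<bar>C\<bar> + 1))"
          using N[OF that] by (intro mult_strict_left_mono) (auto simp: dist_norm)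
        finally show ?thesis by (simp add: dist_norm add_nonneg_pos less_imp_neq[symmetric])
      qed
      then show "\<exists>M. \<forall>m\<ge>M. \<forall>n\<ge>M. dist (\<tau> m) (\<tau> n) < \<epsilon>" by blast
    qed
    then obtain \<tau>' where t': "\<tau> \<longlonglongrightarrow> \<tau>'" using Cauchy_convergent convergent_def by blast
    have "(sheet_part s e, \<tau>') \<in> closure (trace_graph s c)" if s: "s \<in> G" for s
    proof (rule closed_sequentially[OF closed_closure])
      show "(sheet_part s (x n), \<tau> n) \<in> closure (trace_graph s c)" for n by (rule t[OF s])
      show "(\<lambda>n. (sheet_part s (x n), \<tau> n)) \<longlonglongrightarrow> (sheet_part s e, \<tau>')" by (intro tendsto_Pair part_lim t')
    qed
    then show "\<exists>\<tau>. \<forall>s\<in>G. (sheet_part s e, \<tau>) \<in> closure (trace_graph s c)" by blast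
  qed
qed

lemma closed_H_states: "closed H_states"
  unfolding H_states_def by (intro closed_Int closed_weak_states closed_traces)

text \<open>For the weak part, combinations of states are read as combinations of functions through
  \<open>unembed\<close>.\<close>

lemma subspace_H_states: "subspace H_states"
proof -
  have lin: "x + r *\<^sub>R y \<in> H_states" if "x \<in> H_states" "y \<in> H_states" for x y r
  proof -
    have w: "x \<in> weak_states" "y \<in> weak_states" and t: "x \<in> traces" "y \<in> traces" using that by (auto simp: H_states_def)
    have "embed (\<lambda>s z. 1 * unembed x s z + r * unembed y s z) = x + r *\<^sub>R y"
      using sob_lincomb(2)[OF unembed_weak_states(1)[OF w(1)] unembed_weak_states(1)[OF w(2)], of 1 r]
      by (simp add: unembed_weak_states(2)[OF w(1)] unembed_weak_states(2)[OF w(2)])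
    moreover have "embed (\<lambda>s z. 1 * unembed x s z + r * unembed y s z) \<in> weak_states"
      by (intro embed_weak_states sob_lincomb(1) unembed_weak_states w)
    ultimately have "x + r *\<^sub>R y \<in> weak_states" by (simp only:)
    then show ?thesis using traces_lincomb[OF t] by (simp add: H_states_def)
  qed
  have 0: "0 \<in> H_states"
  proof -
    have "0 \<in> weak_states"
      using linear_0[OF bounded_linear.linear[OF bounded_linear_restr[OF lmeasurable_dom]]] by (simp add: weak_states_def)
    then show ?thesis using zero_traces by (simp add: H_states_def)
  qed
  show ?thesis
  proof (rule subspaceI)
    show "x + y \<in> H_states" if "x \<in> H_states" "y \<in> H_states" for x y
      using lin[OF that, of 1] by simp
    show "r *\<^sub>R x \<in> H_states" if "x \<in> H_states" for r x
      using lin[OF 0 that, of r] by simp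
  qed (rule 0)
qed

end

section \<open>The homogenized problem\<close>

text \<open>By the mean value theorem an increment of \<open>f\<close> is a slope between
  \<open>c1\<close> and \<open>c2\<close> times the increment of the argument.\<close>

lemma C1_bounded_derivative:
  fixes f :: "real \<Rightarrow> real"
  assumes f: "f C1_differentiable_on UNIV" and d: "\<And>s. c1 \<le> deriv f s \<and> deriv f s \<le> c2" and c1: "0 < c1"
  shows "\<bar>f x - f y\<bar> \<le> c2 * \<bar>x - y\<bar>" "c1 * (x - y)\<^sup>2 \<le> (f x - f y) * (x - y)"
proof -
  have D: "(f has_real_derivative deriv f s) (at s)" for s
  proof -
    obtain D' where "(f has_vector_derivative D' s) (at s)"
      using f unfolding C1_differentiable_on_def by blast
    then have "(f has_real_derivative D' s) (at s)" by (simp only: has_real_derivative_iff_has_vector_derivative)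
    then show ?thesis using DERIV_imp_deriv by metis
  qed
  have "\<exists>m. c1 \<le> m \<and> m \<le> c2 \<and> f x - f y = m * (x - y)" for x y
  proof (cases x y rule: linorder_cases)
    case less
    from MVT2[OF less, of f "deriv f"] D obtain z where "f y - f x = (y - x) * deriv f z" by blast
    then show ?thesis using d[of z] by (intro exI[of _ "deriv f z"]) (simp add: algebra_simps)
  next
    case equal
    then show ?thesis using d[of 0] by (intro exI[of _ c1]) auto
  next
    case greater
    from MVT2[OF greater, of f "deriv f"] D obtain z where "f x - f y = (x - y) * deriv f z" by blast
    then show ?thesis using d[of z] by (intro exI[of _ "deriv f z"]) (simp add: algebra_simps)
  qed
  then obtain m where m: "c1 \<le> m" "m \<le> c2" "f x - f y = m * (x - y)" by blast
  show "\<bar>f x - f y\<bar> \<le> c2 * \<bar>x - y\<bar>"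
    using m c1 by (simp add: abs_mult mult_right_mono)
  show "c1 * (x - y)\<^sup>2 \<le> (f x - f y) * (x - y)"
    using mult_right_mono[OF m(1) zero_le_power2[of "x - y"]] by (simp add: m(3) power2_eq_square mult.assoc)
qed

text \<open>By completeness only one of the two functions has to be known measurable. This serves
  integrands built from a weak solution and its derivative, whose measurability is not known
  beforehand.\<close>

lemma borel_measurable_AE_lebesgue_on:
  fixes f g :: "'a::euclidean_space \<Rightarrow> real"
  assumes U: "U \<in> sets lebesgue" and f: "f \<in> borel_measurable (lebesgue_on U)" and ae: "AE x in lebesgue_on U. f x = g x"
  shows "g \<in> borel_measurable (lebesgue_on U)" "(\<integral>x. g x \<partial>lebesgue_on U) = (\<integral>x. f x \<partial>lebesgue_on U)"
proof -
  have iff: "u \<in> borel_measurable (lebesgue_on U) \<longleftrightarrow> (\<lambda>x. u x * indicator U x) \<in> borel_measurable lebesgue" for u :: "'a \<Rightarrow> real"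
    using borel_measurable_restrict_space_iff[of U lebesgue u] U by (simp add: mult.commute)
  have "AE x in lebesgue. x \<in> U \<longrightarrow> f x = g x" using ae by (simp only: AE_on_iff[OF U])
  then have "AE x in lebesgue. f x * indicator U x = g x * indicator U x"
    by eventually_elim (simp add: indicator_def)
  from borel_measurable_AE_lebesgue[OF f[unfolded iff] this] show g: "g \<in> borel_measurable (lebesgue_on U)"
    by (simp only: iff)
  show "(\<integral>x. g x \<partial>lebesgue_on U) = (\<integral>x. f x \<partial>lebesgue_on U)"
  proof (rule Bochner_Integration.integral_cong_AE[OF g f])
    show "AE x in lebesgue_on U. g x = f x" using ae by eventually_elim simp
  qed
qed

lemma square_integrable_sum:
  "finite I \<Longrightarrow> (\<And>i. i \<in> I \<Longrightarrow> square_integrable M (f i)) \<Longrightarrow> square_integrable M (\<lambda>x. \<Sum>i\<in>I. f i x)"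
  by (induction rule: finite_induct) (auto intro: square_integrable_add)

section \<open>Reaction terms, elliptic operator and source in state coordinates\<close>

locale homogenized = multisheet +
  fixes T c1 c2 :: real and \<alpha> \<beta> :: "nat \<Rightarrow> real" and k :: "real \<Rightarrow> real" and ki \<kappa> :: "nat \<Rightarrow> real \<Rightarrow> real"
    and f\<^sub>0 :: "point \<times> real \<Rightarrow> real" and g\<^sub>0 :: "nat \<Rightarrow> point \<times> real \<Rightarrow> real"
  assumes T: "T > 0" and c1: "c1 > 0" and c2: "c2 > 0"
    and k: "k C1_differentiable_on UNIV" "\<And>s. c1 \<le> deriv k s \<and> deriv k s \<le> c2"
    and ki: "\<And>i. i \<le> 2 \<Longrightarrow> ki i C1_differentiable_on UNIV" "\<And>i s. i \<le> 2 \<Longrightarrow> c1 \<le> deriv (ki i) s \<and> deriv (ki i) s \<le> c2"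
    and \<kappa>: "\<And>i. i \<le> 2 \<Longrightarrow> \<kappa> i C1_differentiable_on UNIV" "\<And>i s. i \<le> 2 \<Longrightarrow> c1 \<le> deriv (\<kappa> i) s \<and> deriv (\<kappa> i) s \<le> c2"
    and f\<^sub>0: "f\<^sub>0 \<in> L2 (lebesgue_on (\<Omega> \<times> {0<..<T}))"
    and g\<^sub>0: "\<And>i. i \<le> 2 \<Longrightarrow> \<beta> i = 1 \<Longrightarrow> g\<^sub>0 i \<in> L2 (lebesgue_on (layer a l i \<times> {0<..<T}))"
begin

abbreviation M\<^sub>T :: "real measure" where "M\<^sub>T \<equiv> lebesgue_on {0<..<T}"

text \<open>The reaction integrand of a sheet divided by the weight of the sheet;
  \<open>\<kappa>\<close> is unweighted in the operator and therefore appears with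
  \<open>1 / h i m\<close>.\<close>

definition react :: "sheet \<Rightarrow> real \<Rightarrow> real" where
  "react s r = (case s of Upper \<Rightarrow> k r | Branch i m \<Rightarrow> ki i r + 2 * kronecker (\<alpha> i) 1 / h i m * \<kappa> i r)"

text \<open>\<open>c2\<close> for the first reaction and \<open>2 * c2 / h i m\<close> for the
  second, counted whether or not the latter is present.\<close>

definition react_lip :: "sheet \<Rightarrow> real" where "react_lip s = c2 * (1 + 2 / wt s)"

lemma react_lip_nonneg: "s \<in> sheets \<Longrightarrow> 0 \<le> react_lip s"
  using c2 wt_pos[of s] by (simp add: react_lip_def)

lemma react_bounds:
  assumes s: "s \<in> sheets"
  shows "\<bar>react s x - react s y\<bar> \<le> react_lip s * \<bar>x - y\<bar>" "c1 * (x - y)\<^sup>2 \<le> (react s x - react s y) * (x - y)"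
proof -
  have "\<bar>react s x - react s y\<bar> \<le> react_lip s * \<bar>x - y\<bar> \<and> c1 * (x - y)\<^sup>2 \<le> (react s x - react s y) * (x - y)"
  proof (cases s)
    case Upper
    have "c2 * \<bar>x - y\<bar> \<le> react_lip s * \<bar>x - y\<bar>"
      using c2 Upper by (intro mult_right_mono) (auto simp: react_lip_def)
    then show ?thesis using C1_bounded_derivative[OF k c1, of x y] Upper by (simp add: react_def)
  next
    case (Branch i m)
    then have im: "i \<le> 2" "m \<in> branches i" using s by (auto simp: sheets_def)
    define q where "q = 2 * kronecker (\<alpha> i) 1 / h i m"
    have q: "0 \<le> q" "q \<le> 2 / h i m" using h[OF im] by (auto simp: q_def kronecker_def)
    note b1 = C1_bounded_derivative[OF ki[OF im(1)] c1, of x y]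
    note b2 = C1_bounded_derivative[OF \<kappa>[OF im(1)] c1, of x y]
    have eq: "react s x - react s y = (ki i x - ki i y) + q * (\<kappa> i x - \<kappa> i y)"
    proof -
      have "react s r = ki i r + q * \<kappa> i r" for r by (simp only: react_def Branch q_def sheet.case)
      then show ?thesis by (simp add: right_diff_distrib)
    qed
    have "\<bar>react s x - react s y\<bar> \<le> \<bar>ki i x - ki i y\<bar> + q * \<bar>\<kappa> i x - \<kappa> i y\<bar>"
      unfolding eq using q(1) by (metis abs_mult abs_of_nonneg abs_triangle_ineq)
    also have "\<dots> \<le> c2 * \<bar>x - y\<bar> + (2 / h i m) * (c2 * \<bar>x - y\<bar>)"
      using b1(1) b2(1) q h[OF im] by (intro add_mono mult_mono) auto
    also have "\<dots> = react_lip s * \<bar>x - y\<bar>" by (simp add: react_lip_def Branch algebra_simps)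
    finally have 1: "\<bar>react s x - react s y\<bar> \<le> react_lip s * \<bar>x - y\<bar>" .
    have "0 \<le> c1 * (x - y)\<^sup>2" using c1 by simp
    then have "0 \<le> q * ((\<kappa> i x - \<kappa> i y) * (x - y))" using b2(2) q(1) by simp
    then have "c1 * (x - y)\<^sup>2 \<le> (ki i x - ki i y) * (x - y) + q * ((\<kappa> i x - \<kappa> i y) * (x - y))"
      using b1(2) by linarith
    then show ?thesis using 1 unfolding eq by (simp add: distrib_right mult.assoc)
  qed
  then show "\<bar>react s x - react s y\<bar> \<le> react_lip s * \<bar>x - y\<bar>" "c1 * (x - y)\<^sup>2 \<le> (react s x - react s y) * (x - y)"
    by auto
qed

text \<open>The reaction term in the coordinate \<open>sqrt (wt s) * \<phi> s\<close> used by \<open>embed\<close>.\<close>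

definition scaled :: "sheet \<Rightarrow> real \<Rightarrow> real" where
  "scaled s r = sqrt (wt s) * react s (r / sqrt (wt s))"

lemma scaled_lipschitz: "s \<in> sheets \<Longrightarrow> (react_lip s)-lipschitz_on UNIV (scaled s)"
proof (rule lipschitz_onI)
  fix x y assume s: "s \<in> sheets"
  let ?w = "sqrt (wt s)"
  have w: "?w > 0" using wt_pos[OF s] by simp
  have "dist (scaled s x) (scaled s y) = ?w * \<bar>react s (x / ?w) - react s (y / ?w)\<bar>"
    using w by (simp add: scaled_def dist_real_def abs_mult flip: right_diff_distrib)
  also have "\<dots> \<le> ?w * (react_lip s * \<bar>x / ?w - y / ?w\<bar>)"
    using w by (intro mult_left_mono react_bounds s) auto
  also have "\<bar>x / ?w - y / ?w\<bar> = \<bar>x - y\<bar> / ?w" using w by (simp flip: diff_divide_distrib)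
  finally show "dist (scaled s x) (scaled s y) \<le> react_lip s * dist x y"
    using w by (simp add: dist_real_def)
qed (rule react_lip_nonneg)

lemma scaled_monotone: "s \<in> sheets \<Longrightarrow> c1 * (x - y)\<^sup>2 \<le> (scaled s x - scaled s y) * (x - y)"
proof -
  assume s: "s \<in> sheets"
  let ?w = "sqrt (wt s)"
  have w: "?w > 0" "?w * ?w = wt s" using wt_pos[OF s] by auto
  have "c1 * (x - y)\<^sup>2 = wt s * (c1 * (x / ?w - y / ?w)\<^sup>2)"
    using w wt_pos[OF s] by (simp add: power_divide flip: diff_divide_distrib)
  also have "\<dots> \<le> wt s * ((react s (x / ?w) - react s (y / ?w)) * (x / ?w - y / ?w))"
    using wt_pos[OF s] by (intro mult_left_mono react_bounds s) auto
  also have "\<dots> = (scaled s x - scaled s y) * (x - y)"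
  proof -
    have cancel: "u * u * (r * (d / u)) = u * r * d" if "u > 0" for u r d :: real using that by simp
    have "wt s * ((react s (x / ?w) - react s (y / ?w)) * (x / ?w - y / ?w))
        = ?w * ?w * ((react s (x / ?w) - react s (y / ?w)) * ((x - y) / ?w))"
      by (simp only: w(2) diff_divide_distrib)
    also have "\<dots> = ?w * (react s (x / ?w) - react s (y / ?w)) * (x - y)" by (rule cancel[OF w(1)])
    finally show ?thesis by (simp only: scaled_def right_diff_distrib)
  qed
  finally show ?thesis .
qed

text \<open>The vector that represents the operator in the inner product of states. Derivatives are
  multiplied by \<open>wt s\<close> because their integrals are weighted in the operator but not in
  the inner product of H.\<close>

definition N :: "state \<Rightarrow> state" where
  "N e = state (\<lambda>s d. case d of None \<Rightarrow> superpose (dom s) (scaled s) (coord e s None) | Some b \<Rightarrow> wt s *\<^sub>R coord e s (Some b))"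

lemma coord_N [simp]:
  "s \<in> sheets \<Longrightarrow> coord (N e) s None = superpose (dom s) (scaled s) (coord e s None)"
  "s \<in> sheets \<Longrightarrow> b \<in> dirs s \<Longrightarrow> coord (N e) s (Some b) = wt s *\<^sub>R coord e s (Some b)"
  by (simp_all add: N_def)

definition N_lip :: real where "N_lip = (\<Sum>s\<in>sheets. react_lip s + wt s)"

text \<open>\<open>c1\<close> is the monotonicity constant of the reactions and \<open>wt\<close>
  that of the derivative coordinates; the 1 is for the identity that \<open>B\<^sub>H\<close> has on
  the orthogonal complement of \<open>H_states\<close>.\<close>

definition N_mono :: real where "N_mono = Min (insert 1 (insert c1 (wt ` sheets)))"

lemma N_lip: "0 \<le> N_lip" "s \<in> sheets \<Longrightarrow> react_lip s \<le> N_lip" "s \<in> sheets \<Longrightarrow> wt s \<le> N_lip"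
proof -
  have pos: "0 \<le> react_lip s" "0 \<le> wt s" if "s \<in> sheets" for s
    using that react_lip_nonneg wt_pos by (auto intro: less_imp_le)
  then show "0 \<le> N_lip" unfolding N_lip_def by (intro sum_nonneg) auto
  have "react_lip s + wt s \<le> N_lip" if "s \<in> sheets"
    unfolding N_lip_def using that pos finite_sheets by (intro member_le_sum[of s sheets "\<lambda>s. react_lip s + wt s"]) auto
  then show "s \<in> sheets \<Longrightarrow> react_lip s \<le> N_lip" "s \<in> sheets \<Longrightarrow> wt s \<le> N_lip" using pos[of s] by auto
qed

lemma N_mono: "0 < N_mono" "N_mono \<le> 1" "N_mono \<le> c1" "s \<in> sheets \<Longrightarrow> N_mono \<le> wt s"
proof -
  have fin: "finite (insert 1 (insert c1 (wt ` sheets)))" using finite_sheets by simp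
  have le: "r \<in> insert 1 (insert c1 (wt ` sheets)) \<Longrightarrow> N_mono \<le> r" for r
    unfolding N_mono_def by (rule Min_le[OF fin])
  show "N_mono \<le> 1" "N_mono \<le> c1" "s \<in> sheets \<Longrightarrow> N_mono \<le> wt s" using le by auto
  have "N_mono \<in> insert 1 (insert c1 (wt ` sheets))" unfolding N_mono_def by (rule Min_in[OF fin]) simp
  then show "0 < N_mono" using c1 wt_pos by auto
qed

lemma norm_state_sq: "(norm x)\<^sup>2 = (\<Sum>s\<in>sheets. (norm (coord x s None))\<^sup>2 + (\<Sum>b\<in>dirs s. (norm (coord x s (Some b)))\<^sup>2))"
  by (simp only: power2_norm_eq_inner inner_state)

lemma N_lipschitz: "N_lip-lipschitz_on UNIV N"
proof (rule lipschitz_onI)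
  fix x y
  have "(norm (N x - N y))\<^sup>2 \<le> (\<Sum>s\<in>sheets. N_lip\<^sup>2 * (norm (coord (x - y) s None))\<^sup>2 + (\<Sum>b\<in>dirs s. N_lip\<^sup>2 * (norm (coord (x - y) s (Some b)))\<^sup>2))"
    unfolding norm_state_sq
  proof (intro sum_mono add_mono)
    fix s assume s: "s \<in> sheets"
    have "norm (coord (N x - N y) s None) \<le> react_lip s * norm (coord (x - y) s None)"
      using lipschitz_on_normD[OF superpose_lipschitz[OF lmeasurable_dom[of s] scaled_lipschitz[OF s]], where x = "coord x s None" and y = "coord y s None"] s
      by simp
    also have "\<dots> \<le> N_lip * norm (coord (x - y) s None)" using N_lip(2)[OF s] by (intro mult_right_mono) auto
    finally have "(norm (coord (N x - N y) s None))\<^sup>2 \<le> (N_lip * norm (coord (x - y) s None))\<^sup>2" by (intro power_mono) auto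
    then show "(norm (coord (N x - N y) s None))\<^sup>2 \<le> N_lip\<^sup>2 * (norm (coord (x - y) s None))\<^sup>2" by (simp only: power_mult_distrib)
    fix b assume b: "b \<in> dirs s"
    have "coord (N x - N y) s (Some b) = wt s *\<^sub>R coord (x - y) s (Some b)" using s b by (simp add: algebra_simps)
    then have "norm (coord (N x - N y) s (Some b)) \<le> N_lip * norm (coord (x - y) s (Some b))"
      using N_lip(3)[OF s] wt_pos[OF s] by (simp add: mult_right_mono)
    then have "(norm (coord (N x - N y) s (Some b)))\<^sup>2 \<le> (N_lip * norm (coord (x - y) s (Some b)))\<^sup>2" by (intro power_mono) auto
    then show "(norm (coord (N x - N y) s (Some b)))\<^sup>2 \<le> N_lip\<^sup>2 * (norm (coord (x - y) s (Some b)))\<^sup>2" by (simp only: power_mult_distrib)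
  qed
  also have "\<dots> = N_lip\<^sup>2 * (norm (x - y))\<^sup>2" unfolding norm_state_sq by (simp only: sum_distrib_left distrib_left)
  finally have "(norm (N x - N y))\<^sup>2 \<le> (N_lip * norm (x - y))\<^sup>2" by (simp only: power_mult_distrib)
  then show "dist (N x) (N y) \<le> N_lip * dist x y"
    unfolding dist_norm by (rule power2_le_imp_le) (simp add: N_lip)
qed (rule N_lip)

text \<open>Confined to \<open>H_states\<close>, where value coordinates vanish outside their
  domains, so that the superposition controls their full norm. Coercivity comes from the reactions
  for the values and from the elliptic part for the derivatives.\<close>

lemma N_strongly_monotone:
  assumes x: "x \<in> H_states" and y: "y \<in> H_states"
  shows "N_mono * (norm (x - y))\<^sup>2 \<le> (N x - N y) \<bullet> (x - y)"
proof -
  have r: "l2_on (dom s) (l2_fun (coord e s None)) = coord e s None" if "e \<in> H_states" "s \<in> sheets" for e s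
    using that by (auto simp: H_states_def weak_states_def restr_eq)
  have "N_mono * (norm (x - y))\<^sup>2 = (\<Sum>s\<in>sheets. N_mono * (norm (coord (x - y) s None))\<^sup>2 + (\<Sum>b\<in>dirs s. N_mono * (norm (coord (x - y) s (Some b)))\<^sup>2))"
    unfolding norm_state_sq by (simp only: sum_distrib_left distrib_left)
  also have "\<dots> \<le> (N x - N y) \<bullet> (x - y)"
    unfolding inner_state
  proof (intro sum_mono add_mono)
    fix s assume s: "s \<in> sheets"
    have "N_mono * (norm (coord (x - y) s None))\<^sup>2 \<le> c1 * (norm (coord (x - y) s None))\<^sup>2"
      using N_mono(3) by (intro mult_right_mono) auto
    also have "\<dots> \<le> coord (N x - N y) s None \<bullet> coord (x - y) s None"
      using superpose_strongly_monotone[OF lmeasurable_dom[of s] scaled_lipschitz[OF s] scaled_monotone[OF s]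
          L2_on_l2_fun[OF sets_dom, where x = "coord x s None"] L2_on_l2_fun[OF sets_dom, where x = "coord y s None"]] s
      by (simp add: r[OF x s] r[OF y s])
    finally show "N_mono * (norm (coord (x - y) s None))\<^sup>2 \<le> coord (N x - N y) s None \<bullet> coord (x - y) s None" .
    fix b assume b: "b \<in> dirs s"
    have "coord (N x - N y) s (Some b) = wt s *\<^sub>R coord (x - y) s (Some b)" using s b by (simp add: algebra_simps)
    then show "N_mono * (norm (coord (x - y) s (Some b)))\<^sup>2 \<le> coord (N x - N y) s (Some b) \<bullet> coord (x - y) s (Some b)"
      using mult_right_mono[OF N_mono(4)[OF s], of "(norm (coord (x - y) s (Some b)))\<^sup>2"] by (simp add: power2_norm_eq_inner)
  qed
  finally show ?thesis .
qed

lemma hom_operator_eq: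
  assumes \<phi>: "sob \<phi>" and \<psi>: "sob \<psi>"
  shows "hom_operator \<Omega> a l h k ki \<kappa> \<alpha> \<phi> \<psi> = N (embed \<phi>) \<bullet> embed \<psi>"
proof -
  define D where "D s b = (\<integral>x. weak_partial (dom s) b (\<phi> s) x * weak_partial (dom s) b (\<psi> s) x \<partial>lebesgue_on (dom s))" for s b
  define R where "R s = (\<integral>x. react s (\<phi> s x) * \<psi> s x \<partial>lebesgue_on (dom s))" for s
  have rL: "(\<lambda>x. react s (\<phi> s x)) \<in> L2 (lebesgue_on (dom s))" if s: "s \<in> sheets" for s
  proof -
    have "(react_lip s)-lipschitz_on UNIV (react s)"
      by (rule lipschitz_onI) (use react_bounds(1)[OF s] react_lip_nonneg[OF s] in \<open>auto simp: dist_real_def\<close>)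
    from superpose_L2[OF lmeasurable_dom this sob_L2[OF \<phi> s]] show ?thesis .
  qed
  have Ri: "integrable (lebesgue_on (dom s)) (\<lambda>x. react s (\<phi> s x) * \<psi> s x)" if "s \<in> sheets" for s
    by (rule L2_integrable[OF rL[OF that] sob_L2[OF \<psi> that]])
  have Di: "integrable (lebesgue_on (dom s)) (\<lambda>x. weak_partial (dom s) b (\<phi> s) x * weak_partial (dom s) b (\<psi> s) x)"
    if "s \<in> sheets" "b \<in> dirs s" for s b
    by (rule L2_integrable[OF sob_weak_partial(1)[OF \<phi> that] sob_weak_partial(1)[OF \<psi> that]])
  have "N (embed \<phi>) \<bullet> embed \<psi> = (\<Sum>s\<in>sheets. wt s * R s + (\<Sum>b\<in>dirs s. wt s * D s b))"
    unfolding inner_state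
  proof (intro sum.cong arg_cong2[where f = "(+)"] refl)
    fix s assume s: "s \<in> sheets"
    have w: "sqrt (wt s) > 0" using wt_pos[OF s] by simp
    have sL: "(\<lambda>x. sqrt (wt s) * \<phi> s x) \<in> L2 (lebesgue_on (dom s))" by (intro L2_mult sob_L2[OF \<phi> s])
    have "coord (N (embed \<phi>)) s None = superpose (dom s) (scaled s) (l2_on (dom s) (\<lambda>x. sqrt (wt s) * \<phi> s x))"
      using s by (simp add: l2_on_scaleR[OF sets_dom sob_L2[OF \<phi> s]])
    also have "\<dots> = l2_on (dom s) (\<lambda>x. scaled s (sqrt (wt s) * \<phi> s x))"
      by (rule superpose_on[OF lmeasurable_dom scaled_lipschitz[OF s] sL])
    \<comment> \<open>The scalings cancel inside:
      \<open>scaled s (sqrt (wt s) * r) = sqrt (wt s) * react s r\<close>.\<close>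
    also have "\<dots> = sqrt (wt s) *\<^sub>R l2_on (dom s) (\<lambda>x. react s (\<phi> s x))"
      using w by (simp add: scaled_def l2_on_scaleR[OF sets_dom rL[OF s]])
    finally have "coord (N (embed \<phi>)) s None \<bullet> coord (embed \<psi>) s None
        = wt s * (l2_on (dom s) (\<lambda>x. react s (\<phi> s x)) \<bullet> l2_on (dom s) (\<psi> s))"
      using s wt_pos[OF s] by (simp flip: mult.assoc)
    then show "coord (N (embed \<phi>)) s None \<bullet> coord (embed \<psi>) s None = wt s * R s"
      by (simp add: R_def inner_l2_on[OF sets_dom rL[OF s] sob_L2[OF \<psi> s]])
    fix b assume b: "b \<in> dirs s"
    show "coord (N (embed \<phi>)) s (Some b) \<bullet> coord (embed \<psi>) s (Some b) = wt s * D s b"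
      using s b by (simp add: D_def inner_l2_on[OF sets_dom sob_weak_partial(1)[OF \<phi> s b] sob_weak_partial(1)[OF \<psi> s b]])
  qed
  also have "\<dots> = (R Upper + (\<Sum>b\<in>Basis. D Upper b))
      + (\<Sum>i\<le>2. \<Sum>m\<in>branches i. h i m * R (Branch i m) + h i m * D (Branch i m) (0, 1))"
    by (simp add: sum_sheets sum_dirs)
  also have "R Upper + (\<Sum>b\<in>Basis. D Upper b) = (\<integral>x. grad_dot \<Omega> (\<phi> Upper) (\<psi> Upper) x + k (\<phi> Upper x) * \<psi> Upper x \<partial>lebesgue_on \<Omega>)"
  proof -
    have U: "Upper \<in> sheets" by (simp add: sheets_def)
    have gi: "integrable (lebesgue_on \<Omega>) (\<lambda>x. weak_partial \<Omega> b (\<phi> Upper) x * weak_partial \<Omega> b (\<psi> Upper) x)" if "b \<in> Basis" for b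
      using Di[OF U, of b] that by (simp add: dirs_def)
    have ki: "integrable (lebesgue_on \<Omega>) (\<lambda>x. k (\<phi> Upper x) * \<psi> Upper x)"
      using Ri[OF U] by (simp add: react_def)
    show ?thesis unfolding grad_dot_def D_def R_def
      using gi ki by (simp add: react_def Bochner_Integration.integral_sum)
  qed
  also have "(\<Sum>i\<le>2. \<Sum>m\<in>branches i. h i m * R (Branch i m) + h i m * D (Branch i m) (0, 1))
      = (\<Sum>i\<le>2. \<Sum>m\<in>branches i. (\<integral>x. h i m * weak_partial (layer a l i) (0,1) (\<phi> (Branch i m)) x *
                     weak_partial (layer a l i) (0,1) (\<psi> (Branch i m)) x +
             h i m * ki i (\<phi> (Branch i m) x) * \<psi> (Branch i m) x +
             2 * kronecker (\<alpha> i) 1 * \<kappa> i (\<phi> (Branch i m) x) * \<psi> (Branch i m) x \<partial>lebesgue_on (layer a l i)))"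
  proof (intro sum.cong refl)
    fix i m assume i: "i \<in> {..2::nat}" and m: "m \<in> branches i"
    have B: "Branch i m \<in> sheets" and hp: "h i m \<noteq> 0" using i m h[of i m] by (auto simp: sheets_def)
    have "h i m * R (Branch i m) + h i m * D (Branch i m) (0, 1) = (\<integral>x. h i m * (react (Branch i m) (\<phi> (Branch i m) x) * \<psi> (Branch i m) x)
        + h i m * (weak_partial (layer a l i) (0,1) (\<phi> (Branch i m)) x * weak_partial (layer a l i) (0,1) (\<psi> (Branch i m)) x) \<partial>lebesgue_on (layer a l i))"
      using Ri[OF B] Di[OF B, of "(0, 1)"] by (simp add: R_def D_def dirs_def)
    also have "\<dots> = (\<integral>x. h i m * weak_partial (layer a l i) (0,1) (\<phi> (Branch i m)) x *
                     weak_partial (layer a l i) (0,1) (\<psi> (Branch i m)) x +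
             h i m * ki i (\<phi> (Branch i m) x) * \<psi> (Branch i m) x +
             2 * kronecker (\<alpha> i) 1 * \<kappa> i (\<phi> (Branch i m) x) * \<psi> (Branch i m) x \<partial>lebesgue_on (layer a l i))"
      using hp by (intro Bochner_Integration.integral_cong refl) (simp add: react_def algebra_simps)
    finally show "h i m * R (Branch i m) + h i m * D (Branch i m) (0, 1) = \<dots>" .
  qed
  finally show ?thesis by (simp add: hom_operator_def)
qed

text \<open>The Kronecker factor is kept inside: if \<open>\<beta> i\<close> differs from 1, the
  source is the zero function, whatever \<open>g\<^sub>0 i\<close> is.\<close>

definition source :: "sheet \<Rightarrow> point \<times> real \<Rightarrow> real" where
  "source s = (case s of Upper \<Rightarrow> f\<^sub>0 | Branch i m \<Rightarrow> (\<lambda>z. 2 * kronecker (\<beta> i) 1 * g\<^sub>0 i z))"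

lemma source_L2: "s \<in> sheets \<Longrightarrow> source s \<in> L2 (lebesgue_on (dom s \<times> {0<..<T}))"
proof (cases s)
  case (Branch i m)
  assume "s \<in> sheets"
  then show ?thesis using Branch g\<^sub>0[of i] L2_mult[of "g\<^sub>0 i"]
    by (cases "\<beta> i = 1") (auto simp: sheets_def source_def kronecker_def L2_zero)
qed (simp add: source_def f\<^sub>0)

text \<open>A Riesz representation with one null set of times for all \<open>\<psi>\<close>: the
  null sets come from the finitely many sources and not from the test functions.\<close>

lemma functional_exists:
  obtains F where "square_integrable M\<^sub>T F"
    "AE t in M\<^sub>T. \<forall>\<psi>. sob \<psi> \<longrightarrow> hom_functional \<Omega> a l \<beta> f\<^sub>0 g\<^sub>0 t \<psi> = F t \<bullet> embed \<psi>"
proof -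
  let ?P = "\<lambda>s G. square_integrable M\<^sub>T G \<and>
      (AE t in M\<^sub>T. (\<lambda>x. source s (x, t)) \<in> L2 (lebesgue_on (dom s)) \<and> G t = l2_on (dom s) (\<lambda>x. source s (x, t)))"
  have ex: "\<forall>s\<in>sheets. \<exists>G. ?P s G"
  proof
    fix s assume s: "s \<in> sheets"
    show "\<exists>G. ?P s G"
      by (rule time_sections[OF open_dom source_L2[OF s]]) (rule exI, rule conjI)
  qed
  obtain G where P: "\<forall>s\<in>sheets. ?P s (G s)" using bchoice[OF ex] by (rule exE)
  have G: "\<And>s. s \<in> sheets \<Longrightarrow> square_integrable M\<^sub>T (G s)"
    "\<And>s. s \<in> sheets \<Longrightarrow> AE t in M\<^sub>T. (\<lambda>x. source s (x, t)) \<in> L2 (lebesgue_on (dom s)) \<and> G s t = l2_on (dom s) (\<lambda>x. source s (x, t))"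
    by (erule bspec[OF P, THEN conjunct1], erule bspec[OF P, THEN conjunct2])
  \<comment> \<open>The factor \<open>1 / sqrt (wt s)\<close> cancels the scaling of values in
    \<open>embed\<close>.\<close>
  define single where "single s x = state (\<lambda>s' d. if s' = s \<and> d = None then (1 / sqrt (wt s)) *\<^sub>R x else 0)" for s x
  have bl: "bounded_linear (single s)" for s
  proof (rule bounded_linear_intro[where K = "\<bar>1 / sqrt (wt s)\<bar>"])
    show "single s (x + y) = single s x + single s y" "single s (r *\<^sub>R x) = r *\<^sub>R single s x" for x y r
      unfolding single_def state_linear by (auto intro!: state_cong simp: scaleR_add_right)
    show "norm (single s x) \<le> norm x * \<bar>1 / sqrt (wt s)\<bar>" for x
    proof (rule power2_le_imp_le)
      have "(norm (single s x))\<^sup>2 = (\<Sum>s'\<in>sheets. if s' = s then (norm ((1 / sqrt (wt s)) *\<^sub>R x))\<^sup>2 else 0)"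
        unfolding norm_state_sq by (intro sum.cong refl) (simp add: single_def)
      also have "\<dots> \<le> (norm ((1 / sqrt (wt s)) *\<^sub>R x))\<^sup>2" using finite_sheets by (simp add: sum.delta)
      also have "\<dots> = (norm x * \<bar>1 / sqrt (wt s)\<bar>)\<^sup>2" by (simp only: norm_scaleR mult.commute)
      finally show "(norm (single s x))\<^sup>2 \<le> (norm x * \<bar>1 / sqrt (wt s)\<bar>)\<^sup>2" .
    qed simp
  qed
  define F where "F t = (\<Sum>s\<in>sheets. single s (G s t))" for t
  have single_inner: "single s x \<bullet> embed \<psi> = x \<bullet> l2_on (dom s) (\<psi> s)" if s: "s \<in> sheets" for s x \<psi>
  proof -
    have "single s x \<bullet> embed \<psi> = (\<Sum>s'\<in>sheets. if s' = s then x \<bullet> l2_on (dom s) (\<psi> s) else 0)"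
      unfolding inner_state using wt_pos by (intro sum.cong refl) (auto simp: single_def less_imp_neq[symmetric])
    then show ?thesis using s finite_sheets by simp
  qed
  show ?thesis
  proof (rule that[of F])
    show "square_integrable M\<^sub>T F"
      unfolding F_def by (intro square_integrable_sum finite_sheets square_integrable_bounded_linear_comp[OF bl] G)
    have "AE t in M\<^sub>T. \<forall>s\<in>sheets. (\<lambda>x. source s (x, t)) \<in> L2 (lebesgue_on (dom s)) \<and> G s t = l2_on (dom s) (\<lambda>x. source s (x, t))"
      by (rule AE_finite_allI[OF finite_sheets G(2)])
    then show "AE t in M\<^sub>T. \<forall>\<psi>. sob \<psi> \<longrightarrow> hom_functional \<Omega> a l \<beta> f\<^sub>0 g\<^sub>0 t \<psi> = F t \<bullet> embed \<psi>"
    proof eventually_elim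
      case (elim t)
      show ?case
      proof (intro allI impI)
        fix \<psi> assume \<psi>: "sob \<psi>"
        have "F t \<bullet> embed \<psi> = (\<Sum>s\<in>sheets. G s t \<bullet> l2_on (dom s) (\<psi> s))"
          unfolding F_def inner_sum_left by (intro sum.cong refl single_inner)
        also have "\<dots> = (\<Sum>s\<in>sheets. \<integral>x. source s (x, t) * \<psi> s x \<partial>lebesgue_on (dom s))"
          using elim by (intro sum.cong refl) (simp add: inner_l2_on[OF sets_dom _ sob_L2[OF \<psi>]])
        also have "\<dots> = hom_functional \<Omega> a l \<beta> f\<^sub>0 g\<^sub>0 t \<psi>"
          by (simp add: sum_sheets source_def hom_functional_def sum_distrib_left mult.assoc)
        finally show "hom_functional \<Omega> a l \<beta> f\<^sub>0 g\<^sub>0 t \<psi> = F t \<bullet> embed \<psi>" by simp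
      qed
    qed
  qed
qed

end

section \<open>Functions of time with values in V, in H and in the dual of H\<close>

context multisheet
begin

lemma H_sob: "\<phi> \<in> H_space \<Omega> a l \<Longrightarrow> sob \<phi>"
  by (simp add: H_space_iff)

lemma H_norm_diff:
  assumes "sob \<phi>" "sob \<psi>" shows "H_norm \<Omega> a l h (\<phi> - \<psi>) = norm (embed \<phi> - embed \<psi>)"
proof -
  have eq: "\<phi> - \<psi> = (\<lambda>s x. 1 * \<phi> s x + (- 1) * \<psi> s x)" by (simp add: fun_eq_iff)
  show ?thesis
    unfolding eq using sob_lincomb[OF assms, of 1 "- 1"] by (simp add: H_norm_eq)
qed

lemma V_norm_diff:
  assumes \<phi>: "\<phi> \<in> V_space \<Omega> a l" and \<psi>: "\<psi> \<in> V_space \<Omega> a l"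
  shows "V_norm \<Omega> a l h (\<phi> - \<psi>) = norm (embed_value \<phi> - embed_value \<psi>)"
proof -
  have eq: "(\<phi> - \<psi>) s = (\<lambda>x. \<phi> s x - \<psi> s x)" for s by (simp add: fun_eq_iff)
  have L: "\<phi> s \<in> L2 (lebesgue_on (dom s))" "\<psi> s \<in> L2 (lebesgue_on (dom s))" if "s \<in> sheets" for s
    using \<phi> \<psi> that by (auto simp: V_space_iff)
  have V: "\<phi> - \<psi> \<in> V_space \<Omega> a l" unfolding V_space_iff eq using L by (auto intro: L2_diff)
  have "embed_value (\<phi> - \<psi>) = embed_value \<phi> - embed_value \<psi>"
    unfolding embed_value_def state_linear eq
  proof (rule state_cong, goal_cases)
    case (1 s)
    then show ?case using L[OF 1] by (simp add: l2_on_diff[OF sets_dom] scaleR_diff_right)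
  qed simp
  then show ?thesis by (simp only: V_norm_eq[OF V])
qed

lemma zero_V: "(\<lambda>_ _. 0) \<in> V_space \<Omega> a l" "embed_value (\<lambda>_ _. 0) = 0"
proof -
  show "(\<lambda>_ _. 0) \<in> V_space \<Omega> a l" by (simp add: V_space_iff L2_zero)
  show "embed_value (\<lambda>_ _. 0) = 0"
    by (rule state_eqI) (simp_all add: embed_value_def l2_on_zero[OF sets_dom])
qed

text \<open>The image of V under \<open>embed_value\<close>. Its closedness is what matters: the
  abstract theorem places \<open>w t\<close> only in the closure of the range of the value
  operator.\<close>

definition value_states :: "state set" where
  "value_states = {y. value_part y = y} \<inter> (\<Inter>s\<in>sheets. {y. restr (dom s) (coord y s None) = coord y s None})"

lemma closed_value_states: "closed value_states"
  unfolding value_states_def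
  by (intro closed_Int closed_INT ballI closed_Collect_eq continuous_on_id
      bounded_linear.continuous_on[OF bounded_linear_value_part]
      bounded_linear.continuous_on[OF bounded_linear_restr[OF lmeasurable_dom]]
      bounded_linear.continuous_on[OF bounded_linear_coord])

lemma value_part_value_states: "e \<in> H_states \<Longrightarrow> value_part e \<in> value_states"
proof -
  assume e: "e \<in> H_states"
  have "value_part (value_part e) = value_part e"
    by (rule state_eqI) (simp_all add: value_part_def)
  moreover have "restr (dom s) (coord (value_part e) s None) = coord (value_part e) s None" if "s \<in> sheets" for s
    using e that by (simp add: H_states_def weak_states_def value_part_def)
  ultimately show ?thesis by (simp add: value_states_def)
qed

lemma unembed_value_states:
  assumes y: "y \<in> value_states" shows "unembed y \<in> V_space \<Omega> a l" "embed_value (unembed y) = y"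
proof -
  have vp: "value_part y = y" and r: "\<And>s. s \<in> sheets \<Longrightarrow> restr (dom s) (coord y s None) = coord y s None"
    using y by (auto simp: value_states_def)
  show "unembed y \<in> V_space \<Omega> a l" by (simp add: V_space_iff unembed_value(1)[OF _ r])
  have "embed_value (unembed y) = value_part y"
    unfolding embed_value_def value_part_def
    by (rule state_cong) (simp_all add: unembed_value(2)[OF _ r])
  then show "embed_value (unembed y) = y" by (simp only: vp)
qed

definition proj :: "state \<Rightarrow> state" where "proj = orth_proj H_states"

lemma proj:
  shows proj_H: "proj x \<in> H_states" and proj_id: "x \<in> H_states \<Longrightarrow> proj x = x"
    and proj_self_adjoint: "proj x \<bullet> y = x \<bullet> proj y" and norm_proj_le: "norm (proj x) \<le> norm x"
    and bounded_linear_proj: "bounded_linear proj"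
  unfolding proj_def
  using orth_proj(1)[OF closed_H_states subspace_H_states, of x] orth_proj_id[OF closed_H_states subspace_H_states, of x]
    orth_proj_self_adjoint[OF closed_H_states subspace_H_states, of x y]
    norm_orth_proj_le[OF closed_H_states subspace_H_states, of x] bounded_linear_orth_proj[OF closed_H_states subspace_H_states]
  by blast+

lemma proj_diff: "proj (x - y) = proj x - proj y"
  by (rule linear_diff[OF bounded_linear.linear[OF bounded_linear_proj]])

lemma proj_embed: "u \<in> H_space \<Omega> a l \<Longrightarrow> proj (embed u) = embed u"
  by (rule proj_id[OF embed_H])

text \<open>The functional with Riesz representative \<open>x\<close>. On \<open>H_states\<close>
  the correspondence is isometric, which turns state-valued functions of time into Bochner functions
  with values in the dual.\<close>

definition dual :: "state \<Rightarrow> msfun \<Rightarrow> real" where "dual x = (\<lambda>u. x \<bullet> embed u)"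

lemma dual_H_dual: "dual x \<in> H_dual \<Omega> a l h"
  unfolding H_dual_def
proof (intro CollectI conjI ballI allI exI[of _ "norm x"])
  fix \<phi> \<psi> p q assume "\<phi> \<in> H_space \<Omega> a l" "\<psi> \<in> H_space \<Omega> a l"
  then show "dual x (\<lambda>s y. p * \<phi> s y + q * \<psi> s y) = p * dual x \<phi> + q * dual x \<psi>"
    by (simp add: dual_def sob_lincomb(2) H_sob inner_add_right)
next
  fix \<phi> assume "\<phi> \<in> H_space \<Omega> a l"
  then show "\<bar>dual x \<phi>\<bar> \<le> norm x * H_norm \<Omega> a l h \<phi>"
    by (simp add: dual_def H_norm_eq H_sob Cauchy_Schwarz_ineq2)
qed

lemma H_dual_norm_dual:
  assumes x: "x \<in> H_states" shows "H_dual_norm \<Omega> a l h (dual x) = norm x"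
  unfolding H_dual_norm_def
proof (rule cSup_eq_maximum)
  let ?S = "{\<phi> \<in> H_space \<Omega> a l. H_norm \<Omega> a l h \<phi> \<le> 1}"
  \<comment> \<open>The supremum is attained at the normalized vector. For \<open>x = 0\<close> the
    convention \<open>1 / 0 = 0\<close> gives \<open>e = 0\<close>, which attains it as
    well.\<close>
  define e where "e = (1 / norm x) *\<^sub>R x"
  have e: "e \<in> H_states" unfolding e_def by (rule subspace_scale[OF subspace_H_states x])
  have "unembed e \<in> ?S" "\<bar>dual x (unembed e)\<bar> = norm x"
    using unembed_H[OF e] by (auto simp: H_norm_eq H_sob dual_def e_def dot_square_norm power2_eq_square)
  then show "norm x \<in> (\<lambda>\<phi>. \<bar>dual x \<phi>\<bar>) ` ?S" by (intro image_eqI[of _ _ "unembed e"]) auto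
  fix r assume "r \<in> (\<lambda>\<phi>. \<bar>dual x \<phi>\<bar>) ` ?S"
  then obtain \<phi> where \<phi>: "r = \<bar>dual x \<phi>\<bar>" "\<phi> \<in> ?S" by (rule imageE)
  have "\<bar>x \<bullet> embed \<phi>\<bar> \<le> norm x * norm (embed \<phi>)" by (rule Cauchy_Schwarz_ineq2)
  also have "\<dots> \<le> norm x * 1" using \<phi>(2) by (intro mult_left_mono) (auto simp: H_norm_eq H_sob)
  finally show "r \<le> norm x" using \<phi>(1) by (simp add: dual_def)
qed

lemma simple_approximation:
  assumes X: "square_integrable (lebesgue_on {0<..<T}) X" and H: "\<And>t. X t \<in> H_states"
  obtains s where "\<And>n. simple_function (lebesgue_on {0<..<T}) (s n)" "\<And>n t. s n t \<in> H_states"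
    "\<And>t. t \<in> {0<..<T} \<Longrightarrow> (\<lambda>n. norm (s n t - X t)) \<longlonglongrightarrow> 0"
proof -
  have m: "X \<in> borel_measurable (lebesgue_on {0<..<T})" using X by (simp add: square_integrable_def)
  obtain s where s: "\<And>n. simple_function (lebesgue_on {0<..<T}) (s n)"
    "\<And>t. t \<in> space (lebesgue_on {0<..<T}) \<Longrightarrow> (\<lambda>n. s n t) \<longlonglongrightarrow> X t"
    using borel_measurable_implies_sequence_metric[OF m, of 0] by blast
  show ?thesis
  \<comment> \<open>The approximating simple functions may leave \<open>H_states\<close>; projecting
    them keeps them simple and does not change the limit.\<close>
  proof (rule that[of "\<lambda>n t. proj (s n t)"])
    show "simple_function (lebesgue_on {0<..<T}) (\<lambda>t. proj (s n t))" for n by (rule simple_function_compose1[OF s(1)])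
    show "proj (s n t) \<in> H_states" for n t by (rule proj_H)
    fix t assume "t \<in> {0<..<T}"
    then have "(\<lambda>n. proj (s n t)) \<longlonglongrightarrow> proj (X t)"
      by (intro bounded_linear.tendsto[OF bounded_linear_proj] s(2)) simp
    then have "(\<lambda>n. proj (s n t) - X t) \<longlonglongrightarrow> 0" by (intro LIM_zero) (simp only: proj_id[OF H])
    then show "(\<lambda>n. norm (proj (s n t) - X t)) \<longlonglongrightarrow> 0" by (rule tendsto_norm_zero)
  qed
qed

lemma bochner_H:
  assumes X: "square_integrable (lebesgue_on {0<..<T}) X" and H: "\<And>t. X t \<in> H_states"
  shows "(\<lambda>t. unembed (X t)) \<in> bochner_L2 T (H_space \<Omega> a l) (H_norm \<Omega> a l h)"
proof -
  obtain s where s: "\<And>n. simple_function (lebesgue_on {0<..<T}) (s n)" "\<And>n t. s n t \<in> H_states"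
    "\<And>t. t \<in> {0<..<T} \<Longrightarrow> (\<lambda>n. norm (s n t - X t)) \<longlonglongrightarrow> 0"
    by (rule simple_approximation[OF X H]) (rule that)
  show ?thesis
    unfolding bochner_L2_def
  proof (intro CollectI conjI exI[of _ "\<lambda>n t. unembed (s n t)"] allI ballI AE_I2)
    show "simple_function (lebesgue_on {0<..<T}) (\<lambda>t. unembed (s n t))" for n by (rule simple_function_compose1[OF s(1)])
    show "unembed (X t) \<in> H_space \<Omega> a l" "unembed (s n t) \<in> H_space \<Omega> a l" for n t
      by (intro unembed_H H s(2))+
    fix t assume "t \<in> space (lebesgue_on {0<..<T})"
    then have "t \<in> {0<..<T}" by simp
    from s(3)[OF this] show "(\<lambda>n. H_norm \<Omega> a l h (unembed (s n t) - unembed (X t))) \<longlonglongrightarrow> 0"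
      by (simp add: H_norm_diff H_sob unembed_H s(2) H)
  next
    show "integrable (lebesgue_on {0<..<T}) (\<lambda>t. (H_norm \<Omega> a l h (unembed (X t)))\<^sup>2)"
      using X by (simp add: H_norm_eq H_sob unembed_H H square_integrable_def)
  qed
qed

lemma bochner_dual:
  assumes X: "square_integrable (lebesgue_on {0<..<T}) X" and H: "\<And>t. X t \<in> H_states"
  shows "(\<lambda>t. dual (X t)) \<in> bochner_L2 T (H_dual \<Omega> a l h) (H_dual_norm \<Omega> a l h)"
proof -
  obtain s where s: "\<And>n. simple_function (lebesgue_on {0<..<T}) (s n)" "\<And>n t. s n t \<in> H_states"
    "\<And>t. t \<in> {0<..<T} \<Longrightarrow> (\<lambda>n. norm (s n t - X t)) \<longlonglongrightarrow> 0"
    by (rule simple_approximation[OF X H]) (rule that)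
  have diff: "dual x - dual y = dual (x - y)" for x y by (simp add: dual_def fun_eq_iff inner_diff_left)
  show ?thesis
    unfolding bochner_L2_def
  proof (intro CollectI conjI exI[of _ "\<lambda>n t. dual (s n t)"] allI ballI AE_I2)
    show "simple_function (lebesgue_on {0<..<T}) (\<lambda>t. dual (s n t))" for n by (rule simple_function_compose1[OF s(1)])
    show "dual (X t) \<in> H_dual \<Omega> a l h" "dual (s n t) \<in> H_dual \<Omega> a l h" for n t
      by (rule dual_H_dual)+
    fix t assume "t \<in> space (lebesgue_on {0<..<T})"
    then have "t \<in> {0<..<T}" by simp
    from s(3)[OF this] show "(\<lambda>n. H_dual_norm \<Omega> a l h (dual (s n t) - dual (X t))) \<longlonglongrightarrow> 0"
      by (simp add: diff H_dual_norm_dual subspace_diff[OF subspace_H_states] s(2) H)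
  next
    show "integrable (lebesgue_on {0<..<T}) (\<lambda>t. (H_dual_norm \<Omega> a l h (dual (X t)))\<^sup>2)"
      using X by (simp add: H_dual_norm_dual H square_integrable_def)
  qed
qed

end

section \<open>Translation between the abstract problem and the weak formulation\<close>

context homogenized
begin

text \<open>
  The problem is posed on the closed subspace \<open>H_states\<close>; the projection onto it extends the
  operators to all states, as \<open>parabolic_problem\<close> requires.
\<close>

definition Q\<^sub>H :: "state \<Rightarrow> state" where "Q\<^sub>H x = value_part (proj x)"

definition K\<^sub>H :: "state \<Rightarrow> state" where "K\<^sub>H x = proj (value_part (proj x))"

text \<open>The operator is the identity on the orthogonal complement of \<open>H_states\<close>; an
  extension by 0 would not be strongly monotone there.\<close>

definition B\<^sub>H :: "state \<Rightarrow> state" where "B\<^sub>H x = proj (N (proj x)) + (x - proj x)"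

lemma B\<^sub>H_diff: "B\<^sub>H x - B\<^sub>H y = proj (N (proj x) - N (proj y)) + (x - y - proj (x - y))"
  by (simp add: B\<^sub>H_def proj_diff)

lemma B\<^sub>H_lipschitz: "(N_lip + 2)-lipschitz_on UNIV B\<^sub>H"
proof (rule lipschitz_onI)
  show "0 \<le> N_lip + 2" using N_lip(1) by simp
  fix x y
  have "norm (proj (N (proj x) - N (proj y))) \<le> norm (N (proj x) - N (proj y))" by (rule norm_proj_le)
  moreover have "norm (N (proj x) - N (proj y)) \<le> N_lip * norm (proj x - proj y)"
    by (rule lipschitz_on_normD[OF N_lipschitz]) auto
  moreover have "N_lip * norm (proj x - proj y) \<le> N_lip * norm (x - y)"
    using norm_proj_le[of "x - y"] by (intro mult_left_mono N_lip(1)) (simp add: proj_diff)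
  moreover have "norm (x - y - proj (x - y)) \<le> norm (x - y) + norm (proj (x - y))" by (rule norm_triangle_ineq4)
  moreover have "norm (proj (x - y)) \<le> norm (x - y)" by (rule norm_proj_le)
  moreover have "norm (B\<^sub>H x - B\<^sub>H y) \<le> norm (proj (N (proj x) - N (proj y))) + norm (x - y - proj (x - y))"
    unfolding B\<^sub>H_diff by (rule norm_triangle_ineq)
  ultimately have "norm (B\<^sub>H x - B\<^sub>H y) \<le> N_lip * norm (x - y) + 2 * norm (x - y)" by linarith
  then show "dist (B\<^sub>H x) (B\<^sub>H y) \<le> (N_lip + 2) * dist x y" by (simp only: dist_norm distrib_right)
qed

lemma B\<^sub>H_strongly_monotone: "N_mono * (norm (x - y))\<^sup>2 \<le> (B\<^sub>H x - B\<^sub>H y) \<bullet> (x - y)"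
proof -
  \<comment> \<open>\<open>p\<close> is the component of \<open>x - y\<close> in
    \<open>H_states\<close>, where \<open>N\<close> acts, and \<open>q\<close> the orthogonal one,
    on which the operator is the identity.\<close>
  define p where "p = proj (x - y)"
  define q where "q = x - y - p"
  have d: "x - y = p + q" by (simp add: q_def)
  have "proj q = 0" unfolding q_def proj_diff p_def by (simp add: proj_id[OF proj_H])
  moreover have "p = proj p" unfolding p_def by (rule proj_id[OF proj_H, symmetric])
  ultimately have orth: "p \<bullet> q = 0" using proj_self_adjoint[of p q] by simp
  have px: "proj x - proj y = p" by (simp only: p_def proj_diff)
  have "(B\<^sub>H x - B\<^sub>H y) \<bullet> (x - y) = proj (N (proj x) - N (proj y)) \<bullet> (x - y) + q \<bullet> (p + q)"
    unfolding B\<^sub>H_diff inner_add_left by (simp only: q_def p_def d[symmetric])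
      (simp add: q_def p_def)
  also have "proj (N (proj x) - N (proj y)) \<bullet> (x - y) = (N (proj x) - N (proj y)) \<bullet> (proj x - proj y)"
    by (simp only: proj_self_adjoint p_def px)
  also have "q \<bullet> (p + q) = (norm q)\<^sup>2" using orth by (simp add: inner_add_right inner_commute power2_norm_eq_inner)
  finally have eq: "(B\<^sub>H x - B\<^sub>H y) \<bullet> (x - y) = (N (proj x) - N (proj y)) \<bullet> (proj x - proj y) + (norm q)\<^sup>2" .
  have "(norm (x - y))\<^sup>2 = (norm p)\<^sup>2 + (norm q)\<^sup>2"
    unfolding d power2_norm_eq_inner using orth by (simp add: inner_add_left inner_add_right inner_commute)
  moreover have "N_mono * (norm p)\<^sup>2 \<le> (N (proj x) - N (proj y)) \<bullet> (proj x - proj y)"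
    using N_strongly_monotone[OF proj_H proj_H, of x y] by (simp only: px)
  moreover have "N_mono * (norm q)\<^sup>2 \<le> 1 * (norm q)\<^sup>2" using N_mono(2) by (intro mult_right_mono) auto
  ultimately show ?thesis unfolding eq by (simp add: distrib_left)
qed

sublocale parabolic: parabolic_problem Q\<^sub>H K\<^sub>H B\<^sub>H "N_lip + 2" N_mono T
proof (rule parabolic_problem.intro)
  show Q: "bounded_linear Q\<^sub>H" unfolding Q\<^sub>H_def
    by (rule bounded_linear_compose[OF bounded_linear_value_part bounded_linear_proj])
  show "bounded_linear K\<^sub>H" unfolding K\<^sub>H_def
    using bounded_linear_compose[OF bounded_linear_proj Q] by (simp only: Q\<^sub>H_def)
  show "K\<^sub>H x \<bullet> y = Q\<^sub>H x \<bullet> Q\<^sub>H y" for x y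
    unfolding K\<^sub>H_def Q\<^sub>H_def proj_self_adjoint by (rule value_part_self_adjoint)
qed (rule B\<^sub>H_lipschitz N_mono(1) B\<^sub>H_strongly_monotone T)+

lemma Q\<^sub>H_embed: "u \<in> H_space \<Omega> a l \<Longrightarrow> Q\<^sub>H (embed u) = embed_value u"
  by (simp add: Q\<^sub>H_def proj_embed value_part_embed)

lemma V_inner_Q\<^sub>H:
  assumes "y \<in> H_space \<Omega> a l" "u \<in> H_space \<Omega> a l"
  shows "V_inner \<Omega> a l h y u = Q\<^sub>H (embed y) \<bullet> Q\<^sub>H (embed u)"
  using assms by (simp only: V_inner_eq[OF sob_V[OF H_sob] sob_V[OF H_sob]] Q\<^sub>H_embed)

text \<open>Against vectors of \<open>H_states\<close> the extension of the operator to all states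
  is invisible, since \<open>x - proj x\<close> is orthogonal to them.\<close>

lemma rhs_inner: "(proj f - B\<^sub>H x) \<bullet> proj u = (f - N (proj x)) \<bullet> proj u"
proof -
  have "proj f - B\<^sub>H x = proj (f - N (proj x)) - (x - proj x)" by (simp add: B\<^sub>H_def proj_diff)
  moreover have "(x - proj x) \<bullet> proj u = 0"
    by (simp add: proj_self_adjoint[symmetric] proj_diff proj_id[OF proj_H])
  moreover have "proj (f - N (proj x)) \<bullet> proj u = (f - N (proj x)) \<bullet> proj u"
    by (simp only: proj_self_adjoint proj_id[OF proj_H])
  ultimately show ?thesis by (simp add: inner_diff_left)
qed

abbreviation weak :: "(real \<Rightarrow> msfun) \<Rightarrow> bool" where
  "weak \<equiv> weak_solution \<Omega> a l h T (hom_operator \<Omega> a l h k ki \<kappa> \<alpha>) (hom_functional \<Omega> a l \<beta> f\<^sub>0 g\<^sub>0)"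

context
  fixes F\<^sub>0 :: "real \<Rightarrow> state"
  assumes F\<^sub>0: "square_integrable M\<^sub>T F\<^sub>0"
    and functional: "AE t in M\<^sub>T. \<forall>\<psi>. sob \<psi> \<longrightarrow> hom_functional \<Omega> a l \<beta> f\<^sub>0 g\<^sub>0 t \<psi> = F\<^sub>0 t \<bullet> embed \<psi>"
begin

abbreviation F where "F \<equiv> \<lambda>t. proj (F\<^sub>0 t)"

lemma square_integrable_F: "square_integrable M\<^sub>T F"
  by (rule square_integrable_bounded_linear_comp[OF bounded_linear_proj F\<^sub>0])

lemma solution_weak: "\<exists>y. weak y"
proof -
  interpret finite_measure M\<^sub>T by (rule finite_measure_interval)
  obtain v w where sol: "parabolic.solves F v w" and wc: "\<And>t. t \<in> {0..T} \<Longrightarrow> w t \<in> closure (range Q\<^sub>H)"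
    by (rule parabolic.solution_exists[OF square_integrable_F]) (rule that)
  have v: "square_integrable M\<^sub>T v" and w: "continuous_on {0..T} w" "w 0 = 0" "AE t in M\<^sub>T. w t = Q\<^sub>H (v t)"
    and eq: "\<And>\<eta> u. test_function {0<..<T} \<eta> \<Longrightarrow>
      (\<integral>t. (Q\<^sub>H (v t) \<bullet> Q\<^sub>H u) * deriv \<eta> t \<partial>M\<^sub>T) = - (\<integral>t. ((F t - B\<^sub>H (v t)) \<bullet> u) * \<eta> t \<partial>M\<^sub>T)"
    using sol by (simp_all only: parabolic.solves_def)
  define y where "y t = unembed (proj (v t))" for t
  \<comment> \<open>The Riesz representative of the time derivative, read off from the
    equation.\<close>
  define z where "z t = proj (F\<^sub>0 t) - proj (N (proj (v t)))" for t
  define c where "c t = unembed (w t)" for t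
  have yH: "y t \<in> H_space \<Omega> a l" and ey: "embed (y t) = proj (v t)" for t
    unfolding y_def by (rule unembed_H[OF proj_H])+
  have z: "z t \<bullet> proj u = (F\<^sub>0 t - N (proj (v t))) \<bullet> proj u" for t u
    unfolding z_def proj_diff[symmetric] by (simp only: proj_self_adjoint proj_id[OF proj_H])
  have pv: "square_integrable M\<^sub>T (\<lambda>t. proj (v t))"
    by (rule square_integrable_bounded_linear_comp[OF bounded_linear_proj v])
  have y_bochner: "y \<in> bochner_L2 T (H_space \<Omega> a l) (H_norm \<Omega> a l h)"
    unfolding y_def by (rule bochner_H[OF pv proj_H])
  have z_bochner: "(\<lambda>t. dual (z t)) \<in> bochner_L2 T (H_dual \<Omega> a l h) (H_dual_norm \<Omega> a l h)"
  proof (rule bochner_dual)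
    show "square_integrable M\<^sub>T z" unfolding z_def
      by (intro square_integrable_diff square_integrable_F square_integrable_bounded_linear_comp[OF bounded_linear_proj]
          square_integrable_lipschitz[OF finite_measure_axioms N_lipschitz pv])
    show "z t \<in> H_states" for t unfolding z_def by (intro subspace_diff[OF subspace_H_states] proj_H)
  qed
  have deriv: "time_derivative \<Omega> a l h T y (\<lambda>t. dual (z t))"
    unfolding time_derivative_def
  proof (intro allI impI ballI)
    fix \<eta> u assume \<eta>: "test_function {0<..<T} \<eta>" and u: "u \<in> H_space \<Omega> a l"
    have "V_inner \<Omega> a l h (y t) u = Q\<^sub>H (v t) \<bullet> Q\<^sub>H (embed u)" for t
      unfolding V_inner_Q\<^sub>H[OF yH u] ey by (simp only: Q\<^sub>H_def proj_id[OF proj_H])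
    moreover have "dual (z t) u = (F t - B\<^sub>H (v t)) \<bullet> embed u" for t
      using z[of t "embed u"] rhs_inner[of "F\<^sub>0 t" "v t" "embed u"] by (simp only: dual_def proj_embed[OF u])
    ultimately show "(\<integral>t. V_inner \<Omega> a l h (y t) u * deriv \<eta> t \<partial>M\<^sub>T) = - (\<integral>t. dual (z t) u * \<eta> t \<partial>M\<^sub>T)"
      using eq[OF \<eta>, of "embed u"] by (simp only:)
  qed
  have equation: "AE t in M\<^sub>T. \<forall>u\<in>H_space \<Omega> a l. dual (z t) u + hom_operator \<Omega> a l h k ki \<kappa> \<alpha> (y t) u = hom_functional \<Omega> a l \<beta> f\<^sub>0 g\<^sub>0 t u"
    using functional
  proof eventually_elim
    case (elim t)
    show ?case
    proof
      fix u assume u: "u \<in> H_space \<Omega> a l"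
      have "dual (z t) u = (F\<^sub>0 t - N (proj (v t))) \<bullet> embed u"
        using z[of t "embed u"] by (simp only: dual_def proj_embed[OF u])
      then show "dual (z t) u + hom_operator \<Omega> a l h k ki \<kappa> \<alpha> (y t) u = hom_functional \<Omega> a l \<beta> f\<^sub>0 g\<^sub>0 t u"
        using elim H_sob[OF u] by (simp add: hom_operator_eq[OF H_sob[OF yH] H_sob[OF u]] ey inner_diff_left)
    qed
  qed
  have init: "initial_value \<Omega> a l h T y (\<lambda>_ _. 0)"
  proof -
    \<comment> \<open>Each \<open>w t\<close> is a limit of value parts of states in
      \<open>H_states\<close>; closedness of \<open>value_states\<close> makes it the state of a
      function in V, and \<open>c\<close> is the continuous representative.\<close>
    have "range Q\<^sub>H \<subseteq> value_states" unfolding Q\<^sub>H_def using value_part_value_states[OF proj_H] by (rule image_subsetI)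
    then have "closure (range Q\<^sub>H) \<subseteq> value_states" by (rule closure_minimal[OF _ closed_value_states])
    then have wv: "w t \<in> value_states" if "t \<in> {0..T}" for t using wc[OF that] by (rule subsetD)
    have cV: "c t \<in> V_space \<Omega> a l" and ec: "embed_value (c t) = w t" if "t \<in> {0..T}" for t
      unfolding c_def by (rule unembed_value_states[OF wv[OF that]])+
    have "((\<lambda>s. V_norm \<Omega> a l h (c s - c t)) \<longlongrightarrow> 0) (at t within {0..T})" if t: "t \<in> {0..T}" for t
    proof (rule Lim_transform_eventually)
      have "(w \<longlongrightarrow> w t) (at t within {0..T})" using w(1) t unfolding continuous_on_def by (rule bspec)
      then show "((\<lambda>s. norm (w s - w t)) \<longlongrightarrow> 0) (at t within {0..T})" by (intro tendsto_norm_zero LIM_zero)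
      show "\<forall>\<^sub>F s in at t within {0..T}. norm (w s - w t) = V_norm \<Omega> a l h (c s - c t)"
        unfolding eventually_at_filter
      proof (intro always_eventually allI impI)
        fix s assume "s \<in> {0..T}"
        from V_norm_diff[OF cV[OF this] cV[OF t]] show "norm (w s - w t) = V_norm \<Omega> a l h (c s - c t)"
          by (simp only: ec[OF \<open>s \<in> {0..T}\<close>] ec[OF t])
      qed
    qed
    moreover have "AE t in M\<^sub>T. ms_eq \<Omega> a l (y t) (c t)"
      using w(3) AE_space
    proof eventually_elim
      case (elim t)
      then have t: "t \<in> {0..T}" by simp
      have "embed_value (y t) = Q\<^sub>H (embed (y t))" by (rule Q\<^sub>H_embed[OF yH, symmetric])
      also have "\<dots> = w t" unfolding ey elim(1) by (simp only: Q\<^sub>H_def proj_id[OF proj_H])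
      finally show ?case by (simp only: ms_eq_iff[OF sob_V[OF H_sob[OF yH]] cV[OF t]] ec[OF t])
    qed
    moreover have "ms_eq \<Omega> a l (c 0) (\<lambda>_ _. 0)"
    proof -
      have 0: "0 \<in> {0..T}" using T by simp
      show ?thesis by (simp only: ms_eq_iff[OF cV[OF 0] zero_V(1)] ec[OF 0] zero_V(2) w(2))
    qed
    ultimately show ?thesis unfolding initial_value_def using cV by (intro exI[of _ c] conjI ballI)
  qed
  show ?thesis
    unfolding weak_solution_def
    by (rule exI[of _ y], rule conjI[OF y_bochner], rule conjI[OF _ init],
        rule bexI[of _ "\<lambda>t. dual (z t)"], rule conjI[OF deriv equation], rule z_bochner)
qed

text \<open>The converse translation, which makes abstract uniqueness applicable to every weak
  solution. Measurability is given only through approximating simple functions, the initial value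
  only through a continuous representative.\<close>

lemma weak_solves:
  assumes "weak y"
  obtains X w where "parabolic.solves F X w" "AE t in M\<^sub>T. y t \<in> H_space \<Omega> a l \<and> embed (y t) = X t"
proof -
  interpret finite_measure M\<^sub>T by (rule finite_measure_interval)
  have bochner: "y \<in> bochner_L2 T (H_space \<Omega> a l) (H_norm \<Omega> a l h)"
    and init: "initial_value \<Omega> a l h T y (\<lambda>_ _. 0)"
    using assms unfolding weak_solution_def by (simp_all only:)
  obtain y' where deriv: "time_derivative \<Omega> a l h T y y'"
    and equation: "AE t in M\<^sub>T. \<forall>u\<in>H_space \<Omega> a l. y' t u + hom_operator \<Omega> a l h k ki \<kappa> \<alpha> (y t) u = hom_functional \<Omega> a l \<beta> f\<^sub>0 g\<^sub>0 t u"
    using assms unfolding weak_solution_def by (elim conjE bexE)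
  have yH: "AE t in M\<^sub>T. y t \<in> H_space \<Omega> a l" and yi: "integrable M\<^sub>T (\<lambda>t. (H_norm \<Omega> a l h (y t))\<^sup>2)"
    using bochner unfolding bochner_L2_def mem_Collect_eq by (simp_all only:)
  obtain s where simple: "\<forall>n. simple_function M\<^sub>T (s n) \<and> (\<forall>t\<in>{0<..<T}. s n t \<in> H_space \<Omega> a l)"
    and lim: "AE t in M\<^sub>T. (\<lambda>n. H_norm \<Omega> a l h (s n t - y t)) \<longlonglongrightarrow> 0"
    using bochner unfolding bochner_L2_def mem_Collect_eq by (elim conjE exE)
  have s1: "simple_function M\<^sub>T (s n)" for n using spec[OF simple, of n] by (rule conjunct1)
  have s2: "s n t \<in> H_space \<Omega> a l" if "t \<in> {0<..<T}" for n t
    by (rule bspec[OF conjunct2[OF spec[OF simple, of n]] that])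
  \<comment> \<open>A measurable version of \<open>embed (y t)\<close>, the limit of the embedded
    simple functions; at the exceptional times it is whatever \<open>lim\<close> returns.\<close>
  define X where "X t = lim (\<lambda>n. embed (s n t))" for t
  have Xm: "X \<in> borel_measurable M\<^sub>T"
    unfolding X_def by (rule borel_measurable_lim_metric[OF borel_measurable_simple_function[OF simple_function_compose1[OF s1]]])
  have X: "AE t in M\<^sub>T. y t \<in> H_space \<Omega> a l \<and> embed (y t) = X t"
    using yH lim AE_space
  proof eventually_elim
    case (elim t)
    have sH: "s n t \<in> H_space \<Omega> a l" for n by (rule s2) (use elim(3) in simp)
    have "(\<lambda>n. norm (embed (s n t) - embed (y t))) \<longlonglongrightarrow> 0"
      using elim(2) by (simp only: H_norm_diff[OF H_sob[OF sH] H_sob[OF elim(1)]])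
    then have "(\<lambda>n. embed (s n t)) \<longlonglongrightarrow> embed (y t)" by (rule LIM_zero_cancel[OF tendsto_norm_zero_cancel])
    then have "X t = embed (y t)" unfolding X_def by (rule limI)
    then show ?case using elim(1) by simp
  qed
  have XL: "square_integrable M\<^sub>T X"
    unfolding square_integrable_def
  proof (rule conjI[OF Xm], rule integrable_cong_AE_imp[OF yi])
    show "(\<lambda>t. (norm (X t))\<^sup>2) \<in> borel_measurable M\<^sub>T" using Xm by measurable
    show "AE t in M\<^sub>T. (H_norm \<Omega> a l h (y t))\<^sup>2 = (norm (X t))\<^sup>2"
      using X by eventually_elim (simp add: H_norm_eq H_sob)
  qed
  obtain c where "\<forall>t\<in>{0..T}. c t \<in> V_space \<Omega> a l"
    and "\<forall>t\<in>{0..T}. ((\<lambda>s. V_norm \<Omega> a l h (c s - c t)) \<longlongrightarrow> 0) (at t within {0..T})"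
    and cy: "AE t in M\<^sub>T. ms_eq \<Omega> a l (y t) (c t)" and c0: "ms_eq \<Omega> a l (c 0) (\<lambda>_ _. 0)"
    using init unfolding initial_value_def by (elim conjE exE)
  note cV = bspec[OF this(1)] and cc = bspec[OF this(2)]
  define w where "w t = embed_value (c t)" for t
  have wc: "continuous_on {0..T} w"
    unfolding continuous_on_def
  proof (rule ballI, rule LIM_zero_cancel[OF tendsto_norm_zero_cancel])
    fix t assume t: "t \<in> {0..T}"
    show "((\<lambda>s. norm (w s - w t)) \<longlongrightarrow> 0) (at t within {0..T})"
    proof (rule Lim_transform_eventually[OF cc[OF t]])
      show "\<forall>\<^sub>F s in at t within {0..T}. V_norm \<Omega> a l h (c s - c t) = norm (w s - w t)"
        unfolding eventually_at_filter w_def using V_norm_diff[OF cV cV[OF t]] by (intro always_eventually allI impI)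
    qed
  qed
  have w0: "w 0 = 0"
  proof -
    have 0: "0 \<in> {0..T}" using T by simp
    from c0 show ?thesis by (simp only: ms_eq_iff[OF cV[OF 0] zero_V(1)] zero_V(2) w_def)
  qed
  have wX: "AE t in M\<^sub>T. w t = Q\<^sub>H (X t)"
    using X cy AE_space
  proof eventually_elim
    case (elim t)
    have t: "t \<in> {0..T}" using elim(3) by simp
    have yt: "y t \<in> H_space \<Omega> a l" using elim(1) by (rule conjunct1)
    have "embed_value (y t) = w t"
      using elim(2) by (simp only: ms_eq_iff[OF sob_V[OF H_sob[OF yt]] cV[OF t]] w_def)
    then show ?case using elim(1) Q\<^sub>H_embed[OF yt] by simp
  qed
  have "(\<integral>t. (Q\<^sub>H (X t) \<bullet> Q\<^sub>H u) * deriv \<eta> t \<partial>M\<^sub>T) = - (\<integral>t. ((F t - B\<^sub>H (X t)) \<bullet> u) * \<eta> t \<partial>M\<^sub>T)"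
    if \<eta>: "test_function {0<..<T} \<eta>" for \<eta> u
  proof -
    \<comment> \<open>The abstract equation is tested with arbitrary states, the weak one with
      functions in H. For almost every \<open>t\<close> both \<open>Q\<^sub>H\<close> and
      \<open>F t - B\<^sub>H (X t)\<close> treat \<open>u\<close> like \<open>proj u\<close>, so the
      projection mediates.\<close>
    define \<phi> where "\<phi> = unembed (proj u)"
    have \<phi>: "\<phi> \<in> H_space \<Omega> a l" and e\<phi>: "embed \<phi> = proj u"
      unfolding \<phi>_def by (rule unembed_H[OF proj_H])+
    have Um: "{0<..<T} \<in> sets lebesgue" by simp
    have \<eta>m: "\<eta> \<in> borel_measurable M\<^sub>T" "deriv \<eta> \<in> borel_measurable M\<^sub>T"
      using square_integrable_continuous[OF test_function_real(2)[OF \<eta>]] square_integrable_continuous[OF test_function_real(3)[OF \<eta>]]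
      by (auto simp only: square_integrable_def)
    have Qm: "(\<lambda>t. Q\<^sub>H (X t)) \<in> borel_measurable M\<^sub>T"
      using square_integrable_bounded_linear_comp[OF parabolic.Q XL] by (simp only: square_integrable_def)
    have Rm: "(\<lambda>t. F t - B\<^sub>H (X t)) \<in> borel_measurable M\<^sub>T"
      using square_integrable_diff[OF square_integrable_F square_integrable_lipschitz[OF finite_measure_axioms B\<^sub>H_lipschitz XL]]
      by (simp only: square_integrable_def)
    have "(\<integral>t. V_inner \<Omega> a l h (y t) \<phi> * deriv \<eta> t \<partial>M\<^sub>T) = (\<integral>t. (Q\<^sub>H (X t) \<bullet> Q\<^sub>H u) * deriv \<eta> t \<partial>M\<^sub>T)"
    proof (rule borel_measurable_AE_lebesgue_on(2)[OF Um])
      show "(\<lambda>t. (Q\<^sub>H (X t) \<bullet> Q\<^sub>H u) * deriv \<eta> t) \<in> borel_measurable M\<^sub>T" using Qm \<eta>m by measurable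
      show "AE t in M\<^sub>T. (Q\<^sub>H (X t) \<bullet> Q\<^sub>H u) * deriv \<eta> t = V_inner \<Omega> a l h (y t) \<phi> * deriv \<eta> t"
        using X
      proof eventually_elim
        case (elim t)
        then have yt: "y t \<in> H_space \<Omega> a l" and ey: "embed (y t) = X t" by auto
        have "Q\<^sub>H (proj u) = Q\<^sub>H u" by (simp only: Q\<^sub>H_def proj_id[OF proj_H])
        then show ?case by (simp only: V_inner_Q\<^sub>H[OF yt \<phi>] ey e\<phi>)
      qed
    qed
    moreover have "(\<integral>t. y' t \<phi> * \<eta> t \<partial>M\<^sub>T) = (\<integral>t. ((F t - B\<^sub>H (X t)) \<bullet> u) * \<eta> t \<partial>M\<^sub>T)"
    proof (rule borel_measurable_AE_lebesgue_on(2)[OF Um])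
      show "(\<lambda>t. ((F t - B\<^sub>H (X t)) \<bullet> u) * \<eta> t) \<in> borel_measurable M\<^sub>T" using Rm \<eta>m by measurable
      show "AE t in M\<^sub>T. ((F t - B\<^sub>H (X t)) \<bullet> u) * \<eta> t = y' t \<phi> * \<eta> t"
        using X equation functional
      proof eventually_elim
        case (elim t)
        then have yt: "y t \<in> H_space \<Omega> a l" and ey: "embed (y t) = X t" by auto
        have pX: "proj (X t) = X t" unfolding ey[symmetric] by (rule proj_embed[OF yt])
        have "F t - B\<^sub>H (X t) = proj (F\<^sub>0 t - N (X t))" by (simp add: B\<^sub>H_def pX proj_diff)
        then have "(F t - B\<^sub>H (X t)) \<bullet> u = (F\<^sub>0 t - N (X t)) \<bullet> proj u" by (simp only: proj_self_adjoint)
        moreover have "y' t \<phi> + N (X t) \<bullet> proj u = F\<^sub>0 t \<bullet> proj u"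
          using bspec[OF elim(2) \<phi>] elim(3) H_sob[OF \<phi>]
          by (simp add: hom_operator_eq[OF H_sob[OF yt] H_sob[OF \<phi>]] ey e\<phi>)
        ultimately show ?case by (simp add: inner_diff_left)
      qed
    qed
    ultimately show ?thesis using deriv[unfolded time_derivative_def, rule_format, OF \<eta> \<phi>] by (simp only:)
  qed
  then have "parabolic.solves F X w"
    unfolding parabolic.solves_def using XL wc w0 wX by (intro conjI allI impI)
  then show ?thesis using X by (rule that)
qed

lemma weak_unique:
  assumes "weak y" "weak z" shows "AE t in M\<^sub>T. ms_eq \<Omega> a l (z t) (y t)"
proof -
  obtain X w where X: "parabolic.solves F X w" "AE t in M\<^sub>T. y t \<in> H_space \<Omega> a l \<and> embed (y t) = X t"
    by (rule weak_solves[OF assms(1)])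
  obtain Z w' where Z: "parabolic.solves F Z w'" "AE t in M\<^sub>T. z t \<in> H_space \<Omega> a l \<and> embed (z t) = Z t"
    by (rule weak_solves[OF assms(2)])
  from X(2) Z(2) parabolic.solution_unique[OF square_integrable_F X(1) Z(1)] show ?thesis
  proof eventually_elim
    case (elim t)
    then have H: "y t \<in> H_space \<Omega> a l" "z t \<in> H_space \<Omega> a l" and e: "embed (y t) = embed (z t)" by auto
    have "embed_value (z t) = embed_value (y t)" by (simp only: value_part_embed[symmetric] e)
    then show ?case by (simp only: ms_eq_iff[OF sob_V[OF H_sob[OF H(2)]] sob_V[OF H_sob[OF H(1)]]])
  qed
qed

end

theorem well_posed: "\<exists>v. weak v \<and> (\<forall>w. weak w \<longrightarrow> (AE t in M\<^sub>T. ms_eq \<Omega> a l (w t) (v t)))"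
proof -
  obtain F\<^sub>0 where F: "square_integrable M\<^sub>T F\<^sub>0"
    "AE t in M\<^sub>T. \<forall>\<psi>. sob \<psi> \<longrightarrow> hom_functional \<Omega> a l \<beta> f\<^sub>0 g\<^sub>0 t \<psi> = F\<^sub>0 t \<bullet> embed \<psi>"
    by (rule functional_exists)
  obtain v where v: "weak v" using solution_weak[OF F] by (rule exE)
  then show ?thesis using weak_unique[OF F v] by blast
qed

end

theorem theorem5p1:
  fixes \<Omega> :: "point set"
    and T a \<delta> c1 c2 :: real
    and l :: "nat \<Rightarrow> real"
    and h :: "nat \<Rightarrow> nat \<Rightarrow> real"
    and \<alpha> \<beta> :: "nat \<Rightarrow> real"
    and k :: "real \<Rightarrow> real"
    and ki \<kappa> :: "nat \<Rightarrow> real \<Rightarrow> real"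
    and f\<^sub>0 :: "point \<times> real \<Rightarrow> real"
    and g :: "nat \<Rightarrow> nat \<Rightarrow> point \<times> real \<Rightarrow> real"  \<comment> \<open>\<open>g i N\<close> is the datum for \<open>\<epsilon> = a/N\<close>\<close>
    and g\<^sub>0 :: "nat \<Rightarrow> point \<times> real \<Rightarrow> real"
  assumes "T > 0" "a > 0"
    and "l 0 = 0" "l 1 > 0" "l 2 > 0" "l 3 > 0"
    and "open \<Omega>" "connected \<Omega>" "bounded \<Omega>" "lipschitz_boundary \<Omega>"
    and "\<Omega> \<subseteq> {x. snd x > 0}"
    and "{0..a} \<times> {0} \<subseteq> frontier \<Omega>"
    and "\<delta> > 0" "\<Omega> \<inter> {x. 0 < snd x \<and> snd x < \<delta>} = {0<..<a} \<times> {0<..<\<delta>}"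
    and "\<And>i m. i \<le> 2 \<Longrightarrow> m \<in> branches i \<Longrightarrow> 0 < h i m \<and> h i m < 1"
    and "h 1 1 + h 1 2 < h 0 1" "h 2 1 + h 2 2 < h 1 1" "h 2 3 + h 2 4 < h 1 2"
    and "\<And>i. i \<le> 2 \<Longrightarrow> \<alpha> i \<ge> 1 \<and> \<beta> i \<ge> 1"
    and "c1 > 0" "c2 > 0"
    and "k C1_differentiable_on UNIV" "\<And>s. c1 \<le> deriv k s \<and> deriv k s \<le> c2"
    and "\<And>i. i \<le> 2 \<Longrightarrow> ki i C1_differentiable_on UNIV"
    and "\<And>i s. i \<le> 2 \<Longrightarrow> c1 \<le> deriv (ki i) s \<and> deriv (ki i) s \<le> c2"
    and "\<And>i. i \<le> 2 \<Longrightarrow> \<kappa> i C1_differentiable_on UNIV"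
    and "\<And>i s. i \<le> 2 \<Longrightarrow> c1 \<le> deriv (\<kappa> i) s \<and> deriv (\<kappa> i) s \<le> c2"
    and "f\<^sub>0 \<in> L2 (lebesgue_on (\<Omega> \<times> {0<..<T}))"
    and "AE t in lebesgue_on {0<..<T}.
           compact (ess_support \<Omega> (\<lambda>x. f\<^sub>0 (x, t))) \<and> ess_support \<Omega> (\<lambda>x. f\<^sub>0 (x, t)) \<subseteq> \<Omega>"
    and "\<exists>\<epsilon>\<^sub>0>0. \<forall>i\<le>2. \<exists>c. \<forall>N>0. a / real N < \<epsilon>\<^sub>0 \<longrightarrow>
           g i N \<in> sobolev (layer a l i \<times> {0<..<T}) {((1, 0), 0)} \<and>
           L2_norm (lebesgue_on (layer a l i \<times> {0<..<T})) (g i N) +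
           L2_norm (lebesgue_on (layer a l i \<times> {0<..<T}))
             (weak_partial (layer a l i \<times> {0<..<T}) ((1, 0), 0) (g i N)) \<le> c"
    and "\<And>i. i \<le> 2 \<Longrightarrow> \<beta> i = 1 \<Longrightarrow>
           L2_converges (lebesgue_on (layer a l i \<times> {0<..<T})) (g i) (g\<^sub>0 i)"
  shows "\<exists>v. weak_solution \<Omega> a l h T
               (hom_operator \<Omega> a l h k ki \<kappa> \<alpha>) (hom_functional \<Omega> a l \<beta> f\<^sub>0 g\<^sub>0) v \<and>
             (\<forall>w. weak_solution \<Omega> a l h T
                    (hom_operator \<Omega> a l h k ki \<kappa> \<alpha>) (hom_functional \<Omega> a l \<beta> f\<^sub>0 g\<^sub>0) w \<longrightarrow>
                  (AE t in lebesgue_on {0<..<T}. ms_eq \<Omega> a l (w t) (v t)))"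
proof -
  interpret homogenized \<Omega> a \<delta> l h T c1 c2 \<alpha> \<beta> k ki \<kappa> f\<^sub>0 g\<^sub>0
  proof unfold_locales
    \<comment> \<open>The strip on which the trace of the upper sheet is estimated.\<close>
    show "{0<..<a} \<times> {0<..<\<delta>} \<subseteq> \<Omega>" using assms(14) by blast
    show "0 < h i m" if "i \<le> 2" "m \<in> branches i" for i m using assms(15)[OF that] by (rule conjunct1)
    show "g\<^sub>0 i \<in> L2 (lebesgue_on (layer a l i \<times> {0<..<T}))" if "i \<le> 2" "\<beta> i = 1" for i
      using assms(31)[OF that] unfolding L2_converges_def by (rule conjunct1)
  qed (use assms(1-7,9,13,20-28) in simp_all)
  show ?thesis by (rule well_posed)
qed

end
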